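(* Let $\Omega\subset\mathbb{R}^n$ be a bounded smooth domain with $0\in\Omega$, and let $0\le s<m<\frac n2$ with $s\ge 2m-\frac n2$. Set $2^*_m=\frac{2n}{n-2m}$. (i) For every $0<\lambda<\Lambda_1(m,s)$ the infimum $$\mathcal S^\Omega_\lambda(m,s)=\inf_{u\in{\rm Dom}(Q^N_{m,\Omega}),\,u\neq0}\frac{Q^N_{m,\Omega}[u]-\lambda Q^N_{s,\Omega}[u]}{\big(\int_\Omega|u|^{2^*_m}dx\big)^{2/2^*_m}}$$ is achieved, and the equation $(-\Delta_\Omega)^m_N u=\lambda(-\Delta_\Omega)^s_N u+|u|^{2^*_m-2}u$ in $\Omega$ has a nontrivial weak solution $u\in{\rm Dom}(Q^N_{m,\Omega})$. (ii) For every $0<\lambda<\widetilde\Lambda_1(m,s)$ the infimum $$\widetilde{\mathcal S}^\Omega_\lambda(m,s)=\inf_{u\in{\rm Dom}(Q^N_{m,\Omega}),\,u\neq0}\frac{Q^N_{m,\Omega}[u]-\lambda \int_\Omega|x|^{-2s}|u|^2dx}{\big(\int_\Omega|u|^{2^*_m}dx\big)^{2/2^*_m}}$$ is achieved, and the equation $(-\Delta_\Omega)^m_N u=\lambda|x|^{-2s} u+|u|^{2^*_m-2}u$ in $\Omega$ has a nontrivial weak solution $u\in{\rm Dom}(Q^N_{m,\Omega})$.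
   Context: Let $\lambda_j$ and $\varphi_j$ be the eigenvalues and $L_2(\Omega)$-orthonormal eigenfunctions of the Dirichlet Laplacian $-\Delta$ in $\Omega$. For $t\ge0$, the Navier fractional Laplacian $(-\Delta_\Omega)^t_N$ is the $t$-th power of the Dirichlet Laplacian in the sense of spectral theory, with quadratic form $Q^N_{t,\Omega}[u]=\sum_j\lambda_j^t|(u,\varphi_j)|^2$ (so $Q^N_{0,\Omega}[u]=\|u\|^2_{L_2(\Omega)}$), and ${\rm Dom}(Q^N_{m,\Omega})$ is the set of $u=\sum_j c_j\varphi_j$ with $\sum_j\lambda_j^m|c_j|^2<\infty$; the associated bilinear form is $\langle u,v\rangle_{t}=\sum_j\lambda_j^t(u,\varphi_j)\overline{(v,\varphi_j)}$. A weak solution of the first equation is $u\in{\rm Dom}(Q^N_{m,\Omega})$ with $\langle u,v\rangle_m=\lambda\langle u,v\rangle_s+\int_\Omega|u|^{2^*_m-2}u\,v\,dx$ for all $v\in{\rm Dom}(Q^N_{m,\Omega})$; for the second equation, $\langle u,v\rangle_m=\lambda\int_\Omega|x|^{-2s}uv\,dx+\int_\Omega|u|^{2^*_m-2}u\,v\,dx$ for all such $v$. The constants are $$\Lambda_1(m,s)=\inf_{u\in{\rm Dom}(Q^N_{m,\Omega}),u\ne0}\frac{Q^N_{m,\Omega}[u]}{Q^N_{s,\Omega}[u]},\qquad \widetilde\Lambda_1(m,s)=\inf_{u\in{\rm Dom}(Q^N_{m,\Omega}),u\ne0}\frac{Q^N_{m,\Omega}[u]}{\int_\Omega|x|^{-2s}|u|^2dx},$$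 which are positive. *)

theory Defs
  imports "HOL-Analysis.Analysis"
begin

definition pdir :: "('a::euclidean_space \<Rightarrow> real) \<Rightarrow> 'a \<Rightarrow> 'a \<Rightarrow> real" where
  "pdir f b = (\<lambda>x. frechet_derivative f (at x) b)"

definition laplacian :: "('a::euclidean_space \<Rightarrow> real) \<Rightarrow> 'a \<Rightarrow> real" where
  "laplacian f = (\<lambda>x. \<Sum>b\<in>Basis. pdir (pdir f b) b x)"

fun Ck_on :: "nat \<Rightarrow> 'a::euclidean_space set \<Rightarrow> ('a \<Rightarrow> real) \<Rightarrow> bool" where
  "Ck_on 0 U f = continuous_on U f"
| "Ck_on (Suc k) U f = ((\<forall>x\<in>U. f differentiable (at x)) \<and> (\<forall>b\<in>Basis. Ck_on k U (pdir f b)))"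

definition Cinf_on :: "'a::euclidean_space set \<Rightarrow> ('a \<Rightarrow> real) \<Rightarrow> bool" where
  "Cinf_on U f = (\<forall>k. Ck_on k U f)"

definition smooth_bounded_domain :: "'a::euclidean_space set \<Rightarrow> bool" where
  "smooth_bounded_domain \<Omega> = (open \<Omega> \<and> connected \<Omega> \<and> bounded \<Omega> \<and> \<Omega> \<noteq> {} \<and>
     (\<exists>\<rho>. Cinf_on UNIV \<rho> \<and> \<Omega> = {x. \<rho> x < 0} \<and> frontier \<Omega> = {x. \<rho> x = 0} \<and>
          (\<forall>x. \<rho> x = 0 \<longrightarrow> frechet_derivative \<rho> (at x) \<noteq> (\<lambda>h. 0))))"

definition L2_on :: "'a::euclidean_space set \<Rightarrow> ('a \<Rightarrow> real) \<Rightarrow> bool" where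
  "L2_on \<Omega> u = (set_borel_measurable lebesgue \<Omega> u \<and> set_integrable lebesgue \<Omega> (\<lambda>x. (u x)\<^sup>2))"

definition l2_inner :: "'a::euclidean_space set \<Rightarrow> ('a \<Rightarrow> real) \<Rightarrow> ('a \<Rightarrow> real) \<Rightarrow> real" where
  "l2_inner \<Omega> u v = (LINT x:\<Omega>|lebesgue. u x * v x)"

definition nonzero_L2 :: "'a::euclidean_space set \<Rightarrow> ('a \<Rightarrow> real) \<Rightarrow> bool" where
  "nonzero_L2 \<Omega> u = (\<not> (AE x in lebesgue. x \<in> \<Omega> \<longrightarrow> u x = 0))"

definition dirichlet_eigensystem ::
  "'a::euclidean_space set \<Rightarrow> (nat \<Rightarrow> real) \<Rightarrow> (nat \<Rightarrow> 'a \<Rightarrow> real) \<Rightarrow> bool" where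
  "dirichlet_eigensystem \<Omega> lam phi =
     ((\<forall>j. Cinf_on \<Omega> (phi j) \<and> continuous_on (closure \<Omega>) (phi j) \<and>
           (\<forall>x\<in>frontier \<Omega>. phi j x = 0) \<and>
           (\<forall>x\<in>\<Omega>. - laplacian (phi j) x = lam j * phi j x)) \<and>
      (\<forall>i j. set_integrable lebesgue \<Omega> (\<lambda>x. phi i x * phi j x) \<and>
             l2_inner \<Omega> (phi i) (phi j) = (if i = j then 1 else 0)) \<and>
      (\<forall>f. L2_on \<Omega> f \<longrightarrow> (\<forall>j. l2_inner \<Omega> f (phi j) = 0) \<longrightarrow> \<not> nonzero_L2 \<Omega> f))"

definition fcoeff :: "'a::euclidean_space set \<Rightarrow> (nat \<Rightarrow> 'a \<Rightarrow> real) \<Rightarrow> ('a \<Rightarrow> real) \<Rightarrow> nat \<Rightarrow> real" where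
  "fcoeff \<Omega> phi u j = l2_inner \<Omega> u (phi j)"

definition form_dom ::
  "'a::euclidean_space set \<Rightarrow> (nat \<Rightarrow> real) \<Rightarrow> (nat \<Rightarrow> 'a \<Rightarrow> real) \<Rightarrow> real \<Rightarrow> ('a \<Rightarrow> real) \<Rightarrow> bool" where
  "form_dom \<Omega> lam phi t u = (L2_on \<Omega> u \<and> summable (\<lambda>j. lam j powr t * (fcoeff \<Omega> phi u j)\<^sup>2))"

definition Qform ::
  "'a::euclidean_space set \<Rightarrow> (nat \<Rightarrow> real) \<Rightarrow> (nat \<Rightarrow> 'a \<Rightarrow> real) \<Rightarrow> real \<Rightarrow> ('a \<Rightarrow> real) \<Rightarrow> real" where
  "Qform \<Omega> lam phi t u = (\<Sum>j. lam j powr t * (fcoeff \<Omega> phi u j)\<^sup>2)"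

definition bform ::
  "'a::euclidean_space set \<Rightarrow> (nat \<Rightarrow> real) \<Rightarrow> (nat \<Rightarrow> 'a \<Rightarrow> real) \<Rightarrow> real \<Rightarrow> ('a \<Rightarrow> real) \<Rightarrow> ('a \<Rightarrow> real) \<Rightarrow> real" where
  "bform \<Omega> lam phi t u v = (\<Sum>j. lam j powr t * fcoeff \<Omega> phi u j * fcoeff \<Omega> phi v j)"

definition crit_exp :: "nat \<Rightarrow> real \<Rightarrow> real" where
  "crit_exp n m = 2 * real n / (real n - 2 * m)"

definition hardy_int :: "'a::euclidean_space set \<Rightarrow> real \<Rightarrow> ('a \<Rightarrow> real) \<Rightarrow> real" where
  "hardy_int \<Omega> s u = (LINT x:\<Omega>|lebesgue. norm x powr (-2 * s) * (u x)\<^sup>2)"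

definition Lambda1 ::
  "'a::euclidean_space set \<Rightarrow> (nat \<Rightarrow> real) \<Rightarrow> (nat \<Rightarrow> 'a \<Rightarrow> real) \<Rightarrow> real \<Rightarrow> real \<Rightarrow> real" where
  "Lambda1 \<Omega> lam phi m s = Inf {Qform \<Omega> lam phi m u / Qform \<Omega> lam phi s u | u.
      form_dom \<Omega> lam phi m u \<and> nonzero_L2 \<Omega> u}"

definition Lambda1_tilde ::
  "'a::euclidean_space set \<Rightarrow> (nat \<Rightarrow> real) \<Rightarrow> (nat \<Rightarrow> 'a \<Rightarrow> real) \<Rightarrow> real \<Rightarrow> real \<Rightarrow> real" where
  "Lambda1_tilde \<Omega> lam phi m s = Inf {Qform \<Omega> lam phi m u / hardy_int \<Omega> s u | u.
      form_dom \<Omega> lam phi m u \<and> nonzero_L2 \<Omega> u}"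

definition sob_den :: "'a::euclidean_space set \<Rightarrow> real \<Rightarrow> ('a \<Rightarrow> real) \<Rightarrow> real" where
  "sob_den \<Omega> m u = (LINT x:\<Omega>|lebesgue. \<bar>u x\<bar> powr crit_exp DIM('a) m) powr (2 / crit_exp DIM('a) m)"

definition S_ratio ::
  "'a::euclidean_space set \<Rightarrow> (nat \<Rightarrow> real) \<Rightarrow> (nat \<Rightarrow> 'a \<Rightarrow> real) \<Rightarrow> real \<Rightarrow> real \<Rightarrow> real \<Rightarrow> ('a \<Rightarrow> real) \<Rightarrow> real" where
  "S_ratio \<Omega> lam phi m s l u = (Qform \<Omega> lam phi m u - l * Qform \<Omega> lam phi s u) / sob_den \<Omega> m u"

definition S_lambda ::
  "'a::euclidean_space set \<Rightarrow> (nat \<Rightarrow> real) \<Rightarrow> (nat \<Rightarrow> 'a \<Rightarrow> real) \<Rightarrow> real \<Rightarrow> real \<Rightarrow> real \<Rightarrow> real" where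
  "S_lambda \<Omega> lam phi m s l = Inf {S_ratio \<Omega> lam phi m s l u | u.
      form_dom \<Omega> lam phi m u \<and> nonzero_L2 \<Omega> u}"

definition S_ratio_tilde ::
  "'a::euclidean_space set \<Rightarrow> (nat \<Rightarrow> real) \<Rightarrow> (nat \<Rightarrow> 'a \<Rightarrow> real) \<Rightarrow> real \<Rightarrow> real \<Rightarrow> real \<Rightarrow> ('a \<Rightarrow> real) \<Rightarrow> real" where
  "S_ratio_tilde \<Omega> lam phi m s l u = (Qform \<Omega> lam phi m u - l * hardy_int \<Omega> s u) / sob_den \<Omega> m u"

definition S_lambda_tilde ::
  "'a::euclidean_space set \<Rightarrow> (nat \<Rightarrow> real) \<Rightarrow> (nat \<Rightarrow> 'a \<Rightarrow> real) \<Rightarrow> real \<Rightarrow> real \<Rightarrow> real \<Rightarrow> real" where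
  "S_lambda_tilde \<Omega> lam phi m s l = Inf {S_ratio_tilde \<Omega> lam phi m s l u | u.
      form_dom \<Omega> lam phi m u \<and> nonzero_L2 \<Omega> u}"

definition weak_sol1 ::
  "'a::euclidean_space set \<Rightarrow> (nat \<Rightarrow> real) \<Rightarrow> (nat \<Rightarrow> 'a \<Rightarrow> real) \<Rightarrow> real \<Rightarrow> real \<Rightarrow> real \<Rightarrow> ('a \<Rightarrow> real) \<Rightarrow> bool" where
  "weak_sol1 \<Omega> lam phi m s l u = (form_dom \<Omega> lam phi m u \<and>
     (\<forall>v. form_dom \<Omega> lam phi m v \<longrightarrow>
        bform \<Omega> lam phi m u v = l * bform \<Omega> lam phi s u v +
          (LINT x:\<Omega>|lebesgue. \<bar>u x\<bar> powr (crit_exp DIM('a) m - 2) * u x * v x)))"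

definition weak_sol2 ::
  "'a::euclidean_space set \<Rightarrow> (nat \<Rightarrow> real) \<Rightarrow> (nat \<Rightarrow> 'a \<Rightarrow> real) \<Rightarrow> real \<Rightarrow> real \<Rightarrow> real \<Rightarrow> ('a \<Rightarrow> real) \<Rightarrow> bool" where
  "weak_sol2 \<Omega> lam phi m s l u = (form_dom \<Omega> lam phi m u \<and>
     (\<forall>v. form_dom \<Omega> lam phi m v \<longrightarrow>
        bform \<Omega> lam phi m u v = l * (LINT x:\<Omega>|lebesgue. norm x powr (-2 * s) * u x * v x) +
          (LINT x:\<Omega>|lebesgue. \<bar>u x\<bar> powr (crit_exp DIM('a) m - 2) * u x * v x)))"

end

theory Submission
  imports Defs "HOL-Complex_Analysis.Great_Picard"
begin

text \<open>Only quadratic forms are used. Two-sided bounds for the Dirichlet heat kernel, obtained from the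
parabolic maximum principle, compare the form of the inverse power of the Dirichlet Laplacian with the Riesz
kernel c |x - y|^(2m - n): it is dominated by it, and for functions concentrated in a tiny ball it differs
from it by a multiple of the squared mean only. Dually this gives the Sobolev inequality with the
sharp constant of the Hardy-Littlewood-Sobolev inequality. No explicit extremals are needed: near maximizers
of the Riesz form can be pushed, by inversion and scaling, into an arbitrarily small ball with an error of the
order of the squared mean. Their potentials are test functions for which the lower order term, thanks to
s \<ge> 2m - n/2, beats every such error; hence the infimum lies strictly below the Sobolev constant. A minimizing
sequence then cannot lose mass by the Brezis-Lieb lemma, and the minimizer solves the equation after scaling.\<close>

text \<open>For fractional m there is neither a local integration by parts nor a pointwise formula
  for powers of the Dirichlet Laplacian. Everything is read off from heat time: the integral of
  t^(m-1) against the Dirichlet heat form is Gamma(m) times the form of order -m, and against the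
  free kernel it is a Riesz kernel. The lower heat bound loses a constant at the boundary, which is
  integrable in time only near 0; it is used up to time 1, and the later times of the free kernel
  contribute a bounded kernel. Hence an error factor independent of the support. The condition s >=
  2m - n/2 says that the kernel of order 2m - s is at least logarithmically singular on the
  diagonal, and that |x|^(-2s) times the square of |x|^(2m-n) is not integrable at 0. The inversion
  needs a hole: cutting a ball of radius e out of a near maximizer costs O(e^n), while the squared
  mean after inversion and scaling is at least of order e^(n-2m). The maximum principle is applied
  to finite sums of eigenmodes, which are classical solutions; positivity and discreteness of the
  eigenvalues follow from the same comparison.\<close>

abbreviation nn_lborel :: "('a::euclidean_space => ennreal) => ennreal" (binder "NNL " 10)
  where "nn_lborel == nn_integral lborel"

section \<open>Riesz energies and inversion\<close>

lemma dyadic_bracket: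
  fixes x :: real
  assumes "1 <= x"
  shows "\<exists>k::nat. 2 ^ k <= x \<and> x < 2 ^ Suc k"
proof -
  obtain j :: nat where j: "x < 2 ^ j"
    using real_arch_pow[of 2 x] by auto
  define k where "k = (LEAST j::nat. x < 2 ^ j)"
  have 1: "x < 2 ^ k" unfolding k_def using j by (rule LeastI)
  have "k \<noteq> 0" using 1 assms by (intro notI) simp
  then obtain i where i: "k = Suc i" using not0_implies_Suc by blast
  have "\<not> x < 2 ^ i" using not_less_Least[of i "\<lambda>j. x < 2 ^ j"] i k_def by auto
  then show ?thesis using 1 i by (intro exI[of _ i]) auto
qed

lemma suminf_ge_term_ennreal: "f k <= (\<Sum>k. f k :: ennreal)"
  using sum_le_suminf[of f "{k}"] by simp

lemma nn_integral_suminf_cmult: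
  fixes f :: "nat => 'a => ennreal"
  assumes "\<And>k. f k \<in> borel_measurable M"
  shows "(\<integral>\<^sup>+x. (\<Sum>k. c k * f k x) \<partial>M) = (\<Sum>k. c k * (\<integral>\<^sup>+x. f k x \<partial>M))"
proof -
  have "(\<integral>\<^sup>+x. (\<Sum>k. c k * f k x) \<partial>M) = (\<Sum>k. \<integral>\<^sup>+x. c k * f k x \<partial>M)"
    using assms by (intro nn_integral_suminf borel_measurable_times_ennreal) auto
  then show ?thesis using assms by (simp add: nn_integral_cmult)
qed

lemma suminf_geometric_powr:
  fixes c e :: real
  assumes "0 <= c" "0 < e"
  shows "(\<Sum>k. ennreal (c * (2 powr (-e)) ^ k)) = ennreal (c / (1 - 2 powr (-e)))"
proof -
  have "norm (2 powr (-e) :: real) < 1"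
    using assms by (simp add: powr_less_one)
  from sums_mult[OF geometric_sums[OF this], of c] show ?thesis
    using assms by (intro suminf_ennreal_eq) auto
qed

text \<open>The ball is cut into dyadic shells about x, on each of which the kernel is comparable to
  a constant; the resulting geometric series has ratio 2^(a - n) and converges since a < n.\<close>

lemma riesz_kernel_ball:
  assumes "0 < a" "a < real DIM('a::euclidean_space)"
  shows "\<exists>C>0. \<forall>(x::'a) T. 0 < T -->
    (NNL y. ennreal (norm (x - y) powr (-a)) * indicator (ball x T) y)
      <= ennreal (C * T powr (real DIM('a) - a))"
proof -
  define n where "n = real DIM('a)"
  define V where "V = unit_ball_vol n"
  define C where "C = (2 powr a * V * 2 powr n) / (1 - 2 powr (-(n - a)))"
  have V: "0 < V" by (simp add: V_def n_def)
  have "2 powr (-(n - a)) < (1::real)" using assms by (simp add: n_def powr_less_one)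
  then have "0 < C" using V by (simp add: C_def)
  moreover have "(NNL y. ennreal (norm (x - y) powr (-a)) * indicator (ball x T) y)
      <= ennreal (C * T powr (n - a))" if T: "0 < T" for x :: 'a and T
  proof -
    \<comment> \<open>The radius 2 T / 2^k is twice the outer radius of the shell, so that the
      closed shell fits into an open ball. The centre y = x contributes 0 because 0 powr (-a) =
      0.\<close>
    have pw: "ennreal (norm (x - y) powr (-a)) * indicator (ball x T) y
        <= (\<Sum>k. ennreal ((T / 2 ^ Suc k) powr (-a)) * indicator (ball x (2 * T / 2 ^ k)) y)" for y
    proof (cases "y \<in> ball x T \<and> y \<noteq> x")
      case False
      then show ?thesis by (auto simp: indicator_def)
    next
      case True
      then have d: "0 < norm (x - y)" "norm (x - y) < T" by (auto simp: dist_norm)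
      then have "1 <= T / norm (x - y)" by simp
      then obtain k where k: "2 ^ k <= T / norm (x - y)" "T / norm (x - y) < 2 ^ Suc k"
        using dyadic_bracket by blast
      have k1: "norm (x - y) <= T / 2 ^ k" using k(1) d by (simp add: field_simps)
      have k2: "T / 2 ^ Suc k <= norm (x - y)" using k(2) d by (simp add: field_simps)
      have "T / 2 ^ k < 2 * T / 2 ^ k" using T by (simp add: field_simps)
      then have "y \<in> ball x (2 * T / 2 ^ k)" using k1 by (auto simp: dist_norm)
      moreover have "norm (x - y) powr (-a) <= (T / 2 ^ Suc k) powr (-a)"
        using k2 T assms by (intro powr_mono2') auto
      ultimately have "ennreal (norm (x - y) powr (-a)) * indicator (ball x T) y
          <= ennreal ((T / 2 ^ Suc k) powr (-a)) * indicator (ball x (2 * T / 2 ^ k)) y"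
        using True by (simp add: ennreal_leI)
      also have "... <= (\<Sum>k. ennreal ((T / 2 ^ Suc k) powr (-a)) * indicator (ball x (2 * T / 2 ^ k)) y)"
        by (rule suminf_ge_term_ennreal)
      finally show ?thesis .
    qed
    have "(NNL y. ennreal (norm (x - y) powr (-a)) * indicator (ball x T) y)
        <= (NNL y. (\<Sum>k. ennreal ((T / 2 ^ Suc k) powr (-a)) * indicator (ball x (2 * T / 2 ^ k)) y))"
      by (intro nn_integral_mono pw)
    also have "... = (\<Sum>k. ennreal ((T / 2 ^ Suc k) powr (-a)) * (NNL y. indicator (ball x (2 * T / 2 ^ k)) y))"
      by (rule nn_integral_suminf_cmult) (rule borel_measurable_indicator, simp)
    also have "... = (\<Sum>k. ennreal ((T / 2 ^ Suc k) powr (-a)) * emeasure lborel (ball x (2 * T / 2 ^ k)))"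
      by (simp only: nn_integral_indicator borel_open open_ball sets_lborel)
    also have "... = (\<Sum>k. ennreal (2 powr a * V * 2 powr n * T powr (n - a) * (2 powr (-(n - a))) ^ k))"
    proof (intro suminf_cong)
      fix k :: nat
      have e1: "(T / 2 ^ Suc k) powr (-a) = T powr (-a) * 2 powr a * 2 powr (a * real k)"
      proof -
        have "(T / 2 ^ Suc k) powr (-a) = T powr (-a) / (2 powr (real (Suc k))) powr (-a)"
          using T by (simp add: powr_divide powr_realpow[symmetric] del: power_Suc)
        also have "... = T powr (-a) * (2 powr a * 2 powr (a * real k))"
          by (simp add: powr_powr powr_add[symmetric] powr_minus field_simps)
        finally show ?thesis by (simp add: mult.assoc)
      qed
      have e2: "(2 * T / 2 ^ k) ^ DIM('a) = 2 powr n * T powr n * 2 powr (- (n * real k))"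
      proof -
        have "(2 * T / 2 ^ k) ^ DIM('a) = (2 * T / 2 powr (real k)) powr n"
          using T by (simp add: n_def powr_realpow[symmetric])
        also have "... = 2 powr n * T powr n / (2 powr real k) powr n"
          using T by (simp add: powr_divide powr_mult)
        finally show ?thesis by (simp add: powr_powr powr_minus field_simps)
      qed
      have "(T / 2 ^ Suc k) powr (-a) * (V * (2 * T / 2 ^ k) ^ DIM('a))
         = 2 powr a * V * 2 powr n * (T powr (-a) * T powr n) * (2 powr (a * real k) * 2 powr (- (n * real k)))"
        unfolding e1 e2 by (simp add: mult_ac)
      also have "... = 2 powr a * V * 2 powr n * T powr (n - a) * (2 powr (-(n - a))) ^ k"
        by (simp add: powr_add[symmetric] powr_realpow[symmetric] powr_powr algebra_simps)
      finally show "ennreal ((T / 2 ^ Suc k) powr (-a)) * emeasure lborel (ball x (2 * T / 2 ^ k))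
        = ennreal (2 powr a * V * 2 powr n * T powr (n - a) * (2 powr (-(n - a))) ^ k)"
        using T V by (simp add: emeasure_ball V_def n_def ennreal_mult[symmetric])
    qed
    also have "... = ennreal (2 powr a * V * 2 powr n * T powr (n - a) / (1 - 2 powr (-(n - a))))"
      using assms V by (intro suminf_geometric_powr) (auto simp: n_def)
    also have "... = ennreal (C * T powr (n - a))" by (simp add: C_def)
    finally show ?thesis .
  qed
  ultimately show ?thesis unfolding n_def by blast
qed

text \<open>On the shell at distance about 2^k s the kernel is of size (2^k s)^(-a) while the ball
  hypothesis allows growth (2^k s)^(a/2) only, so a geometric series of ratio 2^(-a/2) remains. The
  growth exponent a/2 is the one that Hoelder's inequality gives at the critical exponent, see
  \<open>Lp_ball_bound\<close>.\<close>

lemma riesz_tail_bound: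
  fixes F :: "'a::euclidean_space => real"
  assumes "0 < a" and [measurable]: "F \<in> borel_measurable borel" and F0: "\<And>x. 0 <= F x" and A: "0 <= A" and s: "0 < s"
    and mor: "\<And>t. 0 < t ==> (NNL y. ennreal (F y) * indicator (ball x t) y) <= ennreal (A * t powr (a / 2))"
  shows "(NNL y. ennreal (F y * norm (x - y) powr (-a)) * indicator (- ball x s) y)
     <= ennreal (A * (2 powr (a / 2) / (1 - 2 powr (-(a / 2)))) * s powr (-(a / 2)))"
proof -
  have pw: "ennreal (F y * norm (x - y) powr (-a)) * indicator (- ball x s) y
      <= (\<Sum>k. ennreal ((2 ^ k * s) powr (-a)) * (ennreal (F y) * indicator (ball x (2 ^ Suc k * s)) y))" for y
  proof (cases "y \<in> ball x s")
    case True
    then show ?thesis by (auto simp: indicator_def)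
  next
    case False
    then have d: "s <= norm (x - y)" by (auto simp: dist_norm)
    then have "1 <= norm (x - y) / s" using s by simp
    then obtain k where k: "2 ^ k <= norm (x - y) / s" "norm (x - y) / s < 2 ^ Suc k"
      using dyadic_bracket by blast
    have "y \<in> ball x (2 ^ Suc k * s)" using k(2) s by (auto simp: dist_norm field_simps)
    moreover have "2 ^ k * s <= norm (x - y)" using k(1) s by (simp add: field_simps)
    then have "norm (x - y) powr (-a) <= (2 ^ k * s) powr (-a)"
      using s assms(1) by (intro powr_mono2') auto
    then have "F y * norm (x - y) powr (-a) <= (2 ^ k * s) powr (-a) * F y"
      using mult_right_mono[OF _ F0[of y]] by (simp add: mult.commute[of "F y"])
    ultimately have "ennreal (F y * norm (x - y) powr (-a)) * indicator (- ball x s) y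
        <= ennreal ((2 ^ k * s) powr (-a)) * (ennreal (F y) * indicator (ball x (2 ^ Suc k * s)) y)"
      using False F0 by (simp add: ennreal_mult[symmetric] ennreal_leI)
    also have "... <= (\<Sum>k. ennreal ((2 ^ k * s) powr (-a)) * (ennreal (F y) * indicator (ball x (2 ^ Suc k * s)) y))"
      by (rule suminf_ge_term_ennreal)
    finally show ?thesis .
  qed
  have "(NNL y. ennreal (F y * norm (x - y) powr (-a)) * indicator (- ball x s) y)
     <= (NNL y. (\<Sum>k. ennreal ((2 ^ k * s) powr (-a)) * (ennreal (F y) * indicator (ball x (2 ^ Suc k * s)) y)))"
    by (intro nn_integral_mono pw)
  also have "... = (\<Sum>k. ennreal ((2 ^ k * s) powr (-a)) * (NNL y. ennreal (F y) * indicator (ball x (2 ^ Suc k * s)) y))"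
    by (rule nn_integral_suminf_cmult) (intro borel_measurable_times_ennreal borel_measurable_indicator, auto)
  also have "... <= (\<Sum>k. ennreal ((2 ^ k * s) powr (-a)) * ennreal (A * (2 ^ Suc k * s) powr (a / 2)))"
    using s by (intro suminf_le mult_left_mono mor) auto
  also have "... = (\<Sum>k. ennreal (A * 2 powr (a / 2) * s powr (-(a / 2)) * (2 powr (-(a / 2))) ^ k))"
  proof (intro suminf_cong)
    fix k :: nat
    have e1: "(2 ^ k * s) powr (-a) = 2 powr (- (a * real k)) * s powr (-a)"
      using s by (simp add: powr_mult powr_realpow[symmetric] powr_powr mult.commute)
    have e2: "(2 ^ Suc k * s) powr (a / 2) = 2 powr (a / 2) * 2 powr (a * real k / 2) * s powr (a / 2)"
    proof -
      have "(2 ^ Suc k * s) powr (a / 2) = (2 powr real (Suc k)) powr (a / 2) * s powr (a / 2)"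
        using s by (simp add: powr_mult powr_realpow[symmetric] del: power_Suc)
      then show ?thesis by (simp add: powr_powr powr_add[symmetric] field_simps)
    qed
    have "(2 ^ k * s) powr (-a) * (A * (2 ^ Suc k * s) powr (a / 2))
      = A * 2 powr (a / 2) * (s powr (-a) * s powr (a / 2)) * (2 powr (- (a * real k)) * 2 powr (a * real k / 2))"
      unfolding e1 e2 by (simp add: mult_ac)
    also have "... = A * 2 powr (a / 2) * s powr (-(a / 2)) * (2 powr (-(a / 2))) ^ k"
    proof -
      have "- a + a / 2 = -(a/2)" "- (a * real k) + a * real k / 2 = -(a/2) * real k" by (auto simp: field_simps)
      then show ?thesis by (simp only: powr_add[symmetric] powr_powr powr_realpow[symmetric] powr_gt_zero)
    qed
    finally show "ennreal ((2 ^ k * s) powr (-a)) * ennreal (A * (2 ^ Suc k * s) powr (a / 2))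
      = ennreal (A * 2 powr (a / 2) * s powr (-(a / 2)) * (2 powr (-(a / 2))) ^ k)"
      using A by (simp add: ennreal_mult[symmetric])
  qed
  also have "... = ennreal (A * 2 powr (a / 2) * s powr (-(a / 2)) / (1 - 2 powr (-(a / 2))))"
    using assms by (intro suminf_geometric_powr) auto
  finally show ?thesis by (simp add: mult_ac)
qed

definition riesz :: "real => ('a::euclidean_space => real) => ('a => real) => ennreal" where
  "riesz a f g = (\<integral>\<^sup>+x. \<integral>\<^sup>+y. ennreal (f x * g y * norm (x - y) powr (-a)) \<partial>lborel \<partial>lborel)"

text \<open>Hedberg's argument needs no maximal function here: by symmetry one may integrate over
  F y <= F x only, where F x itself bounds the contribution of the near ball.\<close>

lemma riesz_le_Morrey:
  assumes a: "0 < a" "a < real DIM('a::euclidean_space)" and p: "p = 2 * real DIM('a) / (2 * real DIM('a) - a)"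
  shows "\<exists>C>0. \<forall>(F::'a => real) A. F \<in> borel_measurable borel --> (\<forall>x. 0 <= F x) --> 0 < A -->
    (\<forall>x t. 0 < t --> (NNL y. ennreal (F y) * indicator (ball x t) y) <= ennreal (A * t powr (a / 2))) -->
    riesz a F F <= ennreal (C * A powr (2 - p)) * (NNL x. ennreal (F x powr p))"
proof -
  define n where "n = real DIM('a)"
  obtain C1 where C1: "0 < C1" and ball: "\<And>(x::'a) T. 0 < T ==>
    (NNL y. ennreal (norm (x - y) powr (-a)) * indicator (ball x T) y) <= ennreal (C1 * T powr (n - a))"
    using riesz_kernel_ball[OF a] unfolding n_def by blast
  define C2 where "C2 = 2 powr (a / 2) / (1 - 2 powr (-(a / 2)))"
  have "2 powr (-(a / 2)) < (1::real)" using a by (simp add: powr_less_one)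
  then have C2: "0 < C2" by (simp add: C2_def)
  have n: "a < n" "0 < 2 * n - a" using a by (auto simp: n_def)
  have p2: "p = 2 * n / (2 * n - a)" using p by (simp add: n_def)
  show ?thesis
  proof (intro exI[of _ "2 * (C1 + C2)"] conjI allI impI)
    show "0 < 2 * (C1 + C2)" using C1 C2 by simp
    fix F :: "'a => real" and A :: real
    assume Fm [measurable]: "F \<in> borel_measurable borel" and F0: "\<forall>x. 0 <= F x" and A: "0 < A"
      and mor: "\<forall>x t. 0 < t --> (NNL y. ennreal (F y) * indicator (ball x t) y) <= ennreal (A * t powr (a / 2))"
    \<comment> \<open>Each pair is charged to the point with the larger value; ties are counted
      twice, which an upper bound tolerates.\<close>
    define K where "K = (\<lambda>x y. ennreal (F x * F y * norm (x - y) powr (-a)) * indicator {y. F y <= F x} y)"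
    have K [measurable]: "(\<lambda>(x, y). K x y) \<in> borel_measurable (borel \<Otimes>\<^sub>M borel)"
      unfolding K_def by measurable
    have K' [measurable]: "(\<lambda>(x, y). K y x) \<in> borel_measurable (borel \<Otimes>\<^sub>M borel)"
      unfolding K_def by measurable
    have inner: "(NNL y. K x y) <= ennreal ((C1 + C2) * A powr (2 - p)) * ennreal (F x powr p)" for x
    proof (cases "F x = 0")
      case True
      then show ?thesis by (simp add: K_def)
    next
      case False
      then have Fx: "0 < F x" using F0 by (simp add: order_le_neq_trans)
      \<comment> \<open>This radius balances the near term, F x squared times T^(n - a), against the
        far term A F x T^(-a/2); both then equal A^(2 - p) times the p-th power of F x, up to
        constants.\<close>
      define T where "T = (A / F x) powr (2 / (2 * n - a))"
      have T: "0 < T" using A Fx by (simp add: T_def)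
      have "(NNL y. K x y) <= (NNL y. ennreal (F x * F x) * (ennreal (norm (x - y) powr (-a)) * indicator (ball x T) y)
          + ennreal (F x) * (ennreal (F y * norm (x - y) powr (-a)) * indicator (- ball x T) y))"
      proof (intro nn_integral_mono)
        fix y
        show "K x y <= ennreal (F x * F x) * (ennreal (norm (x - y) powr (-a)) * indicator (ball x T) y)
          + ennreal (F x) * (ennreal (F y * norm (x - y) powr (-a)) * indicator (- ball x T) y)"
        proof (cases "F y <= F x")
          case False
          then show ?thesis by (simp add: K_def)
        next
          case True
          then have "F x * F y * norm (x - y) powr (-a) <= F x * F x * norm (x - y) powr (-a)"
            using Fx F0 by (intro mult_right_mono mult_left_mono) auto
          then show ?thesis
            using True F0 unfolding K_def by (auto simp: indicator_def ennreal_mult[symmetric] mult_ac ennreal_leI)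
        qed
      qed
      also have "... = ennreal (F x * F x) * (NNL y. ennreal (norm (x - y) powr (-a)) * indicator (ball x T) y)
          + ennreal (F x) * (NNL y. ennreal (F y * norm (x - y) powr (-a)) * indicator (- ball x T) y)"
        (is "?l = ?r")
      proof -
        have [measurable]: "ball x T \<in> sets borel" by simp
        have "?l = (NNL y. ennreal (F x * F x) * (ennreal (norm (x - y) powr (-a)) * indicator (ball x T) y))
          + (NNL y. ennreal (F x) * (ennreal (F y * norm (x - y) powr (-a)) * indicator (- ball x T) y))"
          by (intro nn_integral_add) measurable
        also have "... = ?r"
          by (intro arg_cong2[where f = "(+)"] nn_integral_cmult) measurable
        finally show ?thesis .
      qed
      also have "... <= ennreal (F x * F x) * ennreal (C1 * T powr (n - a))
          + ennreal (F x) * ennreal (A * C2 * T powr (-(a / 2)))"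
        unfolding C2_def using mor F0 A T a
        by (intro add_mono mult_left_mono ball riesz_tail_bound) auto
      also have "... = ennreal (F x * F x * (C1 * T powr (n - a)) + F x * (A * C2 * T powr (-(a / 2))))"
        using F0 C1 C2 A by (simp add: ennreal_mult[symmetric] ennreal_plus[symmetric] del: ennreal_plus)
      also have "F x * F x * (C1 * T powr (n - a)) + F x * (A * C2 * T powr (-(a / 2))) = (C1 + C2) * A powr (2 - p) * F x powr p"
      proof -
        have q: "2 / (2 * n - a) * (n - a) = 2 - p" "2 / (2 * n - a) * (-(a / 2)) = 1 - p"
          using n by (auto simp: p2 field_simps)
        have t1: "T powr (n - a) = A powr (2 - p) / F x powr (2 - p)"
          using A Fx by (simp only: T_def powr_powr q) (simp add: powr_divide)
        have t2: "T powr (-(a / 2)) = A powr (1 - p) / F x powr (1 - p)"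
          using A Fx by (simp only: T_def powr_powr q) (simp add: powr_divide)
        have sq: "z powr 2 = z * z" if "0 < z" for z :: real
          using that by (simp add: power2_eq_square)
        have f1: "F x * F x / F x powr (2 - p) = F x powr p"
          using powr_diff[of "F x" 2 "2 - p"] sq[OF Fx] by simp
        have f2: "F x / F x powr (1 - p) = F x powr p"
          using powr_diff[of "F x" 1 "1 - p"] Fx by simp
        have f3: "A * A powr (1 - p) = A powr (2 - p)"
          using powr_add[of A 1 "1 - p"] A by simp
        have "F x * F x * (C1 * T powr (n - a)) = C1 * A powr (2 - p) * (F x * F x / F x powr (2 - p))"
          by (simp add: t1)
        moreover have "F x * (A * C2 * T powr (-(a / 2))) = C2 * (A * A powr (1 - p)) * (F x / F x powr (1 - p))"
          unfolding t2 by simp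
        ultimately show ?thesis unfolding f1 f2 f3 by (simp only: distrib_right)
      qed
      finally show ?thesis using C1 C2 by (simp add: ennreal_mult)
    qed
    have "riesz a F F <= (\<integral>\<^sup>+x. \<integral>\<^sup>+y. K x y + K y x \<partial>lborel \<partial>lborel)"
      unfolding riesz_def
    proof (intro nn_integral_mono)
      fix x y
      show "ennreal (F x * F y * norm (x - y) powr (-a)) <= K x y + K y x"
      proof (cases "F y <= F x")
        case True
        then show ?thesis by (simp add: K_def)
      next
        case False
        then have "F x <= F y" by simp
        then show ?thesis by (simp add: K_def norm_minus_commute mult_ac)
      qed
    qed
    also have "... = (NNL x. (NNL y. K x y) + (NNL y. K y x))"
      by (intro nn_integral_cong nn_integral_add) measurable
    also have "... = (\<integral>\<^sup>+x. \<integral>\<^sup>+y. K x y \<partial>lborel \<partial>lborel) + (\<integral>\<^sup>+x. \<integral>\<^sup>+y. K y x \<partial>lborel \<partial>lborel)"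
      by (intro nn_integral_add) measurable
    also have "(\<integral>\<^sup>+x. \<integral>\<^sup>+y. K y x \<partial>lborel \<partial>lborel) = (\<integral>\<^sup>+x. \<integral>\<^sup>+y. K x y \<partial>lborel \<partial>lborel)"
      by (intro lborel_pair.Fubini') measurable
    also have "(\<integral>\<^sup>+x. \<integral>\<^sup>+y. K x y \<partial>lborel \<partial>lborel) + (\<integral>\<^sup>+x. \<integral>\<^sup>+y. K x y \<partial>lborel \<partial>lborel)
       = 2 * (\<integral>\<^sup>+x. \<integral>\<^sup>+y. K x y \<partial>lborel \<partial>lborel)" by (simp add: mult_2)
    also have "... <= 2 * (NNL x. ennreal ((C1 + C2) * A powr (2 - p)) * ennreal (F x powr p))"
      by (intro mult_left_mono nn_integral_mono inner) auto
    also have "... = ennreal (2 * (C1 + C2) * A powr (2 - p)) * (NNL x. ennreal (F x powr p))"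
    proof (subst nn_integral_cmult)
      show "2 * (ennreal ((C1 + C2) * A powr (2 - p)) * (NNL x. ennreal (F x powr p))) =
        ennreal (2 * (C1 + C2) * A powr (2 - p)) * (NNL x. ennreal (F x powr p))"
        using C1 C2 ennreal_mult[of 2 "(C1 + C2) * A powr (2 - p)"]
        by (simp only: mult.assoc ennreal_numeral) (simp add: mult.assoc)
    qed measurable
    finally show "riesz a F F <= ennreal (2 * (C1 + C2) * A powr (2 - p)) * (NNL x. ennreal (F x powr p))" .
  qed
qed

text \<open>Young's inequality for f and g normalised by P^(1/p) and Q^(1/q). P and Q are upper
  bounds in place of the exact integrals, which lets estimates of masses be inserted directly; a
  vanishing bound is treated apart because the normalisation divides by it.\<close>

lemma nn_Holder:
  fixes f g :: "'a => real"
  assumes pq: "1 < p" "1 < q" "1 / p + 1 / q = 1"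
    and [measurable]: "f \<in> borel_measurable M" "g \<in> borel_measurable M"
    and nn: "\<And>x. 0 <= f x" "\<And>x. 0 <= g x"
    and P: "(\<integral>\<^sup>+x. ennreal (f x powr p) \<partial>M) <= ennreal P" "0 <= P"
    and Q: "(\<integral>\<^sup>+x. ennreal (g x powr q) \<partial>M) <= ennreal Q" "0 <= Q"
  shows "(\<integral>\<^sup>+x. ennreal (f x * g x) \<partial>M) <= ennreal (P powr (1 / p) * Q powr (1 / q))"
proof (cases "P = 0 \<or> Q = 0")
  case True
  have "AE x in M. f x * g x = 0"
    using True
  proof
    assume "P = 0"
    then have "(\<integral>\<^sup>+x. ennreal (f x powr p) \<partial>M) = 0" using P by simp
    then have "AE x in M. ennreal (f x powr p) = 0" by (subst (asm) nn_integral_0_iff_AE) auto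
    then show ?thesis by eventually_elim auto
  next
    assume "Q = 0"
    then have "(\<integral>\<^sup>+x. ennreal (g x powr q) \<partial>M) = 0" using Q by simp
    then have "AE x in M. ennreal (g x powr q) = 0" by (subst (asm) nn_integral_0_iff_AE) auto
    then show ?thesis by eventually_elim auto
  qed
  then have "(\<integral>\<^sup>+x. ennreal (f x * g x) \<partial>M) = (\<integral>\<^sup>+x. 0 \<partial>M)"
    by (intro nn_integral_cong_AE) auto
  then show ?thesis by simp
next
  case False
  then have P0: "0 < P" and Q0: "0 < Q" using P Q by auto
  define u where "u = P powr (1 / p)"
  define v where "v = Q powr (1 / q)"
  have uv: "0 < u" "0 < v" using P0 Q0 by (auto simp: u_def v_def)
  have up: "u powr p = P" "v powr q = Q" using P0 Q0 pq by (auto simp: u_def v_def powr_powr)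
  have pw: "f x * g x <= u * v / (p * P) * f x powr p + u * v / (q * Q) * g x powr q" for x
  proof -
    have "(f x / u) * (g x / v) <= (f x / u) powr p / p + (g x / v) powr q / q"
      using nn uv pq by (intro Youngs_inequality) auto
    also have "... = f x powr p / (p * P) + g x powr q / (q * Q)"
      using nn uv by (simp add: powr_divide up mult.commute)
    finally have "(u * v) * ((f x / u) * (g x / v)) <= (u * v) * (f x powr p / (p * P) + g x powr q / (q * Q))"
      using uv by (intro mult_left_mono) auto
    then show ?thesis using uv by (simp add: field_simps)
  qed
  have "(\<integral>\<^sup>+x. ennreal (f x * g x) \<partial>M)
      <= (\<integral>\<^sup>+x. ennreal (u * v / (p * P)) * ennreal (f x powr p) + ennreal (u * v / (q * Q)) * ennreal (g x powr q) \<partial>M)"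
    using uv P0 Q0 pq
    by (intro nn_integral_mono) (auto simp: ennreal_mult[symmetric] ennreal_plus[symmetric] simp del: ennreal_plus intro!: ennreal_leI order_trans[OF pw])
  also have "... = ennreal (u * v / (p * P)) * (\<integral>\<^sup>+x. ennreal (f x powr p) \<partial>M) + ennreal (u * v / (q * Q)) * (\<integral>\<^sup>+x. ennreal (g x powr q) \<partial>M)"
    by (simp add: nn_integral_add nn_integral_cmult)
  also have "... <= ennreal (u * v / (p * P)) * ennreal P + ennreal (u * v / (q * Q)) * ennreal Q"
    by (intro add_mono mult_left_mono P Q) auto
  also have "... = ennreal (u * v / (p * P) * P + u * v / (q * Q) * Q)"
    using uv P0 Q0 pq by (simp add: ennreal_mult[symmetric] ennreal_plus[symmetric] del: ennreal_plus)
  also have "u * v / (p * P) * P + u * v / (q * Q) * Q = u * v * (1 / p + 1 / q)"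
    using P0 Q0 by (simp add: field_simps)
  finally show ?thesis using pq by (simp add: u_def v_def)
qed

section \<open>Affine changes of variables and inversion\<close>

lemma nn_integral_lborel_affine:
  fixes f :: "'a::euclidean_space => ennreal"
  assumes [measurable]: "f \<in> borel_measurable borel" and c: "c \<noteq> 0"
  shows "(NNL x. f x) = ennreal (\<bar>c\<bar> ^ DIM('a)) * (NNL x. f (t + c *\<^sub>R x))"
  by (subst lborel_affine[OF c, of t])
     (simp add: nn_integral_density nn_integral_distr nn_integral_cmult)

text \<open>The measure with density 1 / (norm x ^ n) is dilation invariant. Averaging over dilations with a
  cutoff w reduces its invariance under inversion to the reflection s -> 2 ln (norm x) - s of the real line.\<close>

lemma nn_integral_inversion_inv_norm:
  fixes f :: "'a::euclidean_space => ennreal"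
  assumes [measurable]: "f \<in> borel_measurable borel"
  shows "(NNL x. f (x /\<^sub>R (norm x)\<^sup>2) * ennreal (norm x powr (- real DIM('a))))
       = (NNL x. f x * ennreal (norm x powr (- real DIM('a))))"
proof -
  let ?n = "real DIM('a)"
  define w :: "'a => ennreal" where "w x = indicator {x. x \<noteq> 0 \<and> 0 <= ln (norm x) \<and> ln (norm x) < 1} x" for x
  have [measurable]: "w \<in> borel_measurable borel" unfolding w_def by measurable
  have w1: "(NNL s. w (exp s *\<^sub>R x)) = 1" if "x \<noteq> 0" for x :: 'a
  proof -
    have "(NNL s. w (exp s *\<^sub>R x)) = (NNL s. indicator {- ln (norm x) ..< 1 - ln (norm x)} s)"
      using that by (intro nn_integral_cong) (auto simp: w_def indicator_def ln_mult)
    then show ?thesis by simp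
  qed
  \<comment> \<open>By \<open>w1\<close> the cutoff has total mass one along every dilation orbit.
    After it is inserted and the integrals are exchanged, the dilation is undone in x at fixed s,
    which leaves the cutoff on x and the orbit integral on g.\<close>
  have key: "(NNL x. g x * ennreal (norm x powr (- ?n)))
     = (NNL x. ennreal (norm x powr (- ?n)) * w x * (NNL s. g (exp (- s) *\<^sub>R x)))"
    if [measurable]: "g \<in> borel_measurable borel" for g :: "'a => ennreal"
  proof -
    have "(NNL x. g x * ennreal (norm x powr (- ?n)))
       = (NNL x. (NNL s. g x * ennreal (norm x powr (- ?n)) * w (exp s *\<^sub>R x)))"
    proof (intro nn_integral_cong)
      fix x :: 'a
      show "g x * ennreal (norm x powr (- ?n)) = (NNL s. g x * ennreal (norm x powr (- ?n)) * w (exp s *\<^sub>R x))"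
        by (cases "x = 0") (auto simp: nn_integral_cmult w1)
    qed
    also have "... = (NNL s. (NNL x. g x * ennreal (norm x powr (- ?n)) * w (exp s *\<^sub>R x)))"
      by (rule lborel_pair.Fubini') measurable
    also have "... = (NNL s. (NNL x. g (exp (- s) *\<^sub>R x) * ennreal (norm x powr (- ?n)) * w x))"
    proof (rule nn_integral_cong)
      fix s :: real
      have "(NNL x. g x * ennreal (norm x powr (- ?n)) * w (exp s *\<^sub>R x))
        = ennreal (exp (- s) ^ DIM('a)) * (NNL x. g (exp (- s) *\<^sub>R x) * ennreal (norm (exp (- s) *\<^sub>R x) powr (- ?n)) * w (exp s *\<^sub>R (exp (- s) *\<^sub>R x)))"
        by (subst nn_integral_lborel_affine[where c = "exp (- s)" and t = 0]) simp_all
      also have "... = (NNL x. ennreal (exp (- s) ^ DIM('a)) * (g (exp (- s) *\<^sub>R x) * ennreal (norm (exp (- s) *\<^sub>R x) powr (- ?n)) * w (exp s *\<^sub>R (exp (- s) *\<^sub>R x))))"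
        by (subst nn_integral_cmult) auto
      also have "... = (NNL x. g (exp (- s) *\<^sub>R x) * ennreal (norm x powr (- ?n)) * w x)"
      proof (intro nn_integral_cong)
        fix x :: 'a
        have "exp (- s) ^ DIM('a) * norm (exp (- s) *\<^sub>R x) powr (- ?n) = norm x powr (- ?n)"
        proof -
          have "exp (- s) powr (- ?n) = inverse (exp (- s) ^ DIM('a))"
            by (simp add: powr_minus powr_realpow)
          then show ?thesis by (simp add: powr_mult)
        qed
        then have "ennreal (exp (- s) ^ DIM('a)) * ennreal (norm (exp (- s) *\<^sub>R x) powr (- ?n)) = ennreal (norm x powr (- ?n))"
          by (simp add: ennreal_mult[symmetric])
        moreover have "exp s *\<^sub>R (exp (- s) *\<^sub>R x) = x"
          by (simp add: exp_minus)
        ultimately show "ennreal (exp (- s) ^ DIM('a)) * (g (exp (- s) *\<^sub>R x) * ennreal (norm (exp (- s) *\<^sub>R x) powr (- ?n)) * w (exp s *\<^sub>R (exp (- s) *\<^sub>R x)))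
          = g (exp (- s) *\<^sub>R x) * ennreal (norm x powr (- ?n)) * w x"
          by (simp only: mult_ac)
      qed
      finally show "(NNL x. g x * ennreal (norm x powr (- ?n)) * w (exp s *\<^sub>R x))
        = (NNL x. g (exp (- s) *\<^sub>R x) * ennreal (norm x powr (- ?n)) * w x)" .
    qed
    also have "... = (NNL x. (NNL s. g (exp (- s) *\<^sub>R x) * ennreal (norm x powr (- ?n)) * w x))"
      by (rule lborel_pair.Fubini') measurable
    also have "... = (NNL x. ennreal (norm x powr (- ?n)) * w x * (NNL s. g (exp (- s) *\<^sub>R x)))"
    proof (rule nn_integral_cong)
      fix x :: 'a
      have "(NNL s. g (exp (- s) *\<^sub>R x) * ennreal (norm x powr (- ?n)) * w x)
        = (NNL s. (ennreal (norm x powr (- ?n)) * w x) * g (exp (- s) *\<^sub>R x))"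
        by (simp only: mult_ac)
      also have "... = ennreal (norm x powr (- ?n)) * w x * (NNL s. g (exp (- s) *\<^sub>R x))"
        by (rule nn_integral_cmult) measurable
      finally show "(NNL s. g (exp (- s) *\<^sub>R x) * ennreal (norm x powr (- ?n)) * w x)
        = ennreal (norm x powr (- ?n)) * w x * (NNL s. g (exp (- s) *\<^sub>R x))" .
    qed
    finally show ?thesis .
  qed
  have refl: "(NNL s. f ((exp (- s) *\<^sub>R x) /\<^sub>R (norm (exp (- s) *\<^sub>R x))\<^sup>2)) = (NNL s. f (exp (- s) *\<^sub>R x))"
    if x: "x \<noteq> 0" for x :: 'a
  proof -
    define L where "L = ln (norm x)"
    have nx: "norm x = exp L" using x by (simp add: L_def)
    have "(NNL s. f (exp (- s) *\<^sub>R x)) = (NNL s. f (exp (- (2 * L + (-1) * s)) *\<^sub>R x))"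
      by (subst nn_integral_real_affine[where c = "-1" and t = "2 * L"]) auto
    also have "... = (NNL s. f ((exp (- s) *\<^sub>R x) /\<^sub>R (norm (exp (- s) *\<^sub>R x))\<^sup>2))"
    proof (intro nn_integral_cong arg_cong[where f = f])
      fix s
      have "exp (- (2 * L + (-1) * s)) = inverse ((exp (- s) * exp L)\<^sup>2) * exp (- s)"
        by (simp add: exp_minus[symmetric] exp_add[symmetric] power2_eq_square mult_exp_exp)
      then show "exp (- (2 * L + (-1) * s)) *\<^sub>R x = (exp (- s) *\<^sub>R x) /\<^sub>R (norm (exp (- s) *\<^sub>R x))\<^sup>2"
        by (simp add: nx)
    qed
    finally show ?thesis by simp
  qed
  have "(NNL x. f (x /\<^sub>R (norm x)\<^sup>2) * ennreal (norm x powr (- ?n)))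
     = (NNL x. ennreal (norm x powr (- ?n)) * w x * (NNL s. f ((exp (- s) *\<^sub>R x) /\<^sub>R (norm (exp (- s) *\<^sub>R x))\<^sup>2)))"
    by (rule key) measurable
  also have "... = (NNL x. ennreal (norm x powr (- ?n)) * w x * (NNL s. f (exp (- s) *\<^sub>R x)))"
  proof (rule nn_integral_cong)
    fix x :: 'a
    show "ennreal (norm x powr (- ?n)) * w x * (NNL s. f ((exp (- s) *\<^sub>R x) /\<^sub>R (norm (exp (- s) *\<^sub>R x))\<^sup>2))
        = ennreal (norm x powr (- ?n)) * w x * (NNL s. f (exp (- s) *\<^sub>R x))"
    proof (cases "x = 0")
      case False
      show ?thesis unfolding refl[OF False] ..
    qed simp
  qed
  also have "... = (NNL x. f x * ennreal (norm x powr (- ?n)))"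
    by (rule key[symmetric]) measurable
  finally show ?thesis .
qed

text \<open>The Jacobian |x|^(-2n) of the inversion results from applying the preceding invariance
  to f(x) |x|^n.\<close>

lemma nn_integral_inversion:
  fixes f :: "'a::euclidean_space => ennreal"
  assumes [measurable]: "f \<in> borel_measurable borel"
  shows "(NNL x. f (x /\<^sub>R (norm x)\<^sup>2) * ennreal (norm x powr (- 2 * real DIM('a)))) = (NNL x. f x)"
proof -
  let ?n = "real DIM('a)"
  have n0: "AE x in lborel. (x::'a) \<noteq> 0" by (rule AE_lborel_singleton)
  have "(NNL x. f (x /\<^sub>R (norm x)\<^sup>2) * ennreal (norm x powr (- 2 * ?n)))
    = (NNL x. (f (x /\<^sub>R (norm x)\<^sup>2) * ennreal (norm (x /\<^sub>R (norm x)\<^sup>2) powr ?n)) * ennreal (norm x powr (- ?n)))"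
  proof (intro nn_integral_cong)
    fix x :: 'a
    have "norm x powr (- 2 * ?n) = norm (x /\<^sub>R (norm x)\<^sup>2) powr ?n * norm x powr (- ?n)"
    proof (cases "x = 0")
      case False
      then have "norm (x /\<^sub>R (norm x)\<^sup>2) = norm x powr (-1)"
        by (simp add: powr_minus field_simps power2_eq_square)
      then show ?thesis by (simp only: powr_powr powr_add[symmetric]) simp
    qed simp
    then show "f (x /\<^sub>R (norm x)\<^sup>2) * ennreal (norm x powr (- 2 * ?n))
      = (f (x /\<^sub>R (norm x)\<^sup>2) * ennreal (norm (x /\<^sub>R (norm x)\<^sup>2) powr ?n)) * ennreal (norm x powr (- ?n))"
      by (simp only: ennreal_mult[OF powr_ge_zero powr_ge_zero] mult_ac)
  qed
  also have "... = (NNL x. (f x * ennreal (norm x powr ?n)) * ennreal (norm x powr (- ?n)))"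
    by (rule nn_integral_inversion_inv_norm) measurable
  also have "... = (NNL x. f x)"
    using n0 by (intro nn_integral_cong_AE, eventually_elim)
      (simp add: mult.assoc ennreal_mult[symmetric] powr_add[symmetric])
  finally show ?thesis .
qed

section \<open>The sharp Hardy-Littlewood-Sobolev constant\<close>

definition nnborel :: "('a::euclidean_space => real) => bool" where
  "nnborel f \<longleftrightarrow> f \<in> borel_measurable borel \<and> (\<forall>x. 0 <= f x)"

definition Lp_mass :: "real => ('a::euclidean_space => real) => ennreal" where
  "Lp_mass p f = (NNL x. ennreal (f x powr p))"

text \<open>For p = 2n/(2n - a) this is the sharp constant of the diagonal Hardy-Littlewood-Sobolev
  inequality. As an extended real it makes sense before its finiteness is known.\<close>

definition riesz_sup :: "'a::euclidean_space itself => real => real => ennreal" where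
  "riesz_sup T a p = (SUP f\<in>{f::'a => real. nnborel f \<and> Lp_mass p f <= 1}. riesz a f f)"

lemma nnborelD: "nnborel f ==> f \<in> borel_measurable borel" "nnborel f ==> 0 <= f x"
  by (auto simp: nnborel_def)

lemma riesz_commute:
  assumes "nnborel f" "nnborel g"
  shows "riesz a f g = riesz a g f"
proof -
  note [measurable] = assms[THEN nnborelD(1)]
  have "riesz a f g = (\<integral>\<^sup>+y. \<integral>\<^sup>+x. ennreal (f x * g y * norm (x - y) powr (-a)) \<partial>lborel \<partial>lborel)"
    unfolding riesz_def by (rule lborel_pair.Fubini') measurable
  then show ?thesis by (simp add: riesz_def norm_minus_commute mult.commute)
qed

lemma riesz_add_right:
  assumes "nnborel f" "nnborel g" "nnborel h"
  shows "riesz a f (\<lambda>x. g x + h x) = riesz a f g + riesz a f h"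
proof -
  note [measurable] = assms[THEN nnborelD(1)]
  have "riesz a f (\<lambda>x. g x + h x) = (NNL x. (NNL y. ennreal (f x * g y * norm (x - y) powr (-a)) + ennreal (f x * h y * norm (x - y) powr (-a))))"
    unfolding riesz_def using assms[THEN nnborelD(2)]
    by (simp add: ennreal_plus[symmetric] distrib_left distrib_right del: ennreal_plus)
  also have "... = (NNL x. (NNL y. ennreal (f x * g y * norm (x - y) powr (-a))) + (NNL y. ennreal (f x * h y * norm (x - y) powr (-a))))"
    by (intro nn_integral_cong nn_integral_add) measurable
  also have "... = riesz a f g + riesz a f h"
    unfolding riesz_def by (rule nn_integral_add) measurable
  finally show ?thesis .
qed

lemma riesz_add_left:
  assumes "nnborel f" "nnborel g" "nnborel h"
  shows "riesz a (\<lambda>x. g x + h x) f = riesz a g f + riesz a h f"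
proof -
  have "nnborel (\<lambda>x. g x + h x)" using assms by (auto simp: nnborel_def)
  then show ?thesis using riesz_add_right[OF assms] riesz_commute assms by metis
qed

lemma riesz_mono:
  assumes "\<And>x. 0 <= f x" "\<And>x. 0 <= g x" "\<And>x. f x <= f' x" "\<And>x. g x <= g' x"
  shows "riesz a f g <= riesz a f' g'"
  unfolding riesz_def using assms
  by (intro nn_integral_mono ennreal_leI mult_right_mono mult_mono order_trans[OF assms(1,3)]) auto

lemma riesz_cmult:
  assumes "nnborel f" "0 <= c"
  shows "riesz a (\<lambda>x. c * f x) (\<lambda>x. c * f x) = ennreal (c\<^sup>2) * riesz a f f"
proof -
  note [measurable] = assms(1)[THEN nnborelD(1)]
  have "riesz a (\<lambda>x. c * f x) (\<lambda>x. c * f x) = (\<integral>\<^sup>+x. \<integral>\<^sup>+y. ennreal (c\<^sup>2) * ennreal (f x * f y * norm (x - y) powr (-a)) \<partial>lborel \<partial>lborel)"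
    unfolding riesz_def using assms nnborelD(2)[OF assms(1)]
    by (simp add: ennreal_mult[symmetric] power2_eq_square mult_ac)
  also have "... = (NNL x. ennreal (c\<^sup>2) * (NNL y. ennreal (f x * f y * norm (x - y) powr (-a))))"
    by (intro nn_integral_cong nn_integral_cmult) measurable
  also have "... = ennreal (c\<^sup>2) * riesz a f f"
    unfolding riesz_def by (rule nn_integral_cmult) measurable
  finally show ?thesis .
qed

lemma Lp_mass_cmult:
  assumes "nnborel f" "0 <= c"
  shows "Lp_mass p (\<lambda>x. c * f x) = ennreal (c powr p) * Lp_mass p f"
proof -
  note [measurable] = assms(1)[THEN nnborelD(1)]
  show ?thesis unfolding Lp_mass_def using assms nnborelD(2)[OF assms(1)]
    by (subst nn_integral_cmult[symmetric]) (auto simp: powr_mult ennreal_mult)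
qed

lemma Lp_mass_affine:
  fixes f :: "'a::euclidean_space => real"
  assumes f: "nnborel f" and s: "0 < s" and p: "0 < p"
  shows "Lp_mass p (\<lambda>x. s powr (real DIM('a) / p) * f (z + s *\<^sub>R x)) = Lp_mass p f"
proof -
  note [measurable] = f[THEN nnborelD(1)]
  have "Lp_mass p f = ennreal (s ^ DIM('a)) * (NNL x. ennreal (f (z + s *\<^sub>R x) powr p))"
    unfolding Lp_mass_def using s by (subst nn_integral_lborel_affine[where c = s and t = z]) auto
  also have "... = (NNL x. ennreal (s ^ DIM('a)) * ennreal (f (z + s *\<^sub>R x) powr p))"
    by (rule nn_integral_cmult[symmetric]) measurable
  also have "... = Lp_mass p (\<lambda>x. s powr (real DIM('a) / p) * f (z + s *\<^sub>R x))"
    unfolding Lp_mass_def using s p nnborelD(2)[OF f]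
    by (simp add: powr_mult powr_powr powr_realpow ennreal_mult)
  finally show ?thesis by simp
qed

text \<open>For this p one has n/p = n - a/2, so the two Jacobians s^n and the kernel factor s^(-a)
  are absorbed exactly by the normalisation that also preserves the p-mass. This common invariance
  is what allows rescaling near maximizers.\<close>

lemma riesz_affine:
  fixes f :: "'a::euclidean_space => real"
  assumes f: "nnborel f" and s: "0 < s" and p: "p = 2 * real DIM('a) / (2 * real DIM('a) - a)" "a < real DIM('a)"
  shows "riesz a (\<lambda>x. s powr (real DIM('a) / p) * f (z + s *\<^sub>R x)) (\<lambda>x. s powr (real DIM('a) / p) * f (z + s *\<^sub>R x)) = riesz a f f"
proof -
  note [measurable] = f[THEN nnborelD(1)]
  have s0: "s \<noteq> 0" using s by simp
  note aff = nn_integral_lborel_affine[OF _ s0, of _ z, unfolded abs_of_pos[OF s]]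
  let ?n = "real DIM('a)"
  have np: "?n / p = ?n - a / 2" using p(2) DIM_positive[where 'a = 'a] by (simp add: p(1) field_simps)
  have "riesz a f f = ennreal (s ^ DIM('a)) * (NNL x. (NNL y. ennreal (f (z + s *\<^sub>R x) * f y * norm (z + s *\<^sub>R x - y) powr (-a))))"
    unfolding riesz_def by (rule aff) measurable
  also have "... = (NNL x. ennreal (s ^ DIM('a)) * (NNL y. ennreal (f (z + s *\<^sub>R x) * f y * norm (z + s *\<^sub>R x - y) powr (-a))))"
    by (rule nn_integral_cmult[symmetric]) measurable
  also have "... = (NNL x. ennreal (s ^ DIM('a)) * (ennreal (s ^ DIM('a)) * (NNL y. ennreal (f (z + s *\<^sub>R x) * f (z + s *\<^sub>R y) * norm (z + s *\<^sub>R x - (z + s *\<^sub>R y)) powr (-a)))))"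
    by (intro nn_integral_cong arg_cong2[where f = "(*)"] aff HOL.refl) measurable
  also have "... = (NNL x. (NNL y. ennreal (s ^ DIM('a)) * (ennreal (s ^ DIM('a)) * ennreal (f (z + s *\<^sub>R x) * f (z + s *\<^sub>R y) * norm (z + s *\<^sub>R x - (z + s *\<^sub>R y)) powr (-a)))))"
    by (intro nn_integral_cong) (simp add: nn_integral_cmult)
  also have "... = riesz a (\<lambda>x. s powr (?n / p) * f (z + s *\<^sub>R x)) (\<lambda>x. s powr (?n / p) * f (z + s *\<^sub>R x))"
    unfolding riesz_def
  proof (intro nn_integral_cong)
    fix x y
    have "z + s *\<^sub>R x - (z + s *\<^sub>R y) = s *\<^sub>R (x - y)" by (simp add: scaleR_diff_right)
    then have "norm (z + s *\<^sub>R x - (z + s *\<^sub>R y)) powr (-a) = s powr (-a) * norm (x - y) powr (-a)"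
      using s by (simp add: powr_mult)
    moreover have "s ^ DIM('a) * (s ^ DIM('a) * s powr (-a)) = s powr (?n / p) * s powr (?n / p)"
      using s by (simp add: np powr_realpow[symmetric] powr_add[symmetric])
    ultimately have "s ^ DIM('a) * (s ^ DIM('a) * (f (z + s *\<^sub>R x) * f (z + s *\<^sub>R y) * norm (z + s *\<^sub>R x - (z + s *\<^sub>R y)) powr (-a)))
      = s powr (?n / p) * f (z + s *\<^sub>R x) * (s powr (?n / p) * f (z + s *\<^sub>R y)) * norm (x - y) powr (-a)"
      by (simp add: mult_ac)
    then show "ennreal (s ^ DIM('a)) * (ennreal (s ^ DIM('a)) * ennreal (f (z + s *\<^sub>R x) * f (z + s *\<^sub>R y) * norm (z + s *\<^sub>R x - (z + s *\<^sub>R y)) powr (-a)))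
      = ennreal (s powr (?n / p) * f (z + s *\<^sub>R x) * (s powr (?n / p) * f (z + s *\<^sub>R y)) * norm (x - y) powr (-a))"
      using s nnborelD(2)[OF f] by (simp add: ennreal_mult[symmetric])
  qed
  finally show ?thesis by simp
qed

text \<open>Hoelder's inequality against the indicator of the ball; the conjugate exponent 2n/a
  turns its volume, of order t^n, into t^(a/2), which is the growth assumed in
  \<open>riesz_le_Morrey\<close>.\<close>

lemma Lp_ball_bound:
  fixes F :: "'a::euclidean_space => real"
  assumes a: "0 < a" "a < real DIM('a)" and p: "p = 2 * real DIM('a) / (2 * real DIM('a) - a)"
    and F: "nnborel F" "Lp_mass p F <= ennreal P" "0 <= P" and t: "0 < t"
  shows "(NNL y. ennreal (F y) * indicator (ball x t) y)
    <= ennreal (P powr (1 / p) * unit_ball_vol (real DIM('a)) powr (a / (2 * real DIM('a))) * t powr (a / 2))"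
proof -
  let ?n = "real DIM('a)"
  let ?V = "unit_ball_vol ?n"
  define q where "q = 2 * ?n / a"
  have pq: "1 < p" "1 < q" "1 / p + 1 / q = 1" using a by (auto simp: p q_def field_simps)
  have "(NNL y. ennreal (F y) * indicator (ball x t) y) = (NNL y. ennreal (F y * indicator (ball x t) y))"
    by (intro nn_integral_cong) (simp add: indicator_def)
  also have "... <= ennreal (P powr (1 / p) * (?V * t ^ DIM('a)) powr (1 / q))"
  proof (rule nn_Holder[OF pq])
    show "F \<in> borel_measurable lborel" using F by (simp add: nnborel_def)
    show "indicator (ball x t) \<in> borel_measurable lborel" by (intro borel_measurable_indicator) simp
    have "(NNL y. ennreal (indicator (ball x t) y powr q)) = (NNL y. indicator (ball x t) y)"
      by (intro nn_integral_cong) (simp add: indicator_def)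
    also have "... = ennreal (?V * t ^ DIM('a))"
      using t by (simp add: nn_integral_indicator emeasure_ball)
    finally show "(NNL y. ennreal (indicator (ball x t) y powr q)) <= ennreal (?V * t ^ DIM('a))" by simp
  qed (use F t in \<open>auto simp: nnborel_def Lp_mass_def\<close>)
  also have "(?V * t ^ DIM('a)) powr (1 / q) = ?V powr (a / (2 * ?n)) * t powr (a / 2)"
    using t a by (simp add: powr_mult q_def powr_realpow[symmetric] powr_powr)
  finally show ?thesis by (simp add: mult.assoc)
qed

lemma riesz_le_sup1:
  fixes f :: "'a::euclidean_space => real"
  assumes "nnborel f" "Lp_mass p f <= 1"
  shows "riesz a f f <= riesz_sup TYPE('a) a p"
  unfolding riesz_sup_def using assms by (intro SUP_upper) auto

lemma riesz_zero_AE: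
  fixes f g :: "'a::euclidean_space => real"
  assumes "nnborel f" "AE x in lborel. f x = 0"
  shows "riesz a f g = 0"
proof -
  have "riesz a f g = (\<integral>\<^sup>+x. 0 \<partial>(lborel::'a measure))"
    unfolding riesz_def
  proof (rule nn_integral_cong_AE)
    show "AE x in lborel. (NNL y. ennreal (f x * g y * norm (x - y) powr (-a))) = 0"
      using assms(2) by eventually_elim simp
  qed
  then show ?thesis by simp
qed

lemma Lp_mass_zero_AE:
  assumes "nnborel f" "Lp_mass p f = 0"
  shows "AE x in lborel. f x = 0"
proof -
  note [measurable] = nnborelD(1)[OF assms(1)]
  have "AE x in lborel. ennreal (f x powr p) = 0"
    using assms(2) unfolding Lp_mass_def by (subst (asm) nn_integral_0_iff_AE) auto
  then show ?thesis by eventually_elim (simp add: ennreal_eq_0_iff)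
qed

lemma riesz_le_sup:
  fixes f :: "'a::euclidean_space => real"
  assumes f: "nnborel f" "Lp_mass p f <= ennreal P" and P: "0 <= P" and p: "0 < p"
  shows "riesz a f f <= riesz_sup TYPE('a) a p * ennreal (P powr (2 / p))"
proof (cases "P = 0")
  case True
  then show ?thesis using f riesz_zero_AE[OF f(1) Lp_mass_zero_AE[OF f(1), of p]] by simp
next
  case False
  define c where "c = P powr (1 / p)"
  have c: "0 < c" using False P by (simp add: c_def)
  have cp: "c powr p = P" "c\<^sup>2 = P powr (2 / p)"
    using False P p by (auto simp: c_def powr_powr power2_eq_square powr_add[symmetric])
  define g where "g x = (1 / c) * f x" for x
  have g: "nnborel g" unfolding g_def using f c by (auto simp: nnborel_def)
  have "Lp_mass p g = ennreal ((1 / c) powr p) * Lp_mass p f"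
    unfolding g_def using f c by (intro Lp_mass_cmult) auto
  also have "... <= ennreal ((1 / c) powr p) * ennreal P" by (intro mult_left_mono f) auto
  also have "... = 1" using c P False by (simp add: ennreal_mult[symmetric] powr_divide cp)
  finally have "riesz a g g <= riesz_sup TYPE('a) a p" by (intro riesz_le_sup1 g)
  then have "ennreal (c\<^sup>2) * riesz a g g <= ennreal (c\<^sup>2) * riesz_sup TYPE('a) a p" by (intro mult_left_mono) auto
  moreover have "f = (\<lambda>x. c * g x)" using c by (auto simp: g_def)
  then have "riesz a f f = ennreal (c\<^sup>2) * riesz a g g" using riesz_cmult[OF g, of c a] c by simp
  ultimately show ?thesis by (simp add: cp mult.commute)
qed

text \<open>Finite since unit p-mass implies the Morrey growth with a universal constant; positive
  since the indicator of the unit ball has positive energy.\<close>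

lemma riesz_sup_pos_finite:
  assumes a: "0 < a" "a < real DIM('a::euclidean_space)" and p: "p = 2 * real DIM('a) / (2 * real DIM('a) - a)"
  obtains A where "0 < A" "riesz_sup TYPE('a) a p = ennreal A"
proof -
  let ?n = "real DIM('a)"
  let ?V = "unit_ball_vol ?n"
  have p0: "0 < p" using a by (simp add: p)
  have V: "0 < ?V" by simp
  obtain C where C: "0 < C" and le: "\<And>(F::'a => real) A. F \<in> borel_measurable borel ==> (\<forall>x. 0 <= F x) ==> 0 < A ==>
    (\<forall>x t. 0 < t --> (NNL y. ennreal (F y) * indicator (ball x t) y) <= ennreal (A * t powr (a / 2))) ==>
    riesz a F F <= ennreal (C * A powr (2 - p)) * (NNL x. ennreal (F x powr p))"
    using riesz_le_Morrey[OF a p] by blast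
  define B where "B = ?V powr (a / (2 * ?n))"
  have B: "0 < B" using V unfolding B_def by (simp only: powr_gt_zero)
  have "riesz_sup TYPE('a) a p <= ennreal (C * B powr (2 - p))"
    unfolding riesz_sup_def
  proof (intro SUP_least, clarify)
    fix f :: "'a => real" assume f: "nnborel f" "Lp_mass p f <= 1"
    have "riesz a f f <= ennreal (C * B powr (2 - p)) * (NNL x. ennreal (f x powr p))"
    proof (rule le)
      show "\<forall>x t. 0 < t --> (NNL y. ennreal (f y) * indicator (ball x t) y) <= ennreal (B * t powr (a / 2))"
        using Lp_ball_bound[OF a p f(1), of 1] f(2) by (simp add: B_def)
    qed (use f B in \<open>auto simp: nnborel_def\<close>)
    also have "... <= ennreal (C * B powr (2 - p)) * 1"
      using f by (intro mult_left_mono) (auto simp: Lp_mass_def)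
    finally show "riesz a f f <= ennreal (C * B powr (2 - p))" by simp
  qed
  then have fin: "riesz_sup TYPE('a) a p < top" using ennreal_less_top le_less_trans by blast
  define f :: "'a => real" where "f x = indicator (ball 0 1) x" for x
  have f: "nnborel f" unfolding f_def nnborel_def
    by (auto intro!: borel_measurable_indicator)
  have mf: "Lp_mass p f = ennreal ?V"
  proof -
    have "Lp_mass p f = (\<integral>\<^sup>+x. indicator (ball 0 1) x \<partial>(lborel::'a measure))"
      unfolding Lp_mass_def f_def by (intro nn_integral_cong) (simp add: indicator_def)
    then show ?thesis by (simp add: nn_integral_indicator emeasure_ball)
  qed
  have "riesz a f f \<noteq> 0"
  proof
    assume z: "riesz a f f = 0"
    have "(\<integral>\<^sup>+x. indicator (ball 0 1) x * (ennreal (2 powr (-a)) * ennreal ?V) \<partial>(lborel::'a measure)) <= riesz a f f"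
      unfolding riesz_def
    proof (intro nn_integral_mono)
      fix x :: 'a
      show "indicator (ball 0 1) x * (ennreal (2 powr (-a)) * ennreal ?V) <= (NNL y. ennreal (f x * f y * norm (x - y) powr (-a)))"
      proof (cases "x \<in> ball 0 1")
        case True
        have "ennreal (2 powr (-a)) * ennreal ?V = ennreal (2 powr (-a)) * (\<integral>\<^sup>+y. indicator (ball 0 1) y \<partial>(lborel::'a measure))"
          by (simp add: nn_integral_indicator emeasure_ball)
        also have "... = (\<integral>\<^sup>+y. ennreal (2 powr (-a)) * indicator (ball 0 1) y \<partial>(lborel::'a measure))"
          by (rule nn_integral_cmult[symmetric]) (intro borel_measurable_indicator, simp)
        also have "... <= (NNL y. ennreal (f x * f y * norm (x - y) powr (-a)))"
        proof (rule nn_integral_mono_AE)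
          show "AE y in lborel. ennreal (2 powr (-a)) * indicator (ball 0 1) y <= ennreal (f x * f y * norm (x - y) powr (-a))"
            using AE_lborel_singleton[of x]
          proof eventually_elim
            case (elim y)
            show ?case
            proof (cases "y \<in> ball 0 1")
              case True
              have "norm (x - y) <= 2" using norm_triangle_ineq4[of x y] True \<open>x \<in> ball 0 1\<close> by simp
              then have "2 powr (-a) <= norm (x - y) powr (-a)" using elim a by (intro powr_mono2') auto
              then show ?thesis using True \<open>x \<in> ball 0 1\<close> by (simp add: f_def ennreal_leI)
            qed simp
          qed
        qed
        finally show ?thesis using True by simp
      qed simp
    qed
    also have "(\<integral>\<^sup>+x. indicator (ball 0 1) x * (ennreal (2 powr (-a)) * ennreal ?V) \<partial>(lborel::'a measure)) = ennreal ?V * (ennreal (2 powr (-a)) * ennreal ?V)"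
      by (subst nn_integral_multc) (auto simp: nn_integral_indicator emeasure_ball intro!: borel_measurable_indicator)
    finally show False using z V by (simp add: ennreal_mult[symmetric])
  qed
  moreover have "riesz a f f <= riesz_sup TYPE('a) a p * ennreal (?V powr (2 / p))"
    using mf V by (intro riesz_le_sup f p0) auto
  ultimately have "riesz_sup TYPE('a) a p \<noteq> 0" by auto
  then show ?thesis using fin that by (cases "riesz_sup TYPE('a) a p") (auto simp: ennreal_eq_0_iff)
qed

section \<open>Near maximizers of the Riesz energy\<close>

text \<open>Vanishing is excluded by the Morrey bound: if every ball mean were small, the energy
  would be at most A/2. A ball with a sizeable mean is carried to the unit ball by the affine
  invariance. The constant c does not depend on delta.\<close>

lemma near_maximizer_normalized:
  assumes a: "0 < a" "a < real DIM('a::euclidean_space)" and p: "p = 2 * real DIM('a) / (2 * real DIM('a) - a)"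
    and A: "riesz_sup TYPE('a) a p = ennreal A" "0 < A"
  shows "\<exists>c>0. \<forall>\<delta>>0. \<exists>F::'a => real. nnborel F \<and> Lp_mass p F <= 1 \<and> ennreal (A - \<delta>) < riesz a F F \<and>
    ennreal c <= (NNL x. ennreal (F x) * indicator (ball 0 1) x)"
proof -
  let ?n = "real DIM('a)"
  have p0: "0 < p" "p < 2" using a by (auto simp: p field_simps)
  have np: "?n / p = ?n - a / 2" using a DIM_positive[where 'a = 'a] by (simp add: p field_simps)
  obtain C where C: "0 < C" and le: "\<And>(F::'a => real) A. F \<in> borel_measurable borel ==> (\<forall>x. 0 <= F x) ==> 0 < A ==>
    (\<forall>x t. 0 < t --> (NNL y. ennreal (F y) * indicator (ball x t) y) <= ennreal (A * t powr (a / 2))) ==>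
    riesz a F F <= ennreal (C * A powr (2 - p)) * (NNL x. ennreal (F x powr p))"
    using riesz_le_Morrey[OF a p] by blast
  \<comment> \<open>This solves C c^(2 - p) = A/2, so a function of unit mass all of whose
    normalised ball means lie below the threshold has energy at most A/2.\<close>
  define c where "c = (A / (2 * C)) powr (1 / (2 - p))"
  have c: "0 < c" using A C by (simp add: c_def)
  have cC: "C * c powr (2 - p) = A / 2" using A C p0 by (simp add: c_def powr_powr)
  show ?thesis
  proof (intro exI[of _ c] conjI allI impI c)
    fix \<delta> :: real assume \<delta>: "0 < \<delta>"
    define \<delta>' where "\<delta>' = min \<delta> (A / 2)"
    have \<delta>': "0 < \<delta>'" "\<delta>' <= A / 2" "\<delta>' <= \<delta>" using \<delta> A by (auto simp: \<delta>'_def)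
    have "ennreal (A - \<delta>') < riesz_sup TYPE('a) a p" using A \<delta>' by (simp add: ennreal_less_iff)
    then obtain F :: "'a => real" where F: "nnborel F" "Lp_mass p F <= 1" "ennreal (A - \<delta>') < riesz a F F"
      unfolding riesz_sup_def less_SUP_iff by auto
    note [measurable] = nnborelD(1)[OF F(1)]
    have "\<exists>z t. 0 < t \<and> ennreal (c * t powr (a / 2)) < (NNL y. ennreal (F y) * indicator (ball z t) y)"
    proof (rule ccontr)
      assume "\<not> ?thesis"
      then have "\<forall>z t. 0 < t --> (NNL y. ennreal (F y) * indicator (ball z t) y) <= ennreal (c * t powr (a / 2))"
        by (meson not_less)
      then have "riesz a F F <= ennreal (C * c powr (2 - p)) * (NNL x. ennreal (F x powr p))"
        using F(1) c by (intro le) (auto simp: nnborel_def)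
      also have "... <= ennreal (C * c powr (2 - p)) * 1"
        using F(2) by (intro mult_left_mono) (auto simp: Lp_mass_def)
      also have "... <= ennreal (A - \<delta>')" using \<delta>' by (simp add: cC ennreal_leI)
      finally show False using F(3) by simp
    qed
    then obtain z t where t: "0 < t" and z: "ennreal (c * t powr (a / 2)) < (NNL y. ennreal (F y) * indicator (ball z t) y)"
      by blast
    define D where "D x = t powr (?n / p) * F (z + t *\<^sub>R x)" for x
    have D: "nnborel D" unfolding D_def nnborel_def using nnborelD[OF F(1)] by auto
    have t0: "t \<noteq> 0" using t by simp
    have [measurable]: "ball z t \<in> sets borel" "ball (0::'a) 1 \<in> sets borel" by auto
    have "(NNL y. ennreal (F y) * indicator (ball z t) y)
       = ennreal (t ^ DIM('a)) * (NNL x. ennreal (F (z + t *\<^sub>R x)) * indicator (ball z t) (z + t *\<^sub>R x))"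
      by (rule nn_integral_lborel_affine[OF _ t0, of _ z, unfolded abs_of_pos[OF t]]) measurable
    also have "... = (NNL x. ennreal (t ^ DIM('a)) * (ennreal (F (z + t *\<^sub>R x)) * indicator (ball z t) (z + t *\<^sub>R x)))"
      by (rule nn_integral_cmult[symmetric]) measurable
    also have "... = (NNL x. ennreal (t powr (a / 2)) * (ennreal (D x) * indicator (ball 0 1) x))"
    proof (rule nn_integral_cong)
      fix x
      have "t ^ DIM('a) = t powr (a / 2) * t powr (?n / p)"
        using t by (simp add: np powr_add[symmetric] powr_realpow)
      moreover have "z + t *\<^sub>R x \<in> ball z t \<longleftrightarrow> x \<in> ball 0 1" using t by (simp add: dist_norm)
      ultimately show "ennreal (t ^ DIM('a)) * (ennreal (F (z + t *\<^sub>R x)) * indicator (ball z t) (z + t *\<^sub>R x))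
        = ennreal (t powr (a / 2)) * (ennreal (D x) * indicator (ball 0 1) x)"
        using nnborelD(2)[OF F(1)] by (simp add: indicator_def D_def ennreal_mult[symmetric] mult.assoc)
    qed
    also have "... = ennreal (t powr (a / 2)) * (NNL x. ennreal (D x) * indicator (ball 0 1) x)"
    proof (rule nn_integral_cmult)
      note [measurable] = nnborelD(1)[OF D]
      show "(\<lambda>x. ennreal (D x) * indicator (ball 0 1) x) \<in> borel_measurable lborel" by measurable
    qed
    finally have "ennreal (t powr (a / 2)) * ennreal c <= ennreal (t powr (a / 2)) * (NNL x. ennreal (D x) * indicator (ball 0 1) x)"
      using z c t by (simp add: ennreal_mult[symmetric] mult.commute)
    then have "ennreal c <= (NNL x. ennreal (D x) * indicator (ball 0 1) x)"
      using t by (subst (asm) ennreal_mult_le_mult_iff) auto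
    moreover have "Lp_mass p D <= 1" unfolding D_def using Lp_mass_affine[OF F(1) t p0(1)] F(2) by simp
    moreover have "ennreal (A - \<delta>) < riesz a D D"
      unfolding D_def riesz_affine[OF F(1) t p a(2)] using F(3) \<delta>'
      by (meson ennreal_leI diff_left_mono le_less_trans)
    ultimately show "\<exists>F::'a => real. nnborel F \<and> Lp_mass p F <= 1 \<and> ennreal (A - \<delta>) < riesz a F F \<and>
      ennreal c <= (NNL x. ennreal (F x) * indicator (ball 0 1) x)"
      using D by blast
  qed
qed

text \<open>Averaging over centres: by Fubini the mean over z in the unit ball of the mass near z is
  at most e^n, so some centre has at most twice that.\<close>

lemma exists_center_small_mass:
  fixes g :: "'a::euclidean_space => ennreal"
  assumes [measurable]: "g \<in> borel_measurable borel" and g: "(NNL x. g x) <= 1" and e: "0 < e"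
  shows "\<exists>z\<in>ball 0 1. (NNL y. g y * indicator {y. norm (z - y) < e} y) <= ennreal (2 * e ^ DIM('a))"
proof (rule ccontr)
  assume neg: "\<not> ?thesis"
  let ?V = "unit_ball_vol (real DIM('a))"
  have V: "0 < ?V" by simp
  have [measurable]: "ball (0::'a) 1 \<in> sets borel" by simp
  have "ennreal (2 * e ^ DIM('a)) * ennreal ?V = (\<integral>\<^sup>+z. ennreal (2 * e ^ DIM('a)) * indicator (ball 0 1) z \<partial>(lborel::'a measure))"
    by (subst nn_integral_cmult_indicator) (auto simp: emeasure_ball)
  also have "... <= (NNL z. (NNL y. indicator (ball 0 1) z * (g y * indicator {y. norm (z - y) < e} y)))"
  proof (rule nn_integral_mono)
    fix z :: 'a
    have "(NNL y. indicator (ball 0 1) z * (g y * indicator {y. norm (z - y) < e} y))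
       = indicator (ball 0 1) z * (NNL y. g y * indicator {y. norm (z - y) < e} y)"
      by (rule nn_integral_cmult) measurable
    then show "ennreal (2 * e ^ DIM('a)) * indicator (ball 0 1) z
      <= (NNL y. indicator (ball 0 1) z * (g y * indicator {y. norm (z - y) < e} y))"
      using neg by (cases "z \<in> ball 0 1") (auto simp: not_le intro: less_imp_le)
  qed
  also have "... = (NNL y. (NNL z. indicator (ball 0 1) z * (g y * indicator {y. norm (z - y) < e} y)))"
    by (rule lborel_pair.Fubini') measurable
  also have "... <= (NNL y. g y * ennreal (?V * e ^ DIM('a)))"
  proof (rule nn_integral_mono)
    fix y :: 'a
    have [measurable]: "ball y e \<in> sets borel" by simp
    have "(NNL z. indicator (ball 0 1) z * (g y * indicator {y. norm (z - y) < e} y))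
      <= (NNL z. g y * indicator (ball y e) z)"
      by (rule nn_integral_mono) (auto simp: indicator_def dist_norm norm_minus_commute)
    also have "... = g y * ennreal (?V * e ^ DIM('a))"
      using e by (subst nn_integral_cmult_indicator) (auto simp: emeasure_ball)
    finally show "(NNL z. indicator (ball 0 1) z * (g y * indicator {y. norm (z - y) < e} y)) <= g y * ennreal (?V * e ^ DIM('a))" .
  qed
  also have "... = (NNL y. g y) * ennreal (?V * e ^ DIM('a))"
    by (rule nn_integral_multc) measurable
  also have "... <= 1 * ennreal (?V * e ^ DIM('a))" by (intro mult_right_mono g) auto
  finally have "2 * e ^ DIM('a) * ?V <= ?V * e ^ DIM('a)"
    using V e by (simp add: ennreal_mult[symmetric])
  then show False using V e by simp
qed

text \<open>The excised mass is of order e^n, and so is the loss of energy, although the cross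
  energy of F and g is a priori only of order e^(n/p). The reason is near maximality: testing with
  the competitor F + g shows that the cross energy is itself of order e^n. The hole prepares an
  inversion about z, which makes the support bounded; the weighted integral in the last claim
  becomes the plain integral of the transformed function.\<close>

lemma near_maximizer_hole:
  assumes a: "0 < a" "a < real DIM('a::euclidean_space)" and p: "p = 2 * real DIM('a) / (2 * real DIM('a) - a)"
    and A: "riesz_sup TYPE('a) a p = ennreal A" "0 < A"
  shows "\<exists>c>0. \<exists>K\<ge>0. \<exists>e0>0. \<forall>e. 0 < e \<and> e < e0 --> (\<exists>(f::'a => real) z. nnborel f \<and> Lp_mass p f <= 1 \<and>
     (\<forall>x. norm (x - z) < e --> f x = 0) \<and> ennreal (A - K * e ^ DIM('a)) <= riesz a f f \<and>
     ennreal c <= (NNL x. ennreal (f x * norm (x - z) powr (-a))))"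
proof -
  let ?n = "real DIM('a)"
  have p0: "1 < p" "p < 2" using a by (auto simp: p field_simps)
  obtain c0 where c0: "0 < c0" and ex: "\<And>\<delta>. 0 < \<delta> ==> \<exists>F::'a => real. nnborel F \<and> Lp_mass p F <= 1 \<and> ennreal (A - \<delta>) < riesz a F F \<and>
    ennreal c0 <= (NNL x. ennreal (F x) * indicator (ball 0 1) x)"
    using near_maximizer_normalized[OF a p A] by blast
  define B where "B = unit_ball_vol ?n powr (a / (2 * ?n))"
  have "0 < unit_ball_vol ?n" by simp
  then have B: "0 < B" unfolding B_def by (simp only: powr_gt_zero)
  \<comment> \<open>Below this radius the excised ball carries at most c0/2 of the integral over the
    unit ball.\<close>
  define e0 where "e0 = min 1 ((c0 / (2 * B)) powr (2 / a))"
  have e0: "0 < e0" using c0 B by (auto simp: e0_def)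
  \<comment> \<open>The energy of f is at least 2 X - A (1 + 48 d), where X > A - d is the energy of
    F and d = e^n; this gives A - (48 A + 2) d.\<close>
  define K where "K = 48 * A + 2"
  \<comment> \<open>For x and z in the unit ball |x - z|^(-a) is at least 2^(-a), and c0/2 is what
    survives the excision.\<close>
  define c where "c = 2 powr (-a) * (c0 / 2)"
  have c: "0 < c" using c0 by (simp add: c_def)
  show ?thesis
  proof (rule exI[of _ c], intro conjI c, rule exI[of _ K], intro conjI, goal_cases)
    case 2
    show ?case
    proof (rule exI[of _ e0], intro conjI allI impI e0)
    fix e assume "0 < e \<and> e < e0"
    then have e: "0 < e" "e < 1" "e < (c0 / (2 * B)) powr (2 / a)" by (auto simp: e0_def)
    define d where "d = e ^ DIM('a)"
    have d: "0 < d" "d <= 1" using e by (auto simp: d_def power_le_one)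
    from ex[OF d(1)] obtain F :: "'a => real" where F: "nnborel F" "Lp_mass p F <= 1" "ennreal (A - d) < riesz a F F"
      and Fc: "ennreal c0 <= (NNL x. ennreal (F x) * indicator (ball 0 1) x)" by blast
    note [measurable] = nnborelD(1)[OF F(1)]
    note F0 = nnborelD(2)[OF F(1)]
    obtain z :: 'a where z: "z \<in> ball 0 1"
      and tau: "(NNL y. ennreal (F y powr p) * indicator {y. norm (z - y) < e} y) <= ennreal (2 * e ^ DIM('a))"
      using exists_center_small_mass[of "\<lambda>y. ennreal (F y powr p)" e] F(2) e unfolding Lp_mass_def by auto
    define f where "f x = (if norm (x - z) < e then 0 else F x)" for x
    define g where "g x = (if norm (x - z) < e then F x else 0)" for x
    have f: "nnborel f" unfolding nnborel_def f_def using F0 by auto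
    have g: "nnborel g" unfolding nnborel_def g_def using F0 by auto
    have Ffg: "F = (\<lambda>x. f x + g x)" by (auto simp: f_def g_def)
    have fF: "f x <= F x" for x using F0 by (simp add: f_def)
    have fm: "Lp_mass p f <= 1"
    proof -
      have "Lp_mass p f <= Lp_mass p F" unfolding Lp_mass_def
        using fF nnborelD(2)[OF f] p0 by (intro nn_integral_mono ennreal_leI powr_mono2) auto
      then show ?thesis using F(2) by simp
    qed
    have Fgm: "nnborel (\<lambda>x. F x + g x)" using F(1) g by (auto simp: nnborel_def)
    \<comment> \<open>On the hole F + g = 2 F, and 2^p <= 4 since p < 2, hence at most three
      additional copies of the mass there.\<close>
    have "Lp_mass p (\<lambda>x. F x + g x) <= (NNL x. ennreal (F x powr p) + 3 * (ennreal (F x powr p) * indicator {y. norm (z - y) < e} x))"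
      unfolding Lp_mass_def
    proof (rule nn_integral_mono)
      fix x
      show "ennreal ((F x + g x) powr p) <= ennreal (F x powr p) + 3 * (ennreal (F x powr p) * indicator {y. norm (z - y) < e} x)"
      proof (cases "norm (x - z) < e")
        case True
        have "2 powr p <= (2::real) powr 2" using p0 by (intro powr_mono) auto
        then have "2 powr p <= (4::real)" by simp
        then have "2 powr p * F x powr p <= 4 * F x powr p" by (intro mult_right_mono) auto
        moreover have "(F x + g x) powr p = 2 powr p * F x powr p"
          using True F0 by (simp add: g_def powr_mult[symmetric] mult_2[symmetric])
        moreover have "ennreal (F x powr p) + 3 * ennreal (F x powr p) = ennreal (4 * F x powr p)"
        proof -
          have "ennreal (F x powr p) + 3 * ennreal (F x powr p) = 4 * ennreal (F x powr p)"
            using distrib_right[of 1 3 "ennreal (F x powr p)"] by simp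
          then show ?thesis by (simp add: ennreal_mult)
        qed
        ultimately show ?thesis using True by (simp add: norm_minus_commute ennreal_leI)
      next
        case False
        then show ?thesis by (simp add: g_def)
      qed
    qed
    also have "... = (NNL x. ennreal (F x powr p)) + 3 * (NNL x. ennreal (F x powr p) * indicator {y. norm (z - y) < e} x)"
      by (simp add: nn_integral_add nn_integral_cmult)
    also have "... <= 1 + 3 * ennreal (2 * e ^ DIM('a))"
      using F(2) tau unfolding Lp_mass_def by (intro add_mono mult_left_mono) auto
    also have "... = ennreal (1 + 6 * d)"
      using d by (simp add: d_def[symmetric] ennreal_mult'[symmetric] ennreal_plus[symmetric] ennreal_numeral[symmetric] ennreal_1[symmetric] del: ennreal_plus ennreal_numeral ennreal_1)
    finally have Pm: "Lp_mass p (\<lambda>x. F x + g x) <= ennreal (1 + 6 * d)" .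
    have pw: "(1 + 6 * d) powr (2 / p) <= 1 + 48 * d"
    proof -
      have "(1 + 6 * d) powr (2 / p) <= (1 + 6 * d) powr 2" using d p0 by (intro powr_mono) (auto simp: field_simps)
      also have "... = (1 + 6 * d)\<^sup>2" using d by simp
      also have "... = 1 + 12 * d + 36 * d * d" by (simp add: power2_eq_square algebra_simps)
      also have "... <= 1 + 48 * d" using d mult_left_mono[of d 1 d] by simp
      finally show ?thesis .
    qed
    have "riesz a F F + 2 * riesz a F g <= riesz a (\<lambda>x. F x + g x) (\<lambda>x. F x + g x)"
    proof -
      have "riesz a (\<lambda>x. F x + g x) (\<lambda>x. F x + g x) = riesz a F (\<lambda>x. F x + g x) + riesz a g (\<lambda>x. F x + g x)"
        by (rule riesz_add_left[OF Fgm F(1) g])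
      also have "... = riesz a F F + riesz a F g + (riesz a g F + riesz a g g)"
        by (simp add: riesz_add_right[OF F(1) F(1) g] riesz_add_right[OF g F(1) g])
      also have "riesz a g F = riesz a F g" by (rule riesz_commute[OF g F(1)])
      finally show ?thesis by (simp add: mult_2 add.assoc add_left_mono)
    qed
    also have "... <= riesz_sup TYPE('a) a p * ennreal ((1 + 6 * d) powr (2 / p))"
      using Pm d p0 by (intro riesz_le_sup Fgm) auto
    also have "... <= ennreal (A * (1 + 48 * d))"
      using pw A by (simp add: ennreal_mult[symmetric] ennreal_leI mult_left_mono)
    finally have ub: "riesz a F F + 2 * riesz a F g <= ennreal (A * (1 + 48 * d))" .
    have lb: "riesz a F F <= riesz a f f + 2 * riesz a F g"
    proof -
      have "riesz a F F = riesz a f F + riesz a g F"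
        using riesz_add_left[OF F(1) f g] by (subst (1) Ffg) simp
      also have "riesz a f F = riesz a f f + riesz a f g"
        using riesz_add_right[OF f f g] by (subst Ffg) simp
      also have "riesz a f g <= riesz a F g"
        using fF F0 nnborelD(2)[OF f] nnborelD(2)[OF g] by (intro riesz_mono) auto
      also have "riesz a g F = riesz a F g" by (rule riesz_commute[OF g F(1)])
      finally show ?thesis by (simp add: mult_2 add_ac add_left_mono add_right_mono)
    qed
    have "ennreal (A - K * d) <= riesz a f f"
    proof (cases "riesz a f f")
      case (real R)
      have "riesz a F F \<noteq> top" "riesz a F g \<noteq> top"
        using ub by (auto simp: top_unique ennreal_mult_eq_top_iff)
      then obtain X Y where X: "riesz a F F = ennreal X" "0 <= X" and Y: "riesz a F g = ennreal Y" "0 <= Y"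
        by (metis ennreal_cases)
      have two: "2 * ennreal Y = ennreal (2 * Y)" using Y by (simp add: ennreal_mult)
      have "X + 2 * Y <= A * (1 + 48 * d)"
        using ub X Y d A unfolding X(1) Y(1) two by (simp add: ennreal_plus[symmetric] del: ennreal_plus)
      moreover have "X <= R + 2 * Y"
        using lb X Y real unfolding X(1) Y(1) two by (simp add: ennreal_plus[symmetric] del: ennreal_plus)
      moreover have "A - d < X"
        using F(3) X by (cases "A - d \<ge> 0") (auto simp: ennreal_less_iff)
      ultimately have "A - K * d <= R" by (simp add: K_def algebra_simps)
      then show ?thesis using real by (simp add: ennreal_leI)
    qed simp
    moreover have "ennreal c <= (NNL x. ennreal (f x * norm (x - z) powr (-a)))"
    proof -
      have [measurable]: "ball (0::'a) 1 \<in> sets borel" "ball z e \<in> sets borel" by auto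
      note [measurable] = nnborelD(1)[OF f]
      have "ennreal c0 <= (NNL x. ennreal (F x) * indicator (ball 0 1) x)" by (rule Fc)
      also have "... <= (NNL x. ennreal (f x) * indicator (ball 0 1) x + ennreal (F x) * indicator (ball z e) x)"
        using F0 by (intro nn_integral_mono) (auto simp: f_def indicator_def dist_norm norm_minus_commute)
      also have "... = (NNL x. ennreal (f x) * indicator (ball 0 1) x) + (NNL x. ennreal (F x) * indicator (ball z e) x)"
        by (rule nn_integral_add) measurable
      also have "(NNL x. ennreal (F x) * indicator (ball z e) x) <= ennreal (B * e powr (a / 2))"
        using Lp_ball_bound[OF a p F(1), of 1 e z] F(2) e by (simp add: B_def)
      also have "B * e powr (a / 2) <= c0 / 2"
      proof -
        have "e powr (a / 2) <= ((c0 / (2 * B)) powr (2 / a)) powr (a / 2)"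
          using e a by (intro powr_mono2) auto
        also have "... = c0 / (2 * B)" using a c0 B by (simp add: powr_powr)
        finally show ?thesis using B by (simp add: field_simps)
      qed
      finally have "ennreal (c0 / 2) + ennreal (c0 / 2) <= ennreal (c0 / 2) + (NNL x. ennreal (f x) * indicator (ball 0 1) x)"
        using c0 by (simp add: ennreal_plus[symmetric] add.commute ennreal_leI add_left_mono del: ennreal_plus)
      then have h: "ennreal (c0 / 2) <= (NNL x. ennreal (f x) * indicator (ball 0 1) x)"
        by (subst (asm) ennreal_add_left_cancel_le) auto
      have "ennreal c = ennreal (2 powr (-a)) * ennreal (c0 / 2)" using c0 ennreal_mult[of "2 powr (-a)" "c0 / 2"] by (simp only: c_def) simp
      also have "... <= ennreal (2 powr (-a)) * (NNL x. ennreal (f x) * indicator (ball 0 1) x)"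
        by (intro mult_left_mono h) auto
      also have "... = (NNL x. ennreal (2 powr (-a)) * (ennreal (f x) * indicator (ball 0 1) x))"
        by (rule nn_integral_cmult[symmetric]) measurable
      also have "... <= (NNL x. ennreal (f x * norm (x - z) powr (-a)))"
      proof (rule nn_integral_mono)
        fix x
        show "ennreal (2 powr (-a)) * (ennreal (f x) * indicator (ball 0 1) x) <= ennreal (f x * norm (x - z) powr (-a))"
        proof (cases "x \<in> ball 0 1 \<and> x \<noteq> z")
          case True
          have "norm (x - z) <= 2" using norm_triangle_ineq4[of x z] True z by simp
          then have "2 powr (-a) <= norm (x - z) powr (-a)" using True a by (intro powr_mono2') auto
          then have "2 powr (-a) * f x <= f x * norm (x - z) powr (-a)"
            using nnborelD(2)[OF f, of x] by (simp add: mult.commute mult_left_mono)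
          then show ?thesis using True nnborelD(2)[OF f, of x] by (simp add: ennreal_mult[symmetric] ennreal_leI)
        next
          case False
          then show ?thesis using e by (auto simp: indicator_def f_def)
        qed
      qed
      finally show ?thesis .
    qed
    ultimately show "\<exists>(f::'a => real) z. nnborel f \<and> Lp_mass p f <= 1 \<and>
     (\<forall>x. norm (x - z) < e --> f x = 0) \<and> ennreal (A - K * e ^ DIM('a)) <= riesz a f f \<and>
     ennreal c <= (NNL x. ennreal (f x * norm (x - z) powr (-a)))"
      using f fm unfolding d_def by (intro exI[of _ f] exI[of _ z] conjI) (auto simp: f_def)
    qed
  qed (use A in \<open>simp add: K_def\<close>)
qed

section \<open>Transport of near maximizers by inversion\<close>

text \<open>The conformal transform attached to the inversion about z. Since 2n - a = 2n/p, the
  weight is the power that makes the p-mass invariant; it makes the Riesz energy invariant as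
  well.\<close>

definition kelvin :: "real => 'a => ('a::euclidean_space => real) => 'a => real" where
  "kelvin a z f = (\<lambda>y. norm y powr (- (2 * real DIM('a) - a)) * f (z + y /\<^sub>R (norm y)\<^sup>2))"

lemma norm_diff_inversion:
  fixes y z :: "'a::real_inner"
  assumes "y \<noteq> 0" "z \<noteq> 0"
  shows "norm (y /\<^sub>R (norm y)\<^sup>2 - z /\<^sub>R (norm z)\<^sup>2) = norm (y - z) / (norm y * norm z)"
proof -
  define a where "a = inner y y"
  define b where "b = inner z z"
  define c where "c = inner y z"
  have a: "(norm y)\<^sup>2 = a" "(norm z)\<^sup>2 = b" "inner y y = a" "inner z z = b" "inner y z = c" "inner z y = c"
    by (auto simp: a_def b_def c_def power2_norm_eq_inner inner_commute)
  have ab: "a \<noteq> 0" "b \<noteq> 0" using assms by (auto simp: a_def b_def)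
  have "(norm (y /\<^sub>R (norm y)\<^sup>2 - z /\<^sub>R (norm z)\<^sup>2))\<^sup>2 = (a - 2 * c + b) / (a * b)"
    unfolding power2_norm_eq_inner[of "_ - _"] using ab
    by (simp add: inner_diff_left inner_diff_right a field_simps)
  also have "a - 2 * c + b = (norm (y - z))\<^sup>2"
    unfolding power2_norm_eq_inner[of "_ - _"] by (simp add: inner_diff_left inner_diff_right a)
  finally have "(norm (y /\<^sub>R (norm y)\<^sup>2 - z /\<^sub>R (norm z)\<^sup>2))\<^sup>2 = (norm (y - z) / (norm y * norm z))\<^sup>2"
    by (simp add: power_divide power_mult_distrib a)
  then show ?thesis by (rule power2_eq_imp_eq) auto
qed

lemma nnborel_kelvin: "nnborel f ==> nnborel (kelvin a z f)"
  by (auto simp: nnborel_def kelvin_def)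

lemma nn_integral_lborel_translate:
  fixes f :: "'a::euclidean_space => ennreal"
  assumes "f \<in> borel_measurable borel"
  shows "(NNL x. f (z + x)) = (NNL x. f x)"
  using nn_integral_lborel_affine[OF assms, of 1 z] by simp

lemma Lp_mass_kelvin:
  fixes f :: "'a::euclidean_space => real"
  assumes a: "a < real DIM('a)" and p: "p = 2 * real DIM('a) / (2 * real DIM('a) - a)" and f: "nnborel f"
  shows "Lp_mass p (kelvin a z f) = Lp_mass p f"
proof -
  note [measurable] = nnborelD(1)[OF f]
  have "0 < real DIM('a)" by simp
  then have e: "- (2 * real DIM('a) - a) * p = - 2 * real DIM('a)" using a by (simp add: p field_simps)
  have "Lp_mass p (kelvin a z f) = (NNL y. ennreal (f (z + y /\<^sub>R (norm y)\<^sup>2) powr p) * ennreal (norm y powr (- 2 * real DIM('a))))"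
    unfolding Lp_mass_def kelvin_def
  proof (rule nn_integral_cong)
    fix y :: 'a
    have "(norm y powr (- (2 * real DIM('a) - a)) * f (z + y /\<^sub>R (norm y)\<^sup>2)) powr p
      = f (z + y /\<^sub>R (norm y)\<^sup>2) powr p * norm y powr (- 2 * real DIM('a))"
      using nnborelD(2)[OF f] by (simp only: powr_mult powr_powr e powr_ge_zero) (rule mult.commute)
    then show "ennreal ((norm y powr (- (2 * real DIM('a) - a)) * f (z + y /\<^sub>R (norm y)\<^sup>2)) powr p)
      = ennreal (f (z + y /\<^sub>R (norm y)\<^sup>2) powr p) * ennreal (norm y powr (- 2 * real DIM('a)))"
      by (simp add: ennreal_mult)
  qed
  also have "... = (NNL y. ennreal (f (z + y) powr p))"
    by (rule nn_integral_inversion[of "\<lambda>y. ennreal (f (z + y) powr p)"]) measurable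
  also have "... = Lp_mass p f" unfolding Lp_mass_def
    by (rule nn_integral_lborel_translate) measurable
  finally show ?thesis .
qed

text \<open>The weight is the Jacobian |y|^(-2n) times a factor that turns into |x - z|^(-a). The
  integral is therefore not invariant, unlike mass and energy; this freedom is what makes the
  squared mean outweigh the cost of the hole.\<close>

lemma nn_integral_kelvin:
  fixes f :: "'a::euclidean_space => real"
  assumes f: "nnborel f"
  shows "(NNL y. ennreal (kelvin a z f y)) = (NNL x. ennreal (f x * norm (x - z) powr (-a)))"
proof -
  note [measurable] = nnborelD(1)[OF f]
  have "(NNL y. ennreal (kelvin a z f y))
    = (NNL y. ennreal (f (z + y /\<^sub>R (norm y)\<^sup>2) * norm (y /\<^sub>R (norm y)\<^sup>2) powr (-a)) * ennreal (norm y powr (- 2 * real DIM('a))))"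
  proof (rule nn_integral_cong)
    fix y :: 'a
    have "norm y powr (- (2 * real DIM('a) - a)) = norm (y /\<^sub>R (norm y)\<^sup>2) powr (-a) * norm y powr (- 2 * real DIM('a))"
    proof (cases "y = 0")
      case False
      then have "norm (y /\<^sub>R (norm y)\<^sup>2) = norm y powr (-1)"
        by (simp add: powr_minus field_simps power2_eq_square)
      then show ?thesis by (simp only: powr_powr powr_add[symmetric]) simp
    qed simp
    then show "ennreal (kelvin a z f y) = ennreal (f (z + y /\<^sub>R (norm y)\<^sup>2) * norm (y /\<^sub>R (norm y)\<^sup>2) powr (-a)) * ennreal (norm y powr (- 2 * real DIM('a)))"
      using nnborelD(2)[OF f] unfolding kelvin_def
      by (subst ennreal_mult[symmetric]) (simp_all only: mult_ac mult_nonneg_nonneg powr_ge_zero)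
  qed
  also have "... = (NNL y. ennreal (f (z + y) * norm y powr (-a)))"
    by (rule nn_integral_inversion[of "\<lambda>y. ennreal (f (z + y) * norm y powr (-a))"]) measurable
  also have "... = (NNL y. ennreal (f (z + y) * norm (z + y - z) powr (-a)))" by simp
  also have "... = (NNL x. ennreal (f x * norm (x - z) powr (-a)))"
    by (rule nn_integral_lborel_translate[of "\<lambda>x. ennreal (f x * norm (x - z) powr (-a))"]) measurable
  finally show ?thesis .
qed

text \<open>By \<open>norm_diff_inversion\<close> the kernel at the inverted points is |x|^a |y|^a
  times the kernel at x and y; combined with the two weights, exactly the Jacobians |x|^(-2n) and
  |y|^(-2n) remain.\<close>

lemma riesz_kelvin:
  fixes f :: "'a::euclidean_space => real"
  assumes f: "nnborel f"
  shows "riesz a (kelvin a z f) (kelvin a z f) = riesz a f f"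
proof -
  note [measurable] = nnborelD(1)[OF f]
  note f0 = nnborelD(2)[OF f]
  let ?n = "real DIM('a)"
  let ?i = "\<lambda>y::'a. y /\<^sub>R (norm y)\<^sup>2"
  let ?w = "\<lambda>y::'a. ennreal (norm y powr (- 2 * ?n))"
  have pw: "ennreal (kelvin a z f x * kelvin a z f y * norm (x - y) powr (-a))
    = (ennreal (f (z + ?i x) * f (z + ?i y) * norm (?i x - ?i y) powr (-a)) * ?w y) * ?w x" for x y :: 'a
  proof (cases "x = 0 \<or> y = 0")
    case True
    then show ?thesis by (auto simp: kelvin_def)
  next
    case False
    define X where "X = norm x"
    define Y where "Y = norm y"
    have XY: "0 < X" "0 < Y" using False by (auto simp: X_def Y_def)
    have "norm (?i x - ?i y) = norm (x - y) / (X * Y)"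
      using norm_diff_inversion[of x y] False by (simp add: X_def Y_def)
    then have "norm (?i x - ?i y) powr (-a) = norm (x - y) powr (-a) * (X powr a * Y powr a)"
      using XY by (simp only: powr_divide powr_mult) (simp add: powr_minus divide_inverse)
    moreover have "t powr (- (2 * ?n - a)) = t powr a * t powr (- 2 * ?n)" for t
      by (simp only: powr_add[symmetric]) simp
    ultimately have "kelvin a z f x * kelvin a z f y * norm (x - y) powr (-a)
     = (f (z + ?i x) * f (z + ?i y) * norm (?i x - ?i y) powr (-a) * Y powr (- 2 * ?n)) * X powr (- 2 * ?n)"
      unfolding kelvin_def X_def[symmetric] Y_def[symmetric] by (simp only: mult_ac)
    then show ?thesis using f0
      by (simp only: X_def Y_def ennreal_mult mult_nonneg_nonneg powr_ge_zero)
  qed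
  have "riesz a (kelvin a z f) (kelvin a z f)
    = (NNL x. (NNL y. (ennreal (f (z + ?i x) * f (z + ?i y) * norm (?i x - ?i y) powr (-a)) * ?w y) * ?w x))"
    unfolding riesz_def pw ..
  also have "... = (NNL x. (NNL y. ennreal (f (z + ?i x) * f (z + ?i y) * norm (?i x - ?i y) powr (-a)) * ?w y) * ?w x)"
    by (intro nn_integral_cong nn_integral_multc) measurable
  also have "... = (NNL x. (NNL y. ennreal (f (z + ?i x) * f (z + y) * norm (?i x - y) powr (-a))) * ?w x)"
    by (intro nn_integral_cong arg_cong2[where f = "(*)"] refl
      nn_integral_inversion[of "\<lambda>y. ennreal (f (z + ?i _) * f (z + y) * norm (?i _ - y) powr (-a))"]) measurable
  also have "... = (NNL x. (NNL y. ennreal (f (z + x) * f (z + y) * norm (x - y) powr (-a))))"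
    by (rule nn_integral_inversion[of "\<lambda>x. \<integral>\<^sup>+y. ennreal (f (z + x) * f (z + y) * norm (x - y) powr (-a)) \<partial>lborel"]) measurable
  also have "... = (NNL x. (NNL y. ennreal (f (z + x) * f (z + y) * norm ((z + x) - (z + y)) powr (-a))))"
    by simp
  also have "... = (NNL x. (NNL y. ennreal (f (z + x) * f y * norm ((z + x) - y) powr (-a))))"
    by (intro nn_integral_cong nn_integral_lborel_translate[of "\<lambda>y. ennreal (f (z + _) * f y * norm ((z + _) - y) powr (-a))"]) measurable
  also have "... = riesz a f f" unfolding riesz_def
    by (rule nn_integral_lborel_translate[of "\<lambda>x. \<integral>\<^sup>+y. ennreal (f x * f y * norm (x - y) powr (-a)) \<partial>lborel"]) measurable
  finally show ?thesis .
qed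

text \<open>Loss against gain: the hole costs K e^n, whereas after inversion and contraction to
  radius r the squared mean is at least of order (r e)^a. As a < n, a small e makes the gain win for
  any prescribed r and k.\<close>

lemma near_maximizer_compact_support:
  assumes a: "0 < a" "a < real DIM('a::euclidean_space)" and p: "p = 2 * real DIM('a) / (2 * real DIM('a) - a)"
    and A: "riesz_sup TYPE('a) a p = ennreal A" "0 < A" and r: "0 < r" and k: "0 < k"
  shows "\<exists>f::'a => real. nnborel f \<and> Lp_mass p f <= 1 \<and> (\<forall>x. r < norm x --> f x = 0) \<and>
     ennreal A < riesz a f f + ennreal k * (NNL x. ennreal (f x))\<^sup>2"
proof -
  let ?n = "real DIM('a)"
  have p0: "0 < p" using a by (auto simp: p)
  have np: "?n / p = ?n - a / 2" using a DIM_positive[where 'a = 'a] by (simp add: p field_simps)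
  obtain c K e0 where c: "0 < c" and K: "0 <= K" and e0: "0 < e0" and ex: "\<forall>e. 0 < e \<and> e < e0 --> (\<exists>(f::'a => real) z. nnborel f \<and> Lp_mass p f <= 1 \<and>
     (\<forall>x. norm (x - z) < e --> f x = 0) \<and> ennreal (A - K * e ^ DIM('a)) <= riesz a f f \<and>
     ennreal c <= (NNL x. ennreal (f x * norm (x - z) powr (-a))))"
    using near_maximizer_hole[OF a p A] by (elim exE conjE) (rule that)
  define L where "L = k * (r powr a * c\<^sup>2)"
  have L: "0 < L" using k r c by (simp add: L_def)
  \<comment> \<open>At e = e1 one has (K + 1) e^(n - a) = L, so below it the loss K e^n is smaller
    than the gain L e^a.\<close>
  define e1 where "e1 = (L / (K + 1)) powr (1 / (?n - a))"
  have e1: "0 < e1" using L K by (auto simp: e1_def)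
  define e where "e = min (min e0 e1) A / 2"
  have "e < e0" "e < e1" "0 < e" using e0 e1 A by (auto simp: e_def)
  note e = this
  have "K * e powr (?n - a) < L"
  proof -
    have "e powr (?n - a) < e1 powr (?n - a)" using e a by (intro powr_less_mono2) auto
    also have "e1 powr (?n - a) = L / (K + 1)" using a L K by (simp add: e1_def powr_powr)
    finally have "e powr (?n - a) * (K + 1) < L" using K by (simp add: field_simps)
    moreover have "K * e powr (?n - a) <= e powr (?n - a) * (K + 1)" by (simp add: algebra_simps)
    ultimately show ?thesis by simp
  qed
  then have "K * e powr (?n - a) * e powr a < L * e powr a" using e by (intro mult_strict_right_mono) auto
  then have Ke: "K * e ^ DIM('a) < L * e powr a"
    using e by (simp add: mult.assoc powr_add[symmetric] powr_realpow)
  from ex[rule_format, OF conjI[OF e(3) e(1)]] obtain f0 :: "'a => real" and z where f0: "nnborel f0" "Lp_mass p f0 <= 1" "\<And>x. norm (x - z) < e ==> f0 x = 0"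
     "ennreal (A - K * e ^ DIM('a)) <= riesz a f0 f0" "ennreal c <= (NNL x. ennreal (f0 x * norm (x - z) powr (-a)))"
    by blast
  define h where "h = kelvin a z f0"
  have h: "nnborel h" "Lp_mass p h <= 1" "ennreal (A - K * e ^ DIM('a)) <= riesz a h h" "ennreal c <= (NNL x. ennreal (h x))"
    using f0 by (simp_all add: h_def nnborel_kelvin Lp_mass_kelvin[OF a(2) p f0(1)] riesz_kelvin nn_integral_kelvin)
  have hs: "h x = 0" if "1 / e < norm x" for x
  proof -
    have "0 < 1 / e" using e by simp
    then have x: "0 < norm x" using that by linarith
    have "norm (z + x /\<^sub>R (norm x)\<^sup>2 - z) = 1 / norm x" using x by (simp add: field_simps power2_eq_square)
    also have "... < e" using that x e by (simp add: field_simps)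
    finally show ?thesis unfolding h_def kelvin_def using f0(3) by simp
  qed
  \<comment> \<open>Inversion turns the hole of radius e into a support of radius 1/e; this dilation
    contracts it to radius r.\<close>
  define s where "s = 1 / (r * e)"
  have s: "0 < s" using r e by (simp add: s_def)
  define f where "f x = s powr (?n / p) * h (0 + s *\<^sub>R x)" for x
  note [measurable] = nnborelD(1)[OF h(1)]
  have f: "nnborel f" "Lp_mass p f <= 1"
    unfolding f_def using Lp_mass_affine[OF h(1) s p0, of 0] h nnborelD(2)[OF h(1)] by (auto simp: nnborel_def)
  have rf: "riesz a f f = riesz a h h"
    unfolding f_def by (rule riesz_affine[OF h(1) s p a(2)])
  have fs: "f x = 0" if "r < norm x" for x
  proof -
    have "1 / e < norm (s *\<^sub>R x)" using that r e by (simp add: s_def field_simps)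
    then show ?thesis by (simp add: f_def hs)
  qed
  have s0: "s \<noteq> 0" using s by simp
  have "ennreal (s powr (- (a / 2))) * (NNL x. ennreal (h x))
      = ennreal (s powr (- (a / 2))) * (ennreal (s ^ DIM('a)) * (NNL x. ennreal (h (0 + s *\<^sub>R x))))"
    by (intro arg_cong2[where f = "(*)"] refl nn_integral_lborel_affine[OF _ s0, of _ 0, unfolded abs_of_pos[OF s]]) measurable
  also have "... = ennreal (s powr (?n / p)) * (NNL x. ennreal (h (0 + s *\<^sub>R x)))"
    using s by (simp add: mult.assoc[symmetric] ennreal_mult[symmetric] powr_realpow[symmetric] powr_add[symmetric] np)
  also have "... = (NNL x. ennreal (s powr (?n / p)) * ennreal (h (0 + s *\<^sub>R x)))"
    by (rule nn_integral_cmult[symmetric]) measurable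
  also have "... = (NNL x. ennreal (f x))"
    unfolding f_def using nnborelD(2)[OF h(1)] by (simp add: ennreal_mult)
  finally have fi: "(NNL x. ennreal (f x)) = ennreal (s powr (- (a / 2))) * (NNL x. ennreal (h x))" by simp
  have "ennreal (s powr (- (a / 2)) * c) <= (NNL x. ennreal (f x))"
    unfolding fi using c by (simp add: ennreal_mult h mult_left_mono)
  then have "(ennreal (s powr (- (a / 2)) * c))\<^sup>2 <= (NNL x. ennreal (f x))\<^sup>2"
    by (simp only: power2_eq_square) (intro mult_mono, auto)
  moreover have "(ennreal (s powr (- (a / 2)) * c))\<^sup>2 = ennreal ((r * e) powr a * c\<^sup>2)"
  proof -
    have "s powr (- (a / 2)) = (r * e) powr (a / 2)"
      using r e by (simp add: s_def powr_divide powr_minus)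
    then have "(s powr (- (a / 2)) * c)\<^sup>2 = (r * e) powr a * c\<^sup>2"
      using r e by (simp add: power_mult_distrib power2_eq_square[of "_ powr _"] powr_add[symmetric])
    then show ?thesis using c by (simp add: ennreal_power)
  qed
  ultimately have "ennreal k * ennreal ((r * e) powr a * c\<^sup>2) <= ennreal k * (NNL x. ennreal (f x))\<^sup>2"
    by (intro mult_left_mono) auto
  moreover have "ennreal k * ennreal ((r * e) powr a * c\<^sup>2) = ennreal (L * e powr a)"
    using k r e by (simp add: L_def ennreal_mult[symmetric] powr_mult mult_ac)
  ultimately have gain: "ennreal (L * e powr a) <= ennreal k * (NNL x. ennreal (f x))\<^sup>2" by simp
  \<comment> \<open>The maximum with 0 reflects that \<open>ennreal\<close> sends a negative A - K
    e^n to 0.\<close>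
  have "ennreal A < ennreal (max 0 (A - K * e ^ DIM('a)) + L * e powr a)"
  proof (rule ennreal_lessI)
    show "A < max 0 (A - K * e ^ DIM('a)) + L * e powr a" using Ke by (auto simp: max_def)
    then show "0 < max 0 (A - K * e ^ DIM('a)) + L * e powr a" using A by linarith
  qed
  also have "... = ennreal (A - K * e ^ DIM('a)) + ennreal (L * e powr a)"
    using L by (simp add: ennreal_plus ennreal_max_0)
  also have "... <= riesz a f f + ennreal k * (NNL x. ennreal (f x))\<^sup>2"
    unfolding rf by (intro add_mono h gain)
  finally show ?thesis using f fs by blast
qed

text \<open>Writes the sum as one double integral with the nonnegative kernel |x - y|^(-a) + k, so
  that Fatou's lemma handles energy and squared mean at once.\<close>

lemma riesz_plus_square:
  assumes f: "nnborel f" and k: "0 <= k"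
  shows "(\<integral>\<^sup>+x. \<integral>\<^sup>+y. ennreal (f x * f y * (norm (x - y) powr (-a) + k)) \<partial>lborel \<partial>lborel)
    = riesz a f f + ennreal k * (NNL x. ennreal (f x))\<^sup>2"
proof -
  note [measurable] = nnborelD(1)[OF f]
  note f0 = nnborelD(2)[OF f]
  let ?I = "\<integral>\<^sup>+x. ennreal (f x) \<partial>lborel"
  have pw: "ennreal (f x * f y * (norm (x - y) powr (-a) + k)) = ennreal (f x * f y * norm (x - y) powr (-a)) + ennreal k * ennreal (f x) * ennreal (f y)" for x y
    using f0 k by (simp add: ennreal_mult[symmetric] ennreal_plus[symmetric] distrib_left mult_ac del: ennreal_plus)
  have "(\<integral>\<^sup>+x. \<integral>\<^sup>+y. ennreal (f x * f y * (norm (x - y) powr (-a) + k)) \<partial>lborel \<partial>lborel)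
    = (NNL x. (NNL y. ennreal (f x * f y * norm (x - y) powr (-a))) + (NNL y. ennreal k * ennreal (f x) * ennreal (f y)))"
    unfolding pw by (intro nn_integral_cong nn_integral_add) measurable
  also have "... = (NNL x. (NNL y. ennreal (f x * f y * norm (x - y) powr (-a))) + ennreal k * ennreal (f x) * ?I)"
    by (simp add: nn_integral_cmult)
  also have "... = riesz a f f + (NNL x. ennreal k * ennreal (f x) * ?I)"
    unfolding riesz_def by (rule nn_integral_add) measurable
  also have "(NNL x. ennreal k * ennreal (f x) * ?I) = ennreal k * ?I\<^sup>2"
    by (simp add: nn_integral_multc nn_integral_cmult power2_eq_square mult.assoc)
  finally show ?thesis .
qed

lemma riesz_plus_square_liminf:
  fixes f :: "'a::euclidean_space => real"
  assumes f: "nnborel f" and g: "\<And>j::nat. nnborel (g j)" and k: "0 <= k"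
    and lim: "AE x in lborel. (\<lambda>j. g j x) \<longlonglongrightarrow> f x"
  shows "riesz a f f + ennreal k * (NNL x. ennreal (f x))\<^sup>2
     <= liminf (\<lambda>j. riesz a (g j) (g j) + ennreal k * (NNL x. ennreal (g j x))\<^sup>2)"
proof -
  note [measurable] = nnborelD(1)[OF f] nnborelD(1)[OF g]
  let ?K = "\<lambda>x y. norm (x - y) powr (-a) + k"
  have "(\<integral>\<^sup>+x. \<integral>\<^sup>+y. ennreal (f x * f y * ?K x y) \<partial>lborel \<partial>lborel)
     <= (NNL x. liminf (\<lambda>j. \<integral>\<^sup>+y. ennreal (g j x * g j y * ?K x y) \<partial>lborel))"
  proof (rule nn_integral_mono_AE)
    show "AE x in lborel. (NNL y. ennreal (f x * f y * ?K x y)) <= liminf (\<lambda>j. \<integral>\<^sup>+y. ennreal (g j x * g j y * ?K x y) \<partial>lborel)"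
      using lim
    proof eventually_elim
      case (elim x)
      have "(NNL y. ennreal (f x * f y * ?K x y)) = (NNL y. liminf (\<lambda>j. ennreal (g j x * g j y * ?K x y)))"
      proof (rule nn_integral_cong_AE)
        show "AE y in lborel. ennreal (f x * f y * ?K x y) = liminf (\<lambda>j. ennreal (g j x * g j y * ?K x y))"
          using lim
        proof eventually_elim
          case (elim y)
          have "(\<lambda>j. ennreal (g j x * g j y * ?K x y)) \<longlonglongrightarrow> ennreal (f x * f y * ?K x y)"
            using elim \<open>(\<lambda>j. g j x) \<longlonglongrightarrow> f x\<close> by (intro tendsto_intros tendsto_ennrealI)
          then show ?case by (intro lim_imp_Liminf[symmetric]) auto
        qed
      qed
      also have "... <= liminf (\<lambda>j. \<integral>\<^sup>+y. ennreal (g j x * g j y * ?K x y) \<partial>lborel)"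
        by (rule nn_integral_liminf) measurable
      finally show ?case .
    qed
  qed
  also have "... <= liminf (\<lambda>j. \<integral>\<^sup>+x. \<integral>\<^sup>+y. ennreal (g j x * g j y * ?K x y) \<partial>lborel \<partial>lborel)"
    by (rule nn_integral_liminf) measurable
  finally show ?thesis by (simp only: riesz_plus_square[OF f k] riesz_plus_square[OF g k])
qed

text \<open>By lower semicontinuity the strict inequality survives truncation, approximation by
  continuous functions and a cutoff to radius r. The approximants may have mass slightly above 1;
  the room between A and an intermediate value b pays for rescaling them.\<close>

lemma near_maximizer_continuous:
  assumes a: "0 < a" "a < real DIM('a::euclidean_space)" and p: "p = 2 * real DIM('a) / (2 * real DIM('a) - a)"
    and A: "riesz_sup TYPE('a) a p = ennreal A" "0 < A" and r: "0 < r" and k: "0 < k"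
  shows "\<exists>f::'a => real. continuous_on UNIV f \<and> (\<forall>x. 0 <= f x) \<and> Lp_mass p f <= 1 \<and> (\<forall>x. r <= norm x --> f x = 0) \<and>
     ennreal A < riesz a f f + ennreal k * (NNL x. ennreal (f x))\<^sup>2"
proof -
  let ?J = "\<lambda>f::'a => real. riesz a f f + ennreal k * (NNL x. ennreal (f x))\<^sup>2"
  have p0: "0 < p" using a by (auto simp: p)
  have "0 < r / 2" using r by simp
  from near_maximizer_compact_support[OF a p A this k] obtain h :: "'a => real" where h: "nnborel h" "Lp_mass p h <= 1"
    "\<And>x. r / 2 < norm x ==> h x = 0" "ennreal A < ?J h" by blast
  note [measurable] = nnborelD(1)[OF h(1)]
  \<comment> \<open>Truncation provides the bound by j that later dominates the p-masses of the
    continuous approximants.\<close>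
  define hj where "hj j x = min (h x) (real j)" for j x
  have hj: "nnborel (hj j)" for j using nnborelD(2)[OF h(1)] unfolding nnborel_def hj_def by auto
  have "?J h <= liminf (\<lambda>j. ?J (hj j))"
  proof (rule riesz_plus_square_liminf[OF h(1) hj])
    show "AE x in lborel. (\<lambda>j. hj j x) \<longlonglongrightarrow> h x"
    proof (rule AE_I2)
      fix x
      obtain j0 where "h x <= real j0" using real_arch_simple by blast
      then have "eventually (\<lambda>j. hj j x = h x) sequentially"
        unfolding eventually_sequentially hj_def by (intro exI[of _ j0]) auto
      then show "(\<lambda>j. hj j x) \<longlonglongrightarrow> h x" by (rule tendsto_eventually)
    qed
  qed (use k in auto)
  with h(4) have "ennreal A < liminf (\<lambda>j. ?J (hj j))" by (rule less_le_trans)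
  then have "eventually (\<lambda>j. ennreal A < ?J (hj j)) sequentially" by (rule less_LiminfD)
  then obtain j where j: "ennreal A < ?J (hj j)" by (auto simp: eventually_sequentially)
  define u where "u = hj j"
  have u: "nnborel u" "\<And>x. u x <= real j" "\<And>x. r / 2 < norm x ==> u x = 0" "ennreal A < ?J u"
    using hj[of j] j h(3) by (auto simp: u_def hj_def)
  have um: "Lp_mass p u <= 1"
  proof -
    have "Lp_mass p u <= Lp_mass p h" unfolding Lp_mass_def u_def hj_def
      using p0 nnborelD(2)[OF h(1)] by (intro nn_integral_mono ennreal_leI powr_mono2) auto
    then show ?thesis using h(2) by simp
  qed
  note [measurable] = nnborelD(1)[OF u(1)]
  note u0 = nnborelD(2)[OF u(1)]
  \<comment> \<open>A value strictly in between is kept in reserve: the factor b/A > 1 is spent on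
    the final normalisation.\<close>
  from u(4) obtain B where B: "ennreal A < B" "B < ?J u" using dense by blast
  then obtain b where b: "B = ennreal b" "0 <= b" by (cases B) auto
  have Ab: "A < b" using B(1) b A by (simp add: ennreal_less_iff)
  have "u \<in> borel_measurable lebesgue" using nnborelD(1)[OF u(1)] by (intro measurable_completion) simp
  then have "u measurable_on UNIV"
    by (intro lebesgue_measurable_imp_measurable_on) auto
  then obtain N G where N: "negligible N" and G: "\<And>i. continuous_on UNIV (G i)"
    and Glim: "\<And>x. x \<notin> N ==> (\<lambda>i. G i x) \<longlonglongrightarrow> (if x \<in> UNIV then u x else 0)"
    unfolding measurable_on_def by blast
  \<comment> \<open>Equal to 1 for |x| <= r/2, where u lives, and to 0 for |x| >= r.\<close>
  define X where "X x = max 0 (min 1 (2 - 2 * norm x / r))" for x :: 'a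
  define g where "g i x = max 0 (min (real j) (G i x)) * X x" for i :: nat and x
  have gc: "continuous_on UNIV (g i)" for i
    unfolding g_def X_def using G[of i] r by (auto intro!: continuous_intros)
  have g0: "0 <= g i x" for i x by (simp add: g_def X_def)
  have gnn: "nnborel (g i)" for i
    using g0 borel_measurable_continuous_onI[OF gc] by (auto simp: nnborel_def)
  have gs: "g i x = 0" if "r <= norm x" for i x
    using that r by (simp add: g_def X_def field_simps max_def)
  have X1: "u x * X x = u x" for x
  proof (cases "r / 2 < norm x")
    case False
    then have "X x = 1" using r by (simp add: X_def field_simps min_def max_def)
    then show ?thesis by simp
  qed (simp add: u(3))
  have "AE x in lebesgue. x \<notin> N" using N by (auto simp: negligible_iff_null_sets intro: AE_not_in)
  then have "AE x in lborel. x \<notin> N" by (simp add: AE_completion_iff)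
  then have lim: "AE x in lborel. (\<lambda>i. g i x) \<longlonglongrightarrow> u x"
  proof eventually_elim
    case (elim x)
    have "(\<lambda>i. max 0 (min (real j) (G i x)) * X x) \<longlonglongrightarrow> max 0 (min (real j) (u x)) * X x"
      using Glim[OF elim] by (intro tendsto_intros tendsto_max tendsto_min) simp
    also have "max 0 (min (real j) (u x)) * X x = u x" using u(2)[of x] u0[of x] X1[of x] by (simp add: min_def max_def)
    finally show ?case by (simp add: g_def)
  qed
  have "B < liminf (\<lambda>i. ?J (g i))"
    using B(2) riesz_plus_square_liminf[OF u(1) gnn _ lim, of k a] k by (meson less_imp_le less_le_trans)
  then have ev1: "eventually (\<lambda>i. B < ?J (g i)) sequentially" by (rule less_LiminfD)
  have gj: "g i x <= real j" for i x
  proof -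
    have "max 0 (min (real j) (G i x)) * X x <= real j * 1"
      by (intro mult_mono) (auto simp: X_def)
    then show ?thesis by (simp add: g_def)
  qed
  note [measurable] = nnborelD(1)[OF gnn]
  have "(\<lambda>i. Lp_mass p (g i)) \<longlonglongrightarrow> Lp_mass p u"
    unfolding Lp_mass_def
  proof (rule nn_integral_dominated_convergence[where w = "\<lambda>x. ennreal (real j powr p) * indicator (cball 0 r) x"])
    have "(\<integral>\<^sup>+ x. ennreal (real j powr p) * indicator (cball 0 r) x \<partial>(lborel::'a measure)) = ennreal (real j powr p) * emeasure lborel (cball (0::'a) r)"
      by (rule nn_integral_cmult_indicator) simp
    also have "... < \<infinity>" using r by (simp add: emeasure_cball ennreal_mult_less_top)
    finally show "(\<integral>\<^sup>+ x. ennreal (real j powr p) * indicator (cball 0 r) x \<partial>(lborel::'a measure)) < \<infinity>" .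
    show "AE x in lborel. ennreal (g i x powr p) <= ennreal (real j powr p) * indicator (cball 0 r) x" for i
    proof (rule AE_I2)
      fix x
      show "ennreal (g i x powr p) <= ennreal (real j powr p) * indicator (cball 0 r) x"
        using gs[of x i] g0 gj p0 by (cases "norm x <= r") (auto intro!: ennreal_leI powr_mono2)
    qed
    show "AE x in lborel. (\<lambda>i. ennreal (g i x powr p)) \<longlonglongrightarrow> ennreal (u x powr p)"
      using lim
    proof eventually_elim
      case (elim x)
      show ?case using elim p0 g0 by (intro tendsto_ennrealI tendsto_powr') auto
    qed
    show "(\<lambda>x. ennreal (real j powr p) * indicator (cball 0 r) x) \<in> borel_measurable lborel"
      by (intro borel_measurable_times_ennreal borel_measurable_indicator) auto
  qed measurable
  \<comment> \<open>The tolerated mass: scaling a mass P back to 1 multiplies both quadratic terms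
    by c^2 = A/b, which is affordable since their sum exceeds b.\<close>
  moreover define P where "P = (b / A) powr (p / 2)"
  have P: "1 < P" unfolding P_def using Ab A p0 by (intro gr_one_powr) auto
  have "(1::ennreal) < ennreal P" using P by (simp flip: ennreal_1 add: ennreal_less_iff)
  then have "Lp_mass p u < ennreal P" using um by (rule le_less_trans[rotated])
  ultimately have ev2: "eventually (\<lambda>i. Lp_mass p (g i) < ennreal P) sequentially"
    by (rule order_tendstoD(2))
  from eventually_conj[OF ev1 ev2] obtain i where i: "B < ?J (g i)" "Lp_mass p (g i) < ennreal P"
    by (auto simp: eventually_sequentially)
  define c where "c = P powr (- (1 / p))"
  have c: "0 < c" using P by (simp add: c_def)
  have cp: "c powr p = 1 / P" "c\<^sup>2 = A / b"
  proof -
    show "c powr p = 1 / P" unfolding c_def powr_powr using p0 P by (simp add: powr_minus divide_inverse)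
    have "c\<^sup>2 = P powr (- (2 / p))" by (simp add: c_def power2_eq_square powr_add[symmetric])
    also have "... = (b / A) powr (- 1)" unfolding P_def powr_powr using p0 by simp
    finally show "c\<^sup>2 = A / b" using Ab A by (simp add: powr_minus)
  qed
  define f where "f x = c * g i x" for x
  have "Lp_mass p f = ennreal (1 / P) * Lp_mass p (g i)"
    unfolding f_def using Lp_mass_cmult[OF gnn, of c p i] c by (simp add: cp)
  also have "... <= ennreal (1 / P) * ennreal P" using i by (intro mult_left_mono) auto
  also have "... = 1" using P by (simp add: ennreal_mult[symmetric])
  finally have fm: "Lp_mass p f <= 1" .
  have ff: "f = (\<lambda>x. c * g i x)" by (auto simp: f_def)
  have "(NNL x. ennreal (f x)) = ennreal c * (NNL x. ennreal (g i x))"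
    unfolding f_def using c g0 by (simp add: ennreal_mult nn_integral_cmult)
  then have "?J f = ennreal (c\<^sup>2) * riesz a (g i) (g i) + ennreal k * (ennreal c * (NNL x. ennreal (g i x)))\<^sup>2"
    using riesz_cmult[OF gnn, of c a i] c by (simp only: ff less_imp_le)
  also have "... = ennreal (c\<^sup>2) * ?J (g i)"
    using c by (simp add: power_mult_distrib ennreal_power distrib_left mult_ac)
  finally have Jf: "?J f = ennreal (c\<^sup>2) * ?J (g i)" .
  have "ennreal A = ennreal (c\<^sup>2) * B" unfolding cp b using Ab A by (simp add: ennreal_mult[symmetric])
  also have "... < ennreal (c\<^sup>2) * ?J (g i)" using i(1) c
    by (intro ennreal_mult_strict_left_mono) auto
  finally have "ennreal A < ?J f" using Jf by simp
  moreover have "continuous_on UNIV f" unfolding f_def using gc[of i] by (intro continuous_intros)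
  ultimately show ?thesis using fm c g0 gs by (intro exI[of _ f]) (auto simp: f_def)
qed

section \<open>Gaussian integrals\<close>

lemma nn_integral_exp_minus_abs: "(\<integral>\<^sup>+x. ennreal (exp (- \<bar>x\<bar>)) \<partial>(lborel::real measure)) <= 2"
proof -
  have 1: "(\<integral>\<^sup>+x. ennreal (exp (- x)) * indicator {0..} x \<partial>(lborel::real measure)) = 1"
  proof -
    have "(\<integral>\<^sup>+x. ennreal (exp (- x)) * indicator {0..} x \<partial>(lborel::real measure)) = ennreal (0 - (- exp (- 0)))"
    proof (rule nn_integral_FTC_atLeast)
      have "((\<lambda>x::real. exp (- x)) \<longlongrightarrow> 0) at_top" by (rule exp_at_bot[THEN filterlim_compose]) (rule filterlim_uminus_at_bot_at_top)
      then show "((\<lambda>x::real. - exp (- x)) \<longlongrightarrow> 0) at_top" using tendsto_minus by fastforce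
    qed (auto intro!: derivative_eq_intros)
    then show ?thesis by simp
  qed
  have "(\<integral>\<^sup>+x. ennreal (exp x) * indicator {..0} x \<partial>(lborel::real measure)) = (\<integral>\<^sup>+x. ennreal (exp (- x)) * indicator {0..} x \<partial>(lborel::real measure))"
    by (subst nn_integral_real_affine[where c = "-1" and t = 0]) (auto intro!: nn_integral_cong simp: indicator_def)
  with 1 have 2: "(\<integral>\<^sup>+x. ennreal (exp x) * indicator {..0} x \<partial>(lborel::real measure)) = 1" by simp
  have "(\<integral>\<^sup>+x. ennreal (exp (- \<bar>x\<bar>)) \<partial>(lborel::real measure))
     <= (\<integral>\<^sup>+x. ennreal (exp (- x)) * indicator {0..} x + ennreal (exp x) * indicator {..0} x \<partial>(lborel::real measure))"
    by (intro nn_integral_mono) (auto simp: indicator_def abs_if)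
  also have "... = 1 + 1" using 1 2 by (subst nn_integral_add) auto
  finally show ?thesis by simp
qed

lemma gauss_half_finite: "(\<integral>\<^sup>+y. ennreal (exp (- (norm y)\<^sup>2 / 2)) \<partial>(lborel::'a::euclidean_space measure)) < \<infinity>"
proof -
  have "(\<integral>\<^sup>+y. ennreal (exp (- (norm y)\<^sup>2 / 2)) \<partial>(lborel::'a measure))
    = (\<integral>\<^sup>+y. (\<Prod>b\<in>Basis. ennreal (exp (- (y \<bullet> b)\<^sup>2 / 2))) \<partial>(lborel::'a measure))"
  proof (rule nn_integral_cong)
    fix y :: 'a
    have "(norm y)\<^sup>2 = (\<Sum>b\<in>Basis. (y \<bullet> b)\<^sup>2)"
      unfolding power2_norm_eq_inner by (subst euclidean_inner) (simp add: power2_eq_square)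
    then have "- (norm y)\<^sup>2 / 2 = (\<Sum>b\<in>Basis. - (y \<bullet> b)\<^sup>2 / 2)"
      by (simp add: sum_negf sum_divide_distrib)
    then show "ennreal (exp (- (norm y)\<^sup>2 / 2)) = (\<Prod>b\<in>Basis. ennreal (exp (- (y \<bullet> b)\<^sup>2 / 2)))"
      by (simp add: exp_sum prod_ennreal)
  qed
  also have "... = (\<Prod>b\<in>(Basis::'a set). (NNL x. ennreal (exp (- x\<^sup>2 / 2))))"
    by (rule nn_integral_lborel_prod) auto
  also have "... < \<infinity>"
  proof -
    have "(\<integral>\<^sup>+x. ennreal (exp (- x\<^sup>2 / 2)) \<partial>(lborel::real measure)) <= (\<integral>\<^sup>+x. ennreal (exp (1 / 2)) * ennreal (exp (- \<bar>x\<bar>)) \<partial>(lborel::real measure))"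
    proof (intro nn_integral_mono)
      fix x :: real
      have "0 <= (\<bar>x\<bar> - 1)\<^sup>2" by simp
      then have "- x\<^sup>2 / 2 <= 1 / 2 + - \<bar>x\<bar>" by (simp add: power2_diff)
      then show "ennreal (exp (- x\<^sup>2 / 2)) <= ennreal (exp (1 / 2)) * ennreal (exp (- \<bar>x\<bar>))"
        by (simp add: ennreal_mult[symmetric] exp_add[symmetric] del: exp_le_cancel_iff) (simp add: ennreal_leI)
    qed
    also have "... = ennreal (exp (1 / 2)) * (\<integral>\<^sup>+x. ennreal (exp (- \<bar>x\<bar>)) \<partial>(lborel::real measure))"
      by (rule nn_integral_cmult) measurable
    also have "... <= ennreal (exp (1 / 2)) * 2" by (intro mult_left_mono nn_integral_exp_minus_abs) auto
    also have "... < \<infinity>" by (simp add: ennreal_mult_less_top)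
    finally show ?thesis by (simp add: power_less_top_ennreal)
  qed
  finally show ?thesis .
qed

text \<open>The second moment is what controls the convergence of caloric extensions to their
  initial data.\<close>

lemma gauss_moment_finite:
  "(\<integral>\<^sup>+y. ennreal (exp (- (norm y)\<^sup>2) * (norm y)\<^sup>2) \<partial>(lborel::'a::euclidean_space measure)) < \<infinity>"
  "(\<integral>\<^sup>+y. ennreal (exp (- (norm y)\<^sup>2)) \<partial>(lborel::'a::euclidean_space measure)) < \<infinity>"
proof -
  have "(\<integral>\<^sup>+y. ennreal (exp (- (norm y)\<^sup>2) * (norm y)\<^sup>2) \<partial>(lborel::'a::euclidean_space measure))
     <= (\<integral>\<^sup>+y. ennreal 2 * ennreal (exp (- (norm y)\<^sup>2 / 2)) \<partial>(lborel::'a measure))"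
  proof (rule nn_integral_mono)
    fix y :: 'a
    define r where "r = (norm y)\<^sup>2"
    have "r <= 2 * exp (r / 2)" using exp_ge_add_one_self[of "r / 2"] by linarith
    then have "exp (- r) * r <= exp (- r) * (2 * exp (r / 2))" by simp
    also have "... = 2 * exp (- r / 2)" by (simp add: mult_exp_exp)
    finally show "ennreal (exp (- (norm y)\<^sup>2) * (norm y)\<^sup>2) <= ennreal 2 * ennreal (exp (- (norm y)\<^sup>2 / 2))"
      unfolding r_def by (subst ennreal_mult[symmetric]) (auto intro: ennreal_leI)
  qed
  also have "... = ennreal 2 * (\<integral>\<^sup>+y. ennreal (exp (- (norm y)\<^sup>2 / 2)) \<partial>(lborel::'a measure))"
    by (rule nn_integral_cmult) measurable
  also have "... < \<infinity>" using gauss_half_finite[where 'a = 'a] by (simp add: ennreal_mult_less_top)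
  finally show "(\<integral>\<^sup>+y. ennreal (exp (- (norm y)\<^sup>2) * (norm y)\<^sup>2) \<partial>(lborel::'a::euclidean_space measure)) < \<infinity>" .
  have "(\<integral>\<^sup>+y. ennreal (exp (- (norm y)\<^sup>2)) \<partial>(lborel::'a measure)) <= (\<integral>\<^sup>+y. ennreal (exp (- (norm y)\<^sup>2 / 2)) \<partial>(lborel::'a measure))"
    by (intro nn_integral_mono ennreal_leI) auto
  then show "(\<integral>\<^sup>+y. ennreal (exp (- (norm y)\<^sup>2)) \<partial>(lborel::'a::euclidean_space measure)) < \<infinity>"
    using gauss_half_finite[where 'a = 'a] by (rule le_less_trans)
qed

text \<open>The number pi^(n/2), kept in the form of an integral so that the heat kernel integrates
  to one directly from its definition.\<close>

definition gauss_Z :: "'a::euclidean_space itself => real" where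
  "gauss_Z T = enn2real (\<integral>\<^sup>+y. ennreal (exp (- (norm y)\<^sup>2)) \<partial>(lborel::'a measure))"

lemma gauss_Z: "(\<integral>\<^sup>+y. ennreal (exp (- (norm y)\<^sup>2)) \<partial>(lborel::'a::euclidean_space measure)) = ennreal (gauss_Z TYPE('a))"
  and gauss_Z_pos: "0 < gauss_Z TYPE('a::euclidean_space)"
proof -
  show 1: "(\<integral>\<^sup>+y. ennreal (exp (- (norm y)\<^sup>2)) \<partial>(lborel::'a::euclidean_space measure)) = ennreal (gauss_Z TYPE('a))"
    unfolding gauss_Z_def using gauss_moment_finite(2)[where 'a = 'a] by simp
  have "(\<integral>\<^sup>+y. ennreal (exp (- (norm y)\<^sup>2)) \<partial>(lborel::'a measure)) \<noteq> 0"
  proof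
    assume "(\<integral>\<^sup>+y. ennreal (exp (- (norm y)\<^sup>2)) \<partial>(lborel::'a measure)) = 0"
    then have "AE y in (lborel::'a measure). ennreal (exp (- (norm y)\<^sup>2)) = 0"
      by (subst (asm) nn_integral_0_iff_AE) auto
    then have "AE y in (lborel::'a measure). False" by eventually_elim (simp add: ennreal_eq_0_iff not_le)
    then show False by (simp add: eventually_False ae_filter_eq_bot_iff)
  qed
  then have "gauss_Z TYPE('a) \<noteq> 0" using 1 by auto
  then show "0 < gauss_Z TYPE('a)" unfolding gauss_Z_def by (simp add: order_le_neq_trans)
qed

section \<open>The heat kernel and the parabolic maximum principle\<close>

definition heat_kernel :: "real => 'a::euclidean_space => real" where
  "heat_kernel t z = (4 * t) powr (- (real DIM('a) / 2)) * exp (- (norm z)\<^sup>2 / (4 * t)) / gauss_Z TYPE('a)"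

lemma heat_kernel_nonneg [simp]: "0 <= heat_kernel t (z::'a::euclidean_space)"
  using gauss_Z_pos[where 'a = 'a] by (auto simp: heat_kernel_def)

lemma heat_kernel_measurable [measurable]:
  "(\<lambda>p. heat_kernel (fst p) (snd p :: 'a::euclidean_space)) \<in> borel_measurable (borel \<Otimes>\<^sub>M borel)"
  unfolding heat_kernel_def by measurable

lemma heat_kernel_measurable' [measurable (raw)]:
  assumes [measurable]: "f \<in> borel_measurable M" "g \<in> borel_measurable M"
  shows "(\<lambda>x. heat_kernel (f x) (g x :: 'a::euclidean_space)) \<in> borel_measurable M"
  unfolding heat_kernel_def by measurable

lemma heat_kernel_minus: "heat_kernel t (x - y) = heat_kernel t (y - x)"
  by (simp add: heat_kernel_def norm_minus_commute)

lemma nn_integral_heat_kernel: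
  fixes \<phi> :: "'a::euclidean_space => real"
  assumes [measurable]: "\<phi> \<in> borel_measurable borel" and t: "0 < t" and nn: "\<And>z. 0 <= \<phi> z"
  shows "(NNL y. ennreal (heat_kernel t (x - y) * \<phi> (x - y)))
    = (NNL y. ennreal (exp (- (norm y)\<^sup>2) * \<phi> ((2 * sqrt t) *\<^sub>R y))) / ennreal (gauss_Z TYPE('a))"
proof -
  define Z where "Z = gauss_Z TYPE('a)"
  have Z: "0 < Z" by (simp add: Z_def gauss_Z_pos)
  define c where "c = 2 * sqrt t"
  have c: "0 < c" "c\<^sup>2 = 4 * t" using t by (auto simp: c_def power_mult_distrib)
  have c0: "- c \<noteq> 0" using c by simp
  have cn: "c ^ DIM('a) * (4 * t) powr (- (real DIM('a) / 2)) = 1"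
  proof -
    have "(4 * t) powr (- (real DIM('a) / 2)) = (c powr 2) powr (- (real DIM('a) / 2))" using c by simp
    also have "... = c powr (- real DIM('a))" by (simp only: powr_powr) simp
    finally show ?thesis using c by (simp add: powr_minus powr_realpow)
  qed
  have "(NNL y. ennreal (heat_kernel t (x - y) * \<phi> (x - y)))
    = ennreal (\<bar>- c\<bar> ^ DIM('a)) * (NNL y. ennreal (heat_kernel t (x - (x + (- c) *\<^sub>R y)) * \<phi> (x - (x + (- c) *\<^sub>R y))))"
    by (rule nn_integral_lborel_affine[OF _ c0]) measurable
  also have "... = (NNL y. ennreal (\<bar>- c\<bar> ^ DIM('a)) * ennreal (heat_kernel t (x - (x + (- c) *\<^sub>R y)) * \<phi> (x - (x + (- c) *\<^sub>R y))))"
    by (rule nn_integral_cmult[symmetric]) measurable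
  also have "... = (NNL y. ennreal (exp (- (norm y)\<^sup>2) * \<phi> (c *\<^sub>R y)) / ennreal Z)"
  proof (rule nn_integral_cong)
    fix y :: 'a
    have "- (norm (c *\<^sub>R y))\<^sup>2 / (4 * t) = - (norm y)\<^sup>2" using c t by (simp add: power_mult_distrib)
    then have "heat_kernel t (c *\<^sub>R y) = (4 * t) powr (- (real DIM('a) / 2)) * exp (- (norm y)\<^sup>2) / Z"
      unfolding heat_kernel_def Z_def by simp
    then have "c ^ DIM('a) * (heat_kernel t (c *\<^sub>R y) * \<phi> (c *\<^sub>R y))
       = (c ^ DIM('a) * (4 * t) powr (- (real DIM('a) / 2))) * exp (- (norm y)\<^sup>2) * \<phi> (c *\<^sub>R y) / Z" by simp
    also have "... = exp (- (norm y)\<^sup>2) * \<phi> (c *\<^sub>R y) / Z" unfolding cn by simp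
    finally show "ennreal (\<bar>- c\<bar> ^ DIM('a)) * ennreal (heat_kernel t (x - (x + (- c) *\<^sub>R y)) * \<phi> (x - (x + (- c) *\<^sub>R y)))
      = ennreal (exp (- (norm y)\<^sup>2) * \<phi> (c *\<^sub>R y)) / ennreal Z"
      using c nn Z by (simp add: ennreal_mult[symmetric] divide_ennreal)
  qed
  also have "... = (NNL y. ennreal (exp (- (norm y)\<^sup>2) * \<phi> (c *\<^sub>R y))) / ennreal Z"
    by (rule nn_integral_divide) measurable
  finally show ?thesis by (simp add: c_def Z_def)
qed

lemma nn_integral_heat_kernel_1:
  assumes "0 < t"
  shows "(\<integral>\<^sup>+y. ennreal (heat_kernel t (x - y)) \<partial>(lborel::'a::euclidean_space measure)) = 1"
  using nn_integral_heat_kernel[of "\<lambda>_. 1" t x] assms gauss_Z[where 'a = 'a] gauss_Z_pos[where 'a = 'a]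
  by (simp add: divide_ennreal)

lemma powr_exp_bound:
  fixes b x :: real
  assumes "0 < b" "0 <= x"
  shows "x powr b * exp (- x) <= b powr b"
proof -
  have "x / b <= exp (x / b)" using exp_ge_add_one_self[of "x / b"] by linarith
  then have "(x / b) powr b <= exp (x / b) powr b" using assms by (intro powr_mono2) auto
  also have "... = exp x" using assms by (simp add: powr_def)
  finally have "x powr b <= b powr b * exp x" using assms by (simp add: powr_divide field_simps)
  then show ?thesis by (simp add: exp_minus field_simps)
qed

text \<open>Since x^(n/2) exp(-x) <= (n/2)^(n/2), this constant bounds |z|^n times the heat kernel
  at all times simultaneously. The uniformity in time is what permits a comparison on the whole
  lateral boundary.\<close>

definition heat_sup :: "'a::euclidean_space itself => real" where
  "heat_sup T = (real DIM('a) / 2) powr (real DIM('a) / 2) / gauss_Z T"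

lemma heat_sup_pos: "0 < heat_sup TYPE('a::euclidean_space)"
  by (simp add: heat_sup_def gauss_Z_pos)

lemma heat_kernel_le_norm:
  fixes z :: "'a::euclidean_space"
  assumes t: "0 < t" and z: "z \<noteq> 0"
  shows "heat_kernel t z <= heat_sup TYPE('a) * norm z powr (- real DIM('a))"
proof -
  let ?n = "real DIM('a)"
  define x where "x = (norm z)\<^sup>2 / (4 * t)"
  have x: "0 < x" using t z by (simp add: x_def)
  have t4: "4 * t = (norm z) powr 2 / x" using t z by (simp add: x_def)
  have "(4 * t) powr (- (?n / 2)) = x powr (?n / 2) * norm z powr (- ?n)"
    unfolding t4 powr_divide powr_powr using x z by (simp add: powr_minus field_simps)
  then have "heat_kernel t z = (x powr (?n / 2) * exp (- x)) * norm z powr (- ?n) / gauss_Z TYPE('a)"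
    by (simp add: heat_kernel_def x_def)
  also have "... <= ((?n / 2) powr (?n / 2)) * norm z powr (- ?n) / gauss_Z TYPE('a)"
    using x gauss_Z_pos[where 'a = 'a] by (intro divide_right_mono mult_right_mono powr_exp_bound) auto
  finally show ?thesis by (simp add: heat_sup_def)
qed

lemma heat_kernel_le:
  fixes z :: "'a::euclidean_space"
  assumes t: "0 < t"
  shows "heat_kernel t z <= (4 * t) powr (- (real DIM('a) / 2)) / gauss_Z TYPE('a)"
proof -
  have "exp (- (norm z)\<^sup>2 / (4 * t)) <= 1" using t by simp
  then have "(4 * t) powr (- (real DIM('a) / 2)) * exp (- (norm z)\<^sup>2 / (4 * t)) <= (4 * t) powr (- (real DIM('a) / 2)) * 1"
    by (intro mult_left_mono) auto
  then show ?thesis unfolding heat_kernel_def using gauss_Z_pos[where 'a = 'a]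
    by (intro divide_right_mono) auto
qed

section \<open>The pointwise heat equation and the maximum principle\<close>

text \<open>The heat equation at a single point, encoded by derivatives along coordinate lines: this
  is the information exploited at a maximum, it is stable under linear combinations, and it holds
  for eigenmodes and for caloric extensions alike. \<open>d1\<close> is demanded near 0 so that it
  can be differentiated again.\<close>

definition heat_at :: "(real => 'a::euclidean_space => real) => real => 'a => bool" where
  "heat_at w t x \<longleftrightarrow> (\<exists>wt d1 d2. ((\<lambda>s. w s x) has_real_derivative wt) (at t) \<and>
     (\<forall>b\<in>Basis. (\<forall>\<^sub>F s in nhds 0. ((\<lambda>s. w t (x + s *\<^sub>R b)) has_real_derivative d1 b s) (at s)) \<and>
       (d1 b has_real_derivative d2 b) (at 0)) \<and> wt = sum d2 Basis)"

lemma heat_at_add: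
  assumes "heat_at v t x" "heat_at w t x"
  shows "heat_at (\<lambda>t x. v t x + w t x) t x"
proof -
  from assms(1) obtain vt c1 c2 where v: "((\<lambda>s. v s x) has_real_derivative vt) (at t)"
     "\<And>b. b \<in> Basis ==> (\<forall>\<^sub>F s in nhds 0. ((\<lambda>s. v t (x + s *\<^sub>R b)) has_real_derivative c1 b s) (at s))"
     "\<And>b. b \<in> Basis ==> (c1 b has_real_derivative c2 b) (at 0)" "vt = sum c2 Basis"
    unfolding heat_at_def by blast
  from assms(2) obtain wt d1 d2 where w: "((\<lambda>s. w s x) has_real_derivative wt) (at t)"
     "\<And>b. b \<in> Basis ==> (\<forall>\<^sub>F s in nhds 0. ((\<lambda>s. w t (x + s *\<^sub>R b)) has_real_derivative d1 b s) (at s))"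
     "\<And>b. b \<in> Basis ==> (d1 b has_real_derivative d2 b) (at 0)" "wt = sum d2 Basis"
    unfolding heat_at_def by blast
  show ?thesis unfolding heat_at_def
  proof (intro exI conjI ballI)
    show "((\<lambda>s. v s x + w s x) has_real_derivative (vt + wt)) (at t)" using v(1) w(1) by (rule DERIV_add)
    fix b :: 'a assume b: "b \<in> Basis"
    show "\<forall>\<^sub>F s in nhds 0. ((\<lambda>s. v t (x + s *\<^sub>R b) + w t (x + s *\<^sub>R b)) has_real_derivative (\<lambda>b s. c1 b s + d1 b s) b s) (at s)"
      using v(2)[OF b] w(2)[OF b] by eventually_elim (rule DERIV_add)
    show "((\<lambda>b s. c1 b s + d1 b s) b has_real_derivative (\<lambda>b. c2 b + d2 b) b) (at 0)"
      using v(3)[OF b] w(3)[OF b] by (rule DERIV_add)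
  next
    show "vt + wt = sum (\<lambda>b. c2 b + d2 b) Basis" using v(4) w(4) by (simp add: sum.distrib)
  qed
qed

lemma heat_at_cmult:
  assumes "heat_at w t x"
  shows "heat_at (\<lambda>t x. c * w t x) t x"
proof -
  from assms obtain wt d1 d2 where w: "((\<lambda>s. w s x) has_real_derivative wt) (at t)"
     "\<And>b. b \<in> Basis ==> (\<forall>\<^sub>F s in nhds 0. ((\<lambda>s. w t (x + s *\<^sub>R b)) has_real_derivative d1 b s) (at s))"
     "\<And>b. b \<in> Basis ==> (d1 b has_real_derivative d2 b) (at 0)" "wt = sum d2 Basis"
    unfolding heat_at_def by blast
  show ?thesis unfolding heat_at_def
  proof (intro exI conjI ballI)
    show "((\<lambda>s. c * w s x) has_real_derivative (c * wt)) (at t)" using w(1) by (rule DERIV_cmult)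
    fix b :: 'a assume b: "b \<in> Basis"
    show "\<forall>\<^sub>F s in nhds 0. ((\<lambda>s. c * w t (x + s *\<^sub>R b)) has_real_derivative (\<lambda>b s. c * d1 b s) b s) (at s)"
      using w(2)[OF b] by eventually_elim (rule DERIV_cmult)
    show "((\<lambda>b s. c * d1 b s) b has_real_derivative (\<lambda>b. c * d2 b) b) (at 0)"
      using w(3)[OF b] by (rule DERIV_cmult)
  next
    show "c * wt = sum (\<lambda>b. c * d2 b) Basis" using w(4) by (simp add: sum_distrib_left)
  qed
qed

lemma heat_at_const: "heat_at (\<lambda>t x. c) t x"
  unfolding heat_at_def
  by (rule exI[of _ 0], rule exI[of _ "\<lambda>_ _. 0"], rule exI[of _ "\<lambda>_. 0"]) auto

lemma heat_at_sum:
  assumes "finite J" "\<And>j. j \<in> J ==> heat_at (w j) t x"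
  shows "heat_at (\<lambda>t x. \<Sum>j\<in>J. w j t x) t x"
  using assms by (induction J) (auto simp: heat_at_const intro: heat_at_add)

text \<open>Otherwise \<open>d1\<close> would be positive just to the right of its zero at 0, and
  the mean value theorem would make f increase there.\<close>

lemma second_derivative_local_max:
  fixes f :: "real => real"
  assumes "\<forall>\<^sub>F s in nhds 0. (f has_real_derivative d1 s) (at s)" and D: "(d1 has_real_derivative D) (at 0)"
    and "\<forall>\<^sub>F s in nhds 0. f s <= f 0"
  shows "D <= 0"
proof (rule ccontr)
  assume "\<not> D <= 0"
  then have Dp: "0 < D" by simp
  have "\<forall>\<^sub>F s in nhds 0. (f has_real_derivative d1 s) (at s) \<and> f s <= f 0"
    using assms(1,3) by (rule eventually_conj)
  then obtain r where r: "0 < r" "\<And>s. \<bar>s\<bar> < r ==> (f has_real_derivative d1 s) (at s)" "\<And>s. \<bar>s\<bar> < r ==> f s <= f 0"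
    unfolding eventually_nhds_metric dist_real_def by auto
  have d0: "d1 0 = 0"
    using r by (intro DERIV_local_max[of f "d1 0" 0 r]) auto
  from DERIV_pos_inc_right[OF D Dp] obtain e where e: "0 < e" "\<And>h. 0 < h ==> h < e ==> d1 0 < d1 (0 + h)" by blast
  define h where "h = min r e / 2"
  have h: "0 < h" "h < r" "h < e" using r e by (auto simp: h_def)
  have "\<exists>z>0. z < h \<and> f h - f 0 = (h - 0) * d1 z"
    using h r by (intro MVT2) auto
  then obtain z where z: "0 < z" "z < h" "f h - f 0 = (h - 0) * d1 z" by blast
  have "0 < d1 z" using e(2)[of z] z h d0 by simp
  then have "0 < h * d1 z" using h(1) by simp
  then have "f 0 < f h" using z(3) by simp
  moreover have "f h <= f 0" using r(3)[of h] h by simp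
  ultimately show False by simp
qed

text \<open>After subtraction of eta t a positive maximum is impossible: the second derivatives
  along the axes are nonpositive there, hence the time derivative of the difference is negative, and
  slightly earlier values would be larger. The maximum may sit at the final time, which is why only
  earlier times are compared with it.\<close>

lemma parabolic_max_principle:
  fixes w :: "real => 'a::euclidean_space => real"
  assumes \<Omega>: "open \<Omega>" "bounded \<Omega>" and T: "0 < T"
    and cont: "continuous_on ({0..T} \<times> closure \<Omega>) (\<lambda>p. w (fst p) (snd p))"
    and init: "\<And>x. x \<in> closure \<Omega> ==> w 0 x <= 0"
    and bd: "\<And>t x. 0 <= t ==> x \<in> frontier \<Omega> ==> w t x <= 0"
    and heat: "\<And>t x. 0 < t ==> x \<in> \<Omega> ==> heat_at w t x"
    and x: "x \<in> closure \<Omega>"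
  shows "w T x <= 0"
proof (rule ccontr)
  assume "\<not> w T x <= 0"
  then have pos: "0 < w T x" by simp
  \<comment> \<open>This eta uses up half of the assumed value w T x, so the maximum of w - eta t
    stays positive and can lie neither at time 0 nor on the lateral boundary.\<close>
  define \<eta> where "\<eta> = w T x / (2 * T)"
  have \<eta>: "0 < \<eta>" "\<eta> * T = w T x / 2" using pos T by (auto simp: \<eta>_def)
  let ?K = "{0..T} \<times> closure \<Omega>"
  have cK: "compact ?K" using \<Omega> by (intro compact_Times) (auto simp: compact_closure)
  have nK: "?K \<noteq> {}" using x T by auto
  have "continuous_on ?K (\<lambda>p. w (fst p) (snd p) - \<eta> * fst p)"
    by (intro continuous_intros cont)
  from continuous_attains_sup[OF cK nK this] obtain p where p: "p \<in> ?K"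
    and mx: "\<forall>q\<in>?K. w (fst q) (snd q) - \<eta> * fst q <= w (fst p) (snd p) - \<eta> * fst p" by auto
  define t0 where "t0 = fst p"
  define x0 where "x0 = snd p"
  have t0: "0 <= t0" "t0 <= T" and x0: "x0 \<in> closure \<Omega>" using p by (auto simp: t0_def x0_def)
  have mx': "w t y - \<eta> * t <= w t0 x0 - \<eta> * t0" if "0 <= t" "t <= T" "y \<in> closure \<Omega>" for t y
    using mx[rule_format, of "(t, y)"] that by (simp add: t0_def x0_def)
  have "w T x - \<eta> * T <= w t0 x0 - \<eta> * t0" using mx'[of T x] x T by simp
  then have big: "0 < w t0 x0 - \<eta> * t0" using \<eta> pos by simp
  then have wpos: "0 < w t0 x0" using \<eta> t0 by (smt (verit) mult_nonneg_nonneg)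
  have "t0 \<noteq> 0" using init[OF x0] wpos by auto
  then have t0p: "0 < t0" using t0 by simp
  have "x0 \<notin> frontier \<Omega>" using bd[of t0 x0] t0 wpos by auto
  then have x0i: "x0 \<in> \<Omega>" using x0 \<Omega>(1) by (simp add: frontier_def interior_open)
  obtain wt d1 d2 where w: "((\<lambda>s. w s x0) has_real_derivative wt) (at t0)"
     "\<And>b. b \<in> Basis ==> (\<forall>\<^sub>F s in nhds 0. ((\<lambda>s. w t0 (x0 + s *\<^sub>R b)) has_real_derivative d1 b s) (at s))"
     "\<And>b. b \<in> Basis ==> (d1 b has_real_derivative d2 b) (at 0)" "wt = sum d2 Basis"
    using heat[OF t0p x0i] unfolding heat_at_def by blast
  have "d2 b <= 0" if b: "b \<in> Basis" for b
  proof (rule second_derivative_local_max[OF w(2)[OF b] w(3)[OF b]])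
    have "((\<lambda>s. x0 + s *\<^sub>R b) \<longlongrightarrow> x0 + 0 *\<^sub>R b) (nhds 0)" by (intro tendsto_intros filterlim_ident)
    then have "\<forall>\<^sub>F s in nhds 0. x0 + s *\<^sub>R b \<in> \<Omega>"
      by (rule topological_tendstoD) (use x0i \<Omega>(1) in auto)
    then show "\<forall>\<^sub>F s in nhds 0. w t0 (x0 + s *\<^sub>R b) <= w t0 (x0 + 0 *\<^sub>R b)"
    proof eventually_elim
      case (elim s)
      then show ?case using mx'[of t0 "x0 + s *\<^sub>R b"] t0 closure_subset by auto
    qed
  qed
  then have wt: "wt <= 0" unfolding w(4) by (rule sum_nonpos)
  have "((\<lambda>s. w s x0 - \<eta> * s) has_real_derivative (wt - \<eta>)) (at t0)"
    using w(1) by (auto intro!: derivative_eq_intros)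
  moreover have "wt - \<eta> < 0" using wt \<eta> by simp
  ultimately obtain e where e: "0 < e" "\<And>h. 0 < h ==> h < e ==> w t0 x0 - \<eta> * t0 < w (t0 - h) x0 - \<eta> * (t0 - h)"
    using DERIV_neg_dec_left by blast
  define h where "h = min e t0 / 2"
  have "0 < h" "h < e" "h < t0" using e t0p by (auto simp: h_def)
  then show False using e(2)[of h] mx'[of "t0 - h" x0] t0 x0 by auto
qed

section \<open>Caloric extensions of continuous data\<close>

lemma heat_kernel_exp:
  fixes z :: "'a::euclidean_space"
  assumes "0 < t"
  shows "heat_kernel t z = exp (- (real DIM('a) / 2) * ln (4 * t) - (norm z)\<^sup>2 / (4 * t)) / gauss_Z TYPE('a)"
proof -
  have "(4 * t) powr (- (real DIM('a) / 2)) = exp (- (real DIM('a) / 2) * ln (4 * t))"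
    using assms by (simp add: powr_def)
  then show ?thesis unfolding heat_kernel_def by (simp add: exp_add[symmetric])
qed

lemma heat_kernel_deriv_time:
  fixes z :: "'a::euclidean_space"
  assumes t: "0 < t"
  shows "((\<lambda>s. heat_kernel s z) has_real_derivative
    ((norm z)\<^sup>2 / (4 * t\<^sup>2) - real DIM('a) / (2 * t)) * heat_kernel t z) (at t)"
proof -
  have "((\<lambda>s. exp (- (real DIM('a) / 2) * ln (4 * s) - (norm z)\<^sup>2 / (4 * s)) / gauss_Z TYPE('a)) has_real_derivative
    ((norm z)\<^sup>2 / (4 * t\<^sup>2) - real DIM('a) / (2 * t)) * heat_kernel t z) (at t)"
    using t gauss_Z_pos[where 'a = 'a] unfolding heat_kernel_exp[OF t]
    by (auto intro!: derivative_eq_intros simp: power2_eq_square field_simps)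
  then show ?thesis
    by (rule has_field_derivative_transform_within_open[where S = "{0<..}"]) (auto simp: t heat_kernel_exp)
qed

lemma norm_line:
  fixes z b :: "'a::euclidean_space"
  assumes "b \<in> Basis"
  shows "(norm (z + s *\<^sub>R b))\<^sup>2 = (norm z)\<^sup>2 + 2 * s * (z \<bullet> b) + s\<^sup>2"
proof -
  have "b \<bullet> b = 1" using assms by (simp add: inner_Basis)
  then show ?thesis
    unfolding power2_norm_eq_inner by (simp add: inner_add_left inner_add_right inner_commute power2_eq_square)
qed

lemma heat_kernel_deriv_space:
  fixes z b :: "'a::euclidean_space"
  assumes t: "0 < t" and b: "b \<in> Basis"
  shows "((\<lambda>s. heat_kernel t (z + s *\<^sub>R b)) has_real_derivative
    - ((z \<bullet> b + s) / (2 * t)) * heat_kernel t (z + s *\<^sub>R b)) (at s)"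
  using t gauss_Z_pos[where 'a = 'a] unfolding heat_kernel_def norm_line[OF b]
  by (auto intro!: derivative_eq_intros simp: field_simps)

lemma heat_kernel_deriv_space2:
  fixes z b :: "'a::euclidean_space"
  assumes t: "0 < t" and b: "b \<in> Basis"
  shows "((\<lambda>s. - ((z \<bullet> b + s) / (2 * t)) * heat_kernel t (z + s *\<^sub>R b)) has_real_derivative
    ((z \<bullet> b + s)\<^sup>2 / (4 * t\<^sup>2) - 1 / (2 * t)) * heat_kernel t (z + s *\<^sub>R b)) (at s)"
  using t by (auto intro!: derivative_eq_intros heat_kernel_deriv_space[OF t b] simp: power2_eq_square)
    (simp add: field_simps)

text \<open>The free heat flow of data supported in the box. The integral over a compact box is the
  form to which the Leibniz rule and continuity in parameters apply; \<open>caloric_lborel\<close>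
  returns to the whole space.\<close>

definition caloric :: "'a::euclidean_space => 'a => ('a => real) => real => 'a => real" where
  "caloric a b h t x = integral (cbox a b) (\<lambda>y. heat_kernel t (x - y) * h y)"

lemma continuous_on_heat_kernel:
  fixes g :: "'b::topological_space => 'a::euclidean_space"
  assumes "continuous_on S f" "continuous_on S g" "\<And>p. p \<in> S ==> 0 < f p"
  shows "continuous_on S (\<lambda>p. heat_kernel (f p) (g p))"
proof -
  have "4 * f p \<noteq> 0" if "p \<in> S" for p using assms(3)[OF that] by simp
  then show ?thesis unfolding heat_kernel_def using assms gauss_Z_pos[where 'a = 'a]
    by (intro continuous_intros) auto
qed

lemma heat_at_caloric:
  fixes h :: "'a::euclidean_space => real"
  assumes h: "continuous_on UNIV h" and t: "0 < t"
  shows "heat_at (caloric a b h) t x"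
proof -
  let ?n = "real DIM('a)"
  have hc [continuous_intros]: "continuous_on S (\<lambda>p. h (f p))" if "continuous_on S f" for S :: "'c::topological_space set" and f
    by (rule continuous_on_compose2[OF h that]) auto
  define wt where "wt = integral (cbox a b) (\<lambda>y. (((norm (x - y))\<^sup>2 / (4 * t\<^sup>2) - ?n / (2 * t)) * heat_kernel t (x - y)) * h y)"
  define d1 where "d1 e s = integral (cbox a b) (\<lambda>y. (- (((x - y) \<bullet> e + s) / (2 * t)) * heat_kernel t (x - y + s *\<^sub>R e)) * h y)" for e s
  define d2 where "d2 e = integral (cbox a b) (\<lambda>y. ((((x - y) \<bullet> e + 0)\<^sup>2 / (4 * t\<^sup>2) - 1 / (2 * t)) * heat_kernel t (x - y + 0 *\<^sub>R e)) * h y)" for e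
  have time: "((\<lambda>s. caloric a b h s x) has_real_derivative wt) (at t)"
  proof -
    have "((\<lambda>s. caloric a b h s x) has_field_derivative wt) (at t within {0<..})"
      unfolding caloric_def wt_def
    proof (rule leibniz_rule_field_derivative)
      show "((\<lambda>s. heat_kernel s (x - y) * h y) has_field_derivative
        (((norm (x - y))\<^sup>2 / (4 * s\<^sup>2) - ?n / (2 * s)) * heat_kernel s (x - y)) * h y) (at s within {0<..})"
        if "s \<in> {0<..}" "y \<in> cbox a b" for s y
        using heat_kernel_deriv_time[of s "x - y"] that by (intro DERIV_cmult_right) (auto intro: has_field_derivative_at_within)
      show "(\<lambda>y. heat_kernel s (x - y) * h y) integrable_on cbox a b" if "s \<in> {0<..}" for s
        using that by (intro integrable_continuous continuous_intros continuous_on_heat_kernel) auto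
      show "continuous_on ({0<..} \<times> cbox a b) (\<lambda>(s, y). (((norm (x - y))\<^sup>2 / (4 * s\<^sup>2) - ?n / (2 * s)) * heat_kernel s (x - y)) * h y)"
        unfolding split_beta by (intro continuous_intros continuous_on_heat_kernel) auto
    qed (use t in auto)
    then show ?thesis using t at_within_open[of t "{0<..}"] by simp
  qed
  have s1: "((\<lambda>s. caloric a b h t (x + s *\<^sub>R e)) has_real_derivative d1 e s) (at s)" if e: "e \<in> Basis" for e s
  proof -
    have eq: "x + s *\<^sub>R e - y = x - y + s *\<^sub>R e" for s y by simp
    show ?thesis unfolding caloric_def d1_def eq
    proof (rule leibniz_rule_field_derivative[where U = UNIV])
      show "((\<lambda>s. heat_kernel t (x - y + s *\<^sub>R e) * h y) has_field_derivative
        (- (((x - y) \<bullet> e + s) / (2 * t)) * heat_kernel t (x - y + s *\<^sub>R e)) * h y) (at s within UNIV)" for s y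
        by (intro DERIV_cmult_right heat_kernel_deriv_space t e)
      show "(\<lambda>y. heat_kernel t (x - y + s *\<^sub>R e) * h y) integrable_on cbox a b" for s
        using t by (intro integrable_continuous continuous_intros continuous_on_heat_kernel) auto
      show "continuous_on (UNIV \<times> cbox a b) (\<lambda>(s, y). (- (((x - y) \<bullet> e + s) / (2 * t)) * heat_kernel t (x - y + s *\<^sub>R e)) * h y)"
        unfolding split_beta using t by (intro continuous_intros continuous_on_heat_kernel) auto
    qed auto
  qed
  have s2: "(d1 e has_real_derivative d2 e) (at 0)" if e: "e \<in> Basis" for e
    unfolding d1_def d2_def
  proof (rule leibniz_rule_field_derivative[where U = UNIV])
    show "((\<lambda>s. (- (((x - y) \<bullet> e + s) / (2 * t)) * heat_kernel t (x - y + s *\<^sub>R e)) * h y) has_field_derivative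
      ((((x - y) \<bullet> e + s)\<^sup>2 / (4 * t\<^sup>2) - 1 / (2 * t)) * heat_kernel t (x - y + s *\<^sub>R e)) * h y) (at s within UNIV)" for s y
      by (intro DERIV_cmult_right heat_kernel_deriv_space2 t e)
    show "(\<lambda>y. (- (((x - y) \<bullet> e + s) / (2 * t)) * heat_kernel t (x - y + s *\<^sub>R e)) * h y) integrable_on cbox a b" for s
      using t by (intro integrable_continuous continuous_intros continuous_on_heat_kernel) auto
    show "continuous_on (UNIV \<times> cbox a b) (\<lambda>(s, y). ((((x - y) \<bullet> e + s)\<^sup>2 / (4 * t\<^sup>2) - 1 / (2 * t)) * heat_kernel t (x - y + s *\<^sub>R e)) * h y)"
      unfolding split_beta using t by (intro continuous_intros continuous_on_heat_kernel) auto
  qed auto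
  have "wt = sum d2 Basis"
  proof -
    have "sum d2 Basis = integral (cbox a b) (\<lambda>y. \<Sum>e\<in>Basis. ((((x - y) \<bullet> e + 0)\<^sup>2 / (4 * t\<^sup>2) - 1 / (2 * t)) * heat_kernel t (x - y + 0 *\<^sub>R e)) * h y)"
      unfolding d2_def using t
      by (subst integral_sum) (auto intro!: integrable_continuous continuous_intros continuous_on_heat_kernel)
    also have "(\<lambda>y. \<Sum>e\<in>Basis. ((((x - y) \<bullet> e + 0)\<^sup>2 / (4 * t\<^sup>2) - 1 / (2 * t)) * heat_kernel t (x - y + 0 *\<^sub>R e)) * h y)
      = (\<lambda>y. (((norm (x - y))\<^sup>2 / (4 * t\<^sup>2) - ?n / (2 * t)) * heat_kernel t (x - y)) * h y)"
    proof
      fix y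
      have "(norm (x - y))\<^sup>2 = (\<Sum>e\<in>Basis. ((x - y) \<bullet> e)\<^sup>2)"
        unfolding power2_norm_eq_inner by (subst euclidean_inner) (simp add: power2_eq_square)
      then have "(\<Sum>e\<in>Basis. (((x - y) \<bullet> e + 0)\<^sup>2 / (4 * t\<^sup>2) - 1 / (2 * t))) = (norm (x - y))\<^sup>2 / (4 * t\<^sup>2) - ?n / (2 * t)"
        by (simp add: sum_subtractf sum_divide_distrib)
      then show "(\<Sum>e\<in>Basis. ((((x - y) \<bullet> e + 0)\<^sup>2 / (4 * t\<^sup>2) - 1 / (2 * t)) * heat_kernel t (x - y + 0 *\<^sub>R e)) * h y)
        = (((norm (x - y))\<^sup>2 / (4 * t\<^sup>2) - ?n / (2 * t)) * heat_kernel t (x - y)) * h y"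
        by (simp only: scaleR_zero_left add_0_right sum_distrib_right[symmetric])
    qed
    finally show ?thesis by (simp add: wt_def)
  qed
  then show ?thesis unfolding heat_at_def using time s1 s2
    by (intro exI[of _ wt] exI[of _ d1] exI[of _ d2]) auto
qed

lemma continuous_on_caloric:
  fixes h :: "'a::euclidean_space => real"
  assumes h: "continuous_on UNIV h" and f: "continuous_on S f" and g: "continuous_on S g" and pos: "\<And>p. p \<in> S ==> 0 < f p"
  shows "continuous_on S (\<lambda>p. caloric a b h (f p) (g p))"
proof -
  have "continuous_on ({0<..} \<times> UNIV) (\<lambda>p. integral (cbox a b) (\<lambda>y. heat_kernel (fst p) (snd p - y) * h y))"
  proof (rule integral_continuous_on_param)
    have "continuous_on (({0<..} \<times> UNIV) \<times> cbox a b) (\<lambda>q. h (snd q))"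
      by (rule continuous_on_compose2[OF h]) (auto intro: continuous_intros)
    then show "continuous_on (({0<..} \<times> UNIV) \<times> cbox a b) (\<lambda>(p, y). heat_kernel (fst p) (snd p - y) * h y)"
      unfolding split_beta by (intro continuous_intros continuous_on_heat_kernel) auto
  qed
  from continuous_on_compose2[OF this, of S "\<lambda>p. (f p, g p)"] show ?thesis
    unfolding caloric_def using f g pos by (auto intro!: continuous_intros)
qed

lemma caloric_lborel:
  fixes h :: "'a::euclidean_space => real"
  assumes h: "continuous_on UNIV h" and supp: "\<And>y. y \<notin> cbox a b ==> h y = 0" and t: "0 < t"
  shows "integrable lborel (\<lambda>y. heat_kernel t (x - y) * h y)"
    "caloric a b h t x = (\<integral>y. heat_kernel t (x - y) * h y \<partial>lborel)"
proof -
  have c: "continuous_on (cbox a b) (\<lambda>y. heat_kernel t (x - y) * h y)"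
    using t continuous_on_subset[OF h] by (intro continuous_intros continuous_on_heat_kernel) auto
  have eq: "(\<lambda>y. indicator (cbox a b) y *\<^sub>R (heat_kernel t (x - y) * h y)) = (\<lambda>y. heat_kernel t (x - y) * h y)"
    using supp by (auto simp: indicator_def fun_eq_iff)
  have i: "set_integrable lborel (cbox a b) (\<lambda>y. heat_kernel t (x - y) * h y)"
    unfolding set_integrable_def by (rule borel_integrable_compact[OF compact_cbox c])
  then show "integrable lborel (\<lambda>y. heat_kernel t (x - y) * h y)" unfolding set_integrable_def eq .
  have "integral (cbox a b) (\<lambda>y. heat_kernel t (x - y) * h y) = (LINT y:cbox a b|lborel. heat_kernel t (x - y) * h y)"
    using set_borel_integral_eq_integral(2)[OF i] by simp
  then show "caloric a b h t x = (\<integral>y. heat_kernel t (x - y) * h y \<partial>lborel)"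
    unfolding caloric_def set_lebesgue_integral_def eq .
qed

text \<open>Uniform continuity and boundedness give |h y - h x| <= e/2 + C |x - y|^2 for all x and
  y. The second moment of the heat kernel is proportional to t, so T can be chosen uniformly in
  x.\<close>

lemma caloric_initial:
  fixes h :: "'a::euclidean_space => real"
  assumes h: "continuous_on UNIV h" and supp: "\<And>y. y \<notin> cbox a b ==> h y = 0" and e: "0 < e"
  shows "\<exists>T>0. \<forall>t x. 0 < t \<and> t < T --> \<bar>caloric a b h t x - h x\<bar> <= e"
proof -
  have hm [measurable]: "h \<in> borel_measurable borel" using h by (rule borel_measurable_continuous_onI)
  have "compact (h ` cbox a b)" using h by (intro compact_continuous_image) (auto intro: continuous_on_subset)
  then have "bounded (h ` cbox a b)" by (rule compact_imp_bounded)
  then obtain H0 where H0: "\<And>y. y \<in> cbox a b ==> \<bar>h y\<bar> <= H0" unfolding bounded_iff by auto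
  define H where "H = max H0 1"
  have H: "0 < H" "\<And>y. \<bar>h y\<bar> <= H" using H0 supp by (auto simp: H_def max_def) (metis abs_zero dual_order.trans linear zero_le_one)+
  obtain K0 where K0: "cball (0::'a) K0 \<supseteq> cbox a b" "0 < K0"
    using bounded_cbox[of a b] unfolding bounded_pos by (auto simp: subset_iff)
  have "uniformly_continuous_on (cball 0 (K0 + 1)) h"
    using h by (intro compact_uniformly_continuous) (auto intro: continuous_on_subset)
  then obtain d0 where d0: "0 < d0" "\<And>x y. x \<in> cball 0 (K0 + 1) ==> y \<in> cball 0 (K0 + 1) ==> dist y x < d0 ==> dist (h y) (h x) < e / 2"
    unfolding uniformly_continuous_on_def using e by (metis half_gt_zero)
  define d where "d = min d0 1"
  have d: "0 < d" "d <= 1" using d0 by (auto simp: d_def)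
  have uc: "\<bar>h y - h x\<bar> <= e / 2" if "norm (x - y) < d" for x y
  proof (cases "x \<in> cball 0 K0 \<or> y \<in> cball 0 K0")
    case True
    have "norm x <= norm y + norm (x - y)" "norm y <= norm x + norm (x - y)"
      using norm_triangle_ineq[of y "x - y"] norm_triangle_ineq4[of x "x - y"] by auto
    then have "x \<in> cball 0 (K0 + 1)" "y \<in> cball 0 (K0 + 1)" using True that d by auto
    moreover have "dist y x < d0" using that by (simp add: d_def dist_norm norm_minus_commute)
    ultimately show ?thesis using d0(2)[of x y] by (simp add: dist_real_def)
  next
    case False
    then have "h x = 0" "h y = 0" using K0 supp by blast+
    then show ?thesis using e by simp
  qed
  define C where "C = 2 * H / d\<^sup>2"
  have C: "0 < C" using H d by (simp add: C_def)
  have mod: "\<bar>h y - h x\<bar> <= e / 2 + C * (norm (x - y))\<^sup>2" for x y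
  proof (cases "norm (x - y) < d")
    case True
    have "0 <= C * (norm (x - y))\<^sup>2" using C by simp
    then show ?thesis using uc[OF True] by linarith
  next
    case False
    then have "d\<^sup>2 <= (norm (x - y))\<^sup>2" using d by (intro power_mono) auto
    then have "2 * H <= C * (norm (x - y))\<^sup>2" using d H by (simp add: C_def field_simps)
    moreover have "\<bar>h y - h x\<bar> <= 2 * H" using H(2)[of x] H(2)[of y] by linarith
    ultimately show ?thesis using e by linarith
  qed
  define M where "M = enn2real (\<integral>\<^sup>+y. ennreal (exp (- (norm y)\<^sup>2) * (norm y)\<^sup>2) \<partial>(lborel::'a measure))"
  have M: "(\<integral>\<^sup>+y. ennreal (exp (- (norm y)\<^sup>2) * (norm y)\<^sup>2) \<partial>(lborel::'a measure)) = ennreal M" "0 <= M"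
    unfolding M_def using gauss_moment_finite(1)[where 'a = 'a] by auto
  define Z where "Z = gauss_Z TYPE('a)"
  have Z: "0 < Z" by (simp add: Z_def gauss_Z_pos)
  \<comment> \<open>M + 1 in place of M keeps P positive, as only M >= 0 is recorded.\<close>
  define P where "P = C * 4 * (M + 1) / Z"
  have P: "0 < P" using C M Z by (simp add: P_def)
  define T where "T = (e / 2) / P"
  have T: "0 < T" using e P by (simp add: T_def)
  have "\<bar>caloric a b h t x - h x\<bar> <= e" if t: "0 < t" "t < T" for t x
  proof -
    have iG: "integrable lborel (\<lambda>y. heat_kernel t (x - y))"
      using nn_integral_heat_kernel_1[OF t(1), of x] by (intro integrableI_nonneg) auto
    have "(\<integral>y. heat_kernel t (x - y) \<partial>lborel) = enn2real (NNL y. ennreal (heat_kernel t (x - y)))"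
      by (rule integral_eq_nn_integral) auto
    then have G1: "(\<integral>y. heat_kernel t (x - y) \<partial>lborel) = 1" using nn_integral_heat_kernel_1[OF t(1), of x] by simp
    have iV: "integrable lborel (\<lambda>y. heat_kernel t (x - y) * h y)"
      "caloric a b h t x = (\<integral>y. heat_kernel t (x - y) * h y \<partial>lborel)"
      using caloric_lborel[OF h, of a b t x] supp t by auto
    have "caloric a b h t x - h x = (\<integral>y. heat_kernel t (x - y) * h y \<partial>lborel) - (\<integral>y. heat_kernel t (x - y) * h x \<partial>lborel)"
      using iV(2) G1 iG by simp
    also have "... = (\<integral>y. heat_kernel t (x - y) * h y - heat_kernel t (x - y) * h x \<partial>lborel)"
      using iV(1) iG by (intro Bochner_Integration.integral_diff[symmetric]) auto
    finally have "ennreal \<bar>caloric a b h t x - h x\<bar> = ennreal (norm (\<integral>y. heat_kernel t (x - y) * (h y - h x) \<partial>lborel))"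
      by (simp add: algebra_simps)
    also have "... <= (NNL y. ennreal (norm (heat_kernel t (x - y) * (h y - h x))))"
      by (rule integral_norm_bound_ennreal) (use iV(1) iG in \<open>simp add: right_diff_distrib\<close>)
    also have "... <= (NNL y. ennreal (e / 2) * ennreal (heat_kernel t (x - y)) + ennreal C * ennreal (heat_kernel t (x - y) * (norm (x - y))\<^sup>2))"
    proof (rule nn_integral_mono)
      fix y
      have "norm (heat_kernel t (x - y) * (h y - h x)) <= heat_kernel t (x - y) * (e / 2 + C * (norm (x - y))\<^sup>2)"
        unfolding norm_mult using mod[of y x] by (simp add: mult_left_mono abs_minus_commute)
      also have "... = (e / 2) * heat_kernel t (x - y) + C * (heat_kernel t (x - y) * (norm (x - y))\<^sup>2)"
        by (simp add: algebra_simps)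
      finally show "ennreal (norm (heat_kernel t (x - y) * (h y - h x)))
        <= ennreal (e / 2) * ennreal (heat_kernel t (x - y)) + ennreal C * ennreal (heat_kernel t (x - y) * (norm (x - y))\<^sup>2)"
        using e C by (simp add: ennreal_mult[symmetric] ennreal_plus[symmetric] ennreal_leI del: ennreal_plus)
    qed
    also have "... = ennreal (e / 2) * (NNL y. ennreal (heat_kernel t (x - y))) + ennreal C * (NNL y. ennreal (heat_kernel t (x - y) * (norm (x - y))\<^sup>2))"
      by (simp add: nn_integral_add nn_integral_cmult)
    also have "(NNL y. ennreal (heat_kernel t (x - y) * (norm (x - y))\<^sup>2)) = ennreal (4 * t * M / Z)"
    proof -
      have "(NNL y. ennreal (heat_kernel t (x - y) * (norm (x - y))\<^sup>2))
        = (NNL y. ennreal (exp (- (norm y)\<^sup>2) * (norm ((2 * sqrt t) *\<^sub>R (y::'a)))\<^sup>2)) / ennreal Z"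
        unfolding Z_def by (rule nn_integral_heat_kernel[where \<phi> = "\<lambda>z. (norm z)\<^sup>2"]) (use t in auto)
      also have "(NNL y. ennreal (exp (- (norm y)\<^sup>2) * (norm ((2 * sqrt t) *\<^sub>R (y::'a)))\<^sup>2))
         = (NNL y. ennreal (4 * t) * ennreal (exp (- (norm y)\<^sup>2) * (norm (y::'a))\<^sup>2))"
        using t by (intro nn_integral_cong) (simp add: ennreal_mult[symmetric] power_mult_distrib mult_ac)
      also have "... = ennreal (4 * t) * ennreal M" by (simp add: nn_integral_cmult M)
      finally show ?thesis using t M Z by (simp add: ennreal_mult[symmetric] divide_ennreal)
    qed
    also have "(NNL y. ennreal (heat_kernel t (x - y))) = 1" by (rule nn_integral_heat_kernel_1[OF t(1)])
    also have "ennreal (e / 2) * 1 + ennreal C * ennreal (4 * t * M / Z) = ennreal (e / 2 + C * (4 * t * M / Z))"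
      using e C t M Z by (simp add: ennreal_mult[symmetric] ennreal_plus[symmetric] del: ennreal_plus)
    finally have "\<bar>caloric a b h t x - h x\<bar> <= e / 2 + C * (4 * t * M / Z)"
      using e C t M Z by (subst (asm) ennreal_le_iff) auto
    also have "C * (4 * t * M / Z) <= t * P" using C t M Z by (simp add: P_def field_simps)
    also have "... <= T * P" using t P by (intro mult_right_mono) auto
    also have "... = e / 2" using P by (simp add: T_def)
    finally show ?thesis by simp
  qed
  then show ?thesis using T by blast
qed

lemma directional_derivative:
  fixes f :: "'a::euclidean_space => real"
  assumes "f differentiable (at (x + s *\<^sub>R b))"
  shows "((\<lambda>s. f (x + s *\<^sub>R b)) has_real_derivative pdir f b (x + s *\<^sub>R b)) (at s)"
proof -
  have 1: "(f has_derivative frechet_derivative f (at (x + s *\<^sub>R b))) (at (x + s *\<^sub>R b))"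
    using assms by (simp add: frechet_derivative_works)
  have 2: "((\<lambda>s. x + s *\<^sub>R b) has_derivative (\<lambda>h. h *\<^sub>R b)) (at s)"
    by (auto intro!: derivative_eq_intros)
  have "((\<lambda>s. f (x + s *\<^sub>R b)) has_derivative (\<lambda>h. frechet_derivative f (at (x + s *\<^sub>R b)) (h *\<^sub>R b))) (at s)"
    using has_derivative_compose[OF 2 1] by simp
  moreover have "(\<lambda>h. frechet_derivative f (at (x + s *\<^sub>R b)) (h *\<^sub>R b)) = (*) (pdir f b (x + s *\<^sub>R b))"
    using linear_cmul[OF has_derivative_linear[OF 1]] by (auto simp: pdir_def fun_eq_iff)
  ultimately show ?thesis by (simp add: has_field_derivative_def)
qed

text \<open>Makes combinations of eigenfunctions into continuous functions on the whole space, on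
  which the free heat flow can act.\<close>

lemma continuous_on_zero_extension:
  fixes f :: "'a::topological_space => real"
  assumes "open \<Omega>" "continuous_on (closure \<Omega>) f" "\<And>x. x \<in> frontier \<Omega> ==> f x = 0"
  shows "continuous_on UNIV (\<lambda>x. indicator \<Omega> x * f x)"
proof -
  have "continuous_on (closure \<Omega> \<union> - \<Omega>) (\<lambda>x. if x \<in> \<Omega> then f x else 0)"
  proof (rule continuous_on_cases)
    show "\<forall>x. x \<in> closure \<Omega> \<and> x \<notin> \<Omega> \<or> x \<in> - \<Omega> \<and> x \<in> \<Omega> --> f x = 0"
      using assms(1,3) by (auto simp: frontier_def interior_open)
  qed (use assms in auto)
  moreover have "closure \<Omega> \<union> - \<Omega> = UNIV" using closure_subset by auto
  moreover have "(\<lambda>x. if x \<in> \<Omega> then f x else 0) = (\<lambda>x. indicator \<Omega> x * f x)" by (auto simp: indicator_def)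
  ultimately show ?thesis by metis
qed

section \<open>Comparison of the Dirichlet heat flow with the free one\<close>

locale dirichlet_system =
  fixes \<Omega> :: "'a::euclidean_space set" and lam :: "nat => real" and phi :: "nat => 'a => real"
  assumes open_dom: "open \<Omega>" and bounded_dom: "bounded \<Omega>" and eigensystem: "dirichlet_eigensystem \<Omega> lam phi"
begin

lemma phi_facts:
  "Cinf_on \<Omega> (phi j)" "continuous_on (closure \<Omega>) (phi j)" "x \<in> frontier \<Omega> ==> phi j x = 0"
  "x \<in> \<Omega> ==> laplacian (phi j) x = - (lam j * phi j x)"
proof -
  show "Cinf_on \<Omega> (phi j)" "continuous_on (closure \<Omega>) (phi j)" "x \<in> frontier \<Omega> ==> phi j x = 0"
    using eigensystem unfolding dirichlet_eigensystem_def by auto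
  assume "x \<in> \<Omega>"
  then have "- laplacian (phi j) x = lam j * phi j x"
    using eigensystem unfolding dirichlet_eigensystem_def by auto
  then show "laplacian (phi j) x = - (lam j * phi j x)" by simp
qed

text \<open>The Dirichlet heat flow of a finite combination of eigenfunctions. Finiteness makes it
  continuous up to time 0 and up to the boundary, as the maximum principle demands.\<close>

definition heat_sum :: "nat set => (nat => real) => real => 'a => real" where
  "heat_sum J c t x = (\<Sum>j\<in>J. c j * (exp (- (lam j * t)) * phi j x))"

lemma heat_at_eigen:
  assumes x: "x \<in> \<Omega>"
  shows "heat_at (\<lambda>t x. exp (- (lam j * t)) * phi j x) t x"
proof -
  have "Ck_on (Suc (Suc 0)) \<Omega> (phi j)" using phi_facts(1) by (simp add: Cinf_on_def)
  then have d: "\<And>y. y \<in> \<Omega> ==> phi j differentiable (at y)"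
    "\<And>y b. y \<in> \<Omega> ==> b \<in> Basis ==> pdir (phi j) b differentiable (at y)" by auto
  let ?E = "exp (- (lam j * t))"
  show ?thesis unfolding heat_at_def
  proof (intro exI conjI ballI)
    show "((\<lambda>s. exp (- (lam j * s)) * phi j x) has_real_derivative - lam j * ?E * phi j x) (at t)"
      by (auto intro!: derivative_eq_intros)
    fix b :: 'a assume b: "b \<in> Basis"
    have "((\<lambda>s. x + s *\<^sub>R b) \<longlongrightarrow> x + 0 *\<^sub>R b) (nhds 0)" by (intro tendsto_intros filterlim_ident)
    then have "\<forall>\<^sub>F s in nhds 0. x + s *\<^sub>R b \<in> \<Omega>"
      by (rule topological_tendstoD) (use x open_dom in auto)
    then show "\<forall>\<^sub>F s in nhds 0. ((\<lambda>s. ?E * phi j (x + s *\<^sub>R b)) has_real_derivative (\<lambda>b s. ?E * pdir (phi j) b (x + s *\<^sub>R b)) b s) (at s)"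
      by eventually_elim (intro DERIV_cmult directional_derivative d)
    have "((\<lambda>s. pdir (phi j) b (x + s *\<^sub>R b)) has_real_derivative pdir (pdir (phi j) b) b (x + 0 *\<^sub>R b)) (at 0)"
      by (rule directional_derivative) (use d x b in auto)
    then show "((\<lambda>b s. ?E * pdir (phi j) b (x + s *\<^sub>R b)) b has_real_derivative (\<lambda>b. ?E * pdir (pdir (phi j) b) b x) b) (at 0)"
      by (auto intro: DERIV_cmult)
  next
    have "(\<Sum>b\<in>Basis. ?E * pdir (pdir (phi j) b) b x) = ?E * laplacian (phi j) x"
      by (simp add: laplacian_def sum_distrib_left)
    then show "- lam j * ?E * phi j x = (\<Sum>b\<in>Basis. ?E * pdir (pdir (phi j) b) b x)"
      using phi_facts(4)[OF x, of j] by simp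
  qed
qed

text \<open>The regularization by s compares at time s > 0, where the caloric extension is smooth.\<close>

lemma heat_sum_le_caloric:
  assumes J: "finite J" and h: "continuous_on UNIV h" and supp: "\<And>y. y \<notin> cbox a b ==> h y = 0"
    and init: "\<And>x. x \<in> closure \<Omega> ==> heat_sum J c 0 x <= h x + k"
    and bd: "\<And>t x. 0 < t ==> x \<in> frontier \<Omega> ==> 0 <= caloric a b h t x + k"
    and t: "0 < t" and x: "x \<in> closure \<Omega>"
  shows "heat_sum J c t x <= caloric a b h t x + k"
proof (rule field_le_epsilon)
  fix e :: real assume e: "0 < e"
  have e2: "0 < e / 2" using e by simp
  from caloric_initial[OF h supp e2] obtain T where T: "0 < T"
    and ini: "\<And>s x. 0 < s ==> s < T ==> \<bar>caloric a b h s x - h x\<bar> <= e / 2" by blast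
  have le: "heat_sum J c t x <= caloric a b h (t + s) x + k + e / 2" if s: "0 < s" "s < T" for s
  proof -
    have "(\<lambda>t x. heat_sum J c t x + (-1) * caloric a b h (t + s) x + (- k - e / 2)) t x <= 0"
    proof (rule parabolic_max_principle[OF open_dom bounded_dom t _ _ _ _ x])
      have "continuous_on ({0..t} \<times> closure \<Omega>) (\<lambda>p. caloric a b h (fst p + s) (snd p))"
        using s by (intro continuous_on_caloric h continuous_intros) auto
      moreover have "continuous_on ({0..t} \<times> closure \<Omega>) (\<lambda>p. heat_sum J c (fst p) (snd p))"
        unfolding heat_sum_def using phi_facts(2)
        by (intro continuous_intros) (auto intro!: continuous_on_compose2[OF phi_facts(2)] continuous_intros)
      ultimately show "continuous_on ({0..t} \<times> closure \<Omega>) (\<lambda>p. heat_sum J c (fst p) (snd p) + (-1) * caloric a b h (fst p + s) (snd p) + (- k - e / 2))"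
        by (intro continuous_intros)
    next
      fix y assume "y \<in> closure \<Omega>"
      from init[OF this] ini[OF s, of y]
      show "heat_sum J c 0 y + (-1) * caloric a b h (0 + s) y + (- k - e / 2) <= 0"
        by (simp only: add_0 mult_minus1)
    next
      fix r :: real and y assume r: "0 <= r" and y: "y \<in> frontier \<Omega>"
      have "heat_sum J c r y = 0" unfolding heat_sum_def using phi_facts(3)[OF y] by simp
      then show "heat_sum J c r y + (-1) * caloric a b h (r + s) y + (- k - e / 2) <= 0"
        using bd[OF _ y, of "r + s"] r s e by simp
    next
      fix r :: real and y assume r: "0 < r" and y: "y \<in> \<Omega>"
      have "heat_at (caloric a b h) (r + s) y" using h r s by (intro heat_at_caloric) auto
      then have "heat_at (\<lambda>t x. caloric a b h (t + s) x) r y"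
        unfolding heat_at_def by (simp add: DERIV_shift)
      moreover have "heat_at (heat_sum J c) r y"
        unfolding heat_sum_def using J y by (intro heat_at_sum heat_at_cmult heat_at_eigen)
      ultimately show "heat_at (\<lambda>t x. heat_sum J c t x + (-1) * caloric a b h (t + s) x + (- k - e / 2)) r y"
        by (intro heat_at_add heat_at_cmult heat_at_const)
    qed
    then show ?thesis by simp
  qed
  have "continuous_on {0<..} (\<lambda>s. caloric a b h s x)"
    by (intro continuous_on_caloric h continuous_intros) auto
  then have "isCont (\<lambda>s. caloric a b h s x) t" using t by (simp add: continuous_on_eq_continuous_at)
  then obtain d where d: "0 < d" "\<And>s. \<bar>s - t\<bar> < d ==> \<bar>caloric a b h s x - caloric a b h t x\<bar> < e / 2"
    using e2 unfolding continuous_at_eps_delta dist_real_def by meson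
  define s where "s = min d T / 2"
  have s: "0 < s" "s < d" "s < T" using d T by (auto simp: s_def)
  have "\<bar>caloric a b h (t + s) x - caloric a b h t x\<bar> < e / 2" using d(2)[of "t + s"] s by simp
  then show "heat_sum J c t x <= caloric a b h t x + k + e" using le[OF s(1,3)] by linarith
qed

lemma exists_box: "\<exists>a b. closure \<Omega> \<subseteq> cbox a b"
  using bounded_dom bounded_subset_cbox_symmetric[of "closure \<Omega>"] by (meson bounded_closure)

lemma heat_sum_0_ext:
  "continuous_on UNIV (\<lambda>x. indicator \<Omega> x * heat_sum J c 0 x)"
  "x \<in> closure \<Omega> ==> indicator \<Omega> x * heat_sum J c 0 x = heat_sum J c 0 x"
proof -
  show "continuous_on UNIV (\<lambda>x. indicator \<Omega> x * heat_sum J c 0 x)"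
    unfolding heat_sum_def using phi_facts(2,3)
    by (intro continuous_on_zero_extension open_dom) (auto intro!: continuous_intros)
  assume "x \<in> closure \<Omega>"
  then have "x \<in> \<Omega> \<or> x \<in> frontier \<Omega>" using open_dom by (auto simp: frontier_def interior_open)
  then show "indicator \<Omega> x * heat_sum J c 0 x = heat_sum J c 0 x"
    using phi_facts(3) by (auto simp: heat_sum_def indicator_def)
qed

text \<open>Comparison for c and for -c with the caloric extension of the absolute value of the
  data, which is nonnegative on the boundary where the eigenmodes vanish. This expresses that the
  Dirichlet kernel is dominated by the free one, without constructing the Dirichlet kernel.\<close>

lemma abs_heat_sum_le:
  assumes J: "finite J" and t: "0 < t" and x: "x \<in> closure \<Omega>"
  shows "\<bar>heat_sum J c t x\<bar> <= (\<integral>y. heat_kernel t (x - y) * (indicator \<Omega> y * \<bar>heat_sum J c 0 y\<bar>) \<partial>lborel)"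
proof -
  obtain a b where ab: "closure \<Omega> \<subseteq> cbox a b" using exists_box by blast
  define h where "h y = \<bar>indicator \<Omega> y * heat_sum J c 0 y\<bar>" for y
  have h: "continuous_on UNIV h" unfolding h_def by (intro continuous_intros heat_sum_0_ext)
  have supp: "h y = 0" if "y \<notin> cbox a b" for y
    using that ab closure_subset by (auto simp: h_def indicator_def)
  have hp: "h y = indicator \<Omega> y * \<bar>heat_sum J c 0 y\<bar>" for y by (simp add: h_def indicator_def)
  have cal: "caloric a b h t x = (\<integral>y. heat_kernel t (x - y) * (indicator \<Omega> y * \<bar>heat_sum J c 0 y\<bar>) \<partial>lborel)"
    unfolding hp[symmetric] by (rule caloric_lborel(2)[OF h supp t])
  have bd: "0 <= caloric a b h t x + 0" if "0 < t" for t x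
    using caloric_lborel(2)[OF h, of a b t x] supp that by (simp add: hp)
  have "heat_sum J c t x <= caloric a b h t x + 0"
  proof (intro heat_sum_le_caloric J h supp bd t x)
    fix y assume y: "y \<in> closure \<Omega>"
    show "heat_sum J c 0 y <= h y + 0"
      unfolding h_def heat_sum_0_ext(2)[OF y] by simp
  qed
  moreover have "heat_sum J (\<lambda>j. - c j) t x <= caloric a b h t x + 0"
  proof (intro heat_sum_le_caloric J h supp bd t x)
    fix y assume y: "y \<in> closure \<Omega>"
    have "heat_sum J (\<lambda>j. - c j) 0 y = - heat_sum J c 0 y" by (simp add: heat_sum_def sum_negf)
    then show "heat_sum J (\<lambda>j. - c j) 0 y <= h y + 0"
      unfolding h_def heat_sum_0_ext(2)[OF y] by linarith
  qed
  ultimately show ?thesis unfolding cal by (simp add: heat_sum_def sum_negf abs_le_iff)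
qed

text \<open>Data h at distance at least d from the boundary generate there, at all times, values of
  at most \<open>heat_sup\<close> times d^(-n) times the integral of h; subtracting this constant
  makes the free flow a lower barrier. The combination need not equal h at time 0: the discrepancy D
  is carried along by its own caloric extension and disappears once the combinations approximate h.
  The first claim uses the barrier built from D alone and expresses positivity.\<close>

lemma heat_sum_ge:
  assumes J: "finite J" and t: "0 < t" and x: "x \<in> closure \<Omega>"
    and h: "continuous_on UNIV h" and h0: "\<And>y. 0 <= h y" and d: "0 < d"
    and supp: "\<And>y z. h y \<noteq> 0 ==> z \<in> frontier \<Omega> ==> d <= norm (z - y)" and sO: "\<And>y. y \<notin> \<Omega> ==> h y = 0"
  shows "- (\<integral>y. heat_kernel t (x - y) * (indicator \<Omega> y * \<bar>h y - heat_sum J c 0 y\<bar>) \<partial>lborel) <= heat_sum J c t x"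
    "(\<integral>y. heat_kernel t (x - y) * h y \<partial>lborel) - heat_sup TYPE('a) * d powr (- real DIM('a)) * (\<integral>y. h y \<partial>lborel)
      - (\<integral>y. heat_kernel t (x - y) * (indicator \<Omega> y * \<bar>h y - heat_sum J c 0 y\<bar>) \<partial>lborel) <= heat_sum J c t x"
proof -
  obtain a b where ab: "closure \<Omega> \<subseteq> cbox a b" using exists_box by blast
  define D where "D y = \<bar>h y - indicator \<Omega> y * heat_sum J c 0 y\<bar>" for y
  have D: "continuous_on UNIV D" unfolding D_def by (intro continuous_intros heat_sum_0_ext h)
  have hs: "h y = 0" if "y \<notin> cbox a b" for y using that ab closure_subset sO by blast
  have Ds: "D y = 0" if "y \<notin> cbox a b" for y
    using that ab closure_subset sO hs by (auto simp: D_def indicator_def)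
  have Dp: "D y = indicator \<Omega> y * \<bar>h y - heat_sum J c 0 y\<bar>" for y
    using sO by (simp add: D_def indicator_def)
  have cD: "caloric a b D t x = (\<integral>y. heat_kernel t (x - y) * (indicator \<Omega> y * \<bar>h y - heat_sum J c 0 y\<bar>) \<partial>lborel)" if "0 < t" for t x
    unfolding Dp[symmetric] by (rule caloric_lborel(2)[OF D Ds that])
  have neg: "heat_sum J (\<lambda>j. - c j) s y = - heat_sum J c s y" for s y by (simp add: heat_sum_def sum_negf)
  have "heat_sum J (\<lambda>j. - c j) t x <= caloric a b D t x + 0"
  proof (intro heat_sum_le_caloric J D Ds t x)
    fix y assume y: "y \<in> closure \<Omega>"
    show "heat_sum J (\<lambda>j. - c j) 0 y <= D y + 0"
      unfolding D_def heat_sum_0_ext(2)[OF y] neg using h0[of y] by linarith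
  next
    show "0 <= caloric a b D t x + 0" if "0 < t" for t x
      unfolding cD[OF that] by simp
  qed
  then show "- (\<integral>y. heat_kernel t (x - y) * (indicator \<Omega> y * \<bar>h y - heat_sum J c 0 y\<bar>) \<partial>lborel) <= heat_sum J c t x"
    unfolding neg cD[OF t] by simp
  define k where "k = heat_sup TYPE('a) * d powr (- real DIM('a)) * (\<integral>y. h y \<partial>lborel)"
  have ch: "caloric a b h t x = (\<integral>y. heat_kernel t (x - y) * h y \<partial>lborel)"
    "integrable lborel (\<lambda>y. heat_kernel t (x - y) * h y)" if "0 < t" for t x
    using caloric_lborel[OF h, of a b t x] hs that by auto
  have cDint: "integrable lborel (\<lambda>y. heat_kernel t (x - y) * D y)" if "0 < t" for t x
    using caloric_lborel[OF D, of a b t x] Ds that by auto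
  have E: "continuous_on UNIV (\<lambda>y. D y - h y)" by (intro continuous_intros D h)
  have Es: "D y - h y = 0" if "y \<notin> cbox a b" for y using Ds[OF that] hs[OF that] by simp
  have cE: "caloric a b (\<lambda>y. D y - h y) t x = caloric a b D t x - caloric a b h t x" if "0 < t" for t x
  proof -
    have "caloric a b (\<lambda>y. D y - h y) t x = (\<integral>y. heat_kernel t (x - y) * (D y - h y) \<partial>lborel)"
      by (rule caloric_lborel(2)[OF E Es that])
    also have "... = (\<integral>y. heat_kernel t (x - y) * D y \<partial>lborel) - (\<integral>y. heat_kernel t (x - y) * h y \<partial>lborel)"
      using ch(2)[OF that, of x] cDint[OF that, of x] by (simp add: right_diff_distrib)
    also have "(\<integral>y. heat_kernel t (x - y) * D y \<partial>lborel) = caloric a b D t x"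
      by (rule caloric_lborel(2)[OF D Ds that, symmetric])
    finally show ?thesis using ch(1)[OF that, of x] by simp
  qed
  have hint: "integrable lborel h"
  proof -
    have "integrable lborel (\<lambda>y. indicator (cbox a b) y *\<^sub>R h y)"
      using continuous_on_subset[OF h] by (intro borel_integrable_compact) auto
    moreover have "(\<lambda>y. indicator (cbox a b) y *\<^sub>R h y) = h" using hs by (auto simp: indicator_def fun_eq_iff)
    ultimately show ?thesis by simp
  qed
  have "heat_sum J (\<lambda>j. - c j) t x <= caloric a b (\<lambda>y. D y - h y) t x + k"
  proof (intro heat_sum_le_caloric J E Es t x)
    fix y assume y: "y \<in> closure \<Omega>"
    have "h y - heat_sum J c 0 y <= D y" unfolding D_def heat_sum_0_ext(2)[OF y] by simp
    moreover have "0 <= k" unfolding k_def using h0 heat_sup_pos[where 'a = 'a]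
      by (intro mult_nonneg_nonneg) (auto simp: less_imp_le)
    ultimately show "heat_sum J (\<lambda>j. - c j) 0 y <= D y - h y + k" by (simp add: neg)
  next
    fix s :: real and z assume s: "0 < s" and z: "z \<in> frontier \<Omega>"
    have "caloric a b h s z <= (\<integral>y. heat_sup TYPE('a) * d powr (- real DIM('a)) * h y \<partial>lborel)"
      unfolding ch(1)[OF s]
    proof (rule integral_mono)
      show "heat_kernel s (z - y) * h y <= heat_sup TYPE('a) * d powr (- real DIM('a)) * h y" for y
      proof (cases "h y = 0")
        case False
        have dz: "d <= norm (z - y)" by (rule supp[OF False z])
        then have "z - y \<noteq> 0" using d by auto
        then have "heat_kernel s (z - y) <= heat_sup TYPE('a) * norm (z - y) powr (- real DIM('a))"
          by (rule heat_kernel_le_norm[OF s])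
        also have "... <= heat_sup TYPE('a) * d powr (- real DIM('a))"
          using dz d heat_sup_pos[where 'a = 'a] by (intro mult_left_mono powr_mono2') auto
        finally show ?thesis by (intro mult_right_mono h0)
      qed simp
    qed (use ch(2)[OF s] hint in auto)
    also have "... = k" by (simp add: k_def)
    moreover have "0 <= caloric a b D s z" unfolding cD[OF s] by simp
    ultimately show "0 <= caloric a b (\<lambda>y. D y - h y) s z + k" unfolding cE[OF s] by simp
  qed
  then show "(\<integral>y. heat_kernel t (x - y) * h y \<partial>lborel) - heat_sup TYPE('a) * d powr (- real DIM('a)) * (\<integral>y. h y \<partial>lborel)
      - (\<integral>y. heat_kernel t (x - y) * (indicator \<Omega> y * \<bar>h y - heat_sum J c 0 y\<bar>) \<partial>lborel) <= heat_sum J c t x"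
    unfolding neg cE[OF t] ch(1)[OF t] cD[OF t] k_def by simp
qed

end

section \<open>Square integrable functions and orthonormal bases\<close>

definition L2 :: "'a measure => ('a => real) => bool" where
  "L2 M u \<longleftrightarrow> u \<in> borel_measurable M \<and> integrable M (\<lambda>x. (u x)\<^sup>2)"

definition ip :: "'a measure => ('a => real) => ('a => real) => real" where
  "ip M u v = (\<integral>x. u x * v x \<partial>M)"

lemma L2D: "L2 M u ==> u \<in> borel_measurable M" "L2 M u ==> integrable M (\<lambda>x. (u x)\<^sup>2)"
  by (auto simp: L2_def)

lemma L2_mult_integrable:
  assumes "L2 M u" "L2 M v"
  shows "integrable M (\<lambda>x. u x * v x)"
proof (rule Bochner_Integration.integrable_bound)
  show "integrable M (\<lambda>x. (u x)\<^sup>2 + (v x)\<^sup>2)" using assms by (auto simp: L2_def)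
  show "(\<lambda>x. u x * v x) \<in> borel_measurable M" using assms[THEN L2D(1)] by measurable
  have "\<bar>a * b\<bar> <= a\<^sup>2 + b\<^sup>2" for a b :: real
  proof -
    have "0 <= (\<bar>a\<bar> - \<bar>b\<bar>)\<^sup>2" by simp
    then have "2 * (\<bar>a\<bar> * \<bar>b\<bar>) <= a\<^sup>2 + b\<^sup>2" by (simp add: power2_diff)
    moreover have "0 <= \<bar>a\<bar> * \<bar>b\<bar>" by simp
    ultimately show ?thesis unfolding abs_mult by linarith
  qed
  then show "AE x in M. norm (u x * v x) <= norm ((u x)\<^sup>2 + (v x)\<^sup>2)" by simp
qed

lemma L2_cmult: "L2 M u ==> L2 M (\<lambda>x. c * u x)"
  by (auto simp: L2_def power_mult_distrib)

lemma L2_add: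
  assumes "L2 M u" "L2 M v"
  shows "L2 M (\<lambda>x. u x + v x)"
proof -
  have "integrable M (\<lambda>x. (u x)\<^sup>2 + (v x)\<^sup>2 + 2 * (u x * v x))"
    using assms L2_mult_integrable[OF assms] by (auto simp: L2_def)
  then show ?thesis using assms[THEN L2D(1)] by (auto simp: L2_def power2_sum mult.assoc)
qed

lemma L2_diff:
  assumes "L2 M u" "L2 M v"
  shows "L2 M (\<lambda>x. u x - v x)"
  using L2_add[OF assms(1) L2_cmult[OF assms(2), of "-1"]] by simp

lemma L2_zero: "L2 M (\<lambda>x. 0)" by (simp add: L2_def)

lemma L2_sum:
  assumes "\<And>j. j \<in> J ==> L2 M (f j)"
  shows "L2 M (\<lambda>x. \<Sum>j\<in>J. f j x)"
  using assms by (induction J rule: infinite_finite_induct) (auto simp: L2_zero intro: L2_add)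

lemma L2_abs: "L2 M u ==> L2 M (\<lambda>x. \<bar>u x\<bar>)"
  by (auto simp: L2_def)

lemma ip_commute: "ip M u v = ip M v u"
  by (simp add: ip_def mult.commute)

lemma ip_add_left: "L2 M u ==> L2 M v ==> L2 M w ==> ip M (\<lambda>x. u x + v x) w = ip M u w + ip M v w"
  by (simp add: ip_def distrib_right L2_mult_integrable)

lemma ip_diff_left: "L2 M u ==> L2 M v ==> L2 M w ==> ip M (\<lambda>x. u x - v x) w = ip M u w - ip M v w"
  by (simp add: ip_def left_diff_distrib L2_mult_integrable)

lemma ip_cmult_left: "ip M (\<lambda>x. c * u x) w = c * ip M u w"
  by (simp add: ip_def mult.assoc)

lemma ip_sum_left:
  assumes "\<And>j. j \<in> J ==> L2 M (f j)" "L2 M w"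
  shows "ip M (\<lambda>x. \<Sum>j\<in>J. f j x) w = (\<Sum>j\<in>J. ip M (f j) w)"
  using assms
proof (induction J rule: infinite_finite_induct)
  case (insert j J)
  then have "ip M (\<lambda>x. f j x + (\<Sum>j\<in>J. f j x)) w = ip M (f j) w + ip M (\<lambda>x. \<Sum>j\<in>J. f j x) w"
    by (intro ip_add_left L2_sum) auto
  then show ?case using insert by simp
qed (auto simp: ip_def)

lemma ip_nonneg: "0 <= ip M u u"
  by (simp add: ip_def)

lemma ip_Cauchy_Schwarz:
  assumes "L2 M u" "L2 M v"
  shows "(ip M u v)\<^sup>2 <= ip M u u * ip M v v"
proof -
  have q: "0 <= ip M u u + 2 * t * ip M u v + t\<^sup>2 * ip M v v" for t
  proof -
    have "ip M (\<lambda>x. u x + t * v x) (\<lambda>x. u x + t * v x) = ip M u (\<lambda>x. u x + t * v x) + ip M (\<lambda>x. t * v x) (\<lambda>x. u x + t * v x)"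
      using assms by (intro ip_add_left L2_add L2_cmult)
    also have "ip M u (\<lambda>x. u x + t * v x) = ip M u u + t * ip M u v"
      using assms by (subst ip_commute, subst ip_add_left) (auto intro: L2_cmult simp: ip_cmult_left ip_commute[of _ u v])
    also have "ip M (\<lambda>x. t * v x) (\<lambda>x. u x + t * v x) = t * (ip M u v + t * ip M v v)"
      using assms by (subst ip_cmult_left, subst ip_commute, subst ip_add_left) (auto intro: L2_cmult simp: ip_cmult_left)
    finally show ?thesis using ip_nonneg[of M "\<lambda>x. u x + t * v x"] by (simp add: algebra_simps power2_eq_square)
  qed
  show ?thesis
  proof (cases "ip M v v = 0")
    case True
    have "ip M u v = 0"
    proof (rule ccontr)
      assume n: "ip M u v \<noteq> 0"
      define t where "t = - (ip M u u + 1) / (2 * ip M u v)"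
      have "2 * t * ip M u v = - (ip M u u + 1)" using n by (simp add: t_def)
      then show False using q[of t] True by simp
    qed
    then show ?thesis using True by simp
  next
    case False
    then have p: "0 < ip M v v" using ip_nonneg[of M v] by simp
    define t where "t = - ip M u v / ip M v v"
    have "2 * t * ip M u v + t\<^sup>2 * ip M v v = - (ip M u v)\<^sup>2 / ip M v v"
      using p by (simp add: t_def field_simps power2_eq_square)
    then have "(ip M u v)\<^sup>2 / ip M v v <= ip M u u" using q[of t] by simp
    then show ?thesis using p by (simp add: field_simps)
  qed
qed

lemma L2_integrable:
  assumes "finite_measure M" "L2 M u"
  shows "integrable M u"
proof -
  interpret finite_measure M by fact
  have "L2 M (\<lambda>_. 1)" by (simp add: L2_def)
  from L2_mult_integrable[OF this assms(2)] show ?thesis by simp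
qed

lemma L1_le_L2:
  assumes "finite_measure M" "L2 M u"
  shows "(\<integral>x. \<bar>u x\<bar> \<partial>M) <= sqrt (measure M (space M)) * sqrt (ip M u u)"
proof -
  interpret finite_measure M by fact
  have 1: "L2 M (\<lambda>_. 1)" by (simp add: L2_def)
  have "(ip M (\<lambda>x. \<bar>u x\<bar>) (\<lambda>_. 1))\<^sup>2 <= ip M (\<lambda>x. \<bar>u x\<bar>) (\<lambda>x. \<bar>u x\<bar>) * ip M (\<lambda>_. 1) (\<lambda>_. 1)"
    by (rule ip_Cauchy_Schwarz[OF L2_abs[OF assms(2)] 1])
  then have "(\<integral>x. \<bar>u x\<bar> \<partial>M)\<^sup>2 <= measure M (space M) * ip M u u"
    by (simp add: ip_def mult.commute)
  then have "sqrt ((\<integral>x. \<bar>u x\<bar> \<partial>M)\<^sup>2) <= sqrt (measure M (space M) * ip M u u)" by (rule real_sqrt_le_mono)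
  then show ?thesis by (simp add: real_sqrt_mult)
qed

lemma strict_mono_choice:
  assumes "\<And>k::nat. \<exists>N::nat. \<forall>i\<ge>N. P k i"
  shows "\<exists>r. strict_mono r \<and> (\<forall>k i. i \<ge> r k --> P k i)"
proof -
  obtain N where N: "\<And>k i. i \<ge> N k ==> P k i" using assms by metis
  define r where "r = (\<lambda>k. k + (\<Sum>i\<le>k. N i))"
  have "strict_mono r" unfolding strict_mono_Suc_iff r_def by auto
  moreover have "N k <= r k" for k unfolding r_def by (simp add: trans_le_add2 member_le_sum)
  ultimately show ?thesis using N by (meson order_trans)
qed

text \<open>A fast subsequence has summable L1 increments, because the measure is finite, and hence
  converges almost everywhere; Fatou's lemma transfers the Cauchy estimate to the limit.\<close>

lemma L2_complete:
  assumes M: "finite_measure M" and f: "\<And>k::nat. L2 M (f k)"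
    and cauchy: "\<And>e. 0 < e ==> \<exists>N. \<forall>i\<ge>N. \<forall>j\<ge>N. ip M (\<lambda>x. f i x - f j x) (\<lambda>x. f i x - f j x) <= e"
  shows "\<exists>g r. L2 M g \<and> strict_mono r \<and> (AE x in M. (\<lambda>k. f (r k) x) \<longlonglongrightarrow> g x) \<and>
    (\<lambda>k. ip M (\<lambda>x. f k x - g x) (\<lambda>x. f k x - g x)) \<longlonglongrightarrow> 0"
proof -
  interpret finite_measure M by fact
  note [measurable] = L2D(1)[OF f]
  let ?d = "\<lambda>i j. ip M (\<lambda>x. f i x - f j x) (\<lambda>x. f i x - f j x)"
  have "\<exists>r. strict_mono r \<and> (\<forall>k i. i \<ge> r k --> (\<forall>j\<ge>i. ?d i j <= (1 / 4) ^ k))"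
  proof (rule strict_mono_choice)
    fix k :: nat
    obtain N where "\<forall>i\<ge>N. \<forall>j\<ge>N. ?d i j <= (1 / 4) ^ k" using cauchy[of "(1/4)^k"] by auto
    then show "\<exists>N. \<forall>i\<ge>N. \<forall>j\<ge>i. ?d i j <= (1 / 4) ^ k" by (meson order_trans)
  qed
  then obtain r where r: "strict_mono r" "\<And>k j. j \<ge> r k ==> ?d (r k) j <= (1 / 4) ^ k" by blast
  define m where "m = sqrt (measure M (space M))"
  have step: "(\<integral>\<^sup>+x. ennreal \<bar>f (r (Suc k)) x - f (r k) x\<bar> \<partial>M) <= ennreal (m * (1 / 2) ^ k)" for k
  proof -
    have l: "L2 M (\<lambda>x. f (r (Suc k)) x - f (r k) x)" by (intro L2_diff f)
    have "(\<integral>\<^sup>+x. ennreal \<bar>f (r (Suc k)) x - f (r k) x\<bar> \<partial>M) = ennreal (\<integral>x. \<bar>f (r (Suc k)) x - f (r k) x\<bar> \<partial>M)"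
      using L2_integrable[OF M l] by (intro nn_integral_eq_integral) auto
    also have "(\<integral>x. \<bar>f (r (Suc k)) x - f (r k) x\<bar> \<partial>M) <= m * sqrt (?d (r (Suc k)) (r k))"
      unfolding m_def by (rule L1_le_L2[OF M l])
    also have "?d (r (Suc k)) (r k) = ?d (r k) (r (Suc k))"
      by (simp add: ip_def power2_eq_square[symmetric] power2_commute)
    also have "sqrt (?d (r k) (r (Suc k))) <= sqrt ((1 / 4) ^ k)"
      using r(1) by (intro real_sqrt_le_mono r(2)) (simp add: strict_mono_less_eq)
    also have "sqrt ((1 / 4) ^ k) = (1 / 2 :: real) ^ k" by (simp add: real_sqrt_power real_sqrt_divide)
    finally show ?thesis by (simp add: ennreal_leI m_def mult_left_mono)
  qed
  have "(\<integral>\<^sup>+x. (\<Sum>k. ennreal \<bar>f (r (Suc k)) x - f (r k) x\<bar>) \<partial>M) = (\<Sum>k. \<integral>\<^sup>+x. ennreal \<bar>f (r (Suc k)) x - f (r k) x\<bar> \<partial>M)"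
    by (rule nn_integral_suminf) measurable
  also have "... <= (\<Sum>k. ennreal (m * (1 / 2) ^ k))" by (intro suminf_le step) auto
  also have "... = ennreal (m * 2)"
    using sums_mult[OF geometric_sums[of "1/2::real"], of m]
    by (intro suminf_ennreal_eq) (auto simp: m_def)
  finally have "(\<integral>\<^sup>+x. (\<Sum>k. ennreal \<bar>f (r (Suc k)) x - f (r k) x\<bar>) \<partial>M) \<noteq> \<infinity>"
    by (auto simp: top_unique)
  then have "AE x in M. (\<Sum>k. ennreal \<bar>f (r (Suc k)) x - f (r k) x\<bar>) \<noteq> \<infinity>"
    by (intro nn_integral_PInf_AE) auto
  then have conv: "AE x in M. convergent (\<lambda>k. f (r k) x)"
  proof eventually_elim
    case (elim x)
    have "summable (\<lambda>k. \<bar>f (r (Suc k)) x - f (r k) x\<bar>)"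
      using elim by (intro summable_suminf_not_top) auto
    then have "summable (\<lambda>k. f (r (Suc k)) x - f (r k) x)" by (rule summable_rabs_cancel)
    then have "convergent (\<lambda>n. \<Sum>k<n. (f (r (Suc k)) x - f (r k) x))" by (simp add: summable_iff_convergent)
    then have "convergent (\<lambda>n. f (r n) x - f (r 0) x)" by (simp only: sum_lessThan_telescope[of "\<lambda>k. f (r k) x"])
    then have "convergent (\<lambda>n. (f (r n) x - f (r 0) x) + f (r 0) x)" by (intro convergent_add convergent_const)
    then show ?case by simp
  qed
  define g where "g x = lim (\<lambda>k. f (r k) x)" for x
  have gm [measurable]: "g \<in> borel_measurable M" unfolding g_def by measurable
  have lim: "AE x in M. (\<lambda>k. f (r k) x) \<longlonglongrightarrow> g x"
    using conv by eventually_elim (simp add: g_def convergent_LIMSEQ_iff)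
  have key: "(\<integral>\<^sup>+x. ennreal ((f i x - g x)\<^sup>2) \<partial>M) <= ennreal e" if e: "\<And>j. j \<ge> N ==> ?d i j <= e" for i N e
  proof -
    have "(\<integral>\<^sup>+x. ennreal ((f i x - g x)\<^sup>2) \<partial>M) = (\<integral>\<^sup>+x. liminf (\<lambda>k. ennreal ((f i x - f (r k) x)\<^sup>2)) \<partial>M)"
    proof (rule nn_integral_cong_AE)
      show "AE x in M. ennreal ((f i x - g x)\<^sup>2) = liminf (\<lambda>k. ennreal ((f i x - f (r k) x)\<^sup>2))"
        using lim
      proof eventually_elim
        case (elim x)
        have "(\<lambda>k. ennreal ((f i x - f (r k) x)\<^sup>2)) \<longlonglongrightarrow> ennreal ((f i x - g x)\<^sup>2)"
          using elim by (intro tendsto_ennrealI tendsto_intros)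
        then show ?case by (intro lim_imp_Liminf[symmetric]) auto
      qed
    qed
    also have "... <= liminf (\<lambda>k. \<integral>\<^sup>+x. ennreal ((f i x - f (r k) x)\<^sup>2) \<partial>M)"
      by (rule nn_integral_liminf) measurable
    also have "... <= ennreal e"
    proof (rule Liminf_le)
      show "\<forall>\<^sub>F k in sequentially. (\<integral>\<^sup>+x. ennreal ((f i x - f (r k) x)\<^sup>2) \<partial>M) <= ennreal e"
        unfolding eventually_sequentially
      proof (intro exI[of _ N] allI impI)
        fix k assume "N <= k"
        then have k: "N <= r k" using seq_suble[OF r(1), of k] by simp
        have "(\<integral>\<^sup>+x. ennreal ((f i x - f (r k) x)\<^sup>2) \<partial>M) = ennreal (\<integral>x. (f i x - f (r k) x)\<^sup>2 \<partial>M)"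
          using L2D(2)[OF L2_diff[OF f f]] by (intro nn_integral_eq_integral) auto
        also have "... <= ennreal e" using e[OF k] by (simp add: ip_def power2_eq_square ennreal_leI)
        finally show "(\<integral>\<^sup>+x. ennreal ((f i x - f (r k) x)\<^sup>2) \<partial>M) <= ennreal e" .
      qed
    qed auto
    finally show ?thesis .
  qed
  obtain N1 where N1: "\<And>i j. i \<ge> N1 ==> j \<ge> N1 ==> ?d i j <= 1" using cauchy[of 1] by auto
  have "L2 M (\<lambda>x. f N1 x - g x)" unfolding L2_def
  proof
    have "(\<integral>\<^sup>+x. ennreal ((f N1 x - g x)\<^sup>2) \<partial>M) <= ennreal 1" using N1 by (intro key[of N1]) auto
    then show "integrable M (\<lambda>x. (f N1 x - g x)\<^sup>2)"
      by (intro integrableI_nonneg) (auto intro: le_less_trans)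
  qed measurable
  from L2_diff[OF f this, of N1] have g: "L2 M g" by simp
  have "(\<lambda>k. ip M (\<lambda>x. f k x - g x) (\<lambda>x. f k x - g x)) \<longlonglongrightarrow> 0"
    unfolding LIMSEQ_iff
  proof (intro allI impI)
    fix e :: real assume e: "0 < e"
    then obtain N where N: "\<And>i j. i \<ge> N ==> j \<ge> N ==> ?d i j <= e / 2" using cauchy[of "e/2"] by auto
    show "\<exists>no. \<forall>n\<ge>no. norm (ip M (\<lambda>x. f n x - g x) (\<lambda>x. f n x - g x) - 0) < e"
    proof (intro exI[of _ N] allI impI)
      fix n assume n: "N <= n"
      have "ennreal (\<integral>x. (f n x - g x)\<^sup>2 \<partial>M) = (\<integral>\<^sup>+x. ennreal ((f n x - g x)\<^sup>2) \<partial>M)"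
        using L2D(2)[OF L2_diff[OF f g]] by (intro nn_integral_eq_integral[symmetric]) auto
      also have "... <= ennreal (e / 2)" using N n by (intro key[of N]) auto
      finally have "ip M (\<lambda>x. f n x - g x) (\<lambda>x. f n x - g x) <= e / 2"
        using e by (simp add: ip_def power2_eq_square)
      then show "norm (ip M (\<lambda>x. f n x - g x) (\<lambda>x. f n x - g x) - 0) < e"
        using e ip_nonneg[of M "\<lambda>x. f n x - g x"] by simp
    qed
  qed
  then show ?thesis using g r(1) lim by blast
qed

section \<open>Expansions in an orthonormal basis\<close>

locale onb =
  fixes M :: "'a measure" and phi :: "nat => 'a => real"
  assumes fin: "finite_measure M"
    and phi_L2: "\<And>j. L2 M (phi j)"
    and orth: "\<And>i j. ip M (phi i) (phi j) = (if i = j then 1 else 0)"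
    and complete: "\<And>f. L2 M f ==> (\<And>j. ip M f (phi j) = 0) ==> AE x in M. f x = 0"
begin

definition psum :: "(nat => real) => nat set => 'a => real" where
  "psum c J x = (\<Sum>j\<in>J. c j * phi j x)"

lemma psum_L2: "L2 M (psum c J)"
  unfolding psum_def by (intro L2_sum L2_cmult phi_L2)

lemma ip_psum_phi: "finite J ==> ip M (psum c J) (phi i) = (if i \<in> J then c i else 0)"
  unfolding psum_def
  by (subst ip_sum_left) (auto intro: L2_cmult phi_L2 simp: ip_cmult_left orth if_distrib[of "(*) _"] cong: if_cong)

lemma ip_psum: "L2 M f ==> ip M (psum c J) f = (\<Sum>j\<in>J. c j * ip M f (phi j))"
  unfolding psum_def
  by (subst ip_sum_left) (auto intro: L2_cmult phi_L2 simp: ip_cmult_left ip_commute[of M f])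

lemma ip_psum_psum: "finite J ==> ip M (psum c J) (psum c J) = (\<Sum>j\<in>J. (c j)\<^sup>2)"
  by (subst ip_psum[OF psum_L2]) (auto simp: ip_psum_phi power2_eq_square intro: sum.cong)

lemma psum_diff: "finite J ==> I \<subseteq> J ==> psum c J x - psum c I x = psum c (J - I) x"
  unfolding psum_def by (simp add: sum_diff)

lemma riesz_fischer:
  assumes "summable (\<lambda>j. (c j)\<^sup>2)"
  shows "\<exists>g. L2 M g \<and> (\<forall>j. ip M g (phi j) = c j) \<and>
    (\<lambda>N. ip M (\<lambda>x. psum c {..<N} x - g x) (\<lambda>x. psum c {..<N} x - g x)) \<longlonglongrightarrow> 0"
proof -
  have d: "ip M (\<lambda>x. psum c {..<i} x - psum c {..<j} x) (\<lambda>x. psum c {..<i} x - psum c {..<j} x)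
    = (\<Sum>k\<in>{min i j..<max i j}. (c k)\<^sup>2)" for i j
  proof -
    have "ip M (\<lambda>x. psum c {..<i} x - psum c {..<j} x) (\<lambda>x. psum c {..<i} x - psum c {..<j} x)
      = (\<Sum>k\<in>{j..<i}. (c k)\<^sup>2)" if "j <= i" for i j
    proof -
      have "(\<lambda>x. psum c {..<i} x - psum c {..<j} x) = psum c {j..<i}"
        using that psum_diff[of "{..<i}" "{..<j}" c] by (auto simp: lessThan_minus_lessThan fun_eq_iff)
      then show ?thesis by (simp add: ip_psum_psum)
    qed
    moreover have "ip M (\<lambda>x. psum c {..<i} x - psum c {..<j} x) (\<lambda>x. psum c {..<i} x - psum c {..<j} x)
      = ip M (\<lambda>x. psum c {..<j} x - psum c {..<i} x) (\<lambda>x. psum c {..<j} x - psum c {..<i} x)"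
      by (simp add: ip_def power2_eq_square[symmetric] power2_commute)
    ultimately show ?thesis by (cases "j <= i") (auto simp: min_def max_def)
  qed
  have "\<exists>g r. L2 M g \<and> strict_mono r \<and> (AE x in M. (\<lambda>k. psum c {..<r k} x) \<longlonglongrightarrow> g x) \<and>
    (\<lambda>k. ip M (\<lambda>x. psum c {..<k} x - g x) (\<lambda>x. psum c {..<k} x - g x)) \<longlonglongrightarrow> 0"
  proof (rule L2_complete[OF fin psum_L2])
    fix e :: real assume "0 < e"
    then obtain N where N: "\<And>i j. i \<ge> N ==> norm (\<Sum>k\<in>{i..<j}. (c k)\<^sup>2) < e"
      using assms unfolding summable_Cauchy by blast
    show "\<exists>N. \<forall>i\<ge>N. \<forall>j\<ge>N. ip M (\<lambda>x. psum c {..<i} x - psum c {..<j} x) (\<lambda>x. psum c {..<i} x - psum c {..<j} x) <= e"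
    proof (intro exI[of _ N] allI impI)
      fix i j assume "N <= i" "N <= j"
      then have "norm (\<Sum>k\<in>{min i j..<max i j}. (c k)\<^sup>2) < e" by (intro N) auto
      then show "ip M (\<lambda>x. psum c {..<i} x - psum c {..<j} x) (\<lambda>x. psum c {..<i} x - psum c {..<j} x) <= e"
        unfolding d by simp
    qed
  qed
  then obtain g where g: "L2 M g" "(\<lambda>k. ip M (\<lambda>x. psum c {..<k} x - g x) (\<lambda>x. psum c {..<k} x - g x)) \<longlonglongrightarrow> 0" by blast
  have "ip M g (phi j) = c j" for j
  proof -
    let ?e = "\<lambda>N. ip M (\<lambda>x. psum c {..<N} x - g x) (phi j)"
    have "(\<lambda>N. (?e N)\<^sup>2) \<longlonglongrightarrow> 0"
    proof (rule tendsto_sandwich[OF _ _ tendsto_const g(2)])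
      have "(?e N)\<^sup>2 <= ip M (\<lambda>x. psum c {..<N} x - g x) (\<lambda>x. psum c {..<N} x - g x)" for N
        using ip_Cauchy_Schwarz[OF L2_diff[OF psum_L2 g(1)] phi_L2, of c "{..<N}" j] by (simp add: orth)
      then show "\<forall>\<^sub>F N in sequentially. (?e N)\<^sup>2 <= ip M (\<lambda>x. psum c {..<N} x - g x) (\<lambda>x. psum c {..<N} x - g x)" by simp
    qed simp
    moreover have "?e N = c j - ip M g (phi j)" if "j < N" for N
      using that g(1) by (simp add: ip_diff_left psum_L2 phi_L2 ip_psum_phi)
    then have "\<forall>\<^sub>F N in sequentially. (?e N)\<^sup>2 = (c j - ip M g (phi j))\<^sup>2"
      unfolding eventually_sequentially by (intro exI[of _ "Suc j"]) auto
    ultimately have "(\<lambda>N. (c j - ip M g (phi j))\<^sup>2) \<longlonglongrightarrow> 0"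
      by (rule Lim_transform_eventually)
    then have "(c j - ip M g (phi j))\<^sup>2 = 0" by (simp add: LIMSEQ_const_iff)
    then show ?thesis by simp
  qed
  then show ?thesis using g by blast
qed

lemma bessel:
  assumes "L2 M f"
  shows "summable (\<lambda>j. (ip M f (phi j))\<^sup>2)"
proof (rule bounded_imp_summable)
  fix N
  let ?p = "psum (\<lambda>j. ip M f (phi j)) {..N}"
  have "0 <= ip M (\<lambda>x. f x - ?p x) (\<lambda>x. f x - ?p x)" by (rule ip_nonneg)
  also have "... = ip M f (\<lambda>x. f x - ?p x) - ip M ?p (\<lambda>x. f x - ?p x)"
    by (intro ip_diff_left L2_diff assms psum_L2)
  also have "ip M ?p (\<lambda>x. f x - ?p x) = ip M f ?p - ip M ?p ?p"
    unfolding ip_commute[of M ?p "\<lambda>x. f x - ?p x"] by (intro ip_diff_left assms psum_L2)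
  also have "ip M f (\<lambda>x. f x - ?p x) = ip M f f - ip M ?p f"
    unfolding ip_commute[of M f "\<lambda>x. f x - ?p x"] by (intro ip_diff_left assms psum_L2)
  also have "ip M f ?p = ip M ?p f" by (rule ip_commute)
  also have "ip M ?p f = (\<Sum>j\<le>N. (ip M f (phi j))\<^sup>2)" by (simp add: ip_psum[OF assms] power2_eq_square)
  also have "ip M ?p ?p = (\<Sum>j\<le>N. (ip M f (phi j))\<^sup>2)" by (simp add: ip_psum_psum)
  finally show "(\<Sum>j\<le>N. (ip M f (phi j))\<^sup>2) <= ip M f f" by simp
qed simp

lemma expansion:
  assumes f: "L2 M f"
  shows "(\<lambda>N. ip M (\<lambda>x. psum (\<lambda>j. ip M f (phi j)) {..<N} x - f x) (\<lambda>x. psum (\<lambda>j. ip M f (phi j)) {..<N} x - f x)) \<longlonglongrightarrow> 0"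
proof -
  let ?c = "\<lambda>j. ip M f (phi j)"
  from riesz_fischer[OF bessel[OF f]] obtain g where g: "L2 M g" "\<And>j. ip M g (phi j) = ?c j"
    "(\<lambda>N. ip M (\<lambda>x. psum ?c {..<N} x - g x) (\<lambda>x. psum ?c {..<N} x - g x)) \<longlonglongrightarrow> 0" by blast
  have "AE x in M. f x - g x = 0"
    by (rule complete) (auto intro: L2_diff f g(1) simp: ip_diff_left f g phi_L2)
  then have "ip M (\<lambda>x. psum ?c {..<N} x - g x) (\<lambda>x. psum ?c {..<N} x - g x) = ip M (\<lambda>x. psum ?c {..<N} x - f x) (\<lambda>x. psum ?c {..<N} x - f x)" for N
    unfolding ip_def using L2D(1)[OF f] L2D(1)[OF g(1)] L2D(1)[OF psum_L2]
    by (intro integral_cong_AE) auto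
  then show ?thesis using g(3) by simp
qed

lemma parseval:
  assumes f: "L2 M f" and g: "L2 M g"
  shows "(\<lambda>j. ip M f (phi j) * ip M g (phi j)) sums ip M f g"
proof -
  let ?c = "\<lambda>j. ip M f (phi j)"
  let ?e = "\<lambda>N. ip M (\<lambda>x. psum ?c {..<N} x - f x) g"
  have "(\<lambda>N. (?e N)\<^sup>2) \<longlonglongrightarrow> 0"
  proof (rule tendsto_sandwich[OF _ _ tendsto_const])
    show "(\<lambda>N. ip M (\<lambda>x. psum ?c {..<N} x - f x) (\<lambda>x. psum ?c {..<N} x - f x) * ip M g g) \<longlonglongrightarrow> 0"
      using tendsto_mult_right[OF expansion[OF f], of "ip M g g"] by simp
    show "\<forall>\<^sub>F N in sequentially. (?e N)\<^sup>2 <= ip M (\<lambda>x. psum ?c {..<N} x - f x) (\<lambda>x. psum ?c {..<N} x - f x) * ip M g g"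
      by (intro always_eventually allI ip_Cauchy_Schwarz L2_diff psum_L2 f g)
  qed simp
  from tendsto_real_sqrt[OF this] have "?e \<longlonglongrightarrow> 0"
    by (simp add: tendsto_rabs_zero_iff)
  moreover have "?e N = (\<Sum>j<N. ?c j * ip M g (phi j)) - ip M f g" for N
    by (simp add: ip_diff_left psum_L2 f g ip_psum[OF g])
  ultimately have "(\<lambda>N. (\<Sum>j<N. ?c j * ip M g (phi j)) - ip M f g) \<longlonglongrightarrow> 0" by simp
  then show ?thesis unfolding sums_def by (simp add: LIM_zero_iff)
qed

end

section \<open>The Dirichlet heat semigroup and its spectrum\<close>

context dirichlet_system
begin

abbreviation M where "M \<equiv> lebesgue_on \<Omega>"

lemma dom_sets [measurable]: "\<Omega> \<in> sets borel" "\<Omega> \<in> sets lebesgue"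
  using open_dom by auto

lemma finite_M: "finite_measure M"
proof
  have "emeasure lborel \<Omega> < \<infinity>" using bounded_dom by (rule emeasure_bounded_finite)
  then show "emeasure M (space M) \<noteq> \<infinity>"
    by (simp add: emeasure_restrict_space space_restrict_space)
qed

lemma sigma_finite_M: "sigma_finite_measure M"
  using finite_M by (simp add: finite_measure_def)

lemma id_measurable_M: "(\<lambda>x. x) \<in> measurable M borel"
proof -
  have "(\<lambda>x. x) \<in> measurable lebesgue borel" by (rule measurable_completion) simp
  then show ?thesis by (rule measurable_restrict_space1)
qed

lemma borel_measurable_M: "f \<in> borel_measurable borel ==> f \<in> borel_measurable M"
  using measurable_compose[OF id_measurable_M] by auto

lemma measurable_M_set: "f \<in> borel_measurable M \<longleftrightarrow> set_borel_measurable lebesgue \<Omega> f" for f :: "'a => real"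
  unfolding set_borel_measurable_def by (rule borel_measurable_restrict_space_iff) simp

lemma integrable_M_set: "integrable M f \<longleftrightarrow> set_integrable lebesgue \<Omega> f" for f :: "'a => real"
  unfolding set_integrable_def by (rule integrable_restrict_space) simp

lemma integral_M_set: "integral\<^sup>L M f = (LINT x:\<Omega>|lebesgue. f x)" for f :: "'a => real"
  unfolding set_lebesgue_integral_def by (rule integral_restrict_space) simp

lemma AE_M_iff: "(AE x in M. P x) \<longleftrightarrow> (AE x in lebesgue. x \<in> \<Omega> --> P x)"
  by (rule AE_restrict_space_iff) simp

lemma L2_on_eq: "L2_on \<Omega> u \<longleftrightarrow> L2 M u"
  unfolding L2_on_def L2_def measurable_M_set integrable_M_set ..

lemma l2_inner_eq: "l2_inner \<Omega> u v = ip M u v"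
  unfolding l2_inner_def ip_def integral_M_set ..

lemma nonzero_L2_eq: "nonzero_L2 \<Omega> u \<longleftrightarrow> \<not> (AE x in M. u x = 0)"
  unfolding nonzero_L2_def AE_M_iff ..

lemma fcoeff_eq: "fcoeff \<Omega> phi u j = ip M u (phi j)"
  unfolding fcoeff_def l2_inner_eq ..

lemma phi_ext_borel: "(\<lambda>x. indicator \<Omega> x * phi j x) \<in> borel_measurable borel"
  using phi_facts(2,3) open_dom by (intro borel_measurable_continuous_onI continuous_on_zero_extension) auto

lemma phi_measurable [measurable]: "phi j \<in> borel_measurable M"
proof -
  have "(\<lambda>x. indicator \<Omega> x * phi j x) \<in> borel_measurable M" using phi_ext_borel by (rule borel_measurable_M)
  then show ?thesis by (subst measurable_cong[where g = "\<lambda>x. indicator \<Omega> x * phi j x"]) (auto simp: space_restrict_space)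
qed

lemma bounded_L2: "f \<in> borel_measurable M ==> (\<And>x. \<bar>f x\<bar> <= B) ==> L2 M f"
proof -
  assume f [measurable]: "f \<in> borel_measurable M" and b: "\<And>x. \<bar>f x\<bar> <= B"
  interpret finite_measure M by (rule finite_M)
  have "AE x in M. norm ((f x)\<^sup>2) <= B\<^sup>2"
  proof (rule AE_I2)
    fix x
    have "\<bar>f x\<bar>\<^sup>2 <= B\<^sup>2" using b[of x] by (intro power_mono) auto
    then show "norm ((f x)\<^sup>2) <= B\<^sup>2" by simp
  qed
  then show "L2 M f" unfolding L2_def using integrable_const_bound[of "\<lambda>x. (f x)\<^sup>2" "B\<^sup>2"] by simp
qed

sublocale onb M phi
proof (rule onb.intro)
  have o: "set_integrable lebesgue \<Omega> (\<lambda>x. phi i x * phi j x)" "l2_inner \<Omega> (phi i) (phi j) = (if i = j then 1 else 0)" for i j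
    using eigensystem unfolding dirichlet_eigensystem_def by auto
  show "finite_measure M" by (rule finite_M)
  show "L2 M (phi j)" for j
    using o(1)[of j j] by (simp add: L2_def integrable_M_set power2_eq_square)
  show "ip M (phi i) (phi j) = (if i = j then 1 else 0)" for i j
    using o(2) by (simp add: l2_inner_eq)
  show "AE x in M. f x = 0" if "L2 M f" "\<And>j. ip M f (phi j) = 0" for f
    using that eigensystem unfolding dirichlet_eigensystem_def L2_on_eq l2_inner_eq nonzero_L2_eq by auto
qed

lemma heat_sum_psum: "heat_sum J c t = psum (\<lambda>j. c j * exp (- (lam j * t))) J"
  by (auto simp: heat_sum_def psum_def fun_eq_iff mult.assoc)

lemma heat_sum_0: "heat_sum J c 0 = psum c J"
  by (simp add: heat_sum_psum)

lemma integral_M_lborel: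
  fixes f :: "'a => real"
  assumes "(\<lambda>y. indicator \<Omega> y * f y) \<in> borel_measurable borel"
  shows "(\<integral>y. f y \<partial>M) = (\<integral>y. indicator \<Omega> y * f y \<partial>lborel)"
proof -
  have "(\<integral>y. f y \<partial>M) = (\<integral>y. indicator \<Omega> y * f y \<partial>lebesgue)"
    by (subst integral_restrict_space) auto
  also have "... = (\<integral>y. indicator \<Omega> y * f y \<partial>lborel)"
    using assms by (intro integral_completion) simp
  finally show ?thesis .
qed

definition hk_sup :: "real => real" where
  "hk_sup t = (4 * t) powr (- (real DIM('a) / 2)) / gauss_Z TYPE('a)"

lemma hk_sup_pos: "0 < t ==> 0 < hk_sup t"
  by (simp add: hk_sup_def gauss_Z_pos)

lemma hk_le: "0 < t ==> heat_kernel t (z::'a) <= hk_sup t"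
  unfolding hk_sup_def by (rule heat_kernel_le)

lemma heat_kernel_mult_integrable:
  assumes t: "0 < t" and f: "integrable M f"
  shows "integrable M (\<lambda>y. heat_kernel t (x - y) * f y)"
proof (rule Bochner_Integration.integrable_bound)
  show "integrable M (\<lambda>y. hk_sup t * f y)" using f by simp
  show "(\<lambda>y. heat_kernel t (x - y) * f y) \<in> borel_measurable M"
  proof -
    note [measurable] = id_measurable_M borel_measurable_integrable[OF f]
    show ?thesis by measurable
  qed
  show "AE y in M. norm (heat_kernel t (x - y) * f y) <= norm (hk_sup t * f y)"
    using hk_le[OF t] hk_sup_pos[OF t] by (intro AE_I2) (auto simp: abs_mult intro: mult_right_mono)
qed

lemma L2_int: "L2 M f ==> integrable M f"
  using L2_integrable[OF finite_M] .

lemma abs_heat_sum_le_M: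
  assumes J: "finite J" and t: "0 < t" and x: "x \<in> \<Omega>"
  shows "\<bar>heat_sum J c t x\<bar> <= (\<integral>y. heat_kernel t (x - y) * \<bar>psum c J y\<bar> \<partial>M)"
proof -
  have m: "(\<lambda>y. indicator \<Omega> y * psum c J y) \<in> borel_measurable borel"
    using heat_sum_0_ext(1)[of J c] unfolding heat_sum_0 by (rule borel_measurable_continuous_onI)
  have m2: "(\<lambda>y. \<bar>indicator \<Omega> y * psum c J y\<bar>) \<in> borel_measurable borel" using m by measurable
  have eq: "indicator \<Omega> y * (heat_kernel t (x - y) * \<bar>psum c J y\<bar>) = heat_kernel t (x - y) * \<bar>indicator \<Omega> y * psum c J y\<bar>" for y
    by (simp add: indicator_def)
  have "(\<lambda>y. indicator \<Omega> y * (heat_kernel t (x - y) * \<bar>psum c J y\<bar>)) \<in> borel_measurable borel"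
    unfolding eq using m2 by measurable
  from integral_M_lborel[OF this]
  have "(\<integral>y. heat_kernel t (x - y) * \<bar>psum c J y\<bar> \<partial>M) = (\<integral>y. heat_kernel t (x - y) * (indicator \<Omega> y * \<bar>psum c J y\<bar>) \<partial>lborel)"
    by (simp add: mult_ac)
  then show ?thesis using abs_heat_sum_le[OF J t, of x c] x closure_subset[of \<Omega>] unfolding heat_sum_0 by auto
qed

lemma integral_hk_le:
  assumes t: "0 < t" and f: "integrable M f" and nn: "\<And>y. 0 <= f y"
  shows "(\<integral>y. heat_kernel t (x - y) * f y \<partial>M) <= hk_sup t * (\<integral>y. f y \<partial>M)"
proof -
  have "(\<integral>y. heat_kernel t (x - y) * f y \<partial>M) <= (\<integral>y. hk_sup t * f y \<partial>M)"
    using f nn hk_le[OF t] by (intro integral_mono heat_kernel_mult_integrable t) (auto intro: mult_right_mono)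
  then show ?thesis by simp
qed

lemma abs_heat_sum_sup:
  assumes J: "finite J" and t: "0 < t" and x: "x \<in> \<Omega>"
  shows "\<bar>heat_sum J c t x\<bar> <= hk_sup t * (\<integral>y. \<bar>psum c J y\<bar> \<partial>M)"
proof (rule order_trans[OF abs_heat_sum_le_M[OF assms]])
  have "integrable M (\<lambda>y. \<bar>psum c J y\<bar>)" using L2_int[OF psum_L2] by (rule integrable_abs)
  then show "(\<integral>y. heat_kernel t (x - y) * \<bar>psum c J y\<bar> \<partial>M) <= hk_sup t * (\<integral>y. \<bar>psum c J y\<bar> \<partial>M)"
    by (rule integral_hk_le[OF t]) simp
qed

text \<open>Domination by the free flow forces every eigenmode to decay: a mode with
  \<open>lam j\<close> <= 0 does not shrink in time, while \<open>hk_sup\<close> t tends to 0, so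
  its eigenfunction would vanish on the domain, against normalisation.\<close>

lemma lam_pos: "0 < lam j"
proof (rule ccontr)
  assume "\<not> 0 < lam j"
  then have le: "lam j <= 0" by simp
  define A where "A = (\<integral>y. \<bar>phi j y\<bar> \<partial>M)"
  have A: "0 <= A" by (simp add: A_def)
  have "phi j x = 0" if x: "x \<in> \<Omega>" for x
  proof -
    have b: "\<bar>phi j x\<bar> <= hk_sup t * A" if t: "0 < t" for t
    proof -
      have "\<bar>heat_sum {j} (\<lambda>_. 1) t x\<bar> <= hk_sup t * (\<integral>y. \<bar>psum (\<lambda>_. 1) {j} y\<bar> \<partial>M)"
        by (rule abs_heat_sum_sup) (use t x in auto)
      then have "exp (- (lam j * t)) * \<bar>phi j x\<bar> <= hk_sup t * A"
        by (simp add: heat_sum_def psum_def A_def abs_mult)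
      moreover have "0 <= - (lam j * t)" using le t by (simp add: mult_nonpos_nonneg)
      then have "1 <= exp (- (lam j * t))" by simp
      then have "1 * \<bar>phi j x\<bar> <= exp (- (lam j * t)) * \<bar>phi j x\<bar>" by (intro mult_right_mono) auto
      ultimately show ?thesis by simp
    qed
    have "((\<lambda>t. hk_sup t * A) \<longlongrightarrow> 0 * A) at_top"
    proof (intro tendsto_mult tendsto_const)
      have "filterlim (\<lambda>t::real. 4 * t) at_top at_top"
        by (rule filterlim_tendsto_pos_mult_at_top[OF tendsto_const _ filterlim_ident]) simp
      then have "((\<lambda>t. (4 * t) powr (- (real DIM('a) / 2))) \<longlongrightarrow> 0) at_top"
        by (intro tendsto_neg_powr) auto
      then show "(hk_sup \<longlongrightarrow> 0) at_top" unfolding hk_sup_def by (rule tendsto_divide_zero)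
    qed
    moreover have "eventually (\<lambda>t. \<bar>phi j x\<bar> <= hk_sup t * A) at_top"
      using eventually_gt_at_top[of 0] by eventually_elim (rule b)
    ultimately have "\<bar>phi j x\<bar> <= 0 * A"
      by (intro tendsto_lowerbound) auto
    then show ?thesis by simp
  qed
  then have "ip M (phi j) (phi j) = 0" unfolding ip_def
    by (intro integral_eq_zero_AE AE_I2) (simp add: space_restrict_space)
  then show False using orth[of j j] by simp
qed

text \<open>A trace bound: the sup estimate at time 1 controls the sum over J of exp(-2 lam j) times
  the square of phi j x, uniformly in x and in the finite set J. Integration over the domain bounds
  the sum of exp(-2 lam j), which infinitely many eigenvalues below L would make infinite.\<close>

lemma finite_lam_le: "finite {j. lam j <= L}"
proof (rule ccontr)
  assume inf: "infinite {j. lam j <= L}"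
  define m where "m = sqrt (measure M (space M))"
  define B where "B = (hk_sup 1 * m)\<^sup>2 * measure M (space M)"
  have card: "real (card J) * exp (- (2 * L)) <= B" if J: "finite J" "J \<subseteq> {j. lam j <= L}" for J
  proof -
    have pw: "(\<Sum>j\<in>J. exp (- (2 * lam j)) * (phi j x)\<^sup>2) <= (hk_sup 1 * m)\<^sup>2" if x: "x \<in> \<Omega>" for x
    proof -
      \<comment> \<open>Coefficients adapted to the point x: the value of the flow at time 1 and the
        squared norm of the initial data are then both equal to s, which turns the sup estimate into
        a bound on s.\<close>
      define c where "c j = exp (- lam j) * phi j x" for j
      define s where "s = (\<Sum>j\<in>J. (c j)\<^sup>2)"
      have s0: "0 <= s" by (simp add: s_def sum_nonneg)
      have s_eq: "heat_sum J c 1 x = s"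
        unfolding heat_sum_def s_def c_def by (intro sum.cong) (auto simp: power2_eq_square)
      have "\<bar>heat_sum J c 1 x\<bar> <= hk_sup 1 * (\<integral>y. \<bar>psum c J y\<bar> \<partial>M)"
        using J x by (intro abs_heat_sum_sup) auto
      also have "(\<integral>y. \<bar>psum c J y\<bar> \<partial>M) <= m * sqrt (ip M (psum c J) (psum c J))"
        unfolding m_def by (rule L1_le_L2[OF finite_M psum_L2])
      also have "ip M (psum c J) (psum c J) = s" using J by (simp add: ip_psum_psum s_def)
      finally have "s <= hk_sup 1 * (m * sqrt s)" using s0 hk_sup_pos[of 1] by (simp add: s_eq mult_left_mono)
      then have 1: "sqrt s * sqrt s <= hk_sup 1 * m * sqrt s" using s0 by (simp add: mult.assoc)
      have "sqrt s <= hk_sup 1 * m"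
      proof (cases "s = 0")
        case True
        then show ?thesis using hk_sup_pos[of 1] by (simp add: m_def)
      next
        case False
        then have "0 < sqrt s" using s0 by simp
        then show ?thesis using 1 by (rule mult_right_le_imp_le[rotated])
      qed
      then have "(sqrt s)\<^sup>2 <= (hk_sup 1 * m)\<^sup>2" using s0 by (intro power_mono) auto
      moreover have "s = (\<Sum>j\<in>J. exp (- (2 * lam j)) * (phi j x)\<^sup>2)"
        unfolding s_def c_def by (intro sum.cong) (auto simp: power2_eq_square mult_exp_exp mult_ac)
      ultimately show ?thesis using s0 by simp
    qed
    have ph: "integrable M (\<lambda>x. (phi j x)\<^sup>2)" for j using L2D(2)[OF phi_L2] .
    have "(\<Sum>j\<in>J. exp (- (2 * lam j))) = (\<Sum>j\<in>J. exp (- (2 * lam j)) * (\<integral>x. (phi j x)\<^sup>2 \<partial>M))"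
      using orth by (simp add: ip_def power2_eq_square)
    also have "... = (\<integral>x. (\<Sum>j\<in>J. exp (- (2 * lam j)) * (phi j x)\<^sup>2) \<partial>M)"
      using ph by (subst Bochner_Integration.integral_sum) auto
    also have "... <= (\<integral>x. (hk_sup 1 * m)\<^sup>2 \<partial>M)"
    proof (rule integral_mono)
      interpret finite_measure M by (rule finite_M)
      show "integrable M (\<lambda>x. (hk_sup 1 * m)\<^sup>2)" by simp
    qed (use ph pw in \<open>auto simp: space_restrict_space\<close>)
    also have "... = B" by (simp add: B_def)
    finally have 1: "(\<Sum>j\<in>J. exp (- (2 * lam j))) <= B" .
    have "(\<Sum>j\<in>J. exp (- (2 * L))) <= (\<Sum>j\<in>J. exp (- (2 * lam j)))"
      using J by (intro sum_mono) auto
    then show ?thesis using 1 by simp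
  qed
  obtain N :: nat where N: "B < real N * exp (- (2 * L))"
    using reals_Archimedean3[of "exp (- (2 * L))"] by auto
  obtain J where "finite J" "card J = N" "J \<subseteq> {j. lam j <= L}"
    using infinite_arbitrarily_large[OF inf] by blast
  then show False using card[of J] N by auto
qed

definition heat_form :: "real => ('a => real) => ('a => real) => real" where
  "heat_form t f g = (\<Sum>j. exp (- (lam j * t)) * (ip M f (phi j) * ip M g (phi j)))"

lemma abs_coeff_summable:
  assumes "L2 M f" "L2 M g"
  shows "summable (\<lambda>j. \<bar>ip M f (phi j) * ip M g (phi j)\<bar>)"
proof (rule summable_comparison_test)
  show "summable (\<lambda>j. (ip M f (phi j))\<^sup>2 + (ip M g (phi j))\<^sup>2)"
    by (intro summable_add bessel assms)
  have "\<bar>a * b\<bar> <= a\<^sup>2 + b\<^sup>2" for a b :: real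
  proof -
    have "0 <= (\<bar>a\<bar> - \<bar>b\<bar>)\<^sup>2" by simp
    then have "2 * (\<bar>a\<bar> * \<bar>b\<bar>) <= a\<^sup>2 + b\<^sup>2" by (simp add: power2_diff)
    moreover have "0 <= \<bar>a\<bar> * \<bar>b\<bar>" by simp
    ultimately show ?thesis unfolding abs_mult by linarith
  qed
  then show "\<exists>N. \<forall>n\<ge>N. norm \<bar>ip M f (phi n) * ip M g (phi n)\<bar> <= (ip M f (phi n))\<^sup>2 + (ip M g (phi n))\<^sup>2" by simp
qed

lemma heat_form_sums:
  assumes t: "0 <= t" and f: "L2 M f" and g: "L2 M g"
  shows "(\<lambda>j. exp (- (lam j * t)) * (ip M f (phi j) * ip M g (phi j))) sums heat_form t f g"
  unfolding heat_form_def
proof (rule summable_sums, rule summable_comparison_test)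
  show "summable (\<lambda>j. \<bar>ip M f (phi j) * ip M g (phi j)\<bar>)" by (rule abs_coeff_summable[OF f g])
  have "exp (- (lam j * t)) <= 1" for j using lam_pos[of j] t by simp
  then show "\<exists>N. \<forall>n\<ge>N. norm (exp (- (lam n * t)) * (ip M f (phi n) * ip M g (phi n))) <= \<bar>ip M f (phi n) * ip M g (phi n)\<bar>"
    by (auto simp: abs_mult intro!: mult_left_le_one_le)
qed

lemma heat_form_partial:
  assumes g: "L2 M g"
  shows "(\<Sum>j<N. exp (- (lam j * t)) * (ip M f (phi j) * ip M g (phi j))) = ip M (heat_sum {..<N} (\<lambda>j. ip M f (phi j)) t) g"
  unfolding heat_sum_psum ip_psum[OF g] by (intro sum.cong) auto

lemma psum_L1_tendsto:
  assumes f: "L2 M f"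
  shows "(\<lambda>N. \<integral>y. \<bar>psum (\<lambda>j. ip M f (phi j)) {..<N} y - f y\<bar> \<partial>M) \<longlonglongrightarrow> 0"
proof (rule tendsto_sandwich[OF _ _ tendsto_const])
  let ?p = "\<lambda>N. psum (\<lambda>j. ip M f (phi j)) {..<N}"
  let ?m = "sqrt (measure M (space M))"
  show "(\<lambda>N. ?m * sqrt (ip M (\<lambda>x. ?p N x - f x) (\<lambda>x. ?p N x - f x))) \<longlonglongrightarrow> 0"
    using tendsto_mult[OF tendsto_const tendsto_real_sqrt[OF expansion[OF f]], of ?m] by simp
  show "\<forall>\<^sub>F N in sequentially. (\<integral>y. \<bar>?p N y - f y\<bar> \<partial>M) <= ?m * sqrt (ip M (\<lambda>x. ?p N x - f x) (\<lambda>x. ?p N x - f x))"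
    by (intro always_eventually allI L1_le_L2 finite_M L2_diff psum_L2 f)
qed (auto intro!: always_eventually)

lemma hk_potential_measurable [measurable (raw)]:
  assumes [measurable]: "f \<in> borel_measurable M"
  shows "(\<lambda>x. \<integral>y. heat_kernel t (x - y) * f y \<partial>M) \<in> borel_measurable borel"
proof -
  interpret sigma_finite_measure M by (rule sigma_finite_M)
  note [measurable] = id_measurable_M
  show ?thesis by measurable
qed

lemma hk_potential_integrable:
  assumes t: "0 < t" and f: "L2 M f" and g: "L2 M g" and nn: "\<And>x. 0 <= f x"
  shows "integrable M (\<lambda>x. g x * (\<integral>y. heat_kernel t (x - y) * f y \<partial>M))"
proof (rule Bochner_Integration.integrable_bound)
  note [measurable] = L2D(1)[OF f] L2D(1)[OF g]
  define K where "K = hk_sup t * (\<integral>y. f y \<partial>M)"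
  show "integrable M (\<lambda>x. K * g x)" using L2_int[OF g] by simp
  have "(\<lambda>x. \<integral>y. heat_kernel t (x - y) * f y \<partial>M) \<in> borel_measurable M" by (intro borel_measurable_M) measurable
  then show "(\<lambda>x. g x * (\<integral>y. heat_kernel t (x - y) * f y \<partial>M)) \<in> borel_measurable M" by measurable
  have K: "\<bar>\<integral>y. heat_kernel t (x - y) * f y \<partial>M\<bar> <= K" for x
    unfolding K_def using integral_hk_le[OF t L2_int[OF f] nn, of x] nn by (subst abs_of_nonneg) (auto intro!: integral_nonneg_AE)
  have "0 <= K" unfolding K_def
    using hk_sup_pos[OF t] nn by (intro mult_nonneg_nonneg integral_nonneg_AE) auto
  then have "norm (g x * (\<integral>y. heat_kernel t (x - y) * f y \<partial>M)) <= norm (K * g x)" for x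
    using mult_left_mono[OF K[of x], of "\<bar>g x\<bar>"] by (simp add: abs_mult mult.commute)
  then show "AE x in M. norm (g x * (\<integral>y. heat_kernel t (x - y) * f y \<partial>M)) <= norm (K * g x)" by simp
qed

text \<open>The finite comparison passes to the limit because, at fixed t, the free kernel is
  bounded by \<open>hk_sup\<close> t and the partial sums converge in L1.\<close>

lemma heat_form_le:
  assumes t: "0 < t" and f: "L2 M f"
  shows "heat_form t f f <= (\<integral>x. \<bar>f x\<bar> * (\<integral>y. heat_kernel t (x - y) * \<bar>f y\<bar> \<partial>M) \<partial>M)"
proof -
  note [measurable] = L2D(1)[OF f]
  let ?c = "\<lambda>j. ip M f (phi j)"
  let ?p = "\<lambda>N. psum ?c {..<N}"
  let ?S = "\<lambda>N. \<Sum>j<N. exp (- (lam j * t)) * (?c j * ?c j)"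
  define D where "D N = (\<integral>y. \<bar>?p N y - f y\<bar> \<partial>M)" for N
  define R where "R = (\<integral>x. \<bar>f x\<bar> * (\<integral>y. heat_kernel t (x - y) * \<bar>f y\<bar> \<partial>M) \<partial>M)"
  define A where "A = (\<integral>x. \<bar>f x\<bar> \<partial>M)"
  have Dl: "D \<longlonglongrightarrow> 0" unfolding D_def by (rule psum_L1_tendsto[OF f])
  have le: "?S N <= R + A * (hk_sup t * D N)" for N
  proof -
    have h2: "L2 M (heat_sum {..<N} ?c t)" unfolding heat_sum_psum by (rule psum_L2)
    have "?S N = (\<integral>x. heat_sum {..<N} ?c t x * f x \<partial>M)"
      unfolding heat_form_partial[OF f] by (rule ip_def)
    also have "... <= (\<integral>x. \<bar>f x\<bar> * (\<integral>y. heat_kernel t (x - y) * \<bar>f y\<bar> \<partial>M) + (hk_sup t * D N) * \<bar>f x\<bar> \<partial>M)"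
    proof (rule integral_mono)
      show "integrable M (\<lambda>x. heat_sum {..<N} ?c t x * f x)" by (rule L2_mult_integrable[OF h2 f])
      show "integrable M (\<lambda>x. \<bar>f x\<bar> * (\<integral>y. heat_kernel t (x - y) * \<bar>f y\<bar> \<partial>M) + (hk_sup t * D N) * \<bar>f x\<bar>)"
        using hk_potential_integrable[OF t L2_abs[OF f] L2_abs[OF f]] L2_int[OF f]
        by (intro Bochner_Integration.integrable_add) auto
      fix x assume "x \<in> space M"
      then have x: "x \<in> \<Omega>" by (simp add: space_restrict_space)
      have "\<bar>heat_sum {..<N} ?c t x\<bar> <= (\<integral>y. heat_kernel t (x - y) * \<bar>?p N y\<bar> \<partial>M)"
        using abs_heat_sum_le_M[OF _ t x] by simp
      also have "... <= (\<integral>y. heat_kernel t (x - y) * \<bar>f y\<bar> + heat_kernel t (x - y) * \<bar>?p N y - f y\<bar> \<partial>M)"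
      proof (rule integral_mono)
        show "integrable M (\<lambda>y. heat_kernel t (x - y) * \<bar>?p N y\<bar>)"
          using L2_int[OF psum_L2] by (intro heat_kernel_mult_integrable t) auto
        show "integrable M (\<lambda>y. heat_kernel t (x - y) * \<bar>f y\<bar> + heat_kernel t (x - y) * \<bar>?p N y - f y\<bar>)"
          using L2_int[OF f] L2_int[OF L2_diff[OF psum_L2 f]]
          by (intro Bochner_Integration.integrable_add heat_kernel_mult_integrable t) auto
        fix y
        have "\<bar>?p N y\<bar> <= \<bar>f y\<bar> + \<bar>?p N y - f y\<bar>" by linarith
        from mult_left_mono[OF this, of "heat_kernel t (x - y)"]
        show "heat_kernel t (x - y) * \<bar>?p N y\<bar> <= heat_kernel t (x - y) * \<bar>f y\<bar> + heat_kernel t (x - y) * \<bar>?p N y - f y\<bar>"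
          by (simp add: distrib_left)
      qed
      also have "... = (\<integral>y. heat_kernel t (x - y) * \<bar>f y\<bar> \<partial>M) + (\<integral>y. heat_kernel t (x - y) * \<bar>?p N y - f y\<bar> \<partial>M)"
        using L2_int[OF f] L2_int[OF L2_diff[OF psum_L2 f]]
        by (intro Bochner_Integration.integral_add heat_kernel_mult_integrable t) auto
      also have "(\<integral>y. heat_kernel t (x - y) * \<bar>?p N y - f y\<bar> \<partial>M) <= hk_sup t * D N"
        unfolding D_def using L2_int[OF L2_diff[OF psum_L2 f]] by (intro integral_hk_le t) auto
      finally have b: "\<bar>heat_sum {..<N} ?c t x\<bar> <= (\<integral>y. heat_kernel t (x - y) * \<bar>f y\<bar> \<partial>M) + hk_sup t * D N" by simp
      have "heat_sum {..<N} ?c t x * f x <= \<bar>heat_sum {..<N} ?c t x\<bar> * \<bar>f x\<bar>"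
        by (metis abs_ge_self abs_mult)
      also have "... <= ((\<integral>y. heat_kernel t (x - y) * \<bar>f y\<bar> \<partial>M) + hk_sup t * D N) * \<bar>f x\<bar>"
        by (intro mult_right_mono b) auto
      finally show "heat_sum {..<N} ?c t x * f x <= \<bar>f x\<bar> * (\<integral>y. heat_kernel t (x - y) * \<bar>f y\<bar> \<partial>M) + (hk_sup t * D N) * \<bar>f x\<bar>"
        by (simp add: algebra_simps)
    qed
    also have "... = R + A * (hk_sup t * D N)"
      unfolding R_def A_def using hk_potential_integrable[OF t L2_abs[OF f] L2_abs[OF f]] L2_int[OF f]
      by (subst Bochner_Integration.integral_add) auto
    finally show ?thesis .
  qed
  have "?S \<longlonglongrightarrow> heat_form t f f" using heat_form_sums[OF _ f f, of t] t by (simp add: sums_def)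
  moreover have "(\<lambda>N. R + A * (hk_sup t * D N)) \<longlonglongrightarrow> R + A * (hk_sup t * 0)"
    by (intro tendsto_intros Dl)
  ultimately have "heat_form t f f <= R + A * (hk_sup t * 0)"
    by (rule LIMSEQ_le) (use le in auto)
  then show ?thesis by (simp add: R_def)
qed

text \<open>The lower comparison integrated against the nonnegative g; the discrepancies D N vanish
  in the limit. The two claims divide the time axis later: the second, with its boundary loss,
  serves for t <= 1 and plain positivity for t > 1.\<close>

lemma heat_form_ge:
  assumes t: "0 < t" and h: "continuous_on UNIV h" and h0: "\<And>y. 0 <= h y" and d: "0 < d"
    and supp: "\<And>y z. h y \<noteq> 0 ==> z \<in> frontier \<Omega> ==> d <= norm (z - y)" and sO: "\<And>y. y \<notin> \<Omega> ==> h y = 0"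
    and hL: "L2 M h" and g: "L2 M g" and g0: "\<And>x. 0 <= g x"
  shows "0 <= heat_form t h g"
    "(\<integral>x. g x * (\<integral>y. heat_kernel t (x - y) * h y \<partial>M) \<partial>M)
       - heat_sup TYPE('a) * d powr (- real DIM('a)) * (\<integral>y. h y \<partial>M) * (\<integral>x. g x \<partial>M) <= heat_form t h g"
proof -
  note [measurable] = L2D(1)[OF hL] L2D(1)[OF g]
  let ?c = "\<lambda>j. ip M h (phi j)"
  let ?p = "\<lambda>N. psum ?c {..<N}"
  let ?S = "\<lambda>N. \<Sum>j<N. exp (- (lam j * t)) * (?c j * ip M g (phi j))"
  define D where "D N = (\<integral>y. \<bar>?p N y - h y\<bar> \<partial>M)" for N
  define A where "A = (\<integral>x. g x \<partial>M)"
  define C where "C = heat_sup TYPE('a) * d powr (- real DIM('a)) * (\<integral>y. h y \<partial>M)"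
  define R where "R = (\<integral>x. g x * (\<integral>y. heat_kernel t (x - y) * h y \<partial>M) \<partial>M)"
  have Dl: "D \<longlonglongrightarrow> 0" unfolding D_def by (rule psum_L1_tendsto[OF hL])
  have hb: "h \<in> borel_measurable borel" using h by (rule borel_measurable_continuous_onI)
  have indh: "indicator \<Omega> y * h y = h y" for y by (cases "y \<in> \<Omega>") (auto simp: sO)
  have hM: "(\<integral>y. h y \<partial>lborel) = (\<integral>y. h y \<partial>M)"
    using integral_M_lborel[of h] hb by (simp add: indh)
  have GhM: "(\<integral>y. heat_kernel t (x - y) * h y \<partial>lborel) = (\<integral>y. heat_kernel t (x - y) * h y \<partial>M)" for x
  proof -
    have eq: "indicator \<Omega> y * (heat_kernel t (x - y) * h y) = heat_kernel t (x - y) * h y" for y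
      by (cases "y \<in> \<Omega>") (auto simp: sO)
    show ?thesis using integral_M_lborel[of "\<lambda>y. heat_kernel t (x - y) * h y"] hb by (simp add: eq)
  qed
  have GD: "(\<integral>y. heat_kernel t (x - y) * (indicator \<Omega> y * \<bar>h y - heat_sum {..<N} ?c 0 y\<bar>) \<partial>lborel) <= hk_sup t * D N" for x N
  proof -
    have m: "(\<lambda>y. indicator \<Omega> y * ?p N y) \<in> borel_measurable borel"
      using heat_sum_0_ext(1)[of "{..<N}" ?c] unfolding heat_sum_0 by (rule borel_measurable_continuous_onI)
    have eq: "indicator \<Omega> y * (heat_kernel t (x - y) * \<bar>?p N y - h y\<bar>) = heat_kernel t (x - y) * \<bar>indicator \<Omega> y * ?p N y - h y\<bar>" for y
      by (cases "y \<in> \<Omega>") (auto simp: sO)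
    have "(\<lambda>y. indicator \<Omega> y * (heat_kernel t (x - y) * \<bar>?p N y - h y\<bar>)) \<in> borel_measurable borel"
      unfolding eq using m hb by measurable
    from integral_M_lborel[OF this]
    have "(\<integral>y. heat_kernel t (x - y) * (indicator \<Omega> y * \<bar>h y - heat_sum {..<N} ?c 0 y\<bar>) \<partial>lborel) = (\<integral>y. heat_kernel t (x - y) * \<bar>?p N y - h y\<bar> \<partial>M)"
      by (simp add: heat_sum_0 abs_minus_commute mult_ac)
    also have "... <= hk_sup t * D N"
      unfolding D_def using L2_int[OF L2_diff[OF psum_L2 hL]] by (intro integral_hk_le t) auto
    finally show ?thesis .
  qed
  have Sip: "?S N = (\<integral>x. g x * heat_sum {..<N} ?c t x \<partial>M)" for N
    unfolding heat_form_partial[OF g] ip_def[of M "heat_sum {..<N} ?c t" g] by (simp add: mult.commute)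
  have intS: "integrable M (\<lambda>x. g x * heat_sum {..<N} ?c t x)" for N
    unfolding heat_sum_psum by (rule L2_mult_integrable[OF g psum_L2])
  have lim: "?S \<longlonglongrightarrow> heat_form t h g" using heat_form_sums[OF _ hL g, of t] t by (simp add: sums_def)
  have cl: "x \<in> closure \<Omega>" if "x \<in> space M" for x using that closure_subset by (auto simp: space_restrict_space)
  have le1: "- (A * (hk_sup t * D N)) <= ?S N" for N
  proof -
    have "- (A * (hk_sup t * D N)) = (\<integral>x. g x * (- (hk_sup t * D N)) \<partial>M)" by (simp add: A_def)
    also have "... <= ?S N" unfolding Sip
    proof (rule integral_mono[OF _ intS])
      show "integrable M (\<lambda>x. g x * (- (hk_sup t * D N)))" using L2_int[OF g] by simp
      fix x assume "x \<in> space M"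
      from heat_sum_ge(1)[OF finite_lessThan t cl[OF this] h h0 d supp sO, of N ?c] GD[of x N]
      have "- (hk_sup t * D N) <= heat_sum {..<N} ?c t x" by linarith
      then show "g x * (- (hk_sup t * D N)) <= g x * heat_sum {..<N} ?c t x" by (intro mult_left_mono g0)
    qed
    finally show ?thesis .
  qed
  have "(\<lambda>N. - (A * (hk_sup t * D N))) \<longlonglongrightarrow> - (A * (hk_sup t * 0))" by (intro tendsto_intros Dl)
  from LIMSEQ_le[OF this lim] le1 show "0 <= heat_form t h g" by simp
  have le2: "R - C * A - A * (hk_sup t * D N) <= ?S N" for N
  proof -
    have i: "integrable M (\<lambda>x. g x * (\<integral>y. heat_kernel t (x - y) * h y \<partial>M))"
      by (rule hk_potential_integrable[OF t hL g h0])
    have "R - C * A - A * (hk_sup t * D N) = (\<integral>x. g x * (\<integral>y. heat_kernel t (x - y) * h y \<partial>M) - (C + hk_sup t * D N) * g x \<partial>M)"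
      unfolding R_def A_def using i L2_int[OF g]
      by (subst Bochner_Integration.integral_diff) (auto simp: algebra_simps)
    also have "... <= ?S N" unfolding Sip
    proof (rule integral_mono[OF _ intS])
      show "integrable M (\<lambda>x. g x * (\<integral>y. heat_kernel t (x - y) * h y \<partial>M) - (C + hk_sup t * D N) * g x)"
        using i L2_int[OF g] by (intro Bochner_Integration.integrable_diff) auto
      fix x assume "x \<in> space M"
      from heat_sum_ge(2)[OF finite_lessThan t cl[OF this] h h0 d supp sO, of N ?c] GD[of x N]
      have "(\<integral>y. heat_kernel t (x - y) * h y \<partial>M) - (C + hk_sup t * D N) <= heat_sum {..<N} ?c t x"
        unfolding GhM hM C_def by linarith
      from mult_left_mono[OF this g0[of x]]
      show "g x * (\<integral>y. heat_kernel t (x - y) * h y \<partial>M) - (C + hk_sup t * D N) * g x <= g x * heat_sum {..<N} ?c t x"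
        by (simp add: algebra_simps)
    qed
    finally show ?thesis .
  qed
  have "(\<lambda>N. R - C * A - A * (hk_sup t * D N)) \<longlonglongrightarrow> R - C * A - A * (hk_sup t * 0)" by (intro tendsto_intros Dl)
  from LIMSEQ_le[OF this lim] le2 show "(\<integral>x. g x * (\<integral>y. heat_kernel t (x - y) * h y \<partial>M) \<partial>M)
       - heat_sup TYPE('a) * d powr (- real DIM('a)) * (\<integral>y. h y \<partial>M) * (\<integral>x. g x \<partial>M) <= heat_form t h g"
    by (simp add: R_def C_def A_def)
qed

end

section \<open>Integrals of the heat kernel over time\<close>

lemma nn_integral_powr_0_1:
  assumes "0 < m"
  shows "(NNL t. ennreal (t powr (m - 1)) * indicator {0<..1} t) = ennreal (1 / m)"
proof -
  have "((\<lambda>t. t powr (m - 1)) has_integral (1 powr (m - 1 + 1) / (m - 1 + 1))) {0..1}"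
    using assms by (intro has_integral_powr_from_0) auto
  then have "((\<lambda>t. if t \<in> {0..1} then t powr (m - 1) else 0) has_integral (1 / m)) UNIV"
    using assms by (subst has_integral_restrict_UNIV) simp
  then have "(NNL t. ennreal (if t \<in> {0..1} then t powr (m - 1) else 0)) = ennreal (1 / m)"
    by (intro nn_integral_has_integral_lborel) auto
  moreover have "(NNL t. ennreal (t powr (m - 1)) * indicator {0<..1} t) = (NNL t. ennreal (if t \<in> {0..1} then t powr (m - 1) else 0))"
    by (intro nn_integral_cong) (auto simp: indicator_def)
  ultimately show ?thesis by simp
qed

lemma nn_integral_powr_1_inf:
  fixes e :: real
  assumes "e < -1"
  shows "(NNL t. ennreal (t powr e) * indicator {1<..} t) <= ennreal (1 / (- e - 1))"
proof -
  have "((\<lambda>t. t powr e) has_integral - (1 powr (e + 1)) / (e + 1)) {1..}"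
    using assms by (intro has_integral_powr_to_inf) auto
  then have "((\<lambda>t. if t \<in> {1..} then t powr e else 0) has_integral - (1 powr (e + 1)) / (e + 1)) UNIV"
    by (subst has_integral_restrict_UNIV) simp
  then have "(NNL t. ennreal (if t \<in> {1..} then t powr e else 0)) = ennreal (- (1 powr (e + 1)) / (e + 1))"
    by (intro nn_integral_has_integral_lborel) auto
  moreover have "(NNL t. ennreal (t powr e) * indicator {1<..} t) <= (NNL t. ennreal (if t \<in> {1..} then t powr e else 0))"
    by (intro nn_integral_mono) (auto simp: indicator_def)
  moreover have "- (1 powr (e + 1)) / (e + 1) = 1 / (- e - 1)" using assms by (simp add: field_simps)
  ultimately show ?thesis by simp
qed

lemma nn_integral_inverse_ln:
  assumes "0 < r" "r < 1"
  shows "(NNL t. ennreal (1 / t) * indicator {r..1} t) = ennreal (- ln r)"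
proof -
  have "(NNL t. ennreal (1 / t) * indicator {r..1} t) = ennreal (ln 1 - ln r)"
    by (rule nn_integral_FTC_Icc) (use assms in \<open>auto intro!: derivative_eq_intros simp: divide_inverse\<close>)
  then show ?thesis by simp
qed

lemma nn_integral_gamma:
  assumes s: "0 < s" and l: "0 < l"
  shows "(NNL t. ennreal (t powr (s - 1) * exp (- (l * t))) * indicator {0<..} t) = ennreal (Gamma s * l powr (- s))"
proof -
  have G: "(NNL t. ennreal (indicator {0..} t * t powr (s - 1) / exp t)) = ennreal (Gamma s)"
    using Gamma_conv_nn_integral_real[OF s] by simp
  have "(NNL t. ennreal (indicator {0..} t * t powr (s - 1) / exp t))
    = ennreal \<bar>l\<bar> * (NNL t. ennreal (indicator {0..} (0 + l * t) * (0 + l * t) powr (s - 1) / exp (0 + l * t)))"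
    using l by (intro nn_integral_real_affine) auto
  also have "... = (NNL t. ennreal l * ennreal (indicator {0..} (0 + l * t) * (0 + l * t) powr (s - 1) / exp (0 + l * t)))"
    using l by (subst nn_integral_cmult) auto
  also have "... = (NNL t. ennreal (l powr s) * (ennreal (t powr (s - 1) * exp (- (l * t))) * indicator {0<..} t))"
  proof (rule nn_integral_cong)
    fix t :: real
    show "ennreal l * ennreal (indicator {0..} (0 + l * t) * (0 + l * t) powr (s - 1) / exp (0 + l * t))
      = ennreal (l powr s) * (ennreal (t powr (s - 1) * exp (- (l * t))) * indicator {0<..} t)"
    proof (cases "0 < t")
      case True
      have "l * l powr (s - 1) = l powr s" using powr_add[of l 1 "s - 1"] l by simp
      then have "l * (l powr (s - 1) * t powr (s - 1) / exp (l * t)) = l powr s * (t powr (s - 1) * exp (- (l * t)))"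
        by (simp add: exp_minus divide_inverse mult.assoc[symmetric])
      then show ?thesis using True l by (simp add: ennreal_mult[symmetric] powr_mult)
    next
      case False
      then show ?thesis using l by (cases "t = 0") (auto simp: indicator_def zero_le_mult_iff)
    qed
  qed
  also have "... = ennreal (l powr s) * (NNL t. ennreal (t powr (s - 1) * exp (- (l * t))) * indicator {0<..} t)"
    by (rule nn_integral_cmult) measurable
  finally have e: "ennreal (l powr s) * (NNL t. ennreal (t powr (s - 1) * exp (- (l * t))) * indicator {0<..} t) = ennreal (Gamma s)"
    using G by simp
  have "ennreal (l powr (- s)) * ennreal (l powr s) = 1"
    using l by (simp add: ennreal_mult[symmetric] powr_add[symmetric])
  then have "(NNL t. ennreal (t powr (s - 1) * exp (- (l * t))) * indicator {0<..} t)
    = ennreal (l powr (- s)) * (ennreal (l powr s) * (NNL t. ennreal (t powr (s - 1) * exp (- (l * t))) * indicator {0<..} t))"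
    by (simp add: mult.assoc[symmetric])
  also have "... = ennreal (Gamma s * l powr (- s))"
    unfolding e using Gamma_real_pos[OF s] by (simp add: ennreal_mult[symmetric] mult.commute)
  finally show ?thesis .
qed

lemma heat_kernel_scale:
  fixes z :: "'a::euclidean_space"
  assumes z: "z \<noteq> 0" and t: "0 < t" and e: "norm (e :: 'a) = 1"
  shows "heat_kernel ((norm z)\<^sup>2 * t) z = norm z powr (- real DIM('a)) * heat_kernel t e"
proof -
  have "(4 * ((norm z)\<^sup>2 * t)) powr (- (real DIM('a) / 2)) = (norm z powr 2 * (4 * t)) powr (- (real DIM('a) / 2))"
    using z by (simp add: mult_ac)
  also have "... = norm z powr (- real DIM('a)) * (4 * t) powr (- (real DIM('a) / 2))"
    by (simp only: powr_mult powr_powr) simp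
  finally show ?thesis using z e by (simp add: heat_kernel_def)
qed

text \<open>The substitution t -> |z|^2 t reduces to a unit vector and produces the homogeneity 2m -
  n. Finiteness rests on m > 0 near t = 0, where the kernel is bounded at a unit vector, and on m <
  n/2 at infinity.\<close>

lemma heat_kernel_time_integral:
  assumes m: "0 < m" "m < real DIM('a::euclidean_space) / 2"
  shows "\<exists>c>0. \<forall>z::'a. z \<noteq> 0 -->
    (NNL t. ennreal (t powr (m - 1) * heat_kernel t z) * indicator {0<..} t) = ennreal (c * norm z powr (- (real DIM('a) - 2 * m)))"
proof -
  let ?n = "real DIM('a)"
  obtain e :: 'a where e: "e \<in> Basis" using nonempty_Basis by blast
  then have ne: "norm e = 1" "e \<noteq> 0" by auto
  define I where "I = (NNL t. ennreal (t powr (m - 1) * heat_kernel t e) * indicator {0<..} t)"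
  define K where "K = 4 powr (- (?n / 2)) / gauss_Z TYPE('a)"
  have K: "0 < K" by (simp add: K_def gauss_Z_pos)
  have "I <= (NNL t. ennreal (heat_sup TYPE('a)) * (ennreal (t powr (m - 1)) * indicator {0<..1} t)
     + ennreal K * (ennreal (t powr (m - 1 - ?n / 2)) * indicator {1<..} t))"
    unfolding I_def
  proof (rule nn_integral_mono)
    fix t :: real
    show "ennreal (t powr (m - 1) * heat_kernel t e) * indicator {0<..} t <= ennreal (heat_sup TYPE('a)) * (ennreal (t powr (m - 1)) * indicator {0<..1} t)
     + ennreal K * (ennreal (t powr (m - 1 - ?n / 2)) * indicator {1<..} t)"
    proof (cases "0 < t")
      case t: True
      show ?thesis
      proof (cases "t <= 1")
        case True
        have "t powr (m - 1) * heat_kernel t e <= t powr (m - 1) * heat_sup TYPE('a)"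
          using heat_kernel_le_norm[OF t ne(2)] ne by (intro mult_left_mono) auto
        then show ?thesis using True t heat_sup_pos[where 'a = 'a]
          by (simp add: ennreal_mult[symmetric] mult.commute ennreal_leI)
      next
        case False
        have "t powr (m - 1) * heat_kernel t e <= t powr (m - 1) * ((4 * t) powr (- (?n / 2)) / gauss_Z TYPE('a))"
          by (intro mult_left_mono heat_kernel_le t) auto
        also have "... = K * t powr (m - 1 - ?n / 2)"
        proof -
          have "t powr (m - 1 - ?n / 2) = t powr (m - 1) * t powr (- (?n / 2))"
            by (simp only: powr_add[symmetric]) simp
          then show ?thesis by (simp add: K_def powr_mult)
        qed
        finally show ?thesis using False t K by (simp add: ennreal_mult[symmetric] ennreal_leI)
      qed
    qed simp
  qed
  also have "... = ennreal (heat_sup TYPE('a)) * (NNL t. ennreal (t powr (m - 1)) * indicator {0<..1} t)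
    + ennreal K * (NNL t. ennreal (t powr (m - 1 - ?n / 2)) * indicator {1<..} t)"
    by (simp add: nn_integral_add nn_integral_cmult)
  also have "... <= ennreal (heat_sup TYPE('a)) * ennreal (1 / m) + ennreal K * ennreal (1 / (- (m - 1 - ?n / 2) - 1))"
    using m nn_integral_powr_0_1[OF m(1)] by (intro add_mono mult_left_mono nn_integral_powr_1_inf) auto
  also have "... < top" by (simp add: ennreal_mult_less_top)
  finally have Ifin: "I < top" .
  have "I \<noteq> 0"
  proof
    assume "I = 0"
    then have "AE t in lborel. ennreal (t powr (m - 1) * heat_kernel t e) * indicator {0<..} t = 0"
      unfolding I_def by (subst (asm) nn_integral_0_iff_AE) auto
    then have "AE t in lborel. t \<notin> {0<..<1::real}"
    proof eventually_elim
      case (elim t)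
      show ?case
      proof
        assume t: "t \<in> {0<..<1}"
        have "0 < heat_kernel t e" using t gauss_Z_pos[where 'a = 'a] by (simp add: heat_kernel_def)
        then have "0 < t powr (m - 1) * heat_kernel t e" using t by simp
        then show False using elim t by (simp add: ennreal_eq_0_iff)
      qed
    qed
    then have "{0<..<1::real} \<in> null_sets lborel" by (subst AE_iff_null_sets) auto
    then have "emeasure lborel {0<..<1::real} = 0" by (rule null_setsD1)
    moreover have "emeasure lborel {0<..<1::real} = ennreal (1 - 0)" by (rule emeasure_lborel_Ioo) simp
    ultimately show False by (metis diff_zero ennreal_1 zero_neq_one)
  qed
  then obtain c where c: "0 < c" "I = ennreal c" using Ifin by (cases I) (auto simp: ennreal_eq_0_iff)
  have "(NNL t. ennreal (t powr (m - 1) * heat_kernel t z) * indicator {0<..} t) = ennreal (c * norm z powr (- (?n - 2 * m)))"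
    if z: "z \<noteq> 0" for z :: 'a
  proof -
    define r where "r = (norm z)\<^sup>2"
    have r: "0 < r" using z by (simp add: r_def)
    have "(NNL t. ennreal (t powr (m - 1) * heat_kernel t z) * indicator {0<..} t)
      = ennreal \<bar>r\<bar> * (NNL t. ennreal ((0 + r * t) powr (m - 1) * heat_kernel (0 + r * t) z) * indicator {0<..} (0 + r * t))"
      using r by (intro nn_integral_real_affine) auto
    also have "... = (NNL t. ennreal \<bar>r\<bar> * (ennreal ((0 + r * t) powr (m - 1) * heat_kernel (0 + r * t) z) * indicator {0<..} (0 + r * t)))"
      by (rule nn_integral_cmult[symmetric]) measurable
    also have "... = (NNL t. ennreal (norm z powr (- (?n - 2 * m))) * (ennreal (t powr (m - 1) * heat_kernel t e) * indicator {0<..} t))"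
    proof (rule nn_integral_cong)
      fix t :: real
      show "ennreal \<bar>r\<bar> * (ennreal ((0 + r * t) powr (m - 1) * heat_kernel (0 + r * t) z) * indicator {0<..} (0 + r * t))
        = ennreal (norm z powr (- (?n - 2 * m))) * (ennreal (t powr (m - 1) * heat_kernel t e) * indicator {0<..} t)"
      proof (cases "0 < t")
        case True
        have hk: "heat_kernel (r * t) z = norm z powr (- ?n) * heat_kernel t e"
          unfolding r_def by (rule heat_kernel_scale[OF z True ne(1)])
        have "r * r powr (m - 1) = r powr m" using powr_add[of r 1 "m - 1"] r by simp
        also have "r powr m = norm z powr (2 * m)" unfolding r_def using z
          by (simp add: powr_powr[symmetric])
        finally have "r * (r * t) powr (m - 1) * norm z powr (- ?n) = norm z powr (2 * m) * norm z powr (- ?n) * t powr (m - 1)"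
          using r True by (simp add: powr_mult)
        also have "norm z powr (2 * m) * norm z powr (- ?n) = norm z powr (- (?n - 2 * m))"
          by (simp add: powr_add[symmetric])
        finally have "r * ((r * t) powr (m - 1) * heat_kernel (r * t) z) = norm z powr (- (?n - 2 * m)) * (t powr (m - 1) * heat_kernel t e)"
          unfolding hk by (metis mult.assoc)
        then show ?thesis using True r by (simp add: ennreal_mult[symmetric])
      next
        case False
        then show ?thesis using r by (auto simp: indicator_def zero_less_mult_iff)
      qed
    qed
    also have "... = ennreal (norm z powr (- (?n - 2 * m))) * I"
      unfolding I_def by (rule nn_integral_cmult) measurable
    also have "... = ennreal (c * norm z powr (- (?n - 2 * m)))" using c by (simp add: ennreal_mult[symmetric] mult.commute)
    finally show ?thesis .
  qed
  then show ?thesis using c by blast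
qed

text \<open>Only times between R^2 and 2 R^2 are used: there the Gaussian factor is at least exp(-1)
  up to distance 2 R, and the interval has length R^2.\<close>

lemma heat_kernel_local_lower:
  fixes z :: "'a::euclidean_space"
  assumes s: "s <= real DIM('a) / 2" and R: "0 < R" "2 * R\<^sup>2 <= 1" and z: "norm z <= 2 * R"
  shows "ennreal (exp (-1) * 4 powr (- (real DIM('a) / 2)) / gauss_Z TYPE('a) * 2 powr (s - 1 - real DIM('a) / 2) * R powr (2 * s - real DIM('a)))
    <= (NNL t. ennreal (t powr (s - 1) * heat_kernel t z) * indicator {0<..1} t)"
proof -
  let ?n = "real DIM('a)"
  define Z where "Z = gauss_Z TYPE('a)"
  have Z: "0 < Z" by (simp add: Z_def gauss_Z_pos)
  have R2: "0 < R\<^sup>2" using R by simp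
  define k where "k = exp (-1) * 4 powr (- (?n / 2)) / Z * (2 * R\<^sup>2) powr (s - 1 - ?n / 2)"
  have k0: "0 <= k" using Z by (simp add: k_def)
  have "ennreal k * emeasure lborel {R\<^sup>2..2 * R\<^sup>2} = (NNL t. ennreal k * indicator {R\<^sup>2..2 * R\<^sup>2} t)"
    by (rule nn_integral_cmult_indicator[symmetric]) simp
  also have "... <= (NNL t. ennreal (t powr (s - 1) * heat_kernel t z) * indicator {0<..1} t)"
  proof (rule nn_integral_mono)
    fix t :: real
    show "ennreal k * indicator {R\<^sup>2..2 * R\<^sup>2} t <= ennreal (t powr (s - 1) * heat_kernel t z) * indicator {0<..1} t"
    proof (cases "t \<in> {R\<^sup>2..2 * R\<^sup>2}")
      case True
      then have t': "R\<^sup>2 <= t" "t <= 2 * R\<^sup>2" by auto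
      then have t: "0 < t" "R\<^sup>2 <= t" "t <= 2 * R\<^sup>2" "t <= 1" using R2 R(2) by linarith+
      have "(norm z)\<^sup>2 <= (2 * R)\<^sup>2" using z by (intro power_mono) auto
      then have "(norm z)\<^sup>2 <= 4 * t" using t by (simp add: power_mult_distrib)
      then have "(norm z)\<^sup>2 / (4 * t) <= 1" using t by simp
      then have "exp (-1) <= exp (- (norm z)\<^sup>2 / (4 * t))" by simp
      then have h: "(4 * t) powr (- (?n / 2)) * exp (-1) / Z <= heat_kernel t z"
        unfolding heat_kernel_def Z_def[symmetric] using Z by (intro divide_right_mono mult_left_mono) auto
      have powr_split: "t powr (s - 1 - ?n / 2) = t powr (s - 1) * t powr (- (?n / 2))"
        by (simp only: powr_add[symmetric]) simp
      have "(2 * R\<^sup>2) powr (s - 1 - ?n / 2) <= t powr (s - 1 - ?n / 2)"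
        using t s by (intro powr_mono2') auto
      then have "k <= exp (-1) * 4 powr (- (?n / 2)) / Z * t powr (s - 1 - ?n / 2)"
        unfolding k_def using Z by (intro mult_left_mono) auto
      also have "... = t powr (s - 1) * ((4 * t) powr (- (?n / 2)) * exp (-1) / Z)"
        unfolding powr_split by (simp add: powr_mult)
      also have "... <= t powr (s - 1) * heat_kernel t z" by (intro mult_left_mono h) auto
      finally show ?thesis using True t by (simp add: ennreal_leI)
    qed simp
  qed
  also have "ennreal k * emeasure lborel {R\<^sup>2..2 * R\<^sup>2} = ennreal (k * R\<^sup>2)"
    using k0 R2 by (simp add: ennreal_mult[symmetric])
  also have "k * R\<^sup>2 = exp (-1) * 4 powr (- (?n / 2)) / Z * 2 powr (s - 1 - ?n / 2) * R powr (2 * s - ?n)"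
  proof -
    have "(2 * R\<^sup>2) powr (s - 1 - ?n / 2) * R\<^sup>2 = (2 * R powr 2) powr (s - 1 - ?n / 2) * R powr 2"
      using R by simp
    also have "... = 2 powr (s - 1 - ?n / 2) * (R powr (2 * (s - 1 - ?n / 2)) * R powr 2)"
      by (simp only: powr_mult powr_powr mult.assoc)
    also have "R powr (2 * (s - 1 - ?n / 2)) * R powr 2 = R powr (2 * s - ?n)"
      by (simp only: powr_add[symmetric]) (simp add: algebra_simps)
    finally show ?thesis unfolding k_def by (simp only: mult.assoc)
  qed
  finally show ?thesis by (simp add: Z_def)
qed

text \<open>For t between r^2 and 1 the integrand is at least a constant times t^(s - 1 - n/2),
  hence times 1/t because s <= n/2, and 1/t integrates to the logarithm. With 2m - s in the role of
  s this is where the hypothesis s >= 2m - n/2 acts in the spectral case.\<close>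

lemma heat_kernel_log_lower:
  fixes z :: "'a::euclidean_space"
  assumes s: "s <= real DIM('a) / 2" and r: "0 < r" "r < 1" and z: "norm z <= 2 * r"
  shows "ennreal (exp (-1) * 4 powr (- (real DIM('a) / 2)) / gauss_Z TYPE('a) * (- ln (r\<^sup>2)))
    <= (NNL t. ennreal (t powr (s - 1) * heat_kernel t z) * indicator {0<..1} t)"
proof -
  let ?n = "real DIM('a)"
  define Z where "Z = gauss_Z TYPE('a)"
  have Z: "0 < Z" by (simp add: Z_def gauss_Z_pos)
  define k where "k = exp (-1) * 4 powr (- (?n / 2)) / Z"
  have k0: "0 <= k" using Z by (simp add: k_def)
  have r2: "0 < r\<^sup>2" "r\<^sup>2 < 1" using r by (auto simp: power_less_one_iff)
  have "ennreal (k * (- ln (r\<^sup>2))) = ennreal k * (NNL t. ennreal (1 / t) * indicator {r\<^sup>2..1} t)"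
    unfolding nn_integral_inverse_ln[OF r2] using k0 r2 by (simp add: ennreal_mult[symmetric])
  also have "... = (NNL t. ennreal k * (ennreal (1 / t) * indicator {r\<^sup>2..1} t))"
    by (rule nn_integral_cmult[symmetric]) measurable
  also have "... <= (NNL t. ennreal (t powr (s - 1) * heat_kernel t z) * indicator {0<..1} t)"
  proof (rule nn_integral_mono)
    fix t :: real
    show "ennreal k * (ennreal (1 / t) * indicator {r\<^sup>2..1} t) <= ennreal (t powr (s - 1) * heat_kernel t z) * indicator {0<..1} t"
    proof (cases "t \<in> {r\<^sup>2..1}")
      case True
      then have t': "r\<^sup>2 <= t" "t <= 1" by auto
      then have t: "0 < t" "r\<^sup>2 <= t" "t <= 1" using r2 by linarith+
      have "(norm z)\<^sup>2 <= (2 * r)\<^sup>2" using z by (intro power_mono) auto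
      then have "(norm z)\<^sup>2 <= 4 * t" using t by (simp add: power_mult_distrib)
      then have "(norm z)\<^sup>2 / (4 * t) <= 1" using t by simp
      then have "exp (-1) <= exp (- (norm z)\<^sup>2 / (4 * t))" by simp
      then have h: "(4 * t) powr (- (?n / 2)) * exp (-1) / Z <= heat_kernel t z"
        unfolding heat_kernel_def Z_def[symmetric] using Z by (intro divide_right_mono mult_left_mono) auto
      have powr_split: "t powr (s - 1 - ?n / 2) = t powr (s - 1) * t powr (- (?n / 2))"
        by (simp only: powr_add[symmetric]) simp
      have "t powr (-1) <= t powr (s - 1 - ?n / 2)"
      proof (rule powr_mono')
        show "s - 1 - ?n / 2 <= - 1" using s by linarith
      qed (use t in linarith)+
      moreover have "t powr (-1) = 1 / t" using t by (simp add: powr_minus_divide)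
      ultimately have "1 / t <= t powr (s - 1 - ?n / 2)" by simp
      then have "k * (1 / t) <= k * t powr (s - 1 - ?n / 2)"
        using k0 by (rule mult_left_mono)
      also have "... = t powr (s - 1) * ((4 * t) powr (- (?n / 2)) * exp (-1) / Z)"
        unfolding powr_split by (simp add: k_def powr_mult)
      also have "... <= t powr (s - 1) * heat_kernel t z" by (intro mult_left_mono h) auto
      finally show ?thesis using True t k0 by (simp add: ennreal_mult[symmetric] ennreal_leI)
    qed simp
  qed
  finally show ?thesis by (simp add: k_def Z_def)
qed

text \<open>Over the whole half-line, and divided by Gamma(s), this is the kernel of the power -s of
  the Laplacian on the whole space. The time set is a parameter because the lower comparison is used
  on (0, 1] only: its constant boundary loss times t^(s - 1) is not integrable at infinity.\<close>

definition time_kernel :: "real set => real => 'a::euclidean_space => ennreal" where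
  "time_kernel I s z = (NNL t. ennreal (t powr (s - 1) * heat_kernel t z) * indicator I t)"

lemma time_kernel_Fubini:
  fixes f g :: "'a::euclidean_space => real"
  assumes [measurable]: "f \<in> borel_measurable borel" "g \<in> borel_measurable borel" "I \<in> sets borel"
    and nn: "\<And>x. 0 <= f x" "\<And>x. 0 <= g x"
  shows "(NNL t. ennreal (t powr (s - 1)) * indicator I t * (\<integral>\<^sup>+x. \<integral>\<^sup>+y. ennreal (f x * g y * heat_kernel t (x - y)) \<partial>lborel \<partial>lborel))
    = (\<integral>\<^sup>+x. \<integral>\<^sup>+y. ennreal (f x * g y) * time_kernel I s (x - y) \<partial>lborel \<partial>lborel)"
proof -
  have "(NNL t. ennreal (t powr (s - 1)) * indicator I t * (\<integral>\<^sup>+x. \<integral>\<^sup>+y. ennreal (f x * g y * heat_kernel t (x - y)) \<partial>lborel \<partial>lborel))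
    = (NNL t. (NNL x. ennreal (t powr (s - 1)) * indicator I t * (NNL y. ennreal (f x * g y * heat_kernel t (x - y)))))"
    by (intro nn_integral_cong nn_integral_cmult[symmetric]) measurable
  also have "... = (NNL t. (NNL x. (NNL y. ennreal (t powr (s - 1)) * indicator I t * ennreal (f x * g y * heat_kernel t (x - y)))))"
    by (intro nn_integral_cong nn_integral_cmult[symmetric]) measurable
  also have "... = (NNL x. (NNL t. (NNL y. ennreal (t powr (s - 1)) * indicator I t * ennreal (f x * g y * heat_kernel t (x - y)))))"
    by (rule lborel_pair.Fubini') measurable
  also have "... = (NNL x. (NNL y. (NNL t. ennreal (t powr (s - 1)) * indicator I t * ennreal (f x * g y * heat_kernel t (x - y)))))"
    by (intro nn_integral_cong lborel_pair.Fubini') measurable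
  also have "... = (\<integral>\<^sup>+x. \<integral>\<^sup>+y. ennreal (f x * g y) * time_kernel I s (x - y) \<partial>lborel \<partial>lborel)"
  proof (intro nn_integral_cong)
    fix x y
    have "(NNL t. ennreal (t powr (s - 1)) * indicator I t * ennreal (f x * g y * heat_kernel t (x - y)))
      = (NNL t. ennreal (f x * g y) * (ennreal (t powr (s - 1) * heat_kernel t (x - y)) * indicator I t))"
      using nn by (intro nn_integral_cong) (simp add: ennreal_mult mult_ac)
    also have "... = ennreal (f x * g y) * time_kernel I s (x - y)"
      unfolding time_kernel_def by (rule nn_integral_cmult) measurable
    finally show "(NNL t. ennreal (t powr (s - 1)) * indicator I t * ennreal (f x * g y * heat_kernel t (x - y))) = ennreal (f x * g y) * time_kernel I s (x - y)" .
  qed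
  finally show ?thesis .
qed

section \<open>Energies of inverse powers of the Dirichlet Laplacian\<close>

context dirichlet_system
begin

lemma lam_lower: obtains l where "0 < l" "\<And>j. l <= lam j"
proof -
  define F where "F = lam ` {j. lam j <= 1}"
  have F: "finite F" unfolding F_def using finite_lam_le by simp
  define l where "l = Min (insert 1 F)"
  have "0 < l" unfolding l_def using F lam_pos by (auto simp: F_def)
  moreover have "l <= lam j" for j
  proof (cases "lam j <= 1")
    case True
    then have "lam j \<in> insert 1 F" by (auto simp: F_def)
    then show ?thesis unfolding l_def using F by (intro Min_le) auto
  next
    case False
    have "l <= 1" unfolding l_def using F by (intro Min_le) auto
    then show ?thesis using False by simp
  qed
  ultimately show ?thesis using that by blast
qed

text \<open>The bilinear form of the power -s of the Dirichlet Laplacian, dual to the form of order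
  s; times Gamma(s) it is the integral over t of t^(s - 1) times the heat form.\<close>

definition energy :: "real => ('a => real) => ('a => real) => real" where
  "energy s f g = (\<Sum>j. lam j powr (- s) * (ip M f (phi j) * ip M g (phi j)))"

lemma energy_abs_summable:
  assumes f: "L2 M f" and g: "L2 M g" and s: "0 <= s"
  shows "summable (\<lambda>j. lam j powr (- s) * \<bar>ip M f (phi j) * ip M g (phi j)\<bar>)"
proof -
  obtain l where l: "0 < l" "\<And>j. l <= lam j" using lam_lower by blast
  show ?thesis
  proof (rule summable_comparison_test)
    show "summable (\<lambda>j. l powr (- s) * \<bar>ip M f (phi j) * ip M g (phi j)\<bar>)"
      by (intro summable_mult abs_coeff_summable f g)
    have "lam j powr (- s) <= l powr (- s)" for j using l s by (intro powr_mono2') auto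
    then show "\<exists>N. \<forall>n\<ge>N. norm (lam n powr (- s) * \<bar>ip M f (phi n) * ip M g (phi n)\<bar>) <= l powr (- s) * \<bar>ip M f (phi n) * ip M g (phi n)\<bar>"
      by (auto intro!: mult_right_mono simp: abs_mult)
  qed
qed

lemma energy_sums:
  assumes "L2 M f" "L2 M g" "0 <= s"
  shows "(\<lambda>j. lam j powr (- s) * (ip M f (phi j) * ip M g (phi j))) sums energy s f g"
  unfolding energy_def
  by (rule summable_sums, rule summable_rabs_cancel) (use energy_abs_summable[OF assms] in \<open>simp add: abs_mult\<close>)

text \<open>Termwise this is the Gamma integral; absolute summability justifies the exchange with
  the sum. Nonnegativity of the heat form is assumed because the left side is an integral of
  extended nonnegative values.\<close>

lemma energy_time:
  assumes f: "L2 M f" and g: "L2 M g" and s: "0 < s" and nn: "\<And>t. 0 < t ==> 0 <= heat_form t f g"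
  shows "(NNL t. ennreal (t powr (s - 1)) * indicator {0<..} t * ennreal (heat_form t f g)) = ennreal (Gamma s * energy s f g)"
    "0 <= energy s f g"
proof -
  let ?a = "\<lambda>j. ip M f (phi j) * ip M g (phi j)"
  define F where "F j t = indicator {0<..} t * (t powr (s - 1) * exp (- (lam j * t)) * ?a j)" for j and t :: real
  have Fm [measurable]: "F j \<in> borel_measurable lborel" for j unfolding F_def by measurable
  have nF: "(NNL t. ennreal (norm (F j t))) = ennreal (Gamma s * (lam j powr (- s) * \<bar>?a j\<bar>))" for j
  proof -
    have "(NNL t. ennreal (norm (F j t))) = (NNL t. ennreal \<bar>?a j\<bar> * (ennreal (t powr (s - 1) * exp (- (lam j * t))) * indicator {0<..} t))"
      by (intro nn_integral_cong) (auto simp: F_def indicator_def abs_mult ennreal_mult[symmetric] mult_ac)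
    also have "... = ennreal \<bar>?a j\<bar> * ennreal (Gamma s * lam j powr (- s))"
      by (subst nn_integral_cmult) (auto simp: nn_integral_gamma[OF s lam_pos])
    finally show ?thesis using Gamma_real_pos[OF s] by (simp add: ennreal_mult[symmetric] mult_ac)
  qed
  have Fi: "integrable lborel (F j)" for j
    using nF[of j] by (intro integrableI_bounded) auto
  have nI: "(\<integral>t. norm (F j t) \<partial>lborel) = Gamma s * (lam j powr (- s) * \<bar>?a j\<bar>)" for j
    using nF[of j] Gamma_real_pos[OF s] by (subst integral_eq_nn_integral) auto
  have I: "(\<integral>t. F j t \<partial>lborel) = Gamma s * (lam j powr (- s) * ?a j)" for j
  proof (cases "0 <= ?a j")
    case True
    then have "norm (F j t) = F j t" for t by (auto simp: F_def indicator_def)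
    then show ?thesis using nI[of j] True by simp
  next
    case False
    then have "F j t <= 0" for t
      unfolding F_def using mult_nonneg_nonpos[of "t powr (s - 1) * exp (- (lam j * t))" "?a j"] by (auto simp: indicator_def)
    then have "norm (F j t) = - F j t" for t by simp
    then show ?thesis using nI[of j] False by simp
  qed
  have sumb: "summable (\<lambda>j. \<integral>t. norm (F j t) \<partial>lborel)"
    unfolding nI using s by (intro summable_mult energy_abs_summable f g) auto
  have AEs: "AE t in lborel. summable (\<lambda>j. norm (F j t))"
  proof (rule AE_I2)
    fix t :: real
    show "summable (\<lambda>j. norm (F j t))"
    proof (cases "0 < t")
      case True
      have "summable (\<lambda>j. t powr (s - 1) * \<bar>?a j\<bar>)" by (intro summable_mult abs_coeff_summable f g)
      moreover have "norm (norm (F j t)) <= t powr (s - 1) * \<bar>?a j\<bar>" for j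
      proof -
        have "exp (- (lam j * t)) <= 1" using lam_pos[of j] True by simp
        then have "t powr (s - 1) * exp (- (lam j * t)) * \<bar>?a j\<bar> <= t powr (s - 1) * 1 * \<bar>?a j\<bar>"
          by (intro mult_right_mono mult_left_mono) auto
        then show ?thesis using True by (simp add: F_def abs_mult)
      qed
      ultimately show ?thesis by (rule summable_comparison_test'[where N = 0])
    qed (simp add: F_def)
  qed
  have Fsum: "(\<Sum>j. F j t) = indicator {0<..} t * (t powr (s - 1) * heat_form t f g)" for t
  proof (cases "0 < t")
    case True
    have "(\<lambda>j. t powr (s - 1) * (exp (- (lam j * t)) * ?a j)) sums (t powr (s - 1) * heat_form t f g)"
      using True by (intro sums_mult heat_form_sums f g) auto
    then show ?thesis using True by (simp add: F_def sums_iff mult.assoc)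
  qed (simp add: F_def)
  have si: "integrable lborel (\<lambda>t. indicator {0<..} t * (t powr (s - 1) * heat_form t f g))"
    using integrable_suminf[OF Fi AEs sumb] by (simp add: Fsum)
  have "(\<integral>t. indicator {0<..} t * (t powr (s - 1) * heat_form t f g) \<partial>lborel) = (\<Sum>j. Gamma s * (lam j powr (- s) * ?a j))"
    using integral_suminf[OF Fi AEs sumb] by (simp add: Fsum I)
  also have "... = Gamma s * energy s f g"
    unfolding energy_def using energy_sums[OF f g, of s] s by (intro suminf_mult) (auto simp: sums_iff)
  finally have eq: "(\<integral>t. indicator {0<..} t * (t powr (s - 1) * heat_form t f g) \<partial>lborel) = Gamma s * energy s f g" .
  have nn': "0 <= indicator {0<..} t * (t powr (s - 1) * heat_form t f g)" for t
    using nn[of t] by (auto simp: indicator_def)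
  have "0 <= Gamma s * energy s f g" unfolding eq[symmetric] using nn' by (intro integral_nonneg_AE) auto
  then show "0 <= energy s f g" using Gamma_real_pos[OF s] by (simp add: zero_le_mult_iff)
  have "(NNL t. ennreal (t powr (s - 1)) * indicator {0<..} t * ennreal (heat_form t f g))
     = (NNL t. ennreal (indicator {0<..} t * (t powr (s - 1) * heat_form t f g)))"
  proof (rule nn_integral_cong)
    fix t :: real
    show "ennreal (t powr (s - 1)) * indicator {0<..} t * ennreal (heat_form t f g) = ennreal (indicator {0<..} t * (t powr (s - 1) * heat_form t f g))"
      using nn[of t] by (cases "0 < t") (auto simp: ennreal_mult)
  qed
  also have "... = ennreal (Gamma s * energy s f g)"
    unfolding eq[symmetric] using si nn' by (intro nn_integral_eq_integral) auto
  finally show "(NNL t. ennreal (t powr (s - 1)) * indicator {0<..} t * ennreal (heat_form t f g)) = ennreal (Gamma s * energy s f g)" .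
qed

lemma nn_integral_M_lborel:
  fixes f :: "'a => ennreal"
  assumes "\<And>x. x \<notin> \<Omega> ==> f x = 0"
  shows "(\<integral>\<^sup>+x. f x \<partial>M) = (NNL x. f x)"
proof -
  have "(\<integral>\<^sup>+x. f x \<partial>M) = (\<integral>\<^sup>+x. f x * indicator \<Omega> x \<partial>lebesgue)"
    by (rule nn_integral_restrict_space) simp
  also have "(\<lambda>x. f x * indicator \<Omega> x) = f" using assms by (auto simp: indicator_def fun_eq_iff)
  finally show ?thesis by (simp add: nn_integral_completion)
qed

text \<open>Passes from Bochner integrals over the domain to nonnegative integrals over the whole
  space, the form in which the time integral can be exchanged freely.\<close>

lemma hk_potential_nn:
  assumes t: "0 < t" and fb [measurable]: "f \<in> borel_measurable borel" and gb [measurable]: "g \<in> borel_measurable borel"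
    and nn: "\<And>x. 0 <= f x" "\<And>x. 0 <= g x" and sO: "\<And>x. x \<notin> \<Omega> ==> f x = 0" "\<And>x. x \<notin> \<Omega> ==> g x = 0"
    and f: "L2 M f" and g: "L2 M g"
  shows "ennreal (\<integral>x. g x * (\<integral>y. heat_kernel t (x - y) * f y \<partial>M) \<partial>M)
    = (\<integral>\<^sup>+x. \<integral>\<^sup>+y. ennreal (g x * f y * heat_kernel t (x - y)) \<partial>lborel \<partial>lborel)"
proof -
  have P0: "0 <= (\<integral>y. heat_kernel t (x - y) * f y \<partial>M)" for x
    using nn by (intro integral_nonneg_AE) auto
  have "ennreal (\<integral>x. g x * (\<integral>y. heat_kernel t (x - y) * f y \<partial>M) \<partial>M)
    = (\<integral>\<^sup>+x. ennreal (g x * (\<integral>y. heat_kernel t (x - y) * f y \<partial>M)) \<partial>M)"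
    using hk_potential_integrable[OF t f g nn(1)] nn P0 by (intro nn_integral_eq_integral[symmetric]) auto
  also have "... = (NNL x. ennreal (g x * (\<integral>y. heat_kernel t (x - y) * f y \<partial>M)))"
    by (rule nn_integral_M_lborel) (simp add: sO)
  also have "... = (\<integral>\<^sup>+x. \<integral>\<^sup>+y. ennreal (g x * f y * heat_kernel t (x - y)) \<partial>lborel \<partial>lborel)"
  proof (rule nn_integral_cong)
    fix x :: 'a
    have "ennreal (g x * (\<integral>y. heat_kernel t (x - y) * f y \<partial>M)) = ennreal (g x) * ennreal (\<integral>y. heat_kernel t (x - y) * f y \<partial>M)"
      using nn P0 by (intro ennreal_mult)
    also have "ennreal (\<integral>y. heat_kernel t (x - y) * f y \<partial>M) = (\<integral>\<^sup>+y. ennreal (heat_kernel t (x - y) * f y) \<partial>M)"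
      using heat_kernel_mult_integrable[OF t L2_int[OF f]] nn by (intro nn_integral_eq_integral[symmetric]) auto
    also have "... = (NNL y. ennreal (heat_kernel t (x - y) * f y))"
      by (rule nn_integral_M_lborel) (simp add: sO)
    also have "ennreal (g x) * ... = (NNL y. ennreal (g x) * ennreal (heat_kernel t (x - y) * f y))"
      by (rule nn_integral_cmult[symmetric]) measurable
    also have "... = (NNL y. ennreal (g x * f y * heat_kernel t (x - y)))"
      using nn by (intro nn_integral_cong) (simp add: ennreal_mult[symmetric] mult_ac)
    finally show "ennreal (g x * (\<integral>y. heat_kernel t (x - y) * f y \<partial>M)) = (NNL y. ennreal (g x * f y * heat_kernel t (x - y)))" .
  qed
  finally show ?thesis .
qed

text \<open>The upper heat comparison integrated over all times; off the diagonal, which is null,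
  the free kernel integrates to a multiple of the Riesz kernel.\<close>

lemma energy_le_riesz:
  assumes m: "0 < m" and c: "0 < c"
    and tk: "\<And>z::'a. z \<noteq> 0 ==> time_kernel {0<..} m z = ennreal (c * norm z powr (- a))"
    and fb [measurable]: "f \<in> borel_measurable borel" and sO: "\<And>x. x \<notin> \<Omega> ==> f x = 0" and f: "L2 M f"
  shows "ennreal (Gamma m * energy m f f) <= ennreal c * riesz a (\<lambda>x. \<bar>f x\<bar>) (\<lambda>x. \<bar>f x\<bar>)"
proof -
  let ?g = "\<lambda>x. \<bar>f x\<bar>"
  have nn: "0 <= heat_form t f f" if "0 < t" for t
  proof (rule sums_le[OF _ sums_zero heat_form_sums[OF _ f f]])
    show "0 <= exp (- (lam j * t)) * (ip M f (phi j) * ip M f (phi j))" for j by simp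
  qed (use that in simp)
  have "ennreal (Gamma m * energy m f f) = (NNL t. ennreal (t powr (m - 1)) * indicator {0<..} t * ennreal (heat_form t f f))"
    by (rule energy_time(1)[OF f f m nn, symmetric])
  also have "... <= (NNL t. ennreal (t powr (m - 1)) * indicator {0<..} t * (\<integral>\<^sup>+x. \<integral>\<^sup>+y. ennreal (?g x * ?g y * heat_kernel t (x - y)) \<partial>lborel \<partial>lborel))"
  proof (rule nn_integral_mono)
    fix t :: real
    show "ennreal (t powr (m - 1)) * indicator {0<..} t * ennreal (heat_form t f f)
      <= ennreal (t powr (m - 1)) * indicator {0<..} t * (\<integral>\<^sup>+x. \<integral>\<^sup>+y. ennreal (?g x * ?g y * heat_kernel t (x - y)) \<partial>lborel \<partial>lborel)"
    proof (cases "0 < t")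
      case True
      have "ennreal (heat_form t f f) <= ennreal (\<integral>x. ?g x * (\<integral>y. heat_kernel t (x - y) * ?g y \<partial>M) \<partial>M)"
        by (intro ennreal_leI heat_form_le True f)
      also have "... = (\<integral>\<^sup>+x. \<integral>\<^sup>+y. ennreal (?g x * ?g y * heat_kernel t (x - y)) \<partial>lborel \<partial>lborel)"
        by (rule hk_potential_nn[OF True _ _ _ _ _ _ L2_abs[OF f] L2_abs[OF f]]) (auto simp: sO)
      finally show ?thesis by (rule mult_left_mono) simp
    qed simp
  qed
  also have "... = (\<integral>\<^sup>+x. \<integral>\<^sup>+y. ennreal (?g x * ?g y) * time_kernel {0<..} m (x - y) \<partial>lborel \<partial>lborel)"
    by (rule time_kernel_Fubini) auto
  also have "... = (\<integral>\<^sup>+x. \<integral>\<^sup>+y. ennreal c * ennreal (?g x * ?g y * norm (x - y) powr (- a)) \<partial>lborel \<partial>lborel)"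
  proof (rule nn_integral_cong, rule nn_integral_cong_AE)
    fix x :: 'a
    show "AE y in lborel. ennreal (?g x * ?g y) * time_kernel {0<..} m (x - y) = ennreal c * ennreal (?g x * ?g y * norm (x - y) powr (- a))"
      using AE_lborel_singleton[of x]
    proof eventually_elim
      case (elim y)
      then show ?case using c by (subst tk) (auto simp: ennreal_mult[symmetric] mult_ac)
    qed
  qed
  also have "... = ennreal c * riesz a ?g ?g"
    unfolding riesz_def by (subst nn_integral_cmult[symmetric], measurable) (intro nn_integral_cong nn_integral_cmult, measurable)
  finally show ?thesis .
qed

text \<open>The lower heat comparison is integrated over t <= 1, where the boundary loss contributes
  the factor 1/s, the integral of t^(s - 1); the later times of the Dirichlet flow are discarded by
  positivity.\<close>

lemma energy_ge_time_kernel: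
  assumes h: "continuous_on UNIV h" and h0: "\<And>y. 0 <= h y" and d: "0 < d"
    and supp: "\<And>y z. h y \<noteq> 0 ==> z \<in> frontier \<Omega> ==> d <= norm (z - y)" and sO: "\<And>y. y \<notin> \<Omega> ==> h y = 0"
    and hL: "L2 M h" and g: "L2 M g" and g0: "\<And>x. 0 <= g x" and gO: "\<And>y. y \<notin> \<Omega> ==> g y = 0"
    and gb [measurable]: "g \<in> borel_measurable borel" and s: "0 < s"
  shows "(\<integral>\<^sup>+x. \<integral>\<^sup>+y. ennreal (g x * h y) * time_kernel {0<..1} s (x - y) \<partial>lborel \<partial>lborel)
    <= ennreal (Gamma s * energy s h g + heat_sup TYPE('a) * d powr (- real DIM('a)) / s * ((\<integral>y. h y \<partial>M) * (\<integral>x. g x \<partial>M)))"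
    "0 <= energy s h g"
proof -
  have hb [measurable]: "h \<in> borel_measurable borel" using h by (rule borel_measurable_continuous_onI)
  define C where "C = heat_sup TYPE('a) * d powr (- real DIM('a)) * (\<integral>y. h y \<partial>M) * (\<integral>x. g x \<partial>M)"
  have hi: "0 <= (\<integral>y. h y \<partial>M)" "0 <= (\<integral>x. g x \<partial>M)" using h0 g0 by (auto intro!: integral_nonneg_AE)
  then have C: "0 <= C" using heat_sup_pos[where 'a = 'a] by (simp add: C_def)
  note ge = heat_form_ge[OF _ h h0 d supp sO hL g g0]
  have nn: "0 <= heat_form t h g" if "0 < t" for t by (rule ge(1)[OF that])
  show e0: "0 <= energy s h g" by (rule energy_time(2)[OF hL g s nn])
  have "(\<integral>\<^sup>+x. \<integral>\<^sup>+y. ennreal (g x * h y) * time_kernel {0<..1} s (x - y) \<partial>lborel \<partial>lborel)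
    = (NNL t. ennreal (t powr (s - 1)) * indicator {0<..1} t * (\<integral>\<^sup>+x. \<integral>\<^sup>+y. ennreal (g x * h y * heat_kernel t (x - y)) \<partial>lborel \<partial>lborel))"
    by (rule time_kernel_Fubini[symmetric]) (auto simp: h0 g0)
  also have "... <= (NNL t. ennreal (t powr (s - 1)) * indicator {0<..} t * ennreal (heat_form t h g) + ennreal C * (ennreal (t powr (s - 1)) * indicator {0<..1} t))"
  proof (rule nn_integral_mono)
    fix t :: real
    show "ennreal (t powr (s - 1)) * indicator {0<..1} t * (\<integral>\<^sup>+x. \<integral>\<^sup>+y. ennreal (g x * h y * heat_kernel t (x - y)) \<partial>lborel \<partial>lborel)
      <= ennreal (t powr (s - 1)) * indicator {0<..} t * ennreal (heat_form t h g) + ennreal C * (ennreal (t powr (s - 1)) * indicator {0<..1} t)"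
    proof (cases "0 < t \<and> t <= 1")
      case True
      then have t: "0 < t" by simp
      have "(\<integral>\<^sup>+x. \<integral>\<^sup>+y. ennreal (g x * h y * heat_kernel t (x - y)) \<partial>lborel \<partial>lborel) = ennreal (\<integral>x. g x * (\<integral>y. heat_kernel t (x - y) * h y \<partial>M) \<partial>M)"
        by (rule hk_potential_nn[OF t hb gb h0 g0 sO gO hL g, symmetric])
      also have "... <= ennreal (heat_form t h g + C)"
        using ge(2)[OF t] by (intro ennreal_leI) (simp add: C_def)
      also have "... = ennreal (heat_form t h g) + ennreal C" using nn[OF t] C by simp
      finally have "ennreal (t powr (s - 1)) * (\<integral>\<^sup>+x. \<integral>\<^sup>+y. ennreal (g x * h y * heat_kernel t (x - y)) \<partial>lborel \<partial>lborel)
        <= ennreal (t powr (s - 1)) * (ennreal (heat_form t h g) + ennreal C)" by (rule mult_left_mono) simp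
      then show ?thesis using True by (simp add: distrib_left mult.commute)
    next
      case False
      then show ?thesis by (auto simp: indicator_def)
    qed
  qed
  also have "... = (NNL t. ennreal (t powr (s - 1)) * indicator {0<..} t * ennreal (heat_form t h g)) + (NNL t. ennreal C * (ennreal (t powr (s - 1)) * indicator {0<..1} t))"
  proof (rule nn_integral_add)
    have "(\<lambda>t. heat_form t h g) \<in> borel_measurable borel" unfolding heat_form_def by measurable
    then show "(\<lambda>t. ennreal (t powr (s - 1)) * indicator {0<..} t * ennreal (heat_form t h g)) \<in> borel_measurable lborel" by measurable
  qed measurable
  also have "... = ennreal (Gamma s * energy s h g) + ennreal C * ennreal (1 / s)"
  proof (rule arg_cong2[where f = "(+)"])
    show "(NNL t. ennreal (t powr (s - 1)) * indicator {0<..} t * ennreal (heat_form t h g)) = ennreal (Gamma s * energy s h g)"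
      by (rule energy_time(1)[OF hL g s nn])
    show "(NNL t. ennreal C * (ennreal (t powr (s - 1)) * indicator {0<..1} t)) = ennreal C * ennreal (1 / s)"
      by (subst nn_integral_cmult) (auto simp: nn_integral_powr_0_1[OF s])
  qed
  also have "... = ennreal (Gamma s * energy s h g + C * (1 / s))"
    using e0 C s Gamma_real_pos[OF s] by (simp add: ennreal_mult[symmetric] ennreal_plus[symmetric] del: ennreal_plus)
  also have "C * (1 / s) = heat_sup TYPE('a) * d powr (- real DIM('a)) / s * ((\<integral>y. h y \<partial>M) * (\<integral>x. g x \<partial>M))"
    by (simp add: C_def)
  finally show "(\<integral>\<^sup>+x. \<integral>\<^sup>+y. ennreal (g x * h y) * time_kernel {0<..1} s (x - y) \<partial>lborel \<partial>lborel)
    <= ennreal (Gamma s * energy s h g + heat_sup TYPE('a) * d powr (- real DIM('a)) / s * ((\<integral>y. h y \<partial>M) * (\<integral>x. g x \<partial>M)))" .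
qed

end

section \<open>Energies of functions concentrated near the origin\<close>

definition bump :: "real => ('a::euclidean_space => real) => bool" where
  "bump r h \<longleftrightarrow> continuous_on UNIV h \<and> (\<forall>x. 0 <= h x) \<and> (\<forall>x. r <= norm x --> h x = 0)"

text \<open>For t > 1 the heat kernel is at most a multiple of t^(-n/2) uniformly in z, so the late
  times form a bounded kernel and contribute no more than a multiple of a squared mean.\<close>

lemma time_kernel_tail:
  fixes z :: "'a::euclidean_space"
  assumes "m < real DIM('a) / 2"
  shows "time_kernel {1<..} m z <= ennreal (4 powr (- (real DIM('a) / 2)) / gauss_Z TYPE('a) * (1 / (real DIM('a) / 2 - m)))"
proof -
  let ?n = "real DIM('a)"
  define K where "K = 4 powr (- (?n / 2)) / gauss_Z TYPE('a)"
  have K: "0 < K" by (simp add: K_def gauss_Z_pos)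
  have "time_kernel {1<..} m z <= (NNL t. ennreal K * (ennreal (t powr (m - 1 - ?n / 2)) * indicator {1<..} t))"
    unfolding time_kernel_def
  proof (rule nn_integral_mono)
    fix t :: real
    show "ennreal (t powr (m - 1) * heat_kernel t z) * indicator {1<..} t <= ennreal K * (ennreal (t powr (m - 1 - ?n / 2)) * indicator {1<..} t)"
    proof (cases "1 < t")
      case True
      then have "t powr (m - 1) * heat_kernel t z <= t powr (m - 1) * ((4 * t) powr (- (?n / 2)) / gauss_Z TYPE('a))"
        by (intro mult_left_mono heat_kernel_le) auto
      also have "... = K * t powr (m - 1 - ?n / 2)"
      proof -
        have "t powr (m - 1 - ?n / 2) = t powr (m - 1) * t powr (- (?n / 2))"
          by (simp only: powr_add[symmetric]) simp
        then show ?thesis by (simp add: K_def powr_mult)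
      qed
      finally show ?thesis using True K by (simp add: ennreal_mult[symmetric] ennreal_leI)
    qed simp
  qed
  also have "... = ennreal K * (NNL t. ennreal (t powr (m - 1 - ?n / 2)) * indicator {1<..} t)"
    by (rule nn_integral_cmult) measurable
  also have "... <= ennreal K * ennreal (1 / (- (m - 1 - ?n / 2) - 1))"
    using assms by (intro mult_left_mono nn_integral_powr_1_inf) auto
  also have "... = ennreal (K * (1 / (?n / 2 - m)))" using K assms by (simp add: ennreal_mult[symmetric])
  finally show ?thesis by (simp add: K_def)
qed

lemma time_kernel_split: "time_kernel {0<..} m z = time_kernel {0<..1} m z + time_kernel {1<..} m z"
  unfolding time_kernel_def
  by (subst nn_integral_add[symmetric]) (auto intro!: nn_integral_cong simp: indicator_def)

lemma time_kernel_measurable [measurable]: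
  assumes [measurable]: "I \<in> sets borel"
  shows "(\<lambda>z::'a::euclidean_space. time_kernel I m z) \<in> borel_measurable borel"
  unfolding time_kernel_def by measurable

text \<open>Quantifies the logarithmic divergence of |x|^(-n) at the origin: each dyadic annulus
  contributes at least the same amount, so the bound grows linearly in their number.\<close>

lemma ennreal_sum_annuli:
  fixes \<rho> :: real
  assumes "0 < \<rho>"
  shows "ennreal (real N * (unit_ball_vol (real DIM('a::euclidean_space)) * (1 - (1 / 2) ^ DIM('a))))
    <= (\<integral>\<^sup>+x. ennreal (norm x powr (- real DIM('a))) * indicator {x. \<rho> / 2 ^ N <= norm x \<and> norm x <= \<rho>} x \<partial>(lborel::'a measure))"
proof -
  let ?n = "real DIM('a)"
  let ?V = "unit_ball_vol ?n"
  have Vp: "0 < ?V" by simp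
  define R where "R k = \<rho> / 2 ^ k" for k :: nat
  have Rp: "0 < R k" for k using assms by (simp add: R_def)
  define An where "An k = cball (0::'a) (R k) - cball 0 (R (Suc k))" for k
  have An [measurable]: "An k \<in> sets borel" for k by (simp add: An_def)
  have RS: "R (Suc k) = R k / 2" for k by (simp add: R_def)
  have emA: "emeasure lborel (An k) = ennreal (?V * (1 - (1 / 2) ^ DIM('a)) * R k ^ DIM('a))" for k
  proof -
    have "emeasure lborel (An k) = emeasure lborel (cball (0::'a) (R k)) - emeasure lborel (cball (0::'a) (R (Suc k)))"
      unfolding An_def using Rp[of k] Rp[of "Suc k"] by (intro emeasure_Diff) (auto simp: RS emeasure_cball)
    also have "... = ennreal (?V * R k ^ DIM('a) - ?V * R (Suc k) ^ DIM('a))"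
      using Rp[of k] Rp[of "Suc k"] Vp by (simp add: emeasure_cball ennreal_minus[symmetric])
    also have "?V * R k ^ DIM('a) - ?V * R (Suc k) ^ DIM('a) = ?V * (1 - (1 / 2) ^ DIM('a)) * R k ^ DIM('a)"
      by (simp add: RS power_divide algebra_simps power_one_over)
    finally show ?thesis .
  qed
  have one: "R k powr (- ?n) * R k ^ DIM('a) = 1" for k
    using Rp[of k] by (simp add: powr_minus powr_realpow)
  have pw: "(\<Sum>k<N. ennreal (R k powr (- ?n)) * indicator (An k) x) <= ennreal (norm x powr (- ?n)) * indicator {x. \<rho> / 2 ^ N <= norm x \<and> norm x <= \<rho>} x" for x
  proof (cases "\<exists>k<N. x \<in> An k")
    case True
    then obtain k where k: "k < N" "x \<in> An k" by blast
    have Rmono: "R j <= R i" if "i <= j" for i j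
      unfolding R_def using that assms by (intro divide_left_mono power_increasing) auto
    have uniq: "x \<notin> An j" if "j \<noteq> k" for j
    proof (cases "j < k")
      case True
      then have "R k <= R (Suc j)" by (intro Rmono) simp
      then show ?thesis using k(2) by (auto simp: An_def)
    next
      case False
      then have "R j <= R (Suc k)" using that by (intro Rmono) simp
      then show ?thesis using k(2) by (auto simp: An_def)
    qed
    have "(\<Sum>k<N. ennreal (R k powr (- ?n)) * indicator (An k) x) = (\<Sum>j\<in>{k}. ennreal (R j powr (- ?n)) * indicator (An j) x)"
      using k uniq by (intro sum.mono_neutral_right) auto
    also have "... = ennreal (R k powr (- ?n))" using k by simp
    also have "... <= ennreal (norm x powr (- ?n))"
    proof (rule ennreal_leI, rule powr_mono2')
      show "norm x <= R k" using k by (simp add: An_def)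
      show "0 < norm x" using k Rp[of "Suc k"] by (auto simp: An_def)
    qed simp
    finally have le: "(\<Sum>k<N. ennreal (R k powr (- ?n)) * indicator (An k) x) <= ennreal (norm x powr (- ?n))" .
    have "norm x <= \<rho>" using k Rmono[of 0 k] by (simp add: An_def R_def)
    moreover have "\<rho> / 2 ^ N <= norm x" using k Rmono[of "Suc k" N] by (simp add: An_def R_def)
    ultimately show ?thesis using le by simp
  qed simp
  have "ennreal (real N * (?V * (1 - (1 / 2) ^ DIM('a)))) = (\<Sum>k<N. ennreal (?V * (1 - (1 / 2) ^ DIM('a))))"
  proof -
    have "(1 / 2 :: real) ^ DIM('a) <= 1" by (simp add: power_le_one)
    then have "0 <= ?V * (1 - (1 / 2) ^ DIM('a))" using Vp by (intro mult_nonneg_nonneg) auto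
    then show ?thesis by (simp add: ennreal_mult ennreal_of_nat_eq_real_of_nat)
  qed
  also have "... = (\<Sum>k<N. ennreal (R k powr (- ?n)) * emeasure lborel (An k))"
  proof (rule sum.cong[OF refl])
    fix k
    have "R k powr (- ?n) * (?V * (1 - (1 / 2) ^ DIM('a)) * R k ^ DIM('a)) = ?V * (1 - (1 / 2) ^ DIM('a)) * (R k powr (- ?n) * R k ^ DIM('a))"
      by (simp only: mult_ac)
    then have "?V * (1 - (1 / 2) ^ DIM('a)) = R k powr (- ?n) * (?V * (1 - (1 / 2) ^ DIM('a)) * R k ^ DIM('a))"
      by (simp only: one mult_1_right)
    then show "ennreal (?V * (1 - (1 / 2) ^ DIM('a))) = ennreal (R k powr (- ?n)) * emeasure lborel (An k)"
      unfolding emA by (metis ennreal_mult' powr_ge_zero)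
  qed
  also have "... = (NNL x. (\<Sum>k<N. ennreal (R k powr (- ?n)) * indicator (An k) x))"
    by (subst nn_integral_sum) (auto simp: nn_integral_cmult_indicator)
  also have "... <= (\<integral>\<^sup>+x. ennreal (norm x powr (- ?n)) * indicator {x. \<rho> / 2 ^ N <= norm x \<and> norm x <= \<rho>} x \<partial>(lborel::'a measure))"
    by (intro nn_integral_mono pw)
  finally show ?thesis .
qed

context dirichlet_system
begin

lemma bump_L2: "bump r h ==> L2 M h"
proof -
  assume h: "bump r h"
  then have c: "continuous_on UNIV h" by (simp add: bump_def)
  have "compact (h ` cball 0 r)" using c by (intro compact_continuous_image) (auto intro: continuous_on_subset)
  then have "bounded (h ` cball 0 r)" by (rule compact_imp_bounded)
  then obtain B where "\<forall>x\<in>cball 0 r. \<bar>h x\<bar> <= B" unfolding bounded_iff by auto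
  then have B: "\<And>x. norm x <= r ==> \<bar>h x\<bar> <= B" by auto
  have "\<bar>h x\<bar> <= max B 0" for x
    using B[of x] h by (cases "norm x <= r") (auto simp: bump_def)
  then show "L2 M h" using c by (intro bounded_L2 borel_measurable_M borel_measurable_continuous_onI)
qed

lemma ennreal_integral_M:
  assumes "f \<in> borel_measurable borel" "\<And>x. 0 <= f x" "\<And>x. x \<notin> \<Omega> ==> f x = 0" "integrable M f"
  shows "ennreal (\<integral>x. f x \<partial>M) = (NNL x. ennreal (f x))"
proof -
  have "ennreal (\<integral>x. f x \<partial>M) = (\<integral>\<^sup>+x. ennreal (f x) \<partial>M)"
    using assms by (intro nn_integral_eq_integral[symmetric]) auto
  also have "... = (NNL x. ennreal (f x))" by (rule nn_integral_M_lborel) (simp add: assms)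
  finally show ?thesis .
qed

lemma bump_in_dom:
  assumes "cball 0 (2 * \<rho>) \<subseteq> \<Omega>" "bump r h" "r <= \<rho>" "0 < r"
  shows "\<And>y z. h y \<noteq> 0 ==> z \<in> frontier \<Omega> ==> \<rho> <= norm (z - y)" "\<And>y. y \<notin> \<Omega> ==> h y = 0"
proof -
  fix y z assume y: "h y \<noteq> 0" and z: "z \<in> frontier \<Omega>"
  have "z \<notin> \<Omega>" using z open_dom by (simp add: frontier_def interior_open)
  then have "2 * \<rho> < norm z" using assms(1) by (force simp: not_le)
  moreover have "norm y < r" using y assms(2) by (force simp: bump_def)
  ultimately show "\<rho> <= norm (z - y)" using assms(3) norm_triangle_ineq2[of z y] by linarith
next
  fix y assume "y \<notin> \<Omega>"
  then have "2 * \<rho> < norm y" using assms(1) by (force simp: not_le)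
  then have "r <= norm y" using assms(3,4) by linarith
  then show "h y = 0" using assms(2) by (simp add: bump_def)
qed

text \<open>C collects the two losses: C0 from the boundary at times up to 1 and K from the late
  times of the Riesz kernel. It is fixed by \<open>\<rho>\<close> before the radius r is chosen, and
  therefore can be beaten by shrinking r.\<close>

lemma energy_bump_ge:
  assumes \<rho>: "0 < \<rho>" "cball 0 (2 * \<rho>) \<subseteq> \<Omega>" and m: "0 < m" "m < real DIM('a) / 2" and c: "0 < c"
    and tk: "\<And>z::'a. z \<noteq> 0 ==> time_kernel {0<..} m z = ennreal (c * norm z powr (- a))"
  shows "\<exists>C\<ge>0. \<forall>r h. 0 < r \<and> r <= \<rho> \<and> bump r h -->
    ennreal c * riesz a h h <= ennreal (Gamma m * energy m h h + C * (\<integral>x. h x \<partial>M)\<^sup>2)"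
proof -
  define K where "K = 4 powr (- (real DIM('a) / 2)) / gauss_Z TYPE('a) * (1 / (real DIM('a) / 2 - m))"
  have K: "0 <= K" using m gauss_Z_pos[where 'a = 'a] by (simp add: K_def)
  define C0 where "C0 = heat_sup TYPE('a) * \<rho> powr (- real DIM('a)) / m"
  have C0: "0 <= C0" using m heat_sup_pos[where 'a = 'a] by (simp add: C0_def)
  show ?thesis
  proof (intro exI[of _ "C0 + K"] conjI allI impI)
    show "0 <= C0 + K" using K C0 by simp
    fix r and h :: "'a => real" assume "0 < r \<and> r <= \<rho> \<and> bump r h"
    then have r: "0 < r" "r <= \<rho>" and h: "bump r h" by auto
    have hc: "continuous_on UNIV h" and h0: "\<And>x. 0 <= h x" using h by (auto simp: bump_def)
    have hb [measurable]: "h \<in> borel_measurable borel" using hc by (rule borel_measurable_continuous_onI)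
    note hO = bump_in_dom[OF \<rho>(2) h r(2) r(1)]
    note hL = bump_L2[OF h]
    define X where "X = (\<integral>x. h x \<partial>M)"
    have X0: "0 <= X" unfolding X_def using h0 by (intro integral_nonneg_AE) auto
    have X: "(NNL x. ennreal (h x)) = ennreal X"
      unfolding X_def using ennreal_integral_M[OF hb h0 hO(2) L2_int[OF hL]] by simp
    note ge = energy_ge_time_kernel[OF hc h0 \<rho>(1) hO(1) hO(2) hL hL h0 hO(2) hb m(1)]
    have "ennreal c * riesz a h h = (\<integral>\<^sup>+x. \<integral>\<^sup>+y. ennreal c * ennreal (h x * h y * norm (x - y) powr (- a)) \<partial>lborel \<partial>lborel)"
      unfolding riesz_def by (subst nn_integral_cmult[symmetric], measurable) (intro nn_integral_cong nn_integral_cmult[symmetric], measurable)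
    also have "... <= (\<integral>\<^sup>+x. \<integral>\<^sup>+y. ennreal (h x * h y) * time_kernel {0<..1} m (x - y) + ennreal K * ennreal (h x) * ennreal (h y) \<partial>lborel \<partial>lborel)"
    proof (rule nn_integral_mono, rule nn_integral_mono_AE)
      fix x :: 'a
      show "AE y in lborel. ennreal c * ennreal (h x * h y * norm (x - y) powr (- a)) <= ennreal (h x * h y) * time_kernel {0<..1} m (x - y) + ennreal K * ennreal (h x) * ennreal (h y)"
        using AE_lborel_singleton[of x]
      proof eventually_elim
        case (elim y)
        have "ennreal c * ennreal (h x * h y * norm (x - y) powr (- a)) = ennreal (h x * h y) * ennreal (c * norm (x - y) powr (- a))"
          using c h0 by (simp add: ennreal_mult[symmetric] mult_ac)
        also have "... = ennreal (h x * h y) * (time_kernel {0<..1} m (x - y) + time_kernel {1<..} m (x - y))"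
          using tk[of "x - y"] elim by (simp add: time_kernel_split)
        also have "... <= ennreal (h x * h y) * (time_kernel {0<..1} m (x - y) + ennreal K)"
          unfolding K_def by (intro mult_left_mono add_left_mono time_kernel_tail m) auto
        also have "... = ennreal (h x * h y) * time_kernel {0<..1} m (x - y) + ennreal K * ennreal (h x) * ennreal (h y)"
          using h0 K by (simp add: distrib_left ennreal_mult mult_ac)
        finally show ?case .
      qed
    qed
    also have "... = (NNL x. (NNL y. ennreal (h x * h y) * time_kernel {0<..1} m (x - y)) + (NNL y. ennreal K * ennreal (h x) * ennreal (h y)))"
      by (intro nn_integral_cong nn_integral_add) measurable
    also have "... = (\<integral>\<^sup>+x. \<integral>\<^sup>+y. ennreal (h x * h y) * time_kernel {0<..1} m (x - y) \<partial>lborel \<partial>lborel) + (\<integral>\<^sup>+x. \<integral>\<^sup>+y. ennreal K * ennreal (h x) * ennreal (h y) \<partial>lborel \<partial>lborel)"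
      by (rule nn_integral_add) measurable
    also have "(\<integral>\<^sup>+x. \<integral>\<^sup>+y. ennreal K * ennreal (h x) * ennreal (h y) \<partial>lborel \<partial>lborel) = ennreal (K * X\<^sup>2)"
      using K X0 by (simp add: nn_integral_cmult nn_integral_multc X ennreal_mult[symmetric] power2_eq_square mult_ac)
    also have "(\<integral>\<^sup>+x. \<integral>\<^sup>+y. ennreal (h x * h y) * time_kernel {0<..1} m (x - y) \<partial>lborel \<partial>lborel)
        <= ennreal (Gamma m * energy m h h + C0 * X\<^sup>2)"
      using ge(1) by (simp add: C0_def X_def power2_eq_square)
    also have "ennreal (Gamma m * energy m h h + C0 * X\<^sup>2) + ennreal (K * X\<^sup>2) = ennreal (Gamma m * energy m h h + (C0 + K) * X\<^sup>2)"
      using ge(2) C0 K Gamma_real_pos[OF m(1)] by (simp add: ennreal_plus[symmetric] distrib_right del: ennreal_plus)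
    finally show "ennreal c * riesz a h h <= ennreal (Gamma m * energy m h h + (C0 + K) * (\<integral>x. h x \<partial>M)\<^sup>2)"
      by (simp add: X_def add_right_mono)
  qed
qed

text \<open>Inside a ball of radius r the kernel is at least of order -ln(r^2), which for small r
  exceeds any prescribed multiple together with the boundary loss C0.\<close>

lemma energy_bump_log:
  assumes \<rho>: "0 < \<rho>" "cball 0 (2 * \<rho>) \<subseteq> \<Omega>" and s: "0 < s" "s <= real DIM('a) / 2"
  shows "\<exists>r0>0. r0 <= \<rho> \<and> (\<forall>r h. 0 < r \<and> r <= r0 \<and> bump r h --> K * (\<integral>x. h x \<partial>M)\<^sup>2 <= energy s h h)"
proof -
  define C0 where "C0 = heat_sup TYPE('a) * \<rho> powr (- real DIM('a)) / s"
  have C0: "0 <= C0" using s heat_sup_pos[where 'a = 'a] by (simp add: C0_def)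
  define k where "k = exp (-1) * 4 powr (- (real DIM('a) / 2)) / gauss_Z TYPE('a)"
  have k: "0 < k" by (simp add: k_def gauss_Z_pos)
  define G where "G = Gamma s"
  have G: "0 < G" using Gamma_real_pos[OF s(1)] by (simp add: G_def)
  define L where "L = (\<bar>K\<bar> * G + C0) / k"
  have L: "0 <= L" using C0 k G by (simp add: L_def)
  \<comment> \<open>For r up to this value -ln(r^2) >= L, so that the kernel bound reaches |K| G +
    C0. The additional -1 in the exponent forces r < 1 even if L = 0.\<close>
  define r0 where "r0 = min \<rho> (exp (- L / 2 - 1))"
  have r0: "0 < r0" "r0 <= \<rho>" using \<rho> by (auto simp: r0_def)
  show ?thesis
  proof (intro exI[of _ r0] conjI allI impI r0)
    fix r and h :: "'a => real" assume "0 < r \<and> r <= r0 \<and> bump r h"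
    then have r: "0 < r" "r <= r0" and h: "bump r h" by auto
    have rr: "r <= \<rho>" using r r0 by simp
    have "r <= exp (- L / 2 - 1)" using r by (simp add: r0_def)
    then have "ln r <= ln (exp (- L / 2 - 1))" using r(1) by (subst ln_le_cancel_iff) auto
    then have lnr: "ln r <= - L / 2 - 1" by simp
    have "ln r < 0" using lnr L by simp
    then have r1: "r < 1" using r(1) by simp
    have hc: "continuous_on UNIV h" and h0: "\<And>x. 0 <= h x" using h by (auto simp: bump_def)
    have hb [measurable]: "h \<in> borel_measurable borel" using hc by (rule borel_measurable_continuous_onI)
    note hO = bump_in_dom[OF \<rho>(2) h rr r(1)]
    note hL = bump_L2[OF h]
    define X where "X = (\<integral>x. h x \<partial>M)"
    have X0: "0 <= X" unfolding X_def using h0 by (intro integral_nonneg_AE) auto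
    have X: "(NNL x. ennreal (h x)) = ennreal X"
      unfolding X_def using ennreal_integral_M[OF hb h0 hO(2) L2_int[OF hL]] by simp
    note ge = energy_ge_time_kernel[OF hc h0 \<rho>(1) hO(1) hO(2) hL hL h0 hO(2) hb s(1)]
    have e0: "0 <= energy s h h" by (rule ge(2))
    define q where "q = k * (- ln (r\<^sup>2))"
    have q0: "0 <= q" unfolding q_def using k r(1) \<open>ln r < 0\<close> by (intro mult_nonneg_nonneg) (auto simp: ln_realpow)
    have "ennreal (q * X\<^sup>2) = (\<integral>\<^sup>+x. \<integral>\<^sup>+y. ennreal q * ennreal (h x) * ennreal (h y) \<partial>lborel \<partial>lborel)"
      using q0 X0 by (simp add: nn_integral_cmult nn_integral_multc X ennreal_mult[symmetric] power2_eq_square mult_ac)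
    also have "... <= (\<integral>\<^sup>+x. \<integral>\<^sup>+y. ennreal (h x * h y) * time_kernel {0<..1} s (x - y) \<partial>lborel \<partial>lborel)"
    proof (rule nn_integral_mono, rule nn_integral_mono)
      fix x y :: 'a
      show "ennreal q * ennreal (h x) * ennreal (h y) <= ennreal (h x * h y) * time_kernel {0<..1} s (x - y)"
      proof (cases "norm x < r \<and> norm y < r")
        case True
        then have "norm (x - y) <= 2 * r" using norm_triangle_ineq4[of x y] by linarith
        then have "ennreal q <= time_kernel {0<..1} s (x - y)"
          unfolding q_def k_def time_kernel_def using r r1 s by (intro heat_kernel_log_lower) auto
        then have "ennreal (h x * h y) * ennreal q <= ennreal (h x * h y) * time_kernel {0<..1} s (x - y)"
          by (rule mult_left_mono) simp
        then show ?thesis using h0 by (simp add: ennreal_mult mult_ac)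
      next
        case False
        then have "h x = 0 \<or> h y = 0" using h by (auto simp: bump_def not_less)
        then show ?thesis by auto
      qed
    qed
    also have "... <= ennreal (G * energy s h h + C0 * X\<^sup>2)"
      using ge(1) by (simp add: C0_def X_def power2_eq_square G_def)
    finally have 1: "q * X\<^sup>2 <= G * energy s h h + C0 * X\<^sup>2"
      using e0 C0 G by (subst (asm) ennreal_le_iff) auto
    have "L <= - ln (r\<^sup>2)" using lnr r by (simp add: ln_realpow)
    then have "k * L <= q" unfolding q_def using k by (intro mult_left_mono) auto
    then have "\<bar>K\<bar> * G + C0 <= q" using k by (simp add: L_def)
    then have "(\<bar>K\<bar> * G + C0) * X\<^sup>2 <= q * X\<^sup>2" by (intro mult_right_mono) auto
    with 1 have "G * (\<bar>K\<bar> * X\<^sup>2) <= G * energy s h h" by (simp add: algebra_simps)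
    then have "\<bar>K\<bar> * X\<^sup>2 <= energy s h h" using G by simp
    moreover have "K * X\<^sup>2 <= \<bar>K\<bar> * X\<^sup>2" by (intro mult_right_mono) auto
    ultimately show "K * (\<integral>x. h x \<partial>M)\<^sup>2 <= energy s h h" by (simp add: X_def)
  qed
qed

text \<open>Seen from |x| >= 2 r the potential of h is bounded below like that of a point mass at 0,
  by a multiple of |x|^(2m - n) times the integral of h. The bound is stated after testing with g,
  the form in which the energy comparison delivers it; k and R do not depend on r.\<close>

lemma energy_bump_weighted:
  assumes \<rho>: "0 < \<rho>" "cball 0 (2 * \<rho>) \<subseteq> \<Omega>" and m: "0 < m" "m < real DIM('a) / 2"
  shows "\<exists>k>0. \<exists>R>0. R <= \<rho> \<and> R <= 1 \<and> (\<forall>r h g. 0 < r \<and> r <= \<rho> \<and> bump r h \<and> g \<in> borel_measurable borel \<and> (\<forall>x. 0 <= g x) \<and> L2 M g \<and>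
     integrable M (\<lambda>x. g x * norm x powr (- (real DIM('a) - 2 * m))) \<and>
     (\<forall>x. g x \<noteq> 0 --> 2 * r <= norm x \<and> norm x <= R) -->
     k * ((\<integral>x. h x \<partial>M) * (\<integral>x. g x * norm x powr (- (real DIM('a) - 2 * m)) \<partial>M)) <= energy m h g)"
proof -
  let ?n = "real DIM('a)"
  define a where "a = ?n - 2 * m"
  have a: "0 < a" using m by (simp add: a_def)
  define C0 where "C0 = heat_sup TYPE('a) * \<rho> powr (- ?n) / m"
  have C0: "0 < C0" using m heat_sup_pos[where 'a = 'a] \<rho> by (simp add: C0_def)
  define c where "c = exp (-1) * 4 powr (- (?n / 2)) / gauss_Z TYPE('a) * 2 powr (m - 1 - ?n / 2)"
  have c: "0 < c" by (simp add: c_def gauss_Z_pos)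
  define G where "G = Gamma m"
  have G: "0 < G" using Gamma_real_pos[OF m(1)] by (simp add: G_def)
  \<comment> \<open>The last bound makes the boundary loss at most half of the main term: on the
    support of g one has 1 <= R^a |x|^(-a), so C0 times the integral of g is at most c/2 times the
    integral of g |x|^(-a).\<close>
  define R where "R = min (min \<rho> (1 / 2)) ((c / (2 * C0)) powr (1 / a))"
  have R: "0 < R" "R <= \<rho>" "R <= 1 / 2" "R <= (c / (2 * C0)) powr (1 / a)" using \<rho> c C0 by (auto simp: R_def)
  have Ra: "C0 * R powr a <= c / 2"
  proof -
    have "R powr a <= ((c / (2 * C0)) powr (1 / a)) powr a" using R a by (intro powr_mono2) auto
    also have "... = c / (2 * C0)" using a c C0 by (simp add: powr_powr)
    finally show ?thesis using C0 by (simp add: field_simps)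
  qed
  define k where "k = c / (2 * G)"
  have k: "0 < k" using c G by (simp add: k_def)
  have "k * ((\<integral>x. h x \<partial>M) * (\<integral>x. g x * norm x powr (- a) \<partial>M)) <= energy m h g"
    if r: "0 < r" "r <= \<rho>" and h: "bump r h" and gb [measurable]: "g \<in> borel_measurable borel" and g0: "\<And>x. 0 <= g x" and gL: "L2 M g"
      and gi: "integrable M (\<lambda>x. g x * norm x powr (- a))"
      and gs: "\<And>x. g x \<noteq> 0 ==> 2 * r <= norm x \<and> norm x <= R" for r and h g :: "'a => real"
  proof -
    have hc: "continuous_on UNIV h" and h0: "\<And>x. 0 <= h x" using h by (auto simp: bump_def)
    have hb [measurable]: "h \<in> borel_measurable borel" using hc by (rule borel_measurable_continuous_onI)
    note hO = bump_in_dom[OF \<rho>(2) h r(2) r(1)]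
    note hL = bump_L2[OF h]
    have gO: "g x = 0" if "x \<notin> \<Omega>" for x
    proof (rule ccontr)
      assume "g x \<noteq> 0"
      then have "norm x <= 2 * \<rho>" using gs[of x] R \<rho>(1) by linarith
      then show False using that \<rho>(2) by (auto simp: subset_iff)
    qed
    define X where "X = (\<integral>x. h x \<partial>M)"
    have X0: "0 <= X" unfolding X_def using h0 by (intro integral_nonneg_AE) auto
    have X: "(NNL x. ennreal (h x)) = ennreal X"
      unfolding X_def using ennreal_integral_M[OF hb h0 hO(2) L2_int[OF hL]] by simp
    define W where "W = (\<integral>x. g x * norm x powr (- a) \<partial>M)"
    have W0: "0 <= W" unfolding W_def using g0 by (intro integral_nonneg_AE) auto
    have W: "(NNL x. ennreal (g x * norm x powr (- a))) = ennreal W"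
      unfolding W_def by (rule ennreal_integral_M[symmetric]) (use g0 gO gi in auto)
    have Y: "(\<integral>x. g x \<partial>M) <= R powr a * W"
    proof -
      have "(\<integral>x. g x \<partial>M) <= (\<integral>x. R powr a * (g x * norm x powr (- a)) \<partial>M)"
      proof (rule integral_mono[OF L2_int[OF gL]])
        show "integrable M (\<lambda>x. R powr a * (g x * norm x powr (- a)))" using gi by simp
        fix x
        show "g x <= R powr a * (g x * norm x powr (- a))"
        proof (cases "g x = 0")
          case False
          have nx: "0 < norm x" "norm x <= R" using gs[OF False] r(1) by auto
          have "norm x powr a * norm x powr (- a) <= R powr a * norm x powr (- a)"
            using nx a by (intro mult_right_mono powr_mono2) auto
          moreover have "norm x powr a * norm x powr (- a) = 1" using nx by (simp add: powr_add[symmetric])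
          ultimately have "g x * 1 <= g x * (R powr a * norm x powr (- a))" using g0[of x] by (intro mult_left_mono) auto
          then show ?thesis by (simp add: mult_ac)
        qed simp
      qed
      then show ?thesis by (simp add: W_def)
    qed
    note ge = energy_ge_time_kernel[OF hc h0 \<rho>(1) hO(1) hO(2) hL gL g0 gO gb m(1)]
    have "ennreal (c * (X * W)) = (\<integral>\<^sup>+x. \<integral>\<^sup>+y. ennreal c * ennreal (g x * norm x powr (- a)) * ennreal (h y) \<partial>lborel \<partial>lborel)"
      using c X0 W0 by (simp add: nn_integral_cmult nn_integral_multc X W ennreal_mult[symmetric] mult_ac)
    also have "... <= (\<integral>\<^sup>+x. \<integral>\<^sup>+y. ennreal (g x * h y) * time_kernel {0<..1} m (x - y) \<partial>lborel \<partial>lborel)"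
    proof (rule nn_integral_mono, rule nn_integral_mono)
      fix x y :: 'a
      show "ennreal c * ennreal (g x * norm x powr (- a)) * ennreal (h y) <= ennreal (g x * h y) * time_kernel {0<..1} m (x - y)"
      proof (cases "g x = 0 \<or> h y = 0")
        case False
        then have x: "2 * r <= norm x" "norm x <= R" and y: "norm y < r" using gs[of x] h by (auto simp: bump_def not_le[symmetric])
        have "norm (x - y) <= 2 * norm x" using norm_triangle_ineq4[of x y] x y r by linarith
        moreover have "0 < norm x" using x r by linarith
        moreover have "2 * (norm x)\<^sup>2 <= 1"
        proof -
          have "(norm x)\<^sup>2 <= (1 / 2)\<^sup>2" using x R by (intro power_mono) auto
          then show ?thesis by (simp add: power2_eq_square)
        qed
        ultimately have "ennreal (c * norm x powr (2 * m - ?n)) <= time_kernel {0<..1} m (x - y)"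
          unfolding c_def time_kernel_def using m by (intro heat_kernel_local_lower) auto
        then have "ennreal (g x * h y) * ennreal (c * norm x powr (- a)) <= ennreal (g x * h y) * time_kernel {0<..1} m (x - y)"
          by (intro mult_left_mono) (auto simp: a_def)
        then show ?thesis using h0 g0 c by (simp add: ennreal_mult[symmetric] mult_ac)
      qed auto
    qed
    also have "... <= ennreal (G * energy m h g + C0 * (X * (\<integral>x. g x \<partial>M)))"
      using ge(1) by (simp add: C0_def X_def G_def)
    finally have "c * (X * W) <= G * energy m h g + C0 * (X * (\<integral>x. g x \<partial>M))"
      using ge(2) C0 G X0 g0 by (subst (asm) ennreal_le_iff) (auto intro!: add_nonneg_nonneg mult_nonneg_nonneg integral_nonneg_AE)
    also have "C0 * (X * (\<integral>x. g x \<partial>M)) <= C0 * (X * (R powr a * W))"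
      using C0 X0 by (intro mult_left_mono Y) auto
    also have "... = C0 * R powr a * (X * W)" by (simp add: mult_ac)
    also have "... <= c / 2 * (X * W)" using Ra X0 W0 by (intro mult_right_mono) auto
    finally have "c / 2 * (X * W) <= G * energy m h g" by (simp add: field_simps)
    then show ?thesis using G by (simp add: k_def X_def W_def field_simps)
  qed
  then show ?thesis using k R unfolding a_def by (intro exI[of _ k] conjI exI[of _ R]) auto
qed

end

section \<open>The strict inequality below the Sobolev constant\<close>

lemma series_Cauchy_Schwarz:
  fixes f g :: "nat => real"
  assumes f: "summable (\<lambda>j. (f j)\<^sup>2)" and g: "summable (\<lambda>j. (g j)\<^sup>2)" and T: "(\<lambda>j. f j * g j) sums T"
  shows "T\<^sup>2 <= (\<Sum>j. (f j)\<^sup>2) * (\<Sum>j. (g j)\<^sup>2)"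
proof -
  have "(\<lambda>N. (\<Sum>j<N. f j * g j)\<^sup>2) \<longlonglongrightarrow> T\<^sup>2" using T unfolding sums_def by (rule tendsto_power)
  moreover have "(\<Sum>j<N. f j * g j)\<^sup>2 <= (\<Sum>j. (f j)\<^sup>2) * (\<Sum>j. (g j)\<^sup>2)" for N
  proof -
    have "(\<Sum>j<N. f j * g j)\<^sup>2 <= (\<Sum>j<N. (f j)\<^sup>2) * (\<Sum>j<N. (g j)\<^sup>2)" by (rule Cauchy_Schwarz_ineq_sum)
    also have "... <= (\<Sum>j. (f j)\<^sup>2) * (\<Sum>j. (g j)\<^sup>2)"
      using f g by (intro mult_mono sum_le_suminf sum_nonneg suminf_nonneg) auto
    finally show ?thesis .
  qed
  ultimately show ?thesis by (intro LIMSEQ_le_const2) auto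
qed

section \<open>The Sobolev inequality by duality\<close>

locale critical_system = dirichlet_system \<Omega> lam phi
  for \<Omega> :: "'a::euclidean_space set" and lam phi +
  fixes m :: real
  assumes m_pos: "0 < m" and m_less: "m < real DIM('a) / 2" and zero_in: "0 \<in> \<Omega>"
begin

text \<open>The Riesz exponent n - 2m; of the two exponents that follow, \<open>cq\<close> is the
  critical exponent 2n/(n - 2m) and \<open>cp\<close> its conjugate 2n/(n + 2m).\<close>

definition ca where "ca = real DIM('a) - 2 * m"
definition cp where "cp = 2 * real DIM('a) / (2 * real DIM('a) - ca)"
definition cq where "cq = 2 * real DIM('a) / ca"

lemma exps: "0 < ca" "ca < real DIM('a)" "1 < cp" "2 < cq" "1 / cp + 1 / cq = 1" "(cq - 1) * cp = cq" "2 - 2 / cp = 2 / cq"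
proof -
  let ?n = "real DIM('a)"
  show a: "0 < ca" "ca < ?n" using m_pos m_less by (auto simp: ca_def)
  have n: "0 < ?n" by simp
  show "1 < cp" using a by (simp add: cp_def)
  show "2 < cq" using a by (simp add: cq_def field_simps)
  have p: "1 / cp = 1 - ca / (2 * ?n)" using a by (simp add: cp_def field_simps)
  have q: "1 / cq = ca / (2 * ?n)" by (simp add: cq_def)
  show "1 / cp + 1 / cq = 1" unfolding p q by simp
  then show "2 - 2 / cp = 2 / cq" by simp
  have "cq - 1 = (2 * ?n - ca) / ca" using a by (simp add: cq_def field_simps)
  then show "(cq - 1) * cp = cq" using a by (simp add: cp_def cq_def)
qed

lemma crit_exp_eq: "crit_exp DIM('a) m = cq"
  by (simp add: crit_exp_def cq_def ca_def)

definition hA where "hA = enn2real (riesz_sup TYPE('a) ca cp)"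

lemma hA: "riesz_sup TYPE('a) ca cp = ennreal hA" "0 < hA"
proof -
  obtain A where A: "0 < A" "riesz_sup TYPE('a) ca cp = ennreal A"
    using riesz_sup_pos_finite[OF exps(1,2) cp_def] .
  then have "hA = A" by (simp add: hA_def)
  then show "riesz_sup TYPE('a) ca cp = ennreal hA" "0 < hA" using A by auto
qed

definition hc where "hc = (SOME c. 0 < c \<and> (\<forall>z::'a. z \<noteq> 0 --> time_kernel {0<..} m z = ennreal (c * norm z powr (- ca))))"

lemma hc: "0 < hc" "(z::'a) \<noteq> 0 ==> time_kernel {0<..} m z = ennreal (hc * norm z powr (- ca))"
proof -
  have "\<exists>c>0. \<forall>z::'a. z \<noteq> 0 --> time_kernel {0<..} m z = ennreal (c * norm z powr (- ca))"
    unfolding time_kernel_def ca_def by (rule heat_kernel_time_integral[OF m_pos m_less])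
  then have "0 < hc \<and> (\<forall>z::'a. z \<noteq> 0 --> time_kernel {0<..} m z = ennreal (hc * norm z powr (- ca)))"
    unfolding hc_def by (rule someI_ex[of "\<lambda>c. 0 < c \<and> _ c", unfolded Bex_def])
  then show "0 < hc" "z \<noteq> 0 ==> time_kernel {0<..} m z = ennreal (hc * norm z powr (- ca))" by auto
qed

text \<open>The Sobolev constant obtained by duality: Gamma(m) times the energy of order -m is at
  most \<open>hc\<close> times the Riesz energy, whose sharp constant is \<open>hA\<close>. It
  depends on n and m only, not on the domain.\<close>

definition sob where "sob = Gamma m / (hc * hA)"

lemma sob_pos: "0 < sob"
  using Gamma_real_pos[OF m_pos] hc(1) hA(2) by (simp add: sob_def)

definition ddom :: "real => ('a => real) => bool" where "ddom t u = form_dom \<Omega> lam phi t u"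
definition QQ :: "real => ('a => real) => real" where "QQ t u = Qform \<Omega> lam phi t u"

lemma ddom_iff: "ddom t u \<longleftrightarrow> L2 M u \<and> summable (\<lambda>j. lam j powr t * (ip M u (phi j))\<^sup>2)"
  unfolding ddom_def form_dom_def L2_on_eq fcoeff_eq ..

lemma QQ_eq: "QQ t u = (\<Sum>j. lam j powr t * (ip M u (phi j))\<^sup>2)"
  unfolding QQ_def Qform_def fcoeff_eq ..

lemma QQ_nonneg: "ddom t u ==> 0 <= QQ t u"
  unfolding QQ_eq ddom_iff by (intro suminf_nonneg) auto

text \<open>Riesz energies are integrals of Borel functions over the whole space, whereas elements
  of the form domain are Lebesgue measurable on the domain; this representative mediates between the
  two.\<close>

lemma borel_representative:
  assumes "u \<in> borel_measurable M"
  obtains v :: "'a => real" where "v \<in> borel_measurable borel" "\<And>x. x \<notin> \<Omega> ==> v x = 0" "AE x in M. u x = v x"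
proof -
  have "(\<lambda>x. indicator \<Omega> x * u x) \<in> borel_measurable (completion lborel)"
    using assms unfolding measurable_M_set set_borel_measurable_def by simp
  from completion_ex_borel_measurable_real[OF this] obtain v0 where v0: "v0 \<in> borel_measurable lborel"
    "AE x in lborel. indicator \<Omega> x * u x = v0 x" by blast
  define v where "v x = indicator \<Omega> x * v0 x" for x
  have "v \<in> borel_measurable borel" unfolding v_def using v0(1) by measurable
  moreover have "v x = 0" if "x \<notin> \<Omega>" for x using that by (simp add: v_def)
  moreover have "AE x in lebesgue. indicator \<Omega> x * u x = v0 x" using v0(2) by (rule AE_completion)
  then have "AE x in M. u x = v x" unfolding AE_M_iff by eventually_elim (auto simp: v_def)
  ultimately show ?thesis using that by blast
qed

lemma ip_cong_AE:
  assumes "u \<in> borel_measurable M" "v \<in> borel_measurable M" "g \<in> borel_measurable M" "AE x in M. u x = v x"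
  shows "ip M u g = ip M v g"
  unfolding ip_def using assms by (intro integral_cong_AE) auto

text \<open>Cauchy-Schwarz on the coefficients with the weights lam^(m/2) and lam^(-m/2), after
  Parseval.\<close>

lemma ip_energy_bound:
  assumes u: "ddom m u" and g: "L2 M g"
  shows "(ip M u g)\<^sup>2 <= QQ m u * energy m g g"
proof -
  let ?f = "\<lambda>j. lam j powr (m / 2) * ip M u (phi j)"
  let ?g = "\<lambda>j. lam j powr (- (m / 2)) * ip M g (phi j)"
  have f2: "(?f j)\<^sup>2 = lam j powr m * (ip M u (phi j))\<^sup>2" for j
    by (simp add: power_mult_distrib power2_eq_square[of "_ powr _"] powr_add[symmetric])
  have g2: "(?g j)\<^sup>2 = lam j powr (- m) * (ip M g (phi j) * ip M g (phi j))" for j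
    by (simp add: power_mult_distrib power2_eq_square powr_add[symmetric])
  have fg: "?f j * ?g j = ip M u (phi j) * ip M g (phi j)" for j
  proof -
    have "lam j powr (m / 2) * lam j powr (- (m / 2)) = 1" using lam_pos[of j] by (simp add: powr_add[symmetric])
    then show ?thesis by (simp add: mult_ac)
  qed
  have uL: "L2 M u" using u by (simp add: ddom_iff)
  have "(ip M u g)\<^sup>2 <= (\<Sum>j. (?f j)\<^sup>2) * (\<Sum>j. (?g j)\<^sup>2)"
  proof (rule series_Cauchy_Schwarz)
    show "summable (\<lambda>j. (?f j)\<^sup>2)" using u unfolding f2 ddom_iff by simp
    show "summable (\<lambda>j. (?g j)\<^sup>2)" unfolding g2 using energy_sums[OF g g, of m] m_pos by (simp add: sums_iff)
    show "(\<lambda>j. ?f j * ?g j) sums ip M u g" unfolding fg by (rule parseval[OF uL g])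
  qed
  then show ?thesis unfolding f2 g2 QQ_eq energy_def .
qed

text \<open>u is tested with its sign times |u|^(q - 1). Truncation at level k keeps the test
  function bounded and its power integral I finite, so that I can be divided out of I^2 <= (QQ/sob)
  I^(2/p); Fatou's lemma then removes the truncation and yields the integrability of |u|^q.\<close>

lemma sobolev:
  assumes u: "ddom m u"
  shows "integrable M (\<lambda>x. \<bar>u x\<bar> powr cq)" "sob * (\<integral>x. \<bar>u x\<bar> powr cq \<partial>M) powr (2 / cq) <= QQ m u"
proof -
  have uL: "L2 M u" using u by (simp add: ddom_iff)
  have um [measurable]: "u \<in> borel_measurable M" by (rule L2D(1)[OF uL])
  obtain v where vb [measurable]: "v \<in> borel_measurable borel" and vO: "\<And>x. x \<notin> \<Omega> ==> v x = 0" and uv: "AE x in M. u x = v x"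
    using borel_representative[OF um] by blast
  have vm [measurable]: "v \<in> borel_measurable M" using vb by (rule borel_measurable_M)
  define B where "B = (QQ m u / sob) powr (cq / 2)"
  have Q0: "0 <= QQ m u" by (rule QQ_nonneg[OF u])
  have B0: "0 <= B" by (simp add: B_def)
  define w where "w k x = min \<bar>v x\<bar> (real k)" for k x
  have w0: "0 <= w k x" "w k x <= real k" for k x by (auto simp: w_def)
  have wb [measurable]: "w k \<in> borel_measurable borel" for k unfolding w_def by measurable
  have wm [measurable]: "w k \<in> borel_measurable M" for k using wb by (rule borel_measurable_M)
  have wO: "w k x = 0" if "x \<notin> \<Omega>" for k x using vO[OF that] by (simp add: w_def)
  have wqint: "integrable M (\<lambda>x. w k x powr cq)" for k
  proof -
    interpret finite_measure M by (rule finite_M)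
    show ?thesis
    proof (rule integrable_const_bound[where B = "real k powr cq"])
      show "AE x in M. norm (w k x powr cq) <= real k powr cq"
        using w0 exps by (intro AE_I2) (auto intro!: powr_mono2)
    qed measurable
  qed
  have Ik: "(\<integral>x. w k x powr cq \<partial>M) powr (2 / cq) <= QQ m u / sob" for k
  proof -
    define I where "I = (\<integral>x. w k x powr cq \<partial>M)"
    have I0: "0 <= I" unfolding I_def by simp
    \<comment> \<open>Since (q - 1) p = q, the p-mass of this test function is I itself.\<close>
    define g where "g x = sgn (v x) * w k x powr (cq - 1)" for x
    have gb [measurable]: "g \<in> borel_measurable borel" unfolding g_def by measurable
    have ga: "\<bar>g x\<bar> = w k x powr (cq - 1)" for x
      by (cases "v x = 0") (auto simp: g_def w_def abs_mult abs_sgn_eq)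
    have gL: "L2 M g"
    proof (rule bounded_L2)
      show "g \<in> borel_measurable M" using gb by (rule borel_measurable_M)
      show "\<bar>g x\<bar> <= real k powr (cq - 1)" for x unfolding ga using w0 exps by (intro powr_mono2) auto
    qed
    have gO: "g x = 0" if "x \<notin> \<Omega>" for x using vO[OF that] by (simp add: g_def)
    have "I <= (\<integral>x. v x * g x \<partial>M)"
      unfolding I_def
    proof (rule integral_mono[OF wqint])
      have "L2 M v" using uL uv unfolding L2_def by (auto intro: integrable_cong_AE_imp)
      then show "integrable M (\<lambda>x. v x * g x)" using gL by (rule L2_mult_integrable)
      fix x
      have "w k x powr cq = w k x * w k x powr (cq - 1)" using w0 powr_mult_base[of "w k x" "cq - 1"] by simp
      also have "... <= \<bar>v x\<bar> * w k x powr (cq - 1)" by (intro mult_right_mono) (auto simp: w_def)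
      also have "... = v x * g x" unfolding g_def by (simp add: abs_sgn mult.assoc)
      finally show "w k x powr cq <= v x * g x" .
    qed
    also have "... = ip M u g" unfolding ip_def[symmetric]
      using ip_cong_AE[OF um vm borel_measurable_M[OF gb] uv] by simp
    finally have "I\<^sup>2 <= (ip M u g)\<^sup>2" using I0 by (intro power_mono) auto
    also have "... <= QQ m u * energy m g g" by (rule ip_energy_bound[OF u gL])
    also have "energy m g g <= I powr (2 / cp) / sob"
    proof -
      have nb: "nnborel (\<lambda>x. \<bar>g x\<bar>)" unfolding nnborel_def by auto
      have "Lp_mass cp (\<lambda>x. \<bar>g x\<bar>) = (NNL x. ennreal (w k x powr cq))"
        unfolding Lp_mass_def ga powr_powr exps(6) ..
      also have "... = ennreal I"
        unfolding I_def by (rule ennreal_integral_M[symmetric]) (use wO wqint in auto)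
      finally have mass: "Lp_mass cp (\<lambda>x. \<bar>g x\<bar>) <= ennreal I" by simp
      have "ennreal (Gamma m * energy m g g) <= ennreal hc * riesz ca (\<lambda>x. \<bar>g x\<bar>) (\<lambda>x. \<bar>g x\<bar>)"
        by (rule energy_le_riesz[OF m_pos hc(1) hc(2) gb gO gL])
      also have "... <= ennreal hc * (riesz_sup TYPE('a) ca cp * ennreal (I powr (2 / cp)))"
        using exps by (intro mult_left_mono riesz_le_sup[OF nb mass I0]) auto
      also have "... = ennreal (hc * hA * I powr (2 / cp))"
        unfolding hA(1) using hc(1) hA(2) by (simp add: ennreal_mult[symmetric] mult.assoc)
      finally have "Gamma m * energy m g g <= hc * hA * I powr (2 / cp)"
        using hc(1) hA(2) by (subst (asm) ennreal_le_iff) auto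
      then show ?thesis using Gamma_real_pos[OF m_pos] hc(1) hA(2) by (simp add: sob_def field_simps)
    qed
    finally have le: "I\<^sup>2 <= QQ m u * (I powr (2 / cp) / sob)" using Q0 by (simp add: mult_left_mono)
    show "I powr (2 / cq) <= QQ m u / sob"
    proof (cases "I = 0")
      case True
      then show ?thesis using Q0 sob_pos by simp
    next
      case False
      then have I: "0 < I" using I0 by simp
      have "I powr (2 / cq) * I powr (2 / cp) = I\<^sup>2"
      proof -
        have "2 / cq + 2 / cp = 2" using exps(7) by linarith
        then show ?thesis using I by (simp add: powr_add[symmetric])
      qed
      then have "I powr (2 / cq) * I powr (2 / cp) <= QQ m u / sob * I powr (2 / cp)" using le by simp
      then show ?thesis by (rule mult_right_le_imp_le) (use I in simp)
    qed
  qed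
  have bnd: "(\<integral>x. w k x powr cq \<partial>M) <= B" for k
  proof -
    have I0: "0 <= (\<integral>x. w k x powr cq \<partial>M)" by simp
    have "(\<integral>x. w k x powr cq \<partial>M) = ((\<integral>x. w k x powr cq \<partial>M) powr (2 / cq)) powr (cq / 2)"
      using exps I0 by (simp add: powr_powr)
    also have "... <= B" unfolding B_def using Ik[of k] exps by (intro powr_mono2) auto
    finally show ?thesis .
  qed
  have "(\<integral>\<^sup>+x. ennreal (\<bar>u x\<bar> powr cq) \<partial>M) = (\<integral>\<^sup>+x. liminf (\<lambda>k. ennreal (w k x powr cq)) \<partial>M)"
  proof (rule nn_integral_cong_AE)
    show "AE x in M. ennreal (\<bar>u x\<bar> powr cq) = liminf (\<lambda>k. ennreal (w k x powr cq))"
      using uv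
    proof eventually_elim
      case (elim x)
      obtain k0 where k0: "\<bar>v x\<bar> <= real k0" using real_arch_simple by blast
      have "eventually (\<lambda>k. ennreal (w k x powr cq) = ennreal (\<bar>u x\<bar> powr cq)) sequentially"
        unfolding eventually_sequentially w_def elim using k0 by (intro exI[of _ k0]) (auto simp: min_def)
      then have "(\<lambda>k. ennreal (w k x powr cq)) \<longlonglongrightarrow> ennreal (\<bar>u x\<bar> powr cq)" by (rule tendsto_eventually)
      then show ?case by (intro lim_imp_Liminf[symmetric]) auto
    qed
  qed
  also have "... <= liminf (\<lambda>k. \<integral>\<^sup>+x. ennreal (w k x powr cq) \<partial>M)"
    by (rule nn_integral_liminf) measurable
  also have "... <= ennreal B"
  proof (rule Liminf_le)
    show "\<forall>\<^sub>F k in sequentially. (\<integral>\<^sup>+x. ennreal (w k x powr cq) \<partial>M) <= ennreal B"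
    proof (intro always_eventually allI)
      fix k
      have "(\<integral>\<^sup>+x. ennreal (w k x powr cq) \<partial>M) = ennreal (\<integral>x. w k x powr cq \<partial>M)"
        by (rule nn_integral_eq_integral[OF wqint]) auto
      then show "(\<integral>\<^sup>+x. ennreal (w k x powr cq) \<partial>M) <= ennreal B" using bnd[of k] by (simp add: ennreal_leI)
    qed
  qed simp
  finally have fin: "(\<integral>\<^sup>+x. ennreal (\<bar>u x\<bar> powr cq) \<partial>M) <= ennreal B" .
  show ui: "integrable M (\<lambda>x. \<bar>u x\<bar> powr cq)"
    using fin by (intro integrableI_nonneg) (auto intro: le_less_trans)
  have "ennreal (\<integral>x. \<bar>u x\<bar> powr cq \<partial>M) <= ennreal B"
    using fin nn_integral_eq_integral[OF ui] by simp
  then have "(\<integral>x. \<bar>u x\<bar> powr cq \<partial>M) <= B" using B0 by simp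
  then have "(\<integral>x. \<bar>u x\<bar> powr cq \<partial>M) powr (2 / cq) <= B powr (2 / cq)" using exps by (intro powr_mono2) auto
  also have "... = QQ m u / sob" using exps Q0 sob_pos by (simp add: B_def powr_powr)
  finally show "sob * (\<integral>x. \<bar>u x\<bar> powr cq \<partial>M) powr (2 / cq) <= QQ m u" using sob_pos by (simp add: field_simps)
qed

definition qmass :: "('a => real) => real" where "qmass u = (\<integral>x. \<bar>u x\<bar> powr cq \<partial>M)"

lemma obtain_ball: obtains \<rho> where "0 < \<rho>" "cball 0 (2 * \<rho>) \<subseteq> \<Omega>"
proof -
  obtain e where e: "0 < e" "cball 0 e \<subseteq> \<Omega>" using open_dom zero_in by (auto simp: open_contains_cball)
  show ?thesis by (rule that[of "e / 2"]) (use e in auto)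
qed

section \<open>Potentials as test functions and the strict inequality\<close>

text \<open>u is the power -m of the Dirichlet Laplacian applied to h, described by coefficients. It
  is a relation because u is determined only almost everywhere.\<close>

definition potential_of :: "('a => real) => ('a => real) => bool" where
  "potential_of h u \<longleftrightarrow> L2 M u \<and> (\<forall>j. ip M u (phi j) = lam j powr (- m) * ip M h (phi j))"

lemma potential_exists:
  assumes h: "L2 M h"
  shows "\<exists>u. potential_of h u"
proof -
  obtain l where l: "0 < l" "\<And>j. l <= lam j" using lam_lower by blast
  have "summable (\<lambda>j. (lam j powr (- m) * ip M h (phi j))\<^sup>2)"
  proof (rule summable_comparison_test)
    show "summable (\<lambda>j. (l powr (- m))\<^sup>2 * (ip M h (phi j))\<^sup>2)" by (intro summable_mult bessel h)
    have "lam j powr (- m) <= l powr (- m)" for j using l m_pos by (intro powr_mono2') auto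
    then have "(lam j powr (- m))\<^sup>2 <= (l powr (- m))\<^sup>2" for j by (intro power_mono) auto
    then show "\<exists>N. \<forall>n\<ge>N. norm ((lam n powr (- m) * ip M h (phi n))\<^sup>2) <= (l powr (- m))\<^sup>2 * (ip M h (phi n))\<^sup>2"
      by (auto simp: power_mult_distrib intro!: mult_right_mono)
  qed
  from riesz_fischer[OF this] show ?thesis unfolding potential_of_def by blast
qed

text \<open>With t = m the form of the test function is the energy of h of order m; with t = s the
  lower order term becomes an energy of h of the larger order 2m - s, which is more sensitive to
  spreading and less singular in its kernel.\<close>

lemma potential_facts:
  assumes h: "L2 M h" and u: "potential_of h u" and t: "t <= 2 * m"
  shows "ddom t u" "QQ t u = energy (2 * m - t) h h"
proof -
  have e: "lam j powr t * (ip M u (phi j))\<^sup>2 = lam j powr (- (2 * m - t)) * (ip M h (phi j) * ip M h (phi j))" for j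
  proof -
    have "lam j powr t * (lam j powr (- m) * lam j powr (- m)) = lam j powr (- (2 * m - t))"
      by (simp only: powr_add[symmetric]) simp
    moreover have "lam j powr t * (ip M u (phi j))\<^sup>2 = lam j powr t * (lam j powr (- m) * lam j powr (- m)) * (ip M h (phi j) * ip M h (phi j))"
      using u by (simp add: potential_of_def power2_eq_square mult_ac)
    ultimately show ?thesis by simp
  qed
  show "ddom t u" unfolding ddom_iff e using u energy_sums[OF h h, of "2 * m - t"] t by (auto simp: potential_of_def sums_iff)
  show "QQ t u = energy (2 * m - t) h h" unfolding QQ_eq e energy_def ..
qed

lemma potential_ip:
  assumes h: "L2 M h" and u: "potential_of h u" and g: "L2 M g"
  shows "ip M u g = energy m h g"
proof -
  have "(\<lambda>j. ip M u (phi j) * ip M g (phi j)) sums ip M u g"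
    using u by (intro parseval g) (simp add: potential_of_def)
  moreover have "ip M u (phi j) * ip M g (phi j) = lam j powr (- m) * (ip M h (phi j) * ip M g (phi j))" for j
    using u by (simp add: potential_of_def)
  ultimately have "(\<lambda>j. lam j powr (- m) * (ip M h (phi j) * ip M g (phi j))) sums ip M u g" by simp
  then show ?thesis using energy_sums[OF h g, of m] m_pos sums_unique2 by force
qed

text \<open>The test function is the potential of a near maximizer h of the Riesz form, supported in a tiny ball.
  The error in replacing the Dirichlet kernel by the Riesz kernel is a multiple of (LINT h)^2, which
  the lower order term beats.\<close>

lemma strict_below_sobolev:
  assumes l: "0 < l"
    and B: "\<And>K. \<exists>r0>0. \<forall>r h u. 0 < r \<and> r <= r0 \<and> bump r h \<and> potential_of h u --> K * (\<integral>x. h x \<partial>M)\<^sup>2 <= B u"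
  shows "\<exists>u. ddom m u \<and> \<not> (AE x in M. u x = 0) \<and> QQ m u - l * B u < sob * qmass u powr (2 / cq)"
proof -
  obtain \<rho> where \<rho>: "0 < \<rho>" "cball 0 (2 * \<rho>) \<subseteq> \<Omega>" using obtain_ball .
  define G where "G = Gamma m"
  have G: "0 < G" using Gamma_real_pos[OF m_pos] by (simp add: G_def)
  obtain C where C: "0 <= C" and ge: "\<forall>r h. 0 < r \<and> r <= \<rho> \<and> bump r h -->
    ennreal hc * riesz ca h h <= ennreal (Gamma m * energy m h h + C * (\<integral>x. h x \<partial>M)\<^sup>2)"
    using energy_bump_ge[OF \<rho> m_pos m_less hc] by blast
  \<comment> \<open>With X the squared mean of h, the lower order term l K X = (hc + C) X / G has to
    cover hc X, the defect of h as a maximizer, and C X, the error of the kernel comparison, each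
    divided by G.\<close>
  define K where "K = (hc + C) / (G * l)"
  obtain r0 where r0: "0 < r0" and BK: "\<And>r h u. 0 < r ==> r <= r0 ==> bump r h ==> potential_of h u ==> K * (\<integral>x. h x \<partial>M)\<^sup>2 <= B u"
    using B[of K] by blast
  define r where "r = min r0 \<rho>"
  have r: "0 < r" "r <= r0" "r <= \<rho>" using r0 \<rho> by (auto simp: r_def)
  obtain h :: "'a => real" where hh: "continuous_on UNIV h" "\<forall>x. 0 <= h x" "Lp_mass cp h <= 1" "\<forall>x. r <= norm x --> h x = 0"
    "ennreal hA < riesz ca h h + ennreal 1 * (NNL x. ennreal (h x))\<^sup>2"
    using near_maximizer_continuous[OF exps(1,2) cp_def hA r(1) zero_less_one] by blast
  have bump: "bump r h" using hh by (simp add: bump_def)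
  have hb [measurable]: "h \<in> borel_measurable borel" using hh(1) by (rule borel_measurable_continuous_onI)
  have nb: "nnborel h" using hh by (auto simp: nnborel_def)
  note hO = bump_in_dom[OF \<rho>(2) bump r(3) r(1)]
  note hL = bump_L2[OF bump]
  obtain u where u: "potential_of h u" using potential_exists[OF hL] by blast
  define X where "X = (\<integral>x. h x \<partial>M)\<^sup>2"
  have I: "(NNL x. ennreal (h x)) = ennreal (\<integral>x. h x \<partial>M)"
    using hh by (intro ennreal_integral_M[symmetric] hO(2) L2_int[OF hL]) auto
  have Ip: "0 <= (\<integral>x. h x \<partial>M)" using hh by (intro integral_nonneg_AE) auto
  have X0: "0 <= X" by (simp add: X_def)
  have ud: "ddom m u" and QD: "QQ m u = energy m h h" using potential_facts[OF hL u, of m] m_pos by auto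
  define D where "D = energy m h h"
  have D0: "0 <= D" using QQ_nonneg[OF ud] QD by (simp add: D_def)
  have rle: "riesz ca h h <= ennreal hA"
    using riesz_le_sup1[OF nb hh(3), of ca] hA(1) by simp
  then obtain R where R: "riesz ca h h = ennreal R" "0 <= R" by (cases "riesz ca h h") (auto simp: top_unique)
  have RA: "R <= hA" using rle R hA by simp
  have "ennreal hA < ennreal (R + X)"
    using hh(5) R Ip unfolding I X_def by (simp add: ennreal_power ennreal_plus[symmetric] del: ennreal_plus)
  then have AX: "hA < R + X" using hA(2) by (subst (asm) ennreal_less_iff) auto
  have Xp: "0 < X" using AX RA by simp
  have "ennreal (hc * R) <= ennreal (G * D + C * X)"
    using ge[rule_format, of r h] r bump hc(1) R by (simp add: ennreal_mult G_def D_def X_def)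
  then have low: "hc * R <= G * D + C * X" using G D0 C X0 by (subst (asm) ennreal_le_iff) auto
  have up: "G * D <= hc * hA"
  proof -
    have "ennreal (G * D) <= ennreal hc * riesz ca (\<lambda>x. \<bar>h x\<bar>) (\<lambda>x. \<bar>h x\<bar>)"
      unfolding G_def D_def by (rule energy_le_riesz[OF m_pos hc(1) hc(2) hb hO(2) hL])
    also have "(\<lambda>x. \<bar>h x\<bar>) = h" using hh by auto
    also have "ennreal hc * riesz ca h h <= ennreal hc * ennreal hA" by (intro mult_left_mono rle) auto
    finally show ?thesis using hc(1) hA(2) by (simp add: ennreal_mult[symmetric])
  qed
  \<comment> \<open>A vanishing energy would annihilate all coefficients of h and hence its mean,
    whereas R <= hA < R + X makes X positive.\<close>
  have Dpos: "0 < D"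
  proof (rule ccontr)
    assume "\<not> 0 < D"
    then have "D = 0" using D0 by simp
    have sm: "(\<lambda>j. lam j powr (- m) * (ip M h (phi j) * ip M h (phi j))) sums 0"
      using energy_sums[OF hL hL, of m] m_pos \<open>D = 0\<close> by (simp add: D_def)
    have "ip M h (phi j) = 0" for j
    proof -
      have "summable (\<lambda>j. lam j powr (- m) * (ip M h (phi j) * ip M h (phi j)))" "(\<Sum>j. lam j powr (- m) * (ip M h (phi j) * ip M h (phi j))) = 0"
        using sm by (auto simp: sums_iff)
      then have "lam j powr (- m) * (ip M h (phi j) * ip M h (phi j)) = 0"
        by (subst (asm) suminf_eq_zero_iff) auto
      then show ?thesis using lam_pos[of j] by simp
    qed
    then have "AE x in M. h x = 0" by (rule complete[OF hL])
    then have "(\<integral>x. h x \<partial>M) = 0" by (intro integral_eq_zero_AE)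
    then show False using Xp by (simp add: X_def)
  qed
  have uh: "ip M u h = D" unfolding D_def by (rule potential_ip[OF hL u hL])
  have uL: "L2 M u" using u by (simp add: potential_of_def)
  have nz: "\<not> (AE x in M. u x = 0)"
  proof
    assume "AE x in M. u x = 0"
    then have "ip M u h = 0" unfolding ip_def by (intro integral_eq_zero_AE) auto
    then show False using uh Dpos by simp
  qed
  note sobu = sobolev[OF ud]
  have q0: "0 <= qmass u" by (simp add: qmass_def)
  \<comment> \<open>D is the integral of u h and h has p-mass at most 1. As QQ m u = D, the quotient
    without the lower order term is thus at most 1/D.\<close>
  have "D <= qmass u powr (1 / cq)"
  proof -
    have hm: "h \<in> borel_measurable M" using hb by (rule borel_measurable_M)
    have "ennreal D <= (\<integral>\<^sup>+x. ennreal (norm (u x * h x)) \<partial>M)"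
      using integral_norm_bound_ennreal[OF L2_mult_integrable[OF uL hL]] D0 uh by (simp add: ip_def)
    also have "... = (\<integral>\<^sup>+x. ennreal (h x * \<bar>u x\<bar>) \<partial>M)"
      using hh by (intro nn_integral_cong) (simp add: abs_mult mult.commute)
    also have "... <= ennreal (1 powr (1 / cp) * qmass u powr (1 / cq))"
    proof (rule nn_Holder[OF exps(3) _ exps(5)])
      show "1 < cq" using exps by simp
      have "(\<integral>\<^sup>+x. ennreal (h x powr cp) \<partial>M) = Lp_mass cp h"
        unfolding Lp_mass_def by (rule nn_integral_M_lborel) (simp add: hO(2))
      then show "(\<integral>\<^sup>+x. ennreal (h x powr cp) \<partial>M) <= ennreal 1" using hh(3) by simp
      show "(\<integral>\<^sup>+x. ennreal (\<bar>u x\<bar> powr cq) \<partial>M) <= ennreal (qmass u)"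
        using nn_integral_eq_integral[OF sobu(1)] by (simp add: qmass_def)
    qed (use hm L2D(1)[OF uL] hh q0 in auto)
    finally show ?thesis by simp
  qed
  then have "D\<^sup>2 <= (qmass u powr (1 / cq))\<^sup>2" using D0 by (intro power_mono) auto
  also have "... = qmass u powr (2 / cq)" by (simp add: power2_eq_square powr_add[symmetric])
  finally have Dq: "D\<^sup>2 <= qmass u powr (2 / cq)" .
  have BX: "K * X <= B u" unfolding X_def by (rule BK[OF r(1,2) bump u])
  have "l * (K * X) <= l * B u" using BX l by (intro mult_left_mono) auto
  moreover have "l * (K * X) = (hc + C) * X / G" using l by (simp add: K_def)
  ultimately have lB: "(hc + C) * X / G <= l * B u" by simp
  have "hc * (hA - X) < hc * R" using AX hc(1) by (intro mult_strict_left_mono) auto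
  \<comment> \<open>Multiplied by D / (hc hA), and with D <= hc hA / G, this lower bound on G D
    gives D - (hc + C) X / G < sob D^2.\<close>
  with low have key: "hc * hA - (hc + C) * X < G * D" by (simp add: algebra_simps)
  have cA: "0 < hc * hA" using hc(1) hA(2) by simp
  have "D * (hc * hA - (hc + C) * X) < D * (G * D)" using key Dpos by (intro mult_strict_left_mono)
  then have "D * (hc * hA - (hc + C) * X) / (hc * hA) < D * (G * D) / (hc * hA)"
    using cA by (intro divide_strict_right_mono)
  moreover have "sob * D\<^sup>2 = D * (G * D) / (hc * hA)" by (simp add: sob_def G_def power2_eq_square)
  moreover have "D * (hc * hA - (hc + C) * X) / (hc * hA) = D - (D / (hc * hA)) * ((hc + C) * X)"
    using hc(1) hA(2) by (simp add: field_simps)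
  moreover have "(D / (hc * hA)) * ((hc + C) * X) <= 1 / G * ((hc + C) * X)"
  proof (rule mult_right_mono)
    show "D / (hc * hA) <= 1 / G" using up G cA by (simp add: divide_le_eq le_divide_eq mult.commute)
    show "0 <= (hc + C) * X" using C X0 hc(1) by simp
  qed
  ultimately have "D - 1 / G * ((hc + C) * X) < sob * D\<^sup>2" by linarith
  then have "D - l * B u < sob * D\<^sup>2" using lB by simp
  also have "... <= sob * qmass u powr (2 / cq)" using Dq sob_pos by (intro mult_left_mono) auto
  finally show ?thesis using ud nz QD unfolding D_def by auto
qed

section \<open>The Hardy weight and the strict inequality for both lower order terms\<close>

lemma norm_powr_integrable_M:
  assumes "0 <= b" "b < real DIM('a)"
  shows "integrable M (\<lambda>x. norm x powr (- b))"
proof (cases "b = 0")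
  case True
  interpret finite_measure M by (rule finite_M)
  have "L2 M (\<lambda>x. norm x powr (- b))"
  proof (rule bounded_L2)
    show "(\<lambda>x. norm x powr (- b)) \<in> borel_measurable M" by (intro borel_measurable_M) measurable
    show "\<bar>norm x powr (- b)\<bar> <= 1" for x :: 'a using True by (cases "x = 0") auto
  qed
  then show ?thesis by (rule L2_int)
next
  case False
  then have b: "0 < b" using assms by simp
  obtain T where T: "0 < T" "\<Omega> \<subseteq> ball 0 T"
    using bounded_subset_ballD[OF bounded_dom, of 0] by blast
  obtain C where C: "\<And>(x::'a) T. 0 < T ==> (NNL y. ennreal (norm (x - y) powr (-b)) * indicator (ball x T) y) <= ennreal (C * T powr (real DIM('a) - b))"
    using riesz_kernel_ball[OF b assms(2)] by blast
  have "(\<integral>\<^sup>+x. ennreal (norm x powr (- b)) \<partial>M) = (\<integral>\<^sup>+x. ennreal (norm x powr (- b)) * indicator \<Omega> x \<partial>M)"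
    by (intro nn_integral_cong) (auto simp: space_restrict_space)
  also have "... = (NNL x. ennreal (norm x powr (- b)) * indicator \<Omega> x)"
    by (rule nn_integral_M_lborel) simp
  also have "... <= (\<integral>\<^sup>+y. ennreal (norm (0 - y) powr (-b)) * indicator (ball 0 T) y \<partial>(lborel::'a measure))"
    using T by (intro nn_integral_mono) (auto simp: indicator_def subset_iff)
  also have "... < \<infinity>" using C[OF T(1), of 0] by (auto intro: le_less_trans)
  finally show ?thesis
    by (intro integrableI_nonneg) (auto intro!: borel_measurable_M)
qed

definition hardy :: "real => ('a => real) => real" where
  "hardy s u = (\<integral>x. norm x powr (- 2 * s) * (u x)\<^sup>2 \<partial>M)"

text \<open>The weight |x|^(-2s) raised to n/(2m), the exponent that Young's inequality pairs with
  q/2; it is integrable because s < m.\<close>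

definition hardy_weight :: "real => 'a => real" where
  "hardy_weight s x = norm x powr (- (s * real DIM('a) / m))"

lemma hardy_weight_integrable:
  assumes "0 <= s" "s < m"
  shows "integrable M (hardy_weight s)"
  unfolding hardy_weight_def
proof (rule norm_powr_integrable_M)
  show "s * real DIM('a) / m < real DIM('a)" using assms by (simp add: field_simps)
qed (use assms in simp)

text \<open>Young's inequality with exponents n/(2m) and q/2.\<close>

lemma hardy_weight_bound:
  assumes e: "0 < e"
  shows "norm (x::'a) powr (- 2 * s) * y\<^sup>2 <= e * \<bar>y\<bar> powr cq + e powr (- (real DIM('a) / (2 * m)) / (cq / 2)) * hardy_weight s x"
proof -
  let ?n = "real DIM('a)"
  define P where "P = ?n / (2 * m)"
  define R where "R = cq / 2"
  have P: "1 < P" using m_pos m_less by (simp add: P_def field_simps)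
  have R: "1 < R" using exps by (simp add: R_def)
  have PR: "1 / P + 1 / R = 1" using m_pos exps(1) by (simp add: P_def R_def cq_def ca_def field_simps)
  \<comment> \<open>The Young parameter is tuned so that the coefficient of |y|^q is at most
    e.\<close>
  define k where "k = e powr (1 / R)"
  have k: "0 < k" using e by (simp add: k_def)
  have kR: "k powr R = e" using e R by (simp add: k_def powr_powr)
  define V where "V = norm x powr (- 2 * s)"
  have V0: "0 <= V" by (simp add: V_def)
  have "V * y\<^sup>2 = (V / k) * (k * y\<^sup>2)" using k by simp
  also have "... <= (V / k) powr P / P + (k * y\<^sup>2) powr R / R"
    using k P R PR V0 by (intro Youngs_inequality) auto
  also have "... <= (V / k) powr P / 1 + (k * y\<^sup>2) powr R / 1"
    using P R by (intro add_mono divide_left_mono) auto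
  also have "(k * y\<^sup>2) powr R = e * \<bar>y\<bar> powr cq"
  proof -
    have "(y\<^sup>2) powr R = (\<bar>y\<bar> powr 2) powr R" by simp
    also have "... = \<bar>y\<bar> powr cq" unfolding powr_powr by (simp add: R_def)
    finally show ?thesis using k by (simp add: powr_mult kR)
  qed
  also have "(V / k) powr P = e powr (- P / R) * hardy_weight s x"
  proof -
    have "V powr P = hardy_weight s x" unfolding V_def powr_powr hardy_weight_def
      using m_pos by (simp add: P_def field_simps)
    moreover have "1 / k powr P = e powr (- P / R)" unfolding k_def powr_powr by (simp add: powr_minus_divide)
    moreover have "(V / k) powr P = V powr P * (1 / k powr P)" by (simp add: powr_divide)
    ultimately show ?thesis by simp
  qed
  finally show ?thesis by (simp add: V_def P_def R_def add.commute)
qed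

lemma hardy_integrable:
  assumes u: "ddom m u" and s: "0 <= s" "s < m"
  shows "integrable M (\<lambda>x. norm x powr (- 2 * s) * (u x)\<^sup>2)"
proof (rule Bochner_Integration.integrable_bound)
  have um [measurable]: "u \<in> borel_measurable M" using u by (simp add: ddom_iff L2_def)
  have nm [measurable]: "(\<lambda>x. norm x powr (- 2 * s)) \<in> borel_measurable M" by (intro borel_measurable_M) measurable
  show "integrable M (\<lambda>x. 1 * \<bar>u x\<bar> powr cq + 1 powr (- (real DIM('a) / (2 * m)) / (cq / 2)) * hardy_weight s x)"
    using sobolev(1)[OF u] hardy_weight_integrable[OF s] by simp
  show "(\<lambda>x. norm x powr (- 2 * s) * (u x)\<^sup>2) \<in> borel_measurable M" by measurable
  show "AE x in M. norm (norm x powr (- 2 * s) * (u x)\<^sup>2)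
     <= norm (1 * \<bar>u x\<bar> powr cq + 1 powr (- (real DIM('a) / (2 * m)) / (cq / 2)) * hardy_weight s x)"
    using hardy_weight_bound[of 1] by (intro AE_I2) (auto intro: order_trans[OF _ abs_ge_self])
qed

text \<open>The lower order term of a potential is the energy of h of order 2m - s, and s >= 2m -
  n/2 says that this order is at most n/2, the range of the logarithmic lower bound.\<close>

lemma strict_below_spectral:
  assumes s: "0 <= s" "s < m" "2 * m - real DIM('a) / 2 <= s" and l: "0 < l"
  shows "\<exists>u. ddom m u \<and> \<not> (AE x in M. u x = 0) \<and> QQ m u - l * QQ s u < sob * qmass u powr (2 / cq)"
proof (rule strict_below_sobolev[OF l])
  fix K
  obtain \<rho> where \<rho>: "0 < \<rho>" "cball 0 (2 * \<rho>) \<subseteq> \<Omega>" using obtain_ball .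
  have s': "0 < 2 * m - s" "2 * m - s <= real DIM('a) / 2" using s m_pos by auto
  obtain r0 where r0: "0 < r0" "\<forall>r h. 0 < r \<and> r <= r0 \<and> bump r h --> K * (\<integral>x. h x \<partial>M)\<^sup>2 <= energy (2 * m - s) h h"
    using energy_bump_log[OF \<rho> s', of K] by blast
  show "\<exists>r0>0. \<forall>r h u. 0 < r \<and> r <= r0 \<and> bump r h \<and> potential_of h u --> K * (\<integral>x. h x \<partial>M)\<^sup>2 <= QQ s u"
  proof (intro exI[of _ r0] conjI allI impI r0(1))
    fix r and h u :: "'a => real" assume a: "0 < r \<and> r <= r0 \<and> bump r h \<and> potential_of h u"
    then have "QQ s u = energy (2 * m - s) h h"
      using s m_pos by (intro potential_facts(2) bump_L2) auto
    then show "K * (\<integral>x. h x \<partial>M)\<^sup>2 <= QQ s u" using r0(2) a by auto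
  qed
qed

text \<open>The potential is bounded below only after testing, so the Hardy term is reached by
  Cauchy-Schwarz. Take g = |x|^(-2s - ca) on the annulus between 2 r and R and let W be the integral
  of |x|^(-2s - 2 ca) there. The squared pairing of u and g is at most W times the Hardy term, and
  the pairing is at least k X W with X the mean of h, so the Hardy term is at least k^2 W X^2. W
  grows with the number of dyadic annuli because 2 s + 2 ca >= n.\<close>

lemma strict_below_hardy:
  assumes s: "0 <= s" "s < m" "2 * m - real DIM('a) / 2 <= s" and l: "0 < l"
  shows "\<exists>u. ddom m u \<and> \<not> (AE x in M. u x = 0) \<and> QQ m u - l * hardy s u < sob * qmass u powr (2 / cq)"
proof (rule strict_below_sobolev[OF l])
  fix K :: real
  let ?n = "real DIM('a)"
  obtain \<rho> where \<rho>: "0 < \<rho>" "cball 0 (2 * \<rho>) \<subseteq> \<Omega>" using obtain_ball .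
  obtain k R where k: "0 < k" and R: "0 < R" "R <= \<rho>" "R <= 1" and low: "\<forall>r h g. 0 < r \<and> r <= \<rho> \<and> bump r h \<and> g \<in> borel_measurable borel \<and> (\<forall>x. 0 <= g x) \<and> L2 M g \<and>
     integrable M (\<lambda>x. g x * norm x powr (- (?n - 2 * m))) \<and>
     (\<forall>x. g x \<noteq> 0 --> 2 * r <= norm x \<and> norm x <= R) -->
     k * ((\<integral>x. h x \<partial>M) * (\<integral>x. g x * norm x powr (- (?n - 2 * m)) \<partial>M)) <= energy m h g"
    using energy_bump_weighted[OF \<rho> m_pos m_less] by blast
  define v where "v = unit_ball_vol ?n * (1 - (1 / 2) ^ DIM('a))"
  have "(1 / 2 :: real) ^ DIM('a) < 1" by (simp add: power_less_one_iff)
  then have v: "0 < v" by (simp add: v_def)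
  \<comment> \<open>Number of dyadic annuli that pushes k^2 W above |K|; the radius r0 below is such
    that all of them lie outside the ball of radius 2 r.\<close>
  obtain N :: nat where N: "\<bar>K\<bar> / k\<^sup>2 / v < real N" using reals_Archimedean2 by blast
  define r0 where "r0 = R / 2 ^ N / 2"
  have r0: "0 < r0" "r0 <= \<rho>"
  proof -
    show "0 < r0" using R by (simp add: r0_def)
    have "R / 2 ^ N <= R / 1" using R by (intro divide_left_mono) auto
    then show "r0 <= \<rho>" using R by (simp add: r0_def)
  qed
  show "\<exists>r0>0. \<forall>r h u. 0 < r \<and> r <= r0 \<and> bump r h \<and> potential_of h u --> K * (\<integral>x. h x \<partial>M)\<^sup>2 <= hardy s u"
  proof (intro exI[of _ r0] conjI allI impI r0(1))
    fix r and h u :: "'a => real" assume "0 < r \<and> r <= r0 \<and> bump r h \<and> potential_of h u"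
    then have r: "0 < r" "r <= r0" and h: "bump r h" and u: "potential_of h u" by auto
    note hL = bump_L2[OF h]
    have ud: "ddom m u" using potential_facts(1)[OF hL u, of m] m_pos by simp
    have uL: "L2 M u" using u by (simp add: potential_of_def)
    have um [measurable]: "u \<in> borel_measurable M" by (rule L2D(1)[OF uL])
    define X where "X = (\<integral>x. h x \<partial>M)"
    have X0: "0 <= X" unfolding X_def using h by (intro integral_nonneg_AE) (auto simp: bump_def)
    define I where "I = {x::'a. 2 * r <= norm x \<and> norm x <= R}"
    have Im [measurable]: "I \<in> sets borel" unfolding I_def by measurable
    have IO: "x \<in> \<Omega>" if "x \<in> I" for x using that R \<rho> by (auto simp: I_def subset_iff)
    define w where "w x = norm x powr (- ca) * indicator I x" for x :: 'a
    define g where "g x = norm x powr (- 2 * s) * w x" for x :: 'a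
    have bdd: "\<bar>norm x powr (- e) * indicator I x\<bar> <= (2 * r) powr (- e)" if "0 <= e" for e and x :: 'a
      using r that by (auto simp: indicator_def I_def intro!: powr_mono2')
    have bL: "L2 M (\<lambda>x. norm x powr (- e) * indicator I x)" if "0 <= e" for e
      by (rule bounded_L2[OF _ bdd[OF that]]) (intro borel_measurable_M, measurable)
    have g_eq: "g x = norm x powr (- (2 * s + ca)) * indicator I x" for x
      unfolding g_def w_def by (simp add: powr_add[symmetric] mult.assoc[symmetric])
    have gw: "g x * norm x powr (- ca) = norm x powr (- (2 * s + 2 * ca)) * indicator I x" for x
    proof -
      have "norm x powr (- (2 * s + ca)) * norm x powr (- ca) = norm x powr (- (2 * s + 2 * ca))"
      proof -
        have e: "- (2 * s + ca) + - ca = - (2 * s + 2 * ca)" by simp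
        show ?thesis by (simp only: powr_add[symmetric] e)
      qed
      then show ?thesis unfolding g_eq by (simp add: mult_ac)
    qed
    have e0: "0 <= 2 * s + ca" "0 <= 2 * s + 2 * ca" using s exps(1) by auto
    have gb: "g \<in> borel_measurable borel" unfolding g_def w_def by measurable
    have gL: "L2 M g" unfolding g_eq[abs_def] by (rule bL[OF e0(1)])
    have gwi: "integrable M (\<lambda>x. g x * norm x powr (- ca))" unfolding gw by (rule L2_int[OF bL[OF e0(2)]])
    define W where "W = (\<integral>x. g x * norm x powr (- ca) \<partial>M)"
    have "k * (X * W) <= energy m h g"
    proof -
      have "k * ((\<integral>x. h x \<partial>M) * (\<integral>x. g x * norm x powr (- (?n - 2 * m)) \<partial>M)) <= energy m h g"
      proof (rule low[rule_format, of r h g], intro conjI allI impI)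
        show "r <= \<rho>" using r r0 by simp
        show "integrable M (\<lambda>x. g x * norm x powr (- (?n - 2 * m)))" using gwi by (simp add: ca_def)
        show "0 <= g x" for x by (simp add: g_def w_def)
        show "2 * r <= norm x" if "g x \<noteq> 0" for x using that by (auto simp: g_def w_def I_def indicator_def split: if_splits)
        show "norm x <= R" if "g x \<noteq> 0" for x using that by (auto simp: g_def w_def I_def indicator_def split: if_splits)
      qed (use r h gb gL in auto)
      then show ?thesis by (simp add: X_def W_def ca_def)
    qed
    also have "... = ip M u g" by (rule potential_ip[OF hL u gL, symmetric])
    finally have kXW: "k * (X * W) <= ip M u g" .
    have W0: "0 <= W" unfolding W_def by (intro integral_nonneg_AE) (auto simp: g_def w_def)
    define U1 where "U1 x = norm x powr (- s) * u x" for x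
    define U2 where "U2 x = norm x powr (- s) * w x" for x
    have pp: "norm x powr (- s) * norm x powr (- s) = norm x powr (- 2 * s)" for x :: 'a
      by (simp add: powr_add[symmetric])
    have U1s: "U1 x * U1 x = norm x powr (- 2 * s) * (u x)\<^sup>2" for x
    proof -
      have "U1 x * U1 x = (norm x powr (- s) * norm x powr (- s)) * (u x * u x)" by (simp add: U1_def mult_ac)
      then show ?thesis unfolding pp by (simp add: power2_eq_square)
    qed
    have U2s: "U2 x * U2 x = g x * norm x powr (- ca)" for x
    proof -
      have "U2 x * U2 x = (norm x powr (- s) * norm x powr (- s)) * w x * w x" by (simp add: U2_def mult_ac)
      also have "... = g x * norm x powr (- ca)" unfolding pp by (simp add: g_def w_def indicator_def)
      finally show ?thesis .
    qed
    have U12: "U1 x * U2 x = u x * g x" for x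
    proof -
      have "U1 x * U2 x = (norm x powr (- s) * norm x powr (- s)) * (u x * w x)" by (simp add: U1_def U2_def mult_ac)
      then show ?thesis unfolding pp by (simp add: g_def mult_ac)
    qed
    have nm [measurable]: "(\<lambda>x. norm x powr (- s)) \<in> borel_measurable M" by (intro borel_measurable_M) measurable
    have wm [measurable]: "w \<in> borel_measurable M" unfolding w_def by (intro borel_measurable_M) measurable
    have L1: "L2 M U1" unfolding L2_def power2_eq_square[of "U1 _"] U1s
    proof
      show "U1 \<in> borel_measurable M" unfolding U1_def by measurable
      show "integrable M (\<lambda>x. norm x powr (- 2 * s) * (u x)\<^sup>2)" by (rule hardy_integrable[OF ud s(1,2)])
    qed
    have L2': "L2 M U2" unfolding L2_def power2_eq_square[of "U2 _"] U2s
    proof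
      show "U2 \<in> borel_measurable M" unfolding U2_def by measurable
    qed (rule gwi)
    have "(ip M U1 U2)\<^sup>2 <= ip M U1 U1 * ip M U2 U2" by (rule ip_Cauchy_Schwarz[OF L1 L2'])
    then have cs: "(ip M u g)\<^sup>2 <= hardy s u * W"
      unfolding ip_def U12 U1s U2s by (simp add: hardy_def W_def)
    have "(k * (X * W))\<^sup>2 <= (ip M u g)\<^sup>2" using kXW k X0 W0 by (intro power_mono) auto
    with cs have "(k\<^sup>2 * W * X\<^sup>2) * W <= hardy s u * W" by (simp add: power_mult_distrib power2_eq_square mult_ac)
    moreover have Wlow: "real N * v <= W"
    proof -
      have "ennreal (real N * v) <= (\<integral>\<^sup>+x. ennreal (norm x powr (- ?n)) * indicator {x. R / 2 ^ N <= norm x \<and> norm x <= R} x \<partial>(lborel::'a measure))"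
        unfolding v_def by (rule ennreal_sum_annuli[OF R(1)])
      also have "... <= (NNL x. ennreal (g x * norm x powr (- ca)))"
      proof (rule nn_integral_mono)
        fix x :: 'a
        show "ennreal (norm x powr (- ?n)) * indicator {x. R / 2 ^ N <= norm x \<and> norm x <= R} x <= ennreal (g x * norm x powr (- ca))"
        proof (cases "R / 2 ^ N <= norm x \<and> norm x <= R")
          case True
          have "2 * r <= R / 2 ^ N" using r by (simp add: r0_def)
          then have xI: "x \<in> I" using True by (auto simp: I_def)
          have nx: "0 < norm x" "norm x <= 1" using xI r R by (auto simp: I_def)
          \<comment> \<open>Here |x| <= 1, so the more negative exponent gives the larger power; the
            exponents are ordered by s >= 2m - n/2.\<close>
          have "norm x powr (- ?n) <= norm x powr (- (2 * s + 2 * ca))"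
          proof (rule powr_mono')
            show "- (2 * s + 2 * ca) <= - ?n" using s(3) by (simp add: ca_def)
          qed (use nx in auto)
          then show ?thesis using True xI unfolding gw by (simp add: ennreal_leI)
        qed simp
      qed
      also have "... = ennreal W" unfolding W_def
      proof (rule ennreal_integral_M[symmetric])
        show "(\<lambda>x. g x * norm x powr (- ca)) \<in> borel_measurable borel" using gb by measurable
        show "g x * norm x powr (- ca) = 0" if "x \<notin> \<Omega>" for x using that IO by (auto simp: g_def w_def indicator_def)
      qed (use gwi in \<open>auto simp: g_def w_def\<close>)
      finally show ?thesis using W0 by simp
    qed
    moreover have "\<bar>K\<bar> / k\<^sup>2 < real N * v" using N by (simp only: pos_divide_less_eq[OF v])
    then have Np: "\<bar>K\<bar> / k\<^sup>2 < W" using Wlow by linarith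
    then have Wp: "0 < W" by (rule le_less_trans[rotated]) simp
    ultimately have 1: "k\<^sup>2 * W * X\<^sup>2 <= hardy s u" using mult_right_le_imp_le[of _ W] by blast
    have "\<bar>K\<bar> < W * k\<^sup>2" using Np k by (subst (asm) pos_divide_less_eq) auto
    then have "K <= k\<^sup>2 * W" by (simp add: mult.commute abs_le_iff less_imp_le)
    then have "K * X\<^sup>2 <= k\<^sup>2 * W * X\<^sup>2" by (intro mult_right_mono) auto
    then show "K * (\<integral>x. h x \<partial>M)\<^sup>2 <= hardy s u" using 1 by (simp add: X_def)
  qed
qed

end

section \<open>Existence of minimizers\<close>

text \<open>Domination up to a small multiple of a sequence that is merely bounded in L1. This is
  the common mechanism behind the Brezis-Lieb lemma, the continuity of the Hardy term and the weak
  convergence of coefficient series.\<close>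

lemma tendsto_integral_eps_dominated:
  fixes f F :: "nat => 'a => real" and G :: "real => 'a => real"
  assumes fm [measurable]: "\<And>k. f k \<in> borel_measurable M" and F: "\<And>k. integrable M (F k)" and F0: "\<And>k x. 0 <= F k x"
    and FB: "\<And>k. (\<integral>x. F k x \<partial>M) <= B"
    and G: "\<And>e. 0 < e ==> integrable M (G e)" and G0: "\<And>e x. 0 < e ==> 0 <= G e x"
    and dom: "\<And>e k x. 0 < e ==> \<bar>f k x\<bar> <= e * F k x + G e x"
    and lim: "AE x in M. (\<lambda>k. f k x) \<longlonglongrightarrow> 0"
  shows "(\<lambda>k. \<integral>x. \<bar>f k x\<bar> \<partial>M) \<longlonglongrightarrow> 0" "\<And>k. integrable M (f k)"
proof -
  note [measurable] = borel_measurable_integrable[OF F] borel_measurable_integrable[OF G]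
  show fi: "integrable M (f k)" for k
  proof (rule Bochner_Integration.integrable_bound)
    show "integrable M (\<lambda>x. 1 * F k x + G 1 x)" using F G by auto
    show "AE x in M. norm (f k x) <= norm (1 * F k x + G 1 x)"
    proof (rule AE_I2)
      fix x show "norm (f k x) <= norm (1 * F k x + G 1 x)" using dom[of 1 k x] by simp
    qed
  qed measurable
  have "0 <= (\<integral>x. F 0 x \<partial>M)" using F0 by (intro integral_nonneg_AE AE_I2)
  then have B0: "0 <= B" using FB[of 0] by linarith
  show "(\<lambda>k. \<integral>x. \<bar>f k x\<bar> \<partial>M) \<longlonglongrightarrow> 0"
    unfolding LIMSEQ_iff
  proof (intro allI impI)
    fix r :: real assume r: "0 < r"
    define e where "e = r / (2 * (B + 1))"
    have e: "0 < e" "e * B <= r / 2" using r B0 by (auto simp: e_def field_simps)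
    \<comment> \<open>The part of |f k| exceeding e F k is dominated by G e and tends to 0; the
      remainder integrates to at most e B <= r/2.\<close>
    define H where "H k x = max 0 (\<bar>f k x\<bar> - e * F k x)" for k x
    have Hm [measurable]: "H k \<in> borel_measurable M" for k unfolding H_def by measurable
    have HG: "norm (H k x) <= G e x" for k x
      using dom[OF e(1), of k x] G0[OF e(1), of x] by (auto simp: H_def)
    have Hi: "integrable M (H k)" for k
    proof (rule Bochner_Integration.integrable_bound[OF G[OF e(1)] Hm], rule AE_I2)
      fix x show "norm (H k x) <= norm (G e x)" using HG[of k x] by simp
    qed
    have "(\<lambda>k. \<integral>x. H k x \<partial>M) \<longlonglongrightarrow> (\<integral>x. 0 \<partial>M)"
    proof (rule integral_dominated_convergence[where w = "G e"])
      show "AE x in M. (\<lambda>k. H k x) \<longlonglongrightarrow> 0"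
        using lim
      proof eventually_elim
        case (elim x)
        have 1: "(\<lambda>k. \<bar>f k x\<bar>) \<longlonglongrightarrow> 0" using elim by (rule tendsto_rabs_zero)
        have 2: "0 <= H k x" "H k x <= \<bar>f k x\<bar>" for k using e F0[of k x] by (auto simp: H_def)
        show ?case by (rule tendsto_sandwich[OF always_eventually always_eventually tendsto_const 1]) (use 2 in auto)
      qed
    qed (use G[OF e(1)] HG in auto)
    then have "(\<lambda>k. \<integral>x. H k x \<partial>M) \<longlonglongrightarrow> 0" by simp
    then obtain N where N: "\<And>k. k \<ge> N ==> norm (\<integral>x. H k x \<partial>M) < r / 2"
      using r unfolding LIMSEQ_iff by (metis diff_zero half_gt_zero)
    show "\<exists>no. \<forall>n\<ge>no. norm ((\<integral>x. \<bar>f n x\<bar> \<partial>M) - 0) < r"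
    proof (intro exI[of _ N] allI impI)
      fix n assume n: "N <= n"
      have "(\<integral>x. \<bar>f n x\<bar> \<partial>M) <= (\<integral>x. H n x + e * F n x \<partial>M)"
        using fi Hi F by (intro integral_mono) (auto simp: H_def)
      also have "... = (\<integral>x. H n x \<partial>M) + e * (\<integral>x. F n x \<partial>M)" using Hi F by simp
      also have "... <= (\<integral>x. H n x \<partial>M) + e * B" using e FB[of n] by (intro add_left_mono mult_left_mono) auto
      also have "... < r" using N[OF n] e by simp
      finally show "norm ((\<integral>x. \<bar>f n x\<bar> \<partial>M) - 0) < r" by simp
    qed
  qed
qed

text \<open>Young's inequality for |a|^(q - 1) and |a + b|, that is, the convexity of the q-th power
  at a. It takes the place of differentiating the q-mass, both for the integrability of the
  nonlinearity and in the Euler-Lagrange equation.\<close>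

lemma powr_abs_tangent:
  fixes a b q :: real
  assumes q: "1 < q"
  shows "\<bar>a\<bar> powr q + q * (\<bar>a\<bar> powr (q - 2) * a * b) <= \<bar>a + b\<bar> powr q"
proof (cases "a = 0")
  case True
  then show ?thesis by simp
next
  case False
  define p where "p = q / (q - 1)"
  have p: "1 < p" "1 / p + 1 / q = 1" using q by (auto simp: p_def field_simps)
  have qp: "(q - 1) * p = q" using q by (simp add: p_def)
  have "(\<bar>a\<bar> powr (q - 1)) * \<bar>a + b\<bar> <= (\<bar>a\<bar> powr (q - 1)) powr p / p + \<bar>a + b\<bar> powr q / q"
    using p q by (intro Youngs_inequality) auto
  also have "(\<bar>a\<bar> powr (q - 1)) powr p = \<bar>a\<bar> powr q" by (simp add: powr_powr qp)
  finally have 1: "\<bar>a\<bar> powr (q - 1) * \<bar>a + b\<bar> <= \<bar>a\<bar> powr q / p + \<bar>a + b\<bar> powr q / q" .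
  have qa: "\<bar>a\<bar> powr (q - 2) * a * (a + b) <= \<bar>a\<bar> powr (q - 1) * \<bar>a + b\<bar>"
  proof -
    have "\<bar>a\<bar> powr (q - 1) = \<bar>a\<bar> powr (q - 2) * \<bar>a\<bar>"
      using powr_add[of "\<bar>a\<bar>" "q - 2" 1] False by simp
    moreover have "a * (a + b) <= \<bar>a\<bar> * \<bar>a + b\<bar>" by (metis abs_ge_self abs_mult)
    then have "\<bar>a\<bar> powr (q - 2) * (a * (a + b)) <= \<bar>a\<bar> powr (q - 2) * (\<bar>a\<bar> * \<bar>a + b\<bar>)" by (rule mult_left_mono) simp
    ultimately show ?thesis by (simp add: mult.assoc)
  qed
  have sq: "\<bar>a\<bar> powr (q - 2) * a * a = \<bar>a\<bar> powr q"
  proof -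
    have "\<bar>a\<bar> powr q = \<bar>a\<bar> powr (q - 2) * \<bar>a\<bar> powr 2" by (simp only: powr_add[symmetric]) simp
    also have "\<bar>a\<bar> powr 2 = a * a" using False by (simp add: power2_eq_square)
    finally show ?thesis by simp
  qed
  have "\<bar>a\<bar> powr q + \<bar>a\<bar> powr (q - 2) * a * b <= \<bar>a\<bar> powr q / p + \<bar>a + b\<bar> powr q / q"
    using qa 1 sq by (simp add: distrib_left)
  then have "q * (\<bar>a\<bar> powr q + \<bar>a\<bar> powr (q - 2) * a * b) <= q * (\<bar>a\<bar> powr q / p + \<bar>a + b\<bar> powr q / q)"
    using q by (intro mult_left_mono) auto
  also have "... = (q - 1) * \<bar>a\<bar> powr q + \<bar>a + b\<bar> powr q" using q by (simp add: p_def field_simps)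
  finally show ?thesis by (simp add: algebra_simps)
qed

text \<open>The tangent inequality at a and at a + b bounds the difference by q s^(q - 1) |b| with s
  = |a| + |b|; Young's inequality then moves all but a fraction e of it onto |b|^q.\<close>

lemma powr_abs_diff_bound:
  fixes a b q e :: real
  assumes q: "1 < q" and e: "0 < e"
  shows "\<bar>\<bar>a + b\<bar> powr q - \<bar>a\<bar> powr q\<bar> <= e * \<bar>a\<bar> powr q
    + (e + q * (e / (q * 2 powr q)) powr (1 - q)) * \<bar>b\<bar> powr q"
proof -
  define s where "s = \<bar>a\<bar> + \<bar>b\<bar>"
  have s0: "0 <= s" by (simp add: s_def)
  have tb: "\<bar>c\<bar> powr (q - 2) * c * d <= s powr (q - 1) * \<bar>b\<bar>" if c: "\<bar>c\<bar> <= s" and d: "\<bar>d\<bar> = \<bar>b\<bar>" for c d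
  proof (cases "c = 0")
    case False
    have "\<bar>c\<bar> powr (q - 2) * c * d <= \<bar>c\<bar> powr (q - 2) * \<bar>c\<bar> * \<bar>d\<bar>"
      by (metis abs_ge_self abs_mult abs_of_nonneg powr_ge_zero)
    also have "\<bar>c\<bar> powr (q - 2) * \<bar>c\<bar> = \<bar>c\<bar> powr (q - 1)"
      using powr_add[of "\<bar>c\<bar>" "q - 2" 1] False by simp
    also have "\<bar>c\<bar> powr (q - 1) * \<bar>d\<bar> <= s powr (q - 1) * \<bar>b\<bar>"
      unfolding d using c q by (intro mult_right_mono powr_mono2) auto
    finally show ?thesis .
  qed simp
  have lo: "\<bar>a\<bar> powr q - \<bar>a + b\<bar> powr q <= q * (s powr (q - 1) * \<bar>b\<bar>)"
  proof -
    have "\<bar>a\<bar> powr q + q * (\<bar>a\<bar> powr (q - 2) * a * b) <= \<bar>a + b\<bar> powr q" by (rule powr_abs_tangent[OF q])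
    moreover have "\<bar>a\<bar> powr (q - 2) * a * (- b) <= s powr (q - 1) * \<bar>b\<bar>" by (rule tb) (auto simp: s_def)
    then have "q * (\<bar>a\<bar> powr (q - 2) * a * (- b)) <= q * (s powr (q - 1) * \<bar>b\<bar>)" using q by (intro mult_left_mono) auto
    ultimately show ?thesis by simp
  qed
  have hi: "\<bar>a + b\<bar> powr q - \<bar>a\<bar> powr q <= q * (s powr (q - 1) * \<bar>b\<bar>)"
  proof -
    have "\<bar>a + b\<bar> powr q + q * (\<bar>a + b\<bar> powr (q - 2) * (a + b) * (- b)) <= \<bar>(a + b) + (- b)\<bar> powr q" by (rule powr_abs_tangent[OF q])
    moreover have "\<bar>a + b\<bar> powr (q - 2) * (a + b) * b <= s powr (q - 1) * \<bar>b\<bar>" by (rule tb) (auto simp: s_def)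
    then have "q * (\<bar>a + b\<bar> powr (q - 2) * (a + b) * b) <= q * (s powr (q - 1) * \<bar>b\<bar>)" using q by (intro mult_left_mono) auto
    ultimately show ?thesis by simp
  qed
  \<comment> \<open>With this weight q d s^q <= e (|a|^q + |b|^q), since s^q <= 2^q (|a|^q +
    |b|^q).\<close>
  define d where "d = e / (q * 2 powr q)"
  have d: "0 < d" using e q by (simp add: d_def)
  define p where "p = q / (q - 1)"
  have p: "1 < p" "1 / p + 1 / q = 1" using q by (auto simp: p_def field_simps)
  define k where "k = d powr (1 / p)"
  have k: "0 < k" using d by (simp add: k_def)
  have "s powr (q - 1) * \<bar>b\<bar> = (k * s powr (q - 1)) * (\<bar>b\<bar> / k)" using k by simp
  also have "... <= (k * s powr (q - 1)) powr p / p + (\<bar>b\<bar> / k) powr q / q"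
    using k p q by (intro Youngs_inequality) auto
  also have "... <= (k * s powr (q - 1)) powr p / 1 + (\<bar>b\<bar> / k) powr q / 1"
    using p q by (intro add_mono divide_left_mono) auto
  also have "(k * s powr (q - 1)) powr p = d * s powr q"
  proof -
    have "(1 / p) * p = 1" "(q - 1) * p = q" using p q by (auto simp: p_def)
    then show ?thesis unfolding k_def powr_mult powr_powr using d by simp
  qed
  also have "(\<bar>b\<bar> / k) powr q = d powr (1 - q) * \<bar>b\<bar> powr q"
  proof -
    have "(1 / p) * q = q - 1" using q by (simp add: p_def)
    then have kq: "k powr q = d powr (q - 1)" unfolding k_def powr_powr by simp
    have "(\<bar>b\<bar> / k) powr q = \<bar>b\<bar> powr q * (1 / d powr (q - 1))" by (simp add: powr_divide kq)
    also have "1 / d powr (q - 1) = d powr (- (q - 1))" by (simp only: powr_minus_divide)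
    finally show ?thesis by (simp add: mult.commute)
  qed
  finally have Y: "s powr (q - 1) * \<bar>b\<bar> <= d * s powr q + d powr (1 - q) * \<bar>b\<bar> powr q" by simp
  have sq: "s powr q <= 2 powr q * (\<bar>a\<bar> powr q + \<bar>b\<bar> powr q)"
  proof -
    have "s <= 2 * max \<bar>a\<bar> \<bar>b\<bar>" by (auto simp: s_def)
    then have "s powr q <= (2 * max \<bar>a\<bar> \<bar>b\<bar>) powr q" using s0 q by (intro powr_mono2) auto
    also have "... = 2 powr q * (max \<bar>a\<bar> \<bar>b\<bar>) powr q" by (simp add: powr_mult)
    also have "(max \<bar>a\<bar> \<bar>b\<bar>) powr q <= \<bar>a\<bar> powr q + \<bar>b\<bar> powr q" by (simp add: max_def)
    finally show ?thesis by simp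
  qed
  have "q * (s powr (q - 1) * \<bar>b\<bar>) <= q * (d * s powr q + d powr (1 - q) * \<bar>b\<bar> powr q)"
    using Y q by (intro mult_left_mono) auto
  also have "... = q * d * s powr q + q * d powr (1 - q) * \<bar>b\<bar> powr q" by (simp add: algebra_simps)
  also have "q * d * s powr q <= q * d * (2 powr q * (\<bar>a\<bar> powr q + \<bar>b\<bar> powr q))"
    using sq q d by (intro mult_left_mono) auto
  also have "... = e * (\<bar>a\<bar> powr q + \<bar>b\<bar> powr q)" using q by (simp add: d_def)
  finally have "q * (s powr (q - 1) * \<bar>b\<bar>) <= e * \<bar>a\<bar> powr q + (e + q * d powr (1 - q)) * \<bar>b\<bar> powr q"
    by (simp add: algebra_simps)
  then show ?thesis using lo hi unfolding d_def by linarith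
qed

lemma Brezis_Lieb:
  fixes d :: "nat => 'a => real" and w :: "'a => real"
  assumes q: "1 < q" and dm [measurable]: "\<And>k. d k \<in> borel_measurable M" and wm [measurable]: "w \<in> borel_measurable M"
    and di: "\<And>k. integrable M (\<lambda>x. \<bar>d k x\<bar> powr q)" and wi: "integrable M (\<lambda>x. \<bar>w x\<bar> powr q)"
    and B: "\<And>k. (\<integral>x. \<bar>d k x\<bar> powr q \<partial>M) <= B" and lim: "AE x in M. (\<lambda>k. d k x) \<longlonglongrightarrow> 0"
    and ui: "\<And>k. integrable M (\<lambda>x. \<bar>d k x + w x\<bar> powr q)"
  shows "(\<lambda>k. (\<integral>x. \<bar>d k x + w x\<bar> powr q \<partial>M) - (\<integral>x. \<bar>d k x\<bar> powr q \<partial>M)) \<longlonglongrightarrow> (\<integral>x. \<bar>w x\<bar> powr q \<partial>M)"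
proof -
  define f where "f k x = \<bar>d k x + w x\<bar> powr q - \<bar>d k x\<bar> powr q - \<bar>w x\<bar> powr q" for k x
  \<comment> \<open>The leading 1 absorbs the term |w|^q that is subtracted in f.\<close>
  define G where "G e x = (1 + (e + q * (e / (q * 2 powr q)) powr (1 - q))) * \<bar>w x\<bar> powr q" for e :: real and x
  have "(\<lambda>k. \<integral>x. \<bar>f k x\<bar> \<partial>M) \<longlonglongrightarrow> 0"
  proof (rule tendsto_integral_eps_dominated(1)[where F = "\<lambda>k x. \<bar>d k x\<bar> powr q" and G = G and B = B])
    show "f k \<in> borel_measurable M" for k unfolding f_def by measurable
    show "integrable M (G e)" if "0 < e" for e unfolding G_def using wi by simp
    show "0 <= G e x" if "0 < e" for e x unfolding G_def using that q by (intro mult_nonneg_nonneg) auto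
    show "\<bar>f k x\<bar> <= e * \<bar>d k x\<bar> powr q + G e x" if e: "0 < e" for e k x
      using powr_abs_diff_bound[OF q e, of "d k x" "w x"] unfolding f_def G_def
      by (simp add: distrib_right) (smt (verit) powr_ge_zero)
    show "AE x in M. (\<lambda>k. f k x) \<longlonglongrightarrow> 0"
      using lim
    proof eventually_elim
      case (elim x)
      have "(\<lambda>k. \<bar>d k x + w x\<bar> powr q - \<bar>d k x\<bar> powr q - \<bar>w x\<bar> powr q) \<longlonglongrightarrow> \<bar>0 + w x\<bar> powr q - \<bar>0\<bar> powr q - \<bar>w x\<bar> powr q"
        using q elim by (intro tendsto_intros tendsto_powr') auto
      then show ?case by (simp add: f_def)
    qed
  qed (use di B in auto)
  moreover have fi: "integrable M (f k)" for k unfolding f_def using di wi ui by auto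
  have "norm (\<integral>x. f k x \<partial>M) <= (\<integral>x. \<bar>f k x\<bar> \<partial>M)" for k using integral_norm_bound[of M "f k"] by simp
  ultimately have "(\<lambda>k. \<integral>x. f k x \<partial>M) \<longlonglongrightarrow> 0" by (intro Lim_null_comparison[of "\<lambda>k. \<integral>x. f k x \<partial>M"]) (auto intro!: always_eventually)
  moreover have "(\<integral>x. f k x \<partial>M) = (\<integral>x. \<bar>d k x + w x\<bar> powr q \<partial>M) - (\<integral>x. \<bar>d k x\<bar> powr q \<partial>M) - (\<integral>x. \<bar>w x\<bar> powr q \<partial>M)" for k
    unfolding f_def using di wi ui by simp
  ultimately show ?thesis by (simp add: LIM_zero_iff)
qed

text \<open>Modes with l j > L contribute at most L^(s - m) C uniformly in k, and the finitely many
  others converge one by one. This is the compact embedding of the form domain of order m into that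
  of order s < m.\<close>

lemma weighted_sum_tendsto:
  fixes c :: "nat => nat => real" and d :: "nat => real" and l :: "nat => real"
  assumes l: "\<And>j. 0 < l j" and fin: "\<And>L. finite {j. l j <= L}" and s: "s < m"
    and c: "\<And>k. summable (\<lambda>j. l j powr m * (c k j)\<^sup>2)" "\<And>k. (\<Sum>j. l j powr m * (c k j)\<^sup>2) <= C"
    and d: "summable (\<lambda>j. l j powr m * (d j)\<^sup>2)" "(\<Sum>j. l j powr m * (d j)\<^sup>2) <= C"
    and lim: "\<And>j. (\<lambda>k. c k j) \<longlonglongrightarrow> d j"
    and cs: "\<And>k. summable (\<lambda>j. l j powr s * (c k j)\<^sup>2)" and ds: "summable (\<lambda>j. l j powr s * (d j)\<^sup>2)"
  shows "(\<lambda>k. \<Sum>j. l j powr s * (c k j)\<^sup>2) \<longlonglongrightarrow> (\<Sum>j. l j powr s * (d j)\<^sup>2)"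
proof -
  have "0 <= (\<Sum>j. l j powr m * (d j)\<^sup>2)" using d(1) by (rule suminf_nonneg) simp
  then have C0: "0 <= C" using d(2) by linarith
  have tail: "(\<Sum>j. l j powr s * (a j)\<^sup>2) - (\<Sum>j\<in>J. l j powr s * (a j)\<^sup>2) <= L powr (s - m) * C"
    "0 <= (\<Sum>j. l j powr s * (a j)\<^sup>2) - (\<Sum>j\<in>J. l j powr s * (a j)\<^sup>2)"
    if J: "J = {j. l j <= L}" and L: "0 < L" and am: "summable (\<lambda>j. l j powr m * (a j)\<^sup>2)" "(\<Sum>j. l j powr m * (a j)\<^sup>2) <= C"
      and as: "summable (\<lambda>j. l j powr s * (a j)\<^sup>2)" for a :: "nat => real" and J L
  proof -
    have fJ: "finite J" unfolding J by (rule fin)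
    have sm: "(\<lambda>j. if j \<in> J then 0 else l j powr s * (a j)\<^sup>2) sums ((\<Sum>j. l j powr s * (a j)\<^sup>2) - (\<Sum>j\<in>J. l j powr s * (a j)\<^sup>2))"
    proof -
      have "(\<lambda>j. if j \<in> J then l j powr s * (a j)\<^sup>2 else 0) sums (\<Sum>j\<in>J. l j powr s * (a j)\<^sup>2)"
        by (rule sums_If_finite_set[OF fJ])
      from sums_diff[OF summable_sums[OF as] this] show ?thesis
        by (rule sums_cong[THEN iffD1, rotated]) auto
    qed
    show "0 <= (\<Sum>j. l j powr s * (a j)\<^sup>2) - (\<Sum>j\<in>J. l j powr s * (a j)\<^sup>2)"
      by (rule sums_le[OF _ sums_zero sm]) auto
    have "(\<Sum>j. l j powr s * (a j)\<^sup>2) - (\<Sum>j\<in>J. l j powr s * (a j)\<^sup>2) <= L powr (s - m) * (\<Sum>j. l j powr m * (a j)\<^sup>2)"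
    proof (rule sums_le[OF _ sm sums_mult[OF summable_sums[OF am(1)]]])
      fix j
      show "(if j \<in> J then 0 else l j powr s * (a j)\<^sup>2) <= L powr (s - m) * (l j powr m * (a j)\<^sup>2)"
      proof (cases "j \<in> J")
        case False
        then have "L < l j" unfolding J by simp
        then have "l j powr (s - m) <= L powr (s - m)" using L s by (intro powr_mono2') auto
        then have "l j powr (s - m) * l j powr m <= L powr (s - m) * l j powr m" by (intro mult_right_mono) auto
        moreover have "l j powr (s - m) * l j powr m = l j powr s" by (simp only: powr_add[symmetric]) simp
        ultimately have "l j powr s * (a j)\<^sup>2 <= L powr (s - m) * l j powr m * (a j)\<^sup>2" by (intro mult_right_mono) auto
        then show ?thesis using False by (simp add: mult.assoc)
      qed simp
    qed
    also have "... <= L powr (s - m) * C" by (intro mult_left_mono am) auto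
    finally show "(\<Sum>j. l j powr s * (a j)\<^sup>2) - (\<Sum>j\<in>J. l j powr s * (a j)\<^sup>2) <= L powr (s - m) * C" .
  qed
  show ?thesis unfolding LIMSEQ_iff
  proof (intro allI impI)
    fix r :: real assume r: "0 < r"
    \<comment> \<open>Chosen so that L^(s - m) (C + 1) = r/4; the added 1 keeps the quotient
      meaningful for C = 0.\<close>
    define L where "L = (r / 4 / (C + 1)) powr (1 / (s - m))"
    have L: "0 < L" using r C0 by (simp add: L_def)
    have "L powr (s - m) = r / 4 / (C + 1)" unfolding L_def powr_powr using s r C0 by simp
    then have "L powr (s - m) * (C + 1) = r / 4" using C0 by (subst nonzero_eq_divide_eq[symmetric]) auto
    moreover have "L powr (s - m) * C <= L powr (s - m) * (C + 1)" by (intro mult_left_mono) auto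
    ultimately have LC: "L powr (s - m) * C <= r / 4" by simp
    define J where "J = {j. l j <= L}"
    have "(\<lambda>k. \<Sum>j\<in>J. l j powr s * (c k j)\<^sup>2) \<longlonglongrightarrow> (\<Sum>j\<in>J. l j powr s * (d j)\<^sup>2)"
      by (intro tendsto_intros lim)
    then obtain N where N: "\<And>k. k \<ge> N ==> norm ((\<Sum>j\<in>J. l j powr s * (c k j)\<^sup>2) - (\<Sum>j\<in>J. l j powr s * (d j)\<^sup>2)) < r / 4"
      using r unfolding LIMSEQ_iff by (meson divide_pos_pos zero_less_numeral)
    show "\<exists>no. \<forall>n\<ge>no. norm ((\<Sum>j. l j powr s * (c n j)\<^sup>2) - (\<Sum>j. l j powr s * (d j)\<^sup>2)) < r"
    proof (intro exI[of _ N] allI impI)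
      fix n assume "N <= n"
      from N[OF this] tail[OF J_def L c(1,2) cs, of n] tail[OF J_def L d ds] LC r
      show "norm ((\<Sum>j. l j powr s * (c n j)\<^sup>2) - (\<Sum>j. l j powr s * (d j)\<^sup>2)) < r"
        unfolding real_norm_def by linarith
    qed
  qed
qed

text \<open>A bounded sequence that converges to 0 coefficientwise converges weakly to 0. The
  counting measure turns the series into an integral, to which epsilon-domination applies with the
  weighted squares of c k as F and a multiple of those of w as G.\<close>

lemma weak_sum_tendsto:
  fixes c :: "nat => nat => real" and w l :: "nat => real"
  assumes c: "\<And>k. summable (\<lambda>j. l j powr t * (c k j)\<^sup>2)" "\<And>k. (\<Sum>j. l j powr t * (c k j)\<^sup>2) <= C"
    and w: "summable (\<lambda>j. l j powr t * (w j)\<^sup>2)" and lim: "\<And>j. (\<lambda>k. c k j) \<longlonglongrightarrow> 0"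
  shows "(\<lambda>k. \<Sum>j. l j powr t * w j * c k j) \<longlonglongrightarrow> 0"
proof -
  let ?N = "count_space (UNIV :: nat set)"
  define f where "f k j = l j powr t * w j * c k j" for k j
  have cnt: "integrable ?N g" if "summable g" "\<And>j. 0 <= g j" for g :: "nat => real"
    using that by (simp add: integrable_count_space_nat_iff)
  have dom: "\<bar>f k j\<bar> <= e * (l j powr t * (c k j)\<^sup>2) + (1 / (4 * e)) * (l j powr t * (w j)\<^sup>2)" if e: "0 < e" for e k j
  proof -
    have "0 <= (2 * e * \<bar>c k j\<bar> - \<bar>w j\<bar>)\<^sup>2" by simp
    then have "4 * e * (\<bar>w j\<bar> * \<bar>c k j\<bar>) <= 4 * e * (e * (c k j)\<^sup>2) + (w j)\<^sup>2"
      by (simp add: power2_diff power_mult_distrib power2_eq_square[of e] mult_ac)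
    also have "... = 4 * e * (e * (c k j)\<^sup>2 + (1 / (4 * e)) * (w j)\<^sup>2)" using e by (simp add: distrib_left)
    finally have "\<bar>w j\<bar> * \<bar>c k j\<bar> <= e * (c k j)\<^sup>2 + (1 / (4 * e)) * (w j)\<^sup>2" using e by (simp only: mult_le_cancel_left_pos)
    then have "l j powr t * (\<bar>w j\<bar> * \<bar>c k j\<bar>) <= l j powr t * (e * (c k j)\<^sup>2 + (1 / (4 * e)) * (w j)\<^sup>2)"
      by (rule mult_left_mono) simp
    then show ?thesis by (simp add: f_def abs_mult distrib_left mult_ac)
  qed
  have nn: "0 <= l j powr t * y\<^sup>2" for j y by simp
  have Fi: "integrable ?N (\<lambda>j. l j powr t * (c k j)\<^sup>2)" for k by (rule cnt[OF c(1)]) simp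
  have Gi: "integrable ?N (\<lambda>j. (1 / (4 * e)) * (l j powr t * (w j)\<^sup>2))" for e
    by (intro integrable_mult_right cnt[OF w]) simp
  have FB: "(\<integral>j. l j powr t * (c k j)\<^sup>2 \<partial>?N) <= C" for k
    using c(2)[of k] Fi[of k] by (simp add: integral_count_space_nat)
  have lim': "AE j in ?N. (\<lambda>k. f k j) \<longlonglongrightarrow> 0"
    unfolding f_def using tendsto_mult_right_zero[OF lim] by (intro AE_I2) auto
  note R = tendsto_integral_eps_dominated[of f ?N "\<lambda>k j. l j powr t * (c k j)\<^sup>2" C "\<lambda>e j. (1 / (4 * e)) * (l j powr t * (w j)\<^sup>2)",
      OF _ Fi nn FB Gi _ dom lim']
  have 1: "(\<lambda>k. \<integral>j. \<bar>f k j\<bar> \<partial>?N) \<longlonglongrightarrow> 0" by (rule R(1)) auto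
  have 2: "integrable ?N (f k)" for k by (rule R(2)) auto
  have "norm (\<integral>j. f k j \<partial>?N) <= (\<integral>j. \<bar>f k j\<bar> \<partial>?N)" for k using integral_norm_bound[of ?N "f k"] by simp
  then have "(\<lambda>k. \<integral>j. f k j \<partial>?N) \<longlonglongrightarrow> 0"
    by (intro Lim_null_comparison[OF _ 1]) (auto intro!: always_eventually)
  moreover have "(\<integral>j. f k j \<partial>?N) = (\<Sum>j. f k j)" for k by (rule integral_count_space_nat[OF 2])
  ultimately show ?thesis by (simp add: f_def)
qed

section \<open>Compactness in the form domain\<close>

context critical_system
begin

definition bil :: "real => ('a => real) => ('a => real) => real" where
  "bil t u v = (\<Sum>j. lam j powr t * ip M u (phi j) * ip M v (phi j))"

lemma ip_scaled_add: "L2 M u ==> L2 M v ==> L2 M g ==> ip M (\<lambda>x. u x + c * v x) g = ip M u g + c * ip M v g"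
  by (subst ip_add_left) (auto intro: L2_cmult simp: ip_cmult_left)

lemma bil_summable:
  assumes "ddom t u" "ddom t v"
  shows "summable (\<lambda>j. lam j powr t * ip M u (phi j) * ip M v (phi j))"
proof (rule summable_comparison_test)
  show "\<exists>N. \<forall>j\<ge>N. norm (lam j powr t * ip M u (phi j) * ip M v (phi j))
      <= lam j powr t * (ip M u (phi j))\<^sup>2 + lam j powr t * (ip M v (phi j))\<^sup>2"
  proof (intro exI[of _ 0] allI impI)
    fix j
    have "\<bar>a * b\<bar> <= a\<^sup>2 + b\<^sup>2" for a b :: real
    proof -
      have "2 * \<bar>a * b\<bar> <= a\<^sup>2 + b\<^sup>2" using sum_squares_bound[of "\<bar>a\<bar>" "\<bar>b\<bar>"] by (simp add: abs_mult mult.assoc)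
      then show ?thesis using abs_ge_zero[of "a * b"] by linarith
    qed
    then have "lam j powr t * \<bar>ip M u (phi j) * ip M v (phi j)\<bar> <= lam j powr t * ((ip M u (phi j))\<^sup>2 + (ip M v (phi j))\<^sup>2)"
      by (intro mult_left_mono) auto
    then show "norm (lam j powr t * ip M u (phi j) * ip M v (phi j))
      <= lam j powr t * (ip M u (phi j))\<^sup>2 + lam j powr t * (ip M v (phi j))\<^sup>2"
      by (simp add: abs_mult distrib_left mult.assoc)
  qed
  show "summable (\<lambda>j. lam j powr t * (ip M u (phi j))\<^sup>2 + lam j powr t * (ip M v (phi j))\<^sup>2)"
    using assms by (intro summable_add) (auto simp: ddom_iff)
qed

lemma QQ_expand:
  assumes u: "ddom t u" and v: "ddom t v"
  shows "ddom t (\<lambda>x. u x + c * v x)" "QQ t (\<lambda>x. u x + c * v x) = QQ t u + 2 * c * bil t u v + c\<^sup>2 * QQ t v"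
proof -
  have uv: "L2 M u" "L2 M v" and su: "summable (\<lambda>j. lam j powr t * (ip M u (phi j))\<^sup>2)" "summable (\<lambda>j. lam j powr t * (ip M v (phi j))\<^sup>2)"
    using assms by (auto simp: ddom_iff)
  have "(\<lambda>j. lam j powr t * (ip M u (phi j))\<^sup>2 + 2 * c * (lam j powr t * ip M u (phi j) * ip M v (phi j)) + c\<^sup>2 * (lam j powr t * (ip M v (phi j))\<^sup>2))
    sums (QQ t u + 2 * c * bil t u v + c\<^sup>2 * QQ t v)"
    unfolding QQ_eq bil_def by (intro sums_add sums_mult summable_sums su bil_summable[OF u v])
  then have S: "(\<lambda>j. lam j powr t * (ip M (\<lambda>x. u x + c * v x) (phi j))\<^sup>2) sums (QQ t u + 2 * c * bil t u v + c\<^sup>2 * QQ t v)"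
    unfolding ip_scaled_add[OF uv phi_L2] by (simp add: power2_eq_square algebra_simps)
  show "ddom t (\<lambda>x. u x + c * v x)" unfolding ddom_iff using S uv by (auto intro!: L2_add L2_cmult simp: sums_iff)
  show "QQ t (\<lambda>x. u x + c * v x) = QQ t u + 2 * c * bil t u v + c\<^sup>2 * QQ t v" using S unfolding QQ_eq by (simp add: sums_iff)
qed

lemma ddom_scale: "ddom t u ==> ddom t (\<lambda>x. c * u x)"
  and QQ_scale: "ddom t u ==> QQ t (\<lambda>x. c * u x) = c\<^sup>2 * QQ t u"
  and bil_scale: "ddom t u ==> ddom t v ==> bil t (\<lambda>x. c * u x) v = c * bil t u v"
proof -
  have e: "(\<lambda>j. lam j powr t * (ip M (\<lambda>x. c * u x) (phi j))\<^sup>2) = (\<lambda>j. c\<^sup>2 * (lam j powr t * (ip M u (phi j))\<^sup>2))"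
    by (simp add: ip_cmult_left power_mult_distrib mult_ac)
  show "ddom t u ==> ddom t (\<lambda>x. c * u x)" unfolding ddom_iff e by (auto intro: L2_cmult summable_mult)
  show "ddom t u ==> QQ t (\<lambda>x. c * u x) = c\<^sup>2 * QQ t u" unfolding QQ_eq e ddom_iff by (auto intro: suminf_mult)
  assume uv: "ddom t u" "ddom t v"
  have "(\<lambda>j. lam j powr t * ip M (\<lambda>x. c * u x) (phi j) * ip M v (phi j)) = (\<lambda>j. c * (lam j powr t * ip M u (phi j) * ip M v (phi j)))"
    by (simp add: ip_cmult_left mult_ac)
  then show "bil t (\<lambda>x. c * u x) v = c * bil t u v"
    unfolding bil_def by (simp only: suminf_mult[OF bil_summable[OF uv]])
qed

lemma ddom_diff:
  assumes "ddom t u" "ddom t v"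
  shows "ddom t (\<lambda>x. u x - v x)" "QQ t (\<lambda>x. u x - v x) <= 2 * QQ t u + 2 * QQ t v"
proof -
  have e: "(\<lambda>x. u x - v x) = (\<lambda>x. u x + (-1) * v x)" by simp
  show 1: "ddom t (\<lambda>x. u x - v x)" unfolding e by (rule QQ_expand(1)[OF assms])
  have "0 <= QQ t (\<lambda>x. u x + 1 * v x)" by (rule QQ_nonneg[OF QQ_expand(1)[OF assms]])
  then show "QQ t (\<lambda>x. u x - v x) <= 2 * QQ t u + 2 * QQ t v"
    unfolding e QQ_expand(2)[OF assms] by simp
qed

lemma ddom_mono:
  assumes u: "ddom m u" and s: "s <= m" "0 <= s"
  shows "ddom s u"
proof -
  have uL: "L2 M u" using u by (simp add: ddom_iff)
  have "summable (\<lambda>j. lam j powr s * (ip M u (phi j))\<^sup>2)"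
  proof (rule summable_comparison_test)
    show "summable (\<lambda>j. (ip M u (phi j))\<^sup>2 + lam j powr m * (ip M u (phi j))\<^sup>2)"
      using bessel[OF uL] u by (intro summable_add) (auto simp: ddom_iff)
    have le: "lam j powr s <= 1 + lam j powr m" for j
    proof (cases "lam j <= 1")
      case True
      then have "lam j powr s <= 1" using s lam_pos[of j] by (intro powr_le1) auto
      then show ?thesis using powr_ge_zero[of "lam j" m] by linarith
    next
      case False
      then have "lam j powr s <= lam j powr m" using s by (intro powr_mono) auto
      then show ?thesis by linarith
    qed
    show "\<exists>N. \<forall>j\<ge>N. norm (lam j powr s * (ip M u (phi j))\<^sup>2) <= (ip M u (phi j))\<^sup>2 + lam j powr m * (ip M u (phi j))\<^sup>2"
      using mult_right_mono[OF le zero_le_power2] by (intro exI[of _ 0]) (simp add: distrib_right)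
  qed
  then show ?thesis using uL by (simp add: ddom_iff)
qed

lemma qmass_nonneg: "0 <= qmass u" by (simp add: qmass_def)

lemma qmass_pos:
  assumes "ddom m u" "\<not> (AE x in M. u x = 0)"
  shows "0 < qmass u"
proof -
  have "qmass u \<noteq> 0"
  proof
    assume "qmass u = 0"
    then have "AE x in M. \<bar>u x\<bar> powr cq = 0"
      unfolding qmass_def using sobolev(1)[OF assms(1)] by (subst (asm) integral_nonneg_eq_0_iff_AE) auto
    then have "AE x in M. u x = 0" by eventually_elim simp
    then show False using assms by simp
  qed
  then show ?thesis using qmass_nonneg[of u] by simp
qed

lemma qmass_scale: "qmass (\<lambda>x. c * u x) = \<bar>c\<bar> powr cq * qmass u"
  by (simp add: qmass_def abs_mult powr_mult)

text \<open>A subsequence makes all coefficients converge simultaneously, and their limits define w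
  by the Riesz-Fischer theorem. The compact embedding then gives convergence in L2, and a further
  subsequence converges almost everywhere.\<close>

lemma form_domain_compact:
  fixes U :: "nat => 'a => real"
  assumes U: "\<And>k. ddom m (U k)" and UC: "\<And>k. QQ m (U k) <= C"
  obtains w r where "strict_mono (r :: nat => nat)" "ddom m w" "QQ m w <= C"
    "\<And>j. (\<lambda>k. ip M (U (r k)) (phi j)) \<longlonglongrightarrow> ip M w (phi j)" "AE x in M. (\<lambda>k. U (r k) x) \<longlonglongrightarrow> w x"
proof -
  define c where "c k j = ip M (U k) (phi j)" for k j
  obtain l0 where l0: "0 < l0" "\<And>j. l0 <= lam j" using lam_lower by blast
  have l0m: "l0 powr m <= lam j powr m" for j using l0 m_pos by (intro powr_mono2) (auto intro: less_imp_le)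
  have UL: "L2 M (U k)" and cs: "summable (\<lambda>j. lam j powr m * (c k j)\<^sup>2)" for k using U[of k] by (auto simp: ddom_iff c_def)
  have cC: "(\<Sum>j. lam j powr m * (c k j)\<^sup>2) <= C" for k using UC[of k] by (simp add: QQ_eq c_def)
  have C0: "0 <= C" using UC[of 0] QQ_nonneg[OF U[of 0]] by linarith
  have bound: "norm (c k j) <= sqrt (C / l0 powr m)" for k j
  proof -
    have "l0 powr m * (c k j)\<^sup>2 <= lam j powr m * (c k j)\<^sup>2" by (intro mult_right_mono l0m) simp
    also have "... <= (\<Sum>j. lam j powr m * (c k j)\<^sup>2)"
      using sum_le_suminf[OF cs, of "{j}" k] by simp
    also have "... <= C" by (rule cC)
    finally have "(c k j)\<^sup>2 <= C / l0 powr m" using l0 by (simp add: pos_le_divide_eq mult.commute)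
    then show ?thesis by (intro real_le_rsqrt) simp
  qed
  obtain r1 where r1: "strict_mono (r1 :: nat => nat)" "\<And>j. j \<in> UNIV ==> \<exists>l. (\<lambda>k. c (r1 k) j) \<longlonglongrightarrow> l"
    using function_convergent_subsequence[of "UNIV :: nat set" c "sqrt (C / l0 powr m)"] bound by auto
  define g where "g j = lim (\<lambda>k. c (r1 k) j)" for j
  have g: "(\<lambda>k. c (r1 k) j) \<longlonglongrightarrow> g j" for j
    using r1(2)[of j] unfolding g_def by (auto simp: convergent_def convergent_LIMSEQ_iff[symmetric])
  have gpart: "(\<Sum>j<N. lam j powr m * (g j)\<^sup>2) <= C" for N
  proof (rule LIMSEQ_le_const2)
    show "(\<lambda>k. \<Sum>j<N. lam j powr m * (c (r1 k) j)\<^sup>2) \<longlonglongrightarrow> (\<Sum>j<N. lam j powr m * (g j)\<^sup>2)" by (intro tendsto_intros g)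
    have "(\<Sum>j<N. lam j powr m * (c (r1 k) j)\<^sup>2) <= C" for k
      using sum_le_suminf[OF cs, of "{..<N}" "r1 k"] cC[of "r1 k"] by simp
    then show "\<exists>K. \<forall>k\<ge>K. (\<Sum>j<N. lam j powr m * (c (r1 k) j)\<^sup>2) <= C" by blast
  qed
  have gs: "summable (\<lambda>j. lam j powr m * (g j)\<^sup>2)" by (rule summableI_nonneg_bounded[OF _ gpart]) simp
  have gC: "(\<Sum>j. lam j powr m * (g j)\<^sup>2) <= C" by (rule suminf_le_const[OF gs gpart])
  have "summable (\<lambda>j. (g j)\<^sup>2)"
  proof (rule summable_comparison_test)
    show "summable (\<lambda>j. (1 / l0 powr m) * (lam j powr m * (g j)\<^sup>2))" by (intro summable_mult gs)
    have "(g j)\<^sup>2 <= (1 / l0 powr m) * (lam j powr m * (g j)\<^sup>2)" for j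
      using mult_right_mono[OF l0m zero_le_power2, of "g j" j] l0 by (simp add: pos_le_divide_eq mult.commute)
    then show "\<exists>N. \<forall>j\<ge>N. norm ((g j)\<^sup>2) <= (1 / l0 powr m) * (lam j powr m * (g j)\<^sup>2)" by auto
  qed
  from riesz_fischer[OF this] obtain w where w: "L2 M w" "\<And>j. ip M w (phi j) = g j" by blast
  have wd: "ddom m w" using w gs by (simp add: ddom_iff)
  have wC: "QQ m w <= C" using gC by (simp add: QQ_eq w)
  define D where "D k x = U (r1 k) x - w x" for k x
  have DL: "L2 M (D k)" for k unfolding D_def by (intro L2_diff UL w)
  have Dd: "ddom m (D k)" "QQ m (D k) <= 2 * C + 2 * C" for k
    unfolding D_def using ddom_diff[OF U[of "r1 k"] wd] UC[of "r1 k"] wC by auto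
  have Dc: "ip M (D k) (phi j) = c (r1 k) j - g j" for k j
    unfolding D_def by (subst ip_diff_left) (auto simp: UL w phi_L2 c_def)
  \<comment> \<open>The embedding is used into order 0, which by Parseval is the squared L2 norm;
    the eigenvalues being positive, the weights are indeed 1.\<close>
  have l1: "lam j powr 0 = 1" for j using lam_pos[of j] by simp
  have "(\<lambda>k. \<Sum>j. lam j powr 0 * (ip M (D k) (phi j))\<^sup>2) \<longlonglongrightarrow> (\<Sum>j. lam j powr 0 * 0\<^sup>2)"
  proof (rule weighted_sum_tendsto[where m = m and C = "2 * C + 2 * C"])
    show "(\<lambda>k. ip M (D k) (phi j)) \<longlonglongrightarrow> 0" for j
      using tendsto_diff[OF g[of j] tendsto_const[of "g j"]] by (simp add: Dc)
    show "summable (\<lambda>j. lam j powr 0 * (ip M (D k) (phi j))\<^sup>2)" for k unfolding l1 using bessel[OF DL] by simp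
    show "summable (\<lambda>j. lam j powr m * (ip M (D k) (phi j))\<^sup>2)" "(\<Sum>j. lam j powr m * (ip M (D k) (phi j))\<^sup>2) <= 2 * C + 2 * C" for k
      using Dd[of k] by (auto simp: ddom_iff QQ_eq)
  qed (use lam_pos finite_lam_le m_pos C0 in auto)
  moreover have "(\<Sum>j. lam j powr 0 * (ip M (D k) (phi j))\<^sup>2) = ip M (D k) (D k)" for k
    unfolding l1 using parseval[OF DL DL, of k k] by (simp add: sums_iff power2_eq_square)
  ultimately have D2: "(\<lambda>k. ip M (D k) (D k)) \<longlonglongrightarrow> 0" by simp
  have "(\<lambda>k. \<integral>x. norm (D k x) \<partial>M) \<longlonglongrightarrow> 0"
  proof (rule Lim_null_comparison)
    show "\<forall>\<^sub>F k in sequentially. norm (\<integral>x. norm (D k x) \<partial>M) <= sqrt (measure M (space M)) * sqrt (ip M (D k) (D k))"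
      using L1_le_L2[OF finite_M DL] by (intro always_eventually) simp
    show "(\<lambda>k. sqrt (measure M (space M)) * sqrt (ip M (D k) (D k))) \<longlonglongrightarrow> 0"
      using tendsto_mult_right_zero[OF tendsto_real_sqrt[OF D2, simplified]] .
  qed
  from tendsto_L1_AE_subseq[OF L2_integrable[OF finite_M DL] this]
  obtain r2 where r2: "strict_mono (r2 :: nat => nat)" "AE x in M. (\<lambda>k. D (r2 k) x) \<longlonglongrightarrow> 0" by blast
  show ?thesis
  proof (rule that[of "r1 \<circ> r2" w])
    show "strict_mono (r1 \<circ> r2)" using r1(1) r2(1) by (rule strict_mono_o)
    show "(\<lambda>k. ip M (U ((r1 \<circ> r2) k)) (phi j)) \<longlonglongrightarrow> ip M w (phi j)" for j
      using LIMSEQ_subseq_LIMSEQ[OF g[of j] r2(1)] by (simp add: w c_def o_def)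
    show "AE x in M. (\<lambda>k. U ((r1 \<circ> r2) k) x) \<longlonglongrightarrow> w x"
      using r2(2)
    proof eventually_elim
      case (elim x)
      then have "(\<lambda>k. D (r2 k) x + w x) \<longlonglongrightarrow> 0 + w x" by (intro tendsto_intros)
      then show ?case by (simp add: D_def)
    qed
  qed (use wd wC in auto)
qed

text \<open>In the expansion of the form at w + (U k - w) the cross term tends to 0 by weak
  convergence.\<close>

lemma QQ_splitting:
  fixes U :: "nat => 'a => real"
  assumes U: "\<And>k. ddom m (U k)" and UC: "\<And>k. QQ m (U k) <= C" and w: "ddom m w"
    and lim: "\<And>j. (\<lambda>k. ip M (U k) (phi j)) \<longlonglongrightarrow> ip M w (phi j)"
  shows "(\<lambda>k. QQ m (U k) - QQ m (\<lambda>x. U k x - w x)) \<longlonglongrightarrow> QQ m w"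
proof -
  define D where "D k x = U k x - w x" for k x
  have Dd: "ddom m (D k)" "QQ m (D k) <= 2 * C + 2 * QQ m w" for k
    unfolding D_def using ddom_diff[OF U[of k] w] UC[of k] by auto
  have Dc: "ip M (D k) (phi j) = ip M (U k) (phi j) - ip M w (phi j)" for k j
    unfolding D_def using U[of k] w by (subst ip_diff_left) (auto simp: ddom_iff phi_L2)
  have "(\<lambda>k. bil m w (D k)) \<longlonglongrightarrow> 0"
    unfolding bil_def
  proof (rule weak_sum_tendsto)
    show "summable (\<lambda>j. lam j powr m * (ip M (D k) (phi j))\<^sup>2)" "(\<Sum>j. lam j powr m * (ip M (D k) (phi j))\<^sup>2) <= 2 * C + 2 * QQ m w" for k
      using Dd[of k] by (auto simp: ddom_iff QQ_eq)
    show "summable (\<lambda>j. lam j powr m * (ip M w (phi j))\<^sup>2)" using w by (simp add: ddom_iff)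
    show "(\<lambda>k. ip M (D k) (phi j)) \<longlonglongrightarrow> 0" for j
      using tendsto_diff[OF lim[of j] tendsto_const[of "ip M w (phi j)"]] by (simp add: Dc)
  qed
  then have "(\<lambda>k. QQ m w + 2 * bil m w (D k)) \<longlonglongrightarrow> QQ m w + 2 * 0" by (intro tendsto_intros)
  moreover have "QQ m w + 2 * bil m w (D k) = QQ m (U k) - QQ m (\<lambda>x. U k x - w x)" for k
  proof -
    have "(\<lambda>x. w x + 1 * D k x) = U k" by (simp add: D_def)
    then have "QQ m (U k) = QQ m w + 2 * 1 * bil m w (D k) + 1\<^sup>2 * QQ m (D k)" using QQ_expand(2)[OF w Dd(1), of 1 k] by simp
    then show ?thesis by (simp add: D_def[abs_def])
  qed
  ultimately show ?thesis by simp
qed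

text \<open>The tangent inequality for v and for -v bounds the product by the sum of |w + v|^q and
  |w - v|^q, both integrable by the Sobolev inequality.\<close>

lemma nonlinearity_integrable:
  assumes w: "ddom m w" and v: "ddom m v"
  shows "integrable M (\<lambda>x. \<bar>w x\<bar> powr (cq - 2) * w x * v x)"
proof (rule Bochner_Integration.integrable_bound)
  have [measurable]: "w \<in> borel_measurable M" "v \<in> borel_measurable M" using w v by (auto simp: ddom_iff L2_def)
  show "(\<lambda>x. \<bar>w x\<bar> powr (cq - 2) * w x * v x) \<in> borel_measurable M" by measurable
  have vw: "ddom m (\<lambda>x. w x + 1 * v x)" "ddom m (\<lambda>x. w x + (-1) * v x)" by (rule QQ_expand[OF w v])+
  show "integrable M (\<lambda>x. \<bar>w x + 1 * v x\<bar> powr cq + \<bar>w x + (-1) * v x\<bar> powr cq)"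
    by (intro Bochner_Integration.integrable_add sobolev(1) vw)
  show "AE x in M. norm (\<bar>w x\<bar> powr (cq - 2) * w x * v x) <= norm (\<bar>w x + 1 * v x\<bar> powr cq + \<bar>w x + (-1) * v x\<bar> powr cq)"
  proof (rule AE_I2)
    fix x
    define y where "y = \<bar>w x\<bar> powr (cq - 2) * w x * v x"
    have q: "1 < cq" using exps by simp
    have "\<bar>w x\<bar> powr cq + cq * y <= \<bar>w x + 1 * v x\<bar> powr cq" "\<bar>w x\<bar> powr cq + cq * - y <= \<bar>w x + (-1) * v x\<bar> powr cq"
      using powr_abs_tangent[OF q, of "w x" "v x"] powr_abs_tangent[OF q, of "w x" "- v x"] by (auto simp: y_def)
    then have "cq * y <= \<bar>w x + 1 * v x\<bar> powr cq" "cq * - y <= \<bar>w x + (-1) * v x\<bar> powr cq"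
      using powr_ge_zero[of "\<bar>w x\<bar>" cq] by linarith+
    moreover have "\<bar>y\<bar> <= \<bar>cq * y\<bar>" using q by (simp add: abs_mult mult_le_cancel_right1)
    ultimately have "\<bar>y\<bar> <= \<bar>w x + 1 * v x\<bar> powr cq + \<bar>w x + (-1) * v x\<bar> powr cq"
      using powr_ge_zero[of "\<bar>w x + 1 * v x\<bar>" cq] powr_ge_zero[of "\<bar>w x + (-1) * v x\<bar>" cq] by linarith
    then show "norm (\<bar>w x\<bar> powr (cq - 2) * w x * v x) <= norm (\<bar>w x + 1 * v x\<bar> powr cq + \<bar>w x + (-1) * v x\<bar> powr cq)"
      unfolding y_def[symmetric] real_norm_def by linarith
  qed
qed

end

section \<open>The minimization problem with an abstract lower order term\<close>

text \<open>Collects what the spectral and the Hardy term share: a quadratic functional B with polar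
  form b, continuous along sequences that are bounded in the form domain and converge weakly and
  almost everywhere, dominated by the fraction th of the main form, and pushing some quotient
  strictly below the Sobolev constant.\<close>

locale perturbed_minimization = critical_system \<Omega> lam phi m
  for \<Omega> :: "'a::euclidean_space set" and lam phi m +
  fixes l th :: real and B :: "('a => real) => real" and b :: "('a => real) => ('a => real) => real"
  assumes th: "0 <= th" "th < 1" and B_le: "\<And>u. ddom m u ==> l * B u <= th * QQ m u"
    and B_scale: "\<And>c u. ddom m u ==> B (\<lambda>x. c * u x) = c\<^sup>2 * B u"
    and b_scale: "\<And>c u v. ddom m u ==> ddom m v ==> b (\<lambda>x. c * u x) v = c * b u v"
    and B_expand: "\<And>u v t. ddom m u ==> ddom m v ==> B (\<lambda>x. u x + t * v x) = B u + 2 * t * b u v + t\<^sup>2 * B v"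
    and B_conv: "\<And>U w C. (\<And>k. ddom m (U k)) ==> (\<And>k. QQ m (U k) <= C) ==> ddom m w ==> QQ m w <= C ==>
      (\<And>j. (\<lambda>k. ip M (U k) (phi j)) \<longlonglongrightarrow> ip M w (phi j)) ==> (AE x in M. (\<lambda>k. U k x) \<longlonglongrightarrow> w x) ==>
      (\<lambda>k. B (U k)) \<longlonglongrightarrow> B w"
    and below_sob: "\<exists>u. ddom m u \<and> \<not> (AE x in M. u x = 0) \<and> QQ m u - l * B u < sob * qmass u powr (2 / cq)"
begin

definition EE :: "('a => real) => real" where "EE u = QQ m u - l * B u"

definition ratios :: "real set" where
  "ratios = {EE u / qmass u powr (2 / cq) | u. ddom m u \<and> \<not> (AE x in M. u x = 0)}"

lemma EE_ge: "ddom m u ==> (1 - th) * QQ m u <= EE u"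
  using B_le[of u] by (simp add: EE_def algebra_simps)

lemma EE_nonneg: "ddom m u ==> 0 <= EE u"
  using EE_ge[of u] QQ_nonneg[of m u] th mult_nonneg_nonneg[of "1 - th" "QQ m u"] by linarith

lemma ratios_lower: "y \<in> ratios ==> (1 - th) * sob <= y"
proof -
  assume "y \<in> ratios"
  then obtain u where u: "ddom m u" "\<not> (AE x in M. u x = 0)" and y: "y = EE u / qmass u powr (2 / cq)"
    unfolding ratios_def by blast
  have q: "0 < qmass u powr (2 / cq)" using qmass_pos[OF u] by simp
  have "(1 - th) * (sob * qmass u powr (2 / cq)) <= (1 - th) * QQ m u"
    using sobolev(2)[OF u(1)] th unfolding qmass_def by (intro mult_left_mono) auto
  also have "... <= EE u" by (rule EE_ge[OF u(1)])
  finally show ?thesis unfolding y using q by (simp add: pos_le_divide_eq mult.assoc)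
qed

lemma ratios_bdd: "bdd_below ratios" using ratios_lower by (rule bdd_belowI)

lemma ratios_below_sob: "\<exists>y\<in>ratios. y < sob"
proof -
  obtain u where u: "ddom m u" "\<not> (AE x in M. u x = 0)" "EE u < sob * qmass u powr (2 / cq)"
    using below_sob unfolding EE_def by blast
  have "EE u / qmass u powr (2 / cq) < sob" using u(3) qmass_pos[OF u(1,2)] by (simp add: pos_divide_less_eq)
  moreover have "EE u / qmass u powr (2 / cq) \<in> ratios" unfolding ratios_def using u by blast
  ultimately show ?thesis by blast
qed

lemma Inf_ratios: "0 < Inf ratios" "Inf ratios < sob" "ratios \<noteq> {}"
proof -
  show ne: "ratios \<noteq> {}" using ratios_below_sob by blast
  have "(1 - th) * sob <= Inf ratios" using ratios_lower by (rule cInf_greatest[OF ne])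
  moreover have "0 < (1 - th) * sob" using th sob_pos by simp
  ultimately show "0 < Inf ratios" by linarith
  show "Inf ratios < sob" using ratios_below_sob cInf_lower[OF _ ratios_bdd] by (meson le_less_trans)
qed

lemma Inf_ratios_le: "ddom m u ==> Inf ratios * qmass u powr (2 / cq) <= EE u"
proof (cases "qmass u = 0")
  case False
  assume u: "ddom m u"
  then have q: "0 < qmass u powr (2 / cq)" using False qmass_nonneg[of u] by simp
  have "\<not> (AE x in M. u x = 0)"
  proof
    assume ae: "AE x in M. u x = 0"
    have "qmass u = (\<integral>x. 0 \<partial>M)"
      unfolding qmass_def using ae sobolev(1)[OF u] by (intro integral_cong_AE) auto
    then show False using False by simp
  qed
  then have "EE u / qmass u powr (2 / cq) \<in> ratios" unfolding ratios_def using u by blast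
  from cInf_lower[OF this ratios_bdd] show ?thesis using q by (simp add: pos_le_divide_eq)
qed (simp add: EE_nonneg)

lemma minimizing_sequence: "\<exists>u. ddom m u \<and> qmass u = 1 \<and> EE u < Inf ratios + e" if e: "0 < e"
proof -
  obtain y where y: "y \<in> ratios" "y < Inf ratios + e"
    using cInf_lessD[OF Inf_ratios(3), of "Inf ratios + e"] e by auto
  then obtain u where u: "ddom m u" "\<not> (AE x in M. u x = 0)" and yu: "y = EE u / qmass u powr (2 / cq)"
    unfolding ratios_def by blast
  have q: "0 < qmass u" by (rule qmass_pos[OF u])
  define c where "c = qmass u powr (- (1 / cq))"
  have c: "0 < c" using q by (simp add: c_def)
  have ccq: "c powr cq = 1 / qmass u"
    unfolding c_def powr_powr using exps q by (simp add: powr_minus_divide)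
  have c2: "c\<^sup>2 = 1 / qmass u powr (2 / cq)"
  proof -
    have "c\<^sup>2 = qmass u powr (- (1 / cq) + - (1 / cq))" unfolding c_def power2_eq_square powr_add ..
    also have "- (1 / cq) + - (1 / cq) = - (2 / cq)" by simp
    finally show ?thesis by (simp only: powr_minus_divide)
  qed
  have "qmass (\<lambda>x. c * u x) = 1" using c q by (simp add: qmass_scale ccq)
  moreover have "EE (\<lambda>x. c * u x) = c\<^sup>2 * EE u"
    using u(1) by (simp add: EE_def QQ_scale B_scale right_diff_distrib)
  then have "EE (\<lambda>x. c * u x) = y" by (simp add: c2 yu)
  ultimately show ?thesis using ddom_scale[OF u(1), of c] y(2) by auto
qed

text \<open>With I the infimum and a the q-mass of the limit w, splitting the form and the q-mass
  along a minimizing sequence of mass 1 gives EE w + sob (1 - a)^(2/q) <= I, while EE w >= I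
  a^(2/q). As y <= y^(2/q) on [0, 1] and sob > I, this forces a = 1.\<close>

lemma minimizer_exists: "\<exists>w. ddom m w \<and> qmass w = 1 \<and> EE w = Inf ratios"
proof -
  define I where "I = Inf ratios"
  have I: "0 < I" "I < sob" using Inf_ratios by (auto simp: I_def)
  have "\<exists>u. \<forall>k. ddom m (u k) \<and> qmass (u k) = 1 \<and> EE (u k) < I + 1 / real (Suc k)"
    unfolding I_def by (intro choice allI minimizing_sequence) simp
  then obtain u where u: "\<And>k. ddom m (u k)" "\<And>k. qmass (u k) = 1" "\<And>k. EE (u k) < I + 1 / real (Suc k)" by auto
  define C where "C = (I + 1) / (1 - th)"
  have uC: "QQ m (u k) <= C" for k
  proof -
    have "1 / real (Suc k) <= 1" by simp
    then have "(1 - th) * QQ m (u k) <= I + 1" using EE_ge[OF u(1)[of k]] u(3)[of k] by linarith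
    then show ?thesis using th by (simp add: C_def pos_le_divide_eq mult.commute)
  qed
  obtain w r where r: "strict_mono (r :: nat => nat)" and w: "ddom m w" "QQ m w <= C"
    and wc: "\<And>j. (\<lambda>k. ip M (u (r k)) (phi j)) \<longlonglongrightarrow> ip M w (phi j)" and wae: "AE x in M. (\<lambda>k. u (r k) x) \<longlonglongrightarrow> w x"
    by (rule form_domain_compact[of u C, OF u(1) uC]) (rule that)
  define U where "U k = u (r k)" for k
  have U: "ddom m (U k)" "qmass (U k) = 1" "QQ m (U k) <= C" for k using u uC by (auto simp: U_def)
  have EU: "(\<lambda>k. EE (U k)) \<longlonglongrightarrow> I"
  proof (rule tendsto_sandwich)
    show "\<forall>\<^sub>F k in sequentially. I <= EE (U k)"
      using Inf_ratios_le[OF U(1)] by (intro always_eventually allI) (simp add: U(2) I_def)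
    show "\<forall>\<^sub>F k in sequentially. EE (U k) <= I + 1 / real (Suc (r k))"
      unfolding U_def by (intro always_eventually allI less_imp_le u(3))
    have "(\<lambda>k. I + 1 / real (Suc k)) \<longlonglongrightarrow> I + 0" by (intro tendsto_intros) (rule LIMSEQ_Suc[OF lim_1_over_n, unfolded o_def])
    from LIMSEQ_subseq_LIMSEQ[OF this r] show "(\<lambda>k. I + 1 / real (Suc (r k))) \<longlonglongrightarrow> I" by (simp add: o_def)
  qed simp
  have BU: "(\<lambda>k. B (U k)) \<longlonglongrightarrow> B w"
    by (rule B_conv[OF U(1) U(3) w]) (use wc wae in \<open>auto simp: U_def\<close>)
  define D where "D k x = U k x - w x" for k x
  have Dd: "ddom m (D k)" "QQ m (D k) <= 2 * C + 2 * C" for k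
    unfolding D_def using ddom_diff[OF U(1)[of k] w(1)] U(3)[of k] w(2) by auto
  have QD: "(\<lambda>k. QQ m (U k) - QQ m (D k)) \<longlonglongrightarrow> QQ m w"
    unfolding D_def by (rule QQ_splitting[OF U(1) U(3) w(1)]) (use wc in \<open>simp add: U_def\<close>)
  have "(\<lambda>k. EE (U k) + l * B (U k) - (QQ m (U k) - QQ m (D k))) \<longlonglongrightarrow> I + l * B w - QQ m w"
    by (intro tendsto_intros EU BU QD)
  then have QDl: "(\<lambda>k. QQ m (D k)) \<longlonglongrightarrow> I - EE w" by (simp add: EE_def diff_diff_eq2)
  have q1: "1 < cq" "0 < cq" using exps by auto
  have wm: "w \<in> borel_measurable M" using w by (simp add: ddom_iff L2_def)
  have Dm: "D k \<in> borel_measurable M" for k using Dd[of k] by (simp add: ddom_iff L2_def)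
  have DU: "D k x + w x = U k x" for k x by (simp add: D_def)
  define K where "K = ((2 * C + 2 * C) / sob) powr (cq / 2)"
  have qD: "qmass (D k) <= K" for k
  proof -
    have "qmass (D k) powr (2 / cq) <= (2 * C + 2 * C) / sob"
      using sobolev(2)[OF Dd(1)[of k]] Dd(2)[of k] sob_pos unfolding qmass_def[symmetric] by (simp add: pos_le_divide_eq mult.commute)
    then have "(qmass (D k) powr (2 / cq)) powr (cq / 2) <= K" unfolding K_def using q1 by (intro powr_mono2) auto
    then show ?thesis unfolding powr_powr using q1 qmass_nonneg[of "D k"] by simp
  qed
  have "(\<lambda>k. (\<integral>x. \<bar>D k x + w x\<bar> powr cq \<partial>M) - (\<integral>x. \<bar>D k x\<bar> powr cq \<partial>M)) \<longlonglongrightarrow> (\<integral>x. \<bar>w x\<bar> powr cq \<partial>M)"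
  proof (rule Brezis_Lieb[OF q1(1) Dm wm sobolev(1)[OF Dd(1)] sobolev(1)[OF w(1)]])
    show "(\<integral>x. \<bar>D k x\<bar> powr cq \<partial>M) <= K" for k using qD[of k] by (simp add: qmass_def)
    show "AE x in M. (\<lambda>k. D k x) \<longlonglongrightarrow> 0"
      using wae
    proof eventually_elim
      case (elim x)
      then have "(\<lambda>k. u (r k) x - w x) \<longlonglongrightarrow> w x - w x" by (intro tendsto_intros)
      then show ?case by (simp add: D_def U_def)
    qed
    show "integrable M (\<lambda>x. \<bar>D k x + w x\<bar> powr cq)" for k unfolding DU by (rule sobolev(1)[OF U(1)])
  qed
  then have "(\<lambda>k. 1 - qmass (D k)) \<longlonglongrightarrow> qmass w" unfolding DU qmass_def[symmetric] U(2) .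
  from tendsto_diff[OF tendsto_const[of 1] this] have qDl: "(\<lambda>k. qmass (D k)) \<longlonglongrightarrow> 1 - qmass w" by simp
  have "0 <= 1 - qmass w" by (rule LIMSEQ_le_const[OF qDl]) (use qmass_nonneg in blast)
  note a = qmass_nonneg[of w] this
  have "(\<lambda>k. sob * qmass (D k) powr (2 / cq)) \<longlonglongrightarrow> sob * (1 - qmass w) powr (2 / cq)"
    using q1 qmass_nonneg by (intro tendsto_intros tendsto_powr'[OF qDl]) (auto intro: always_eventually)
  then have le: "sob * (1 - qmass w) powr (2 / cq) <= I - EE w"
    using sobolev(2)[OF Dd(1)] by (intro LIMSEQ_le[OF _ QDl]) (auto simp: qmass_def)
  have Iw: "I * qmass w powr (2 / cq) <= EE w" unfolding I_def by (rule Inf_ratios_le[OF w(1)])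
  \<comment> \<open>Concavity with exponent 2/q < 1: splitting the mass never lowers the total cost,
    and the escaping part is paid for at the strictly higher price sob.\<close>
  have r1: "y <= y powr (2 / cq)" if y: "0 <= y" "y <= 1" for y
  proof (cases "y = 0")
    case False
    then show ?thesis using y exps powr_mono'[of "2 / cq" 1 y] by simp
  qed simp
  have "sob * (1 - qmass w) <= sob * (1 - qmass w) powr (2 / cq)" using a sob_pos by (intro mult_left_mono r1) auto
  moreover have "I * qmass w <= I * qmass w powr (2 / cq)" using a I by (intro mult_left_mono r1) auto
  ultimately have "sob * (1 - qmass w) + I * qmass w <= I" using le Iw by linarith
  then have "(sob - I) * (1 - qmass w) <= 0" by (simp add: algebra_simps)
  then have "1 - qmass w <= 0" using I by (simp add: mult_le_0_iff)
  then have qw: "qmass w = 1" using a by simp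
  then have "EE w = I" using le Iw by simp
  then show ?thesis using w(1) qw unfolding I_def by blast
qed

text \<open>The q-mass of w + t v is bounded below by its tangent at t = 0, which suffices for a
  minimum: comparison with an explicit function of t yields the equation while no derivative is
  taken under the integral sign.\<close>

lemma Euler_Lagrange:
  assumes w: "ddom m w" "qmass w = 1" "EE w = Inf ratios" and v: "ddom m v"
  shows "bil m w v - l * b w v = Inf ratios * (\<integral>x. \<bar>w x\<bar> powr (cq - 2) * w x * v x \<partial>M)"
proof -
  define I where "I = Inf ratios"
  have I: "0 < I" using Inf_ratios by (simp add: I_def)
  define L where "L = (\<integral>x. \<bar>w x\<bar> powr (cq - 2) * w x * v x \<partial>M)"
  define A where "A = bil m w v - l * b w v"
  have q: "1 < cq" "0 < cq" using exps by auto
  have Et: "EE (\<lambda>x. w x + t * v x) = I + 2 * t * A + t\<^sup>2 * EE v" for t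
    using w(3) unfolding EE_def QQ_expand(2)[OF w(1) v] B_expand[OF w(1) v] I_def A_def by (simp add: algebra_simps)
  have qt: "1 + cq * (t * L) <= qmass (\<lambda>x. w x + t * v x)" for t
  proof -
    note iw = sobolev(1)[OF w(1)] and iL = nonlinearity_integrable[OF w(1) v]
    have "1 + cq * (t * L) = (\<integral>x. \<bar>w x\<bar> powr cq + cq * (t * (\<bar>w x\<bar> powr (cq - 2) * w x * v x)) \<partial>M)"
      using iw iL w(2) by (simp add: L_def qmass_def)
    also have "... <= (\<integral>x. \<bar>w x + t * v x\<bar> powr cq \<partial>M)"
    proof (rule integral_mono)
      show "\<bar>w x\<bar> powr cq + cq * (t * (\<bar>w x\<bar> powr (cq - 2) * w x * v x)) <= \<bar>w x + t * v x\<bar> powr cq" for x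
        using powr_abs_tangent[OF q(1), of "w x" "t * v x"] by (simp add: mult_ac)
    qed (use iw iL sobolev(1)[OF QQ_expand(1)[OF w(1) v]] in auto)
    finally show ?thesis by (simp add: qmass_def)
  qed
  \<comment> \<open>The mass of w + t v is replaced by its tangent lower bound, so h is explicit and
    near t = 0 is at least h 0 = 0; its derivative at 0 is 2 A - 2 I L.\<close>
  define h where "h t = I + 2 * t * A + t\<^sup>2 * EE v - I * (1 + cq * (t * L)) powr (2 / cq)" for t
  have "(h has_real_derivative (2 * A - I * (2 / cq * (cq * L)))) (at 0)"
    unfolding h_def using q by (auto intro!: derivative_eq_intros)
  \<comment> \<open>For |t| < d the base 1 + q t L is nonnegative, so that raising to the power 2/q
    is monotone. The added 1 covers L = 0.\<close>
  moreover define d where "d = 1 / (cq * \<bar>L\<bar> + 1)"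
  have cL: "0 <= cq * \<bar>L\<bar>" using q by simp
  then have "0 < d" by (simp add: d_def)
  moreover have "\<forall>t. \<bar>0 - t\<bar> < d --> h 0 <= h t"
  proof (intro allI impI)
    fix t assume "\<bar>0 - t\<bar> < d"
    then have t: "\<bar>t\<bar> * (cq * \<bar>L\<bar> + 1) < 1" using cL by (simp add: d_def pos_less_divide_eq)
    have "\<bar>cq * (t * L)\<bar> = \<bar>t\<bar> * (cq * \<bar>L\<bar>)" using q by (simp add: abs_mult)
    also have "... <= \<bar>t\<bar> * (cq * \<bar>L\<bar> + 1)" by (intro mult_left_mono) auto
    finally have pos: "0 <= 1 + cq * (t * L)" using t by linarith
    have "I * (1 + cq * (t * L)) powr (2 / cq) <= I * qmass (\<lambda>x. w x + t * v x) powr (2 / cq)"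
      using I q pos qt[of t] by (intro mult_left_mono powr_mono2) auto
    also have "... <= EE (\<lambda>x. w x + t * v x)" unfolding I_def by (rule Inf_ratios_le[OF QQ_expand(1)[OF w(1) v]])
    finally show "h 0 <= h t" unfolding Et by (simp add: h_def)
  qed
  ultimately have "2 * A - I * (2 / cq * (cq * L)) = 0" by (rule DERIV_local_min)
  then have "A = I * L" using q by simp
  then show ?thesis by (simp add: A_def I_def L_def)
qed

theorem minimum_attained:
  "\<exists>u. ddom m u \<and> \<not> (AE x in M. u x = 0) \<and> (QQ m u - l * B u) / qmass u powr (2 / cq) = Inf ratios"
proof -
  obtain w where w: "ddom m w" "qmass w = 1" "EE w = Inf ratios" using minimizer_exists by blast
  have "\<not> (AE x in M. w x = 0)"
  proof
    assume ae: "AE x in M. w x = 0"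
    have "qmass w = (\<integral>x. 0 \<partial>M)"
      unfolding qmass_def using ae sobolev(1)[OF w(1)] by (intro integral_cong_AE) auto
    then show False using w by simp
  qed
  then show ?thesis using w unfolding EE_def by (intro exI[of _ w]) simp
qed

theorem weak_solution_exists:
  "\<exists>u. ddom m u \<and> \<not> (AE x in M. u x = 0) \<and>
    (\<forall>v. ddom m v --> bil m u v = l * b u v + (\<integral>x. \<bar>u x\<bar> powr (cq - 2) * u x * v x \<partial>M))"
proof -
  obtain w where w: "ddom m w" "qmass w = 1" "EE w = Inf ratios" using minimizer_exists by blast
  define I where "I = Inf ratios"
  have I: "0 < I" using Inf_ratios by (simp add: I_def)
  \<comment> \<open>The Lagrange multiplier I scales away: the two sides of the equation have
    degrees 1 and q - 1, so c^(q - 2) = I is required.\<close>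
  define c where "c = I powr (1 / (cq - 2))"
  have c: "0 < c" using I by (simp add: c_def)
  have cI: "c powr (cq - 2) = I" unfolding c_def powr_powr using I exps by simp
  have nz: "\<not> (AE x in M. c * w x = 0)"
  proof
    assume "AE x in M. c * w x = 0"
    then have ae: "AE x in M. w x = 0" by eventually_elim (use c in simp)
    have "qmass w = (\<integral>x. 0 \<partial>M)"
      unfolding qmass_def using ae sobolev(1)[OF w(1)] by (intro integral_cong_AE) auto
    then show False using w by simp
  qed
  have "bil m (\<lambda>x. c * w x) v = l * b (\<lambda>x. c * w x) v + (\<integral>x. \<bar>c * w x\<bar> powr (cq - 2) * (c * w x) * v x \<partial>M)" if v: "ddom m v" for v
  proof -
    have e: "\<bar>c * w x\<bar> powr (cq - 2) * (c * w x) * v x = c * I * (\<bar>w x\<bar> powr (cq - 2) * w x * v x)" for x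
    proof -
      have "\<bar>c * w x\<bar> powr (cq - 2) = I * \<bar>w x\<bar> powr (cq - 2)" using c by (simp add: abs_mult powr_mult cI)
      then show ?thesis by (simp add: mult_ac)
    qed
    have "(\<integral>x. \<bar>c * w x\<bar> powr (cq - 2) * (c * w x) * v x \<partial>M) = c * (I * (\<integral>x. \<bar>w x\<bar> powr (cq - 2) * w x * v x \<partial>M))"
      unfolding e by simp
    also have "... = c * (bil m w v - l * b w v)" unfolding Euler_Lagrange[OF w v] I_def ..
    finally show ?thesis unfolding bil_scale[OF w(1) v] b_scale[OF w(1) v] by (simp add: algebra_simps)
  qed
  then show ?thesis using nz ddom_scale[OF w(1), of c] by (intro exI[of _ "\<lambda>x. c * w x"]) blast
qed

end

section \<open>The spectral and the Hardy lower order term\<close>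

context critical_system
begin

text \<open>The fraction is l divided by the infimum. If B u = 0 the bound is trivial; otherwise u
  is nonzero, so its quotient is among those over which the infimum is taken.\<close>

lemma coercive_below_Inf:
  assumes l: "0 < l" "l < Inf {QQ m u / B u | u. ddom m u \<and> \<not> (AE x in M. u x = 0)}"
    and B0: "\<And>u. ddom m u ==> 0 <= B u" and Bz: "\<And>u. ddom m u ==> (AE x in M. u x = 0) ==> B u = 0"
  shows "\<exists>th. 0 <= th \<and> th < 1 \<and> (\<forall>u. ddom m u --> l * B u <= th * QQ m u)"
proof -
  define R where "R = {QQ m u / B u | u. ddom m u \<and> \<not> (AE x in M. u x = 0)}"
  have bdd: "bdd_below R" by (rule bdd_belowI[of _ 0]) (auto simp: R_def QQ_nonneg B0)
  have I: "l < Inf R" using l by (simp add: R_def)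
  have "l * B u <= l / Inf R * QQ m u" if u: "ddom m u" for u
  proof (cases "B u = 0")
    case True
    then show ?thesis using l I QQ_nonneg[OF u] by simp
  next
    case False
    then have Bp: "0 < B u" using B0[OF u] by simp
    have "QQ m u / B u \<in> R" unfolding R_def using u Bz[OF u] False by blast
    from cInf_lower[OF this bdd] have "Inf R * B u <= QQ m u" using Bp by (simp add: pos_le_divide_eq)
    then have "l / Inf R * (Inf R * B u) <= l / Inf R * QQ m u" using l I by (intro mult_left_mono) auto
    then show ?thesis using l I by simp
  qed
  moreover have "0 <= l / Inf R" "l / Inf R < 1" using l I by auto
  ultimately show ?thesis by blast
qed

lemma form_dom_eqs:
  "form_dom \<Omega> lam phi t u \<longleftrightarrow> ddom t u" "Qform \<Omega> lam phi t u = QQ t u" "bform \<Omega> lam phi t u v = bil t u v"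
  "hardy_int \<Omega> s u = hardy s u" "sob_den \<Omega> m u = qmass u powr (2 / cq)"
  unfolding ddom_def QQ_def bform_def bil_def fcoeff_eq hardy_int_def hardy_def sob_den_def qmass_def
    crit_exp_eq integral_M_set by (rule refl)+

lemma spectral_conv:
  fixes U :: "nat => 'a => real"
  assumes s: "0 <= s" "s < m" and U: "\<And>k. ddom m (U k)" "\<And>k. QQ m (U k) <= C" and w: "ddom m w" "QQ m w <= C"
    and lim: "\<And>j. (\<lambda>k. ip M (U k) (phi j)) \<longlonglongrightarrow> ip M w (phi j)"
  shows "(\<lambda>k. QQ s (U k)) \<longlonglongrightarrow> QQ s w"
  unfolding QQ_eq
proof (rule weighted_sum_tendsto[where m = m and C = C and l = lam and s = s
      and c = "\<lambda>k j. ip M (U k) (phi j)" and d = "\<lambda>j. ip M w (phi j)"])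
  have U': "ddom s (U k)" for k using s by (intro ddom_mono[OF U(1)]) auto
  have w': "ddom s w" using s by (intro ddom_mono[OF w(1)]) auto
  show "summable (\<lambda>j. lam j powr s * (ip M (U k) (phi j))\<^sup>2)" for k using U'[of k] by (simp add: ddom_iff)
  show "summable (\<lambda>j. lam j powr s * (ip M w (phi j))\<^sup>2)" using w' by (simp add: ddom_iff)
  show "summable (\<lambda>j. lam j powr m * (ip M (U k) (phi j))\<^sup>2)" "(\<Sum>j. lam j powr m * (ip M (U k) (phi j))\<^sup>2) <= C" for k
    using U[of k] by (auto simp: ddom_iff QQ_eq)
  show "summable (\<lambda>j. lam j powr m * (ip M w (phi j))\<^sup>2)" "(\<Sum>j. lam j powr m * (ip M w (phi j))\<^sup>2) <= C"
    using w by (auto simp: ddom_iff QQ_eq)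
qed (rule lam_pos finite_lam_le s(2) lim)+

lemma ip_zero_AE:
  assumes u: "L2 M u" "AE x in M. u x = 0" and g: "g \<in> borel_measurable M"
  shows "ip M u g = 0"
proof -
  have "ip M u g = ip M (\<lambda>x. 0) g" using L2D(1)[OF u(1)] u(2) g by (intro ip_cong_AE) auto
  then show ?thesis by (simp add: ip_def)
qed

theorem spectral_case:
  assumes s: "0 <= s" "s < m" "2 * m - real DIM('a) / 2 <= s" and l: "0 < l" "l < Lambda1 \<Omega> lam phi m s"
  shows "\<exists>u. form_dom \<Omega> lam phi m u \<and> nonzero_L2 \<Omega> u \<and> S_ratio \<Omega> lam phi m s l u = S_lambda \<Omega> lam phi m s l"
    "\<exists>u. nonzero_L2 \<Omega> u \<and> weak_sol1 \<Omega> lam phi m s l u"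
proof -
  have dm: "ddom s u" if "ddom m u" for u using s by (intro ddom_mono[OF that]) auto
  have "\<exists>th. 0 <= th \<and> th < 1 \<and> (\<forall>u. ddom m u --> l * QQ s u <= th * QQ m u)"
  proof (rule coercive_below_Inf[OF l(1)])
    show "l < Inf {QQ m u / QQ s u | u. ddom m u \<and> \<not> (AE x in M. u x = 0)}"
      using l(2) unfolding Lambda1_def form_dom_eqs nonzero_L2_eq .
    fix u assume u: "ddom m u"
    show "0 <= QQ s u" by (rule QQ_nonneg[OF dm[OF u]])
    assume "AE x in M. u x = 0"
    then show "QQ s u = 0" unfolding QQ_eq using u by (simp add: ip_zero_AE ddom_iff)
  qed
  then obtain th where th: "0 <= th" "th < 1" "\<And>u. ddom m u ==> l * QQ s u <= th * QQ m u" by blast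
  interpret P: perturbed_minimization \<Omega> lam phi m l th "QQ s" "bil s"
  proof unfold_locales
    show "(\<lambda>k. QQ s (U k)) \<longlonglongrightarrow> QQ s w"
      if "\<And>k. ddom m (U k)" "\<And>k. QQ m (U k) <= C" "ddom m w" "QQ m w <= C"
        "\<And>j. (\<lambda>k. ip M (U k) (phi j)) \<longlonglongrightarrow> ip M w (phi j)" "AE x in M. (\<lambda>k. U k x) \<longlonglongrightarrow> w x" for U w C
      using that by (intro spectral_conv[OF s(1,2)])
    show "\<exists>u. ddom m u \<and> \<not> (AE x in M. u x = 0) \<and> QQ m u - l * QQ s u < sob * qmass u powr (2 / cq)"
      by (rule strict_below_spectral[OF s l(1)])
  qed (use th in \<open>auto simp: QQ_scale bil_scale QQ_expand dm\<close>)
  show "\<exists>u. form_dom \<Omega> lam phi m u \<and> nonzero_L2 \<Omega> u \<and> S_ratio \<Omega> lam phi m s l u = S_lambda \<Omega> lam phi m s l"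
    using P.minimum_attained unfolding P.ratios_def P.EE_def S_lambda_def S_ratio_def form_dom_eqs nonzero_L2_eq .
  show "\<exists>u. nonzero_L2 \<Omega> u \<and> weak_sol1 \<Omega> lam phi m s l u"
    using P.weak_solution_exists unfolding weak_sol1_def form_dom_eqs nonzero_L2_eq crit_exp_eq integral_M_set by blast
qed

text \<open>Turns the Hardy term into an L2 inner product, so that its polarisation and its
  Cauchy-Schwarz inequality are those of \<open>ip\<close>.\<close>

definition hardy_factor :: "real => ('a => real) => 'a => real" where
  "hardy_factor s u x = norm x powr (- s) * u x"

lemma hardy_factor_mult: "hardy_factor s u x * hardy_factor s v x = norm x powr (- 2 * s) * u x * v x"
proof -
  have "norm x powr (- s) * norm x powr (- s) = norm x powr (- 2 * s)" by (simp add: powr_add[symmetric])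
  then show ?thesis by (simp add: hardy_factor_def mult_ac)
qed

lemma ip_hardy_factor: "ip M (hardy_factor s u) (hardy_factor s v) = (\<integral>x. norm x powr (- 2 * s) * u x * v x \<partial>M)"
  by (simp add: ip_def hardy_factor_mult)

lemma hardy_eq: "hardy s u = ip M (hardy_factor s u) (hardy_factor s u)"
  by (simp add: ip_hardy_factor hardy_def power2_eq_square mult.assoc)

lemma hardy_factor_L2:
  assumes u: "ddom m u" and s: "0 <= s" "s < m"
  shows "L2 M (hardy_factor s u)"
proof -
  have [measurable]: "u \<in> borel_measurable M" using u by (simp add: ddom_iff L2_def)
  have [measurable]: "(\<lambda>x. norm x powr (- s)) \<in> borel_measurable M" by (intro borel_measurable_M) measurable
  have "hardy_factor s u \<in> borel_measurable M" unfolding hardy_factor_def[abs_def] by measurable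
  moreover have "(hardy_factor s u x)\<^sup>2 = norm x powr (- 2 * s) * (u x)\<^sup>2" for x
    by (simp add: power2_eq_square hardy_factor_mult mult.assoc)
  ultimately show ?thesis unfolding L2_def using hardy_integrable[OF u s] by simp
qed

lemma hardy_factor_cmult: "hardy_factor s (\<lambda>x. c * u x) = (\<lambda>x. c * hardy_factor s u x)"
  by (auto simp: hardy_factor_def)

lemma hardy_factor_add: "hardy_factor s (\<lambda>x. u x + c * v x) = (\<lambda>x. hardy_factor s u x + c * hardy_factor s v x)"
  by (auto simp: hardy_factor_def algebra_simps)

lemma hardy_expand:
  assumes u: "ddom m u" and v: "ddom m v" and s: "0 <= s" "s < m"
  shows "hardy s (\<lambda>x. u x + c * v x) = hardy s u + 2 * c * ip M (hardy_factor s u) (hardy_factor s v) + c\<^sup>2 * hardy s v"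
proof -
  let ?u = "hardy_factor s u" and ?v = "hardy_factor s v"
  have L: "L2 M ?u" "L2 M ?v" "L2 M (\<lambda>x. ?u x + c * ?v x)"
    using hardy_factor_L2[OF u s] hardy_factor_L2[OF v s] by (auto intro: L2_add L2_cmult)
  show ?thesis
    unfolding hardy_eq hardy_factor_add ip_scaled_add[OF L]
      ip_commute[of M ?u "\<lambda>x. ?u x + c * ?v x"] ip_commute[of M ?v "\<lambda>x. ?u x + c * ?v x"]
      ip_scaled_add[OF L(1,2) L(1)] ip_scaled_add[OF L(1,2) L(2)] ip_commute[of M ?v ?u]
    by (simp add: power2_eq_square algebra_simps)
qed

text \<open>For every e the weighted square of U k - w is at most e times its q-th power plus an
  integrable function, thanks to s < m. Boundedness of the q-masses and almost everywhere
  convergence therefore give strong convergence; the cross term follows by Cauchy-Schwarz.\<close>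

lemma hardy_conv:
  fixes U :: "nat => 'a => real"
  assumes s: "0 <= s" "s < m" and U: "\<And>k. ddom m (U k)" "\<And>k. QQ m (U k) <= C" and w: "ddom m w" "QQ m w <= C"
    and lim: "AE x in M. (\<lambda>k. U k x) \<longlonglongrightarrow> w x"
  shows "(\<lambda>k. hardy s (U k)) \<longlonglongrightarrow> hardy s w"
proof -
  define D where "D k x = U k x - w x" for k x
  have Dd: "ddom m (D k)" "QQ m (D k) <= 2 * C + 2 * C" for k
    unfolding D_def using ddom_diff[OF U(1)[of k] w(1)] U(2)[of k] w(2) by auto
  have q1: "1 < cq" "0 < cq" using exps by auto
  define K where "K = ((2 * C + 2 * C) / sob) powr (cq / 2)"
  have qD: "qmass (D k) <= K" for k
  proof -
    have "qmass (D k) powr (2 / cq) <= (2 * C + 2 * C) / sob"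
      using sobolev(2)[OF Dd(1)[of k]] Dd(2)[of k] sob_pos unfolding qmass_def[symmetric] by (simp add: pos_le_divide_eq mult.commute)
    then have "(qmass (D k) powr (2 / cq)) powr (cq / 2) <= K" unfolding K_def using q1 by (intro powr_mono2) auto
    then show ?thesis unfolding powr_powr using q1 qmass_nonneg[of "D k"] by simp
  qed
  define f where "f k x = norm x powr (- 2 * s) * (D k x)\<^sup>2" for k x
  define G where "G e x = e powr (- (real DIM('a) / (2 * m)) / (cq / 2)) * hardy_weight s x" for e and x :: 'a
  have f0: "0 <= f k x" for k x by (simp add: f_def)
  have "(\<lambda>k. \<integral>x. \<bar>f k x\<bar> \<partial>M) \<longlonglongrightarrow> 0"
  proof (rule tendsto_integral_eps_dominated(1)[where F = "\<lambda>k x. \<bar>D k x\<bar> powr cq" and G = G and B = K])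
    show "f k \<in> borel_measurable M" for k
      using hardy_integrable[OF Dd(1) s, of k] unfolding f_def by (rule borel_measurable_integrable)
    show "integrable M (\<lambda>x. \<bar>D k x\<bar> powr cq)" for k by (rule sobolev(1)[OF Dd(1)])
    show "(\<integral>x. \<bar>D k x\<bar> powr cq \<partial>M) <= K" for k using qD[of k] by (simp add: qmass_def)
    show "integrable M (G e)" for e unfolding G_def by (intro integrable_mult_right hardy_weight_integrable[OF s])
    show "0 <= G e x" for e x by (simp add: G_def hardy_weight_def)
    show "\<bar>f k x\<bar> <= e * \<bar>D k x\<bar> powr cq + G e x" if e: "0 < e" for e k x
      unfolding abs_of_nonneg[OF f0] using hardy_weight_bound[OF e] by (simp add: f_def G_def)
    show "AE x in M. (\<lambda>k. f k x) \<longlonglongrightarrow> 0"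
      using lim
    proof eventually_elim
      case (elim x)
      then have "(\<lambda>k. norm x powr (- 2 * s) * (U k x - w x)\<^sup>2) \<longlonglongrightarrow> norm x powr (- 2 * s) * (w x - w x)\<^sup>2"
        by (intro tendsto_mult tendsto_power tendsto_diff tendsto_const)
      then show ?case by (simp add: f_def D_def)
    qed
  qed simp
  then have hD: "(\<lambda>k. hardy s (D k)) \<longlonglongrightarrow> 0" by (simp add: abs_of_nonneg[OF f0]) (simp add: f_def hardy_def)
  let ?c = "\<lambda>k. ip M (hardy_factor s w) (hardy_factor s (D k))"
  have "(\<lambda>k. (?c k)\<^sup>2) \<longlonglongrightarrow> 0"
  proof (rule Lim_null_comparison)
    show "\<forall>\<^sub>F k in sequentially. norm ((?c k)\<^sup>2) <= hardy s w * hardy s (D k)"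
      unfolding hardy_eq using ip_Cauchy_Schwarz[OF hardy_factor_L2[OF w(1) s] hardy_factor_L2[OF Dd(1) s]]
      by (intro always_eventually) simp
    show "(\<lambda>k. hardy s w * hardy s (D k)) \<longlonglongrightarrow> 0" by (rule tendsto_mult_right_zero[OF hD])
  qed
  then have c0: "?c \<longlonglongrightarrow> 0" by (simp add: power_tendsto_0_iff)
  have "(\<lambda>k. hardy s w + 2 * ?c k + hardy s (D k)) \<longlonglongrightarrow> hardy s w + 2 * 0 + 0" by (intro tendsto_intros c0 hD)
  moreover have "hardy s (U k) = hardy s w + 2 * ?c k + hardy s (D k)" for k
  proof -
    have "(\<lambda>x. w x + 1 * D k x) = U k" by (simp add: D_def)
    then show ?thesis using hardy_expand[OF w(1) Dd(1) s, of 1 k] by simp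
  qed
  ultimately show ?thesis by simp
qed

theorem hardy_case:
  assumes s: "0 <= s" "s < m" "2 * m - real DIM('a) / 2 <= s" and l: "0 < l" "l < Lambda1_tilde \<Omega> lam phi m s"
  shows "\<exists>u. form_dom \<Omega> lam phi m u \<and> nonzero_L2 \<Omega> u \<and> S_ratio_tilde \<Omega> lam phi m s l u = S_lambda_tilde \<Omega> lam phi m s l"
    "\<exists>u. nonzero_L2 \<Omega> u \<and> weak_sol2 \<Omega> lam phi m s l u"
proof -
  have "\<exists>th. 0 <= th \<and> th < 1 \<and> (\<forall>u. ddom m u --> l * hardy s u <= th * QQ m u)"
  proof (rule coercive_below_Inf[OF l(1)])
    show "l < Inf {QQ m u / hardy s u | u. ddom m u \<and> \<not> (AE x in M. u x = 0)}"
      using l(2) unfolding Lambda1_tilde_def form_dom_eqs nonzero_L2_eq .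
    fix u assume u: "ddom m u"
    show "0 <= hardy s u" unfolding hardy_eq by (rule ip_nonneg)
    note L = hardy_factor_L2[OF u s(1,2)]
    assume "AE x in M. u x = 0"
    then have "AE x in M. hardy_factor s u x = 0" by eventually_elim (simp add: hardy_factor_def)
    then show "hardy s u = 0" unfolding hardy_eq using L2D(1)[OF L] by (rule ip_zero_AE[OF L])
  qed
  then obtain th where th: "0 <= th" "th < 1" "\<And>u. ddom m u ==> l * hardy s u <= th * QQ m u" by blast
  interpret P: perturbed_minimization \<Omega> lam phi m l th "hardy s" "\<lambda>u v. ip M (hardy_factor s u) (hardy_factor s v)"
  proof unfold_locales
    show "(\<lambda>k. hardy s (U k)) \<longlonglongrightarrow> hardy s w"
      if "\<And>k. ddom m (U k)" "\<And>k. QQ m (U k) <= C" "ddom m w" "QQ m w <= C"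
        "\<And>j. (\<lambda>k. ip M (U k) (phi j)) \<longlonglongrightarrow> ip M w (phi j)" "AE x in M. (\<lambda>k. U k x) \<longlonglongrightarrow> w x" for U w C
      using that by (intro hardy_conv[OF s(1,2)])
    show "hardy s (\<lambda>x. c * u x) = c\<^sup>2 * hardy s u" for c u
      by (simp add: hardy_def power_mult_distrib mult.left_commute)
    show "\<exists>u. ddom m u \<and> \<not> (AE x in M. u x = 0) \<and> QQ m u - l * hardy s u < sob * qmass u powr (2 / cq)"
      by (rule strict_below_hardy[OF s l(1)])
  qed (use th s in \<open>auto simp: hardy_factor_cmult ip_cmult_left hardy_expand\<close>)
  show "\<exists>u. form_dom \<Omega> lam phi m u \<and> nonzero_L2 \<Omega> u \<and> S_ratio_tilde \<Omega> lam phi m s l u = S_lambda_tilde \<Omega> lam phi m s l"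
    using P.minimum_attained unfolding P.ratios_def P.EE_def S_lambda_tilde_def S_ratio_tilde_def form_dom_eqs nonzero_L2_eq .
  show "\<exists>u. nonzero_L2 \<Omega> u \<and> weak_sol2 \<Omega> lam phi m s l u"
    using P.weak_solution_exists unfolding ip_hardy_factor weak_sol2_def form_dom_eqs nonzero_L2_eq crit_exp_eq integral_M_set by blast
qed

end

theorem theorem3:
  fixes \<Omega> :: "'a::euclidean_space set"
    and lam :: "nat \<Rightarrow> real" and phi :: "nat \<Rightarrow> 'a \<Rightarrow> real"
    and m s :: real
  assumes "smooth_bounded_domain \<Omega>" and "0 \<in> \<Omega>"
    and "dirichlet_eigensystem \<Omega> lam phi"
    and "0 \<le> s" and "s < m" and "m < real DIM('a) / 2"
    and "2 * m - real DIM('a) / 2 \<le> s"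
  shows "(\<forall>l. 0 < l \<and> l < Lambda1 \<Omega> lam phi m s \<longrightarrow>
            (\<exists>u. form_dom \<Omega> lam phi m u \<and> nonzero_L2 \<Omega> u \<and>
                 S_ratio \<Omega> lam phi m s l u = S_lambda \<Omega> lam phi m s l) \<and>
            (\<exists>u. nonzero_L2 \<Omega> u \<and> weak_sol1 \<Omega> lam phi m s l u)) \<and>
         (\<forall>l. 0 < l \<and> l < Lambda1_tilde \<Omega> lam phi m s \<longrightarrow>
            (\<exists>u. form_dom \<Omega> lam phi m u \<and> nonzero_L2 \<Omega> u \<and>
                 S_ratio_tilde \<Omega> lam phi m s l u = S_lambda_tilde \<Omega> lam phi m s l) \<and>
            (\<exists>u. nonzero_L2 \<Omega> u \<and> weak_sol2 \<Omega> lam phi m s l u))"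
proof -
  interpret critical_system \<Omega> lam phi m
    using assms by unfold_locales (auto simp: smooth_bounded_domain_def)
  show ?thesis
    using spectral_case[OF assms(4,5,7)] hardy_case[OF assms(4,5,7)] by blast
qed

end
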